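(* Let $G$ be a group acting on a CAT(0) cube complex $X$ and let $g \in G$ be an isometry such that $\langle g \rangle$ is a normal subgroup of $G$. Then $\mathrm{Med}(g)$ is a median subalgebra of $X$ which is $G$-invariant and which decomposes as a product $T \times F \times Q$ of three median algebras $T,F,Q$ such that: (1) the action $G \curvearrowright T \times F \times Q$ decomposes as a product of three actions $G \curvearrowright T$, $G \curvearrowright F$, $G \curvearrowright Q$; (2) $F$ is a single vertex if $g$ is elliptic, and otherwise it is a median flat on which $g$ acts by translations of length $\lim_{n \to +\infty} \frac{1}{n} d(x,g^n x) > 0$ (where $x \in X$ is any vertex); (3) $Q$ is a finite-dimensional cube, possibly reduced to a single vertex; (4) $g$ acts trivially on $T$. Moreover, the dimension of $Q$ is zero if $g$ is loxodromic; it coincides with the minimal dimension of a cube of $X$ stabilised by $g$ if $g$ is elliptic; and otherwise it coincides with the number of hyperplanes inverted by powers of $g$.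
   Context: Cube complexes. A CAT(0) cube complex $X$ (possibly infinite-dimensional) is identified with its one-skeleton: $x\in X$ means that $x$ is a vertex, $d$ is the graph metric on the one-skeleton, and geodesics are combinatorial. Groups act by cubical automorphisms (isometries). A hyperplane is an equivalence class of edges for the relation generated by being opposite edges in a square; removing its edges leaves two components, its halfspaces, which are convex. An isometry inverts a hyperplane if it stabilises it and swaps its two halfspaces. Every triple of vertices $x,y,z$ has a unique median point $\mu(x,y,z)$, the unique vertex lying on a geodesic between any two of $x,y,z$. A median subalgebra is a set of vertices stable under $\mu$. Isometries. Every isometry $g$ of $X$ is exactly one of: elliptic (bounded orbits; equivalently $g$ stabilises a cube); inverting (unbounded orbits and some power of $g$ inverts a hyperplane); loxodromic (there is a bi-infinite geodesic on which $g$ acts by translation of length $\|g\|=\min_{x} d(x,gx)>0$; such a geodesic is called an axis of $g$). Median algebras. A median algebra is a set $M$ with a map $\mu:M^3\to M$ such that $\mu(x,y,y)=y$, $\mu(x,y,z)=\mu(z,x,y)=\mu(x,z,y)$ and $\mu(\mu(x,w,y),w,z)=\mu(x,w,\mu(y,w,z))$. The interval is $I(x,y)=\{z : \mu(x,y,z)=z\}$; $C\subset M$ is convex if $I(x,y)\subset C$ for all $x,y\in C$; $M$ is discrete if all intervals are finite. A halfspace of $M$ is a subset $D$ with $D$ and $D^c$ convex (and non-empty), and $\{D,D^c\}$ is a wall. If $M$ is discrete, any two points are separated by finitely many walls, and the cubulation of $M$ is the CAT(0) cube complex with vertex-set $M$, edges joining points separated by exactly one wall, and $n$-cubes filling in all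 one-skeleta of $n$-cubes. The dimension of $M$ is that of its cubulation. An orientation is a set $\sigma$ of halfspaces containing exactly one halfspace of each wall and such that $A\in\sigma$, $A\subset B$ imply $B\in\sigma$. The Roller compactification $\overline M$ is the set of all orientations, $M$ embeds in it via $x\mapsto\{\text{halfspaces containing }x\}$, the Roller boundary is $\mathfrak{R}M=\overline M\setminus M$, and $\overline M$ is a median algebra with $\mu(\sigma_1,\sigma_2,\sigma_3)=\{\text{halfspaces belonging to at least two of the }\sigma_i\}$. A median flat is a non-empty, finite-dimensional, discrete median algebra $M$ for which there exist $\zeta,\xi\in\mathfrak{R}M$ with $M\subset I(\zeta,\xi)$. A finite-dimensional cube is the median algebra $\{0,1\}^k$, $0 \le k<\infty$ (coordinatewise majority). Products. Decomposing as a product means being isomorphic, as a median algebra, to the product with coordinatewise median. The action decomposes as a product of actions if $h\cdot(t,f,q)=(h\cdot t,h\cdot f,h\cdot q)$ for actions of $G$ on the factors by median automorphisms. An isometry acts on a median flat $F$ by translations of length $\ell$ if each point of $F$ lies on a bi-infinite geodesic of the cubulation of $F$ on which the isometry acts as a translation of length $\ell$. Cubical quotient. Given a collection $\mathcal{J}$ of hyperplanes of $X$, the cubical quotient $X/\mathcal{J}$ is the cubulation of the wallspace consisting of the vertex set of $X$ with the walls (pairs of halfspaces) given by the hyperplanes of $X$ not in $\mathcal{J}$. Its vertices are the orientations of these walls (that is, the sets $\sigma$ of halfspaces delimited by hyperplanes not in $\mathcal{J}$ which contain exactly one halfspace of each of these walls and which satisfy: if $A,B$ are halfspaces of these walls with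 $A\in\sigma$ and $A\subset B$, then $B\in\sigma$) differing on finitely many walls from a principal orientation $\{\text{halfspaces containing }x\}$, $x \in X$; its edges join orientations differing on exactly one wall; cubes are filled in. The canonical map $\pi:X\to X/\mathcal{J}$ sends $x$ to its principal orientation. Median set. $\mathrm{Med}(g)$ is: (elliptic case) the union of all the $d$-dimensional cubes stabilised by $\langle g\rangle$, where $d$ is the minimal dimension of a cube stabilised by $\langle g\rangle$; (loxodromic case) the union of all axes of $g$; (inverting case) the pre-image under $\pi:X\to X/\mathcal{J}$ of the union of all the axes of $g$ in $X/\mathcal{J}$, where $\mathcal{J}$ is the ($\langle g\rangle$-invariant) collection of the hyperplanes of $X$ inverted by powers of $g$; here $g$ induces a loxodromic isometry of $X/\mathcal{J}$. *)

theory Defs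
  imports
    Complex_Main
    "HOL-Algebra.Group_Action"
    "HOL-Algebra.Generated_Groups"
    "HOL-Library.Extended_Nat"
    "HOL-Library.FuncSet"
begin

section \<open>Graphs and the cube complexes they carry\<close>

text \<open>
  A cube complex is represented by its one-skeleton, a simple graph.  The cubes are the induced
  subgraphs isomorphic to one-skeleta of cubes; no further data is needed, since in a CAT(0) cube
  complex every such subgraph bounds a unique cube.
\<close>

record 'v skeleton =
  verts :: "'v set"
  edges :: "'v set set"

definition simple_graph :: "'v skeleton \<Rightarrow> bool" where
  "simple_graph X \<longleftrightarrow>
     (\<forall>e\<in>edges X. \<exists>u\<in>verts X. \<exists>v\<in>verts X. u \<noteq> v \<and> e = {u, v})"

definition walk :: "'v skeleton \<Rightarrow> 'v list \<Rightarrow> bool" where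
  "walk X p \<longleftrightarrow> p \<noteq> [] \<and> set p \<subseteq> verts X \<and>
     (\<forall>i. Suc i < length p \<longrightarrow> {p ! i, p ! Suc i} \<in> edges X)"

definition walk_from_to :: "'v skeleton \<Rightarrow> 'v \<Rightarrow> 'v list \<Rightarrow> 'v \<Rightarrow> bool" where
  "walk_from_to X x p y \<longleftrightarrow> walk X p \<and> hd p = x \<and> last p = y"

definition connected_graph :: "'v skeleton \<Rightarrow> bool" where
  "connected_graph X \<longleftrightarrow> (\<forall>x\<in>verts X. \<forall>y\<in>verts X. \<exists>p. walk_from_to X x p y)"

definition components :: "'v skeleton \<Rightarrow> 'v set set" where
  "components X = (\<lambda>x. {y. \<exists>p. walk_from_to X x p y}) ` verts X"

definition gdist :: "'v skeleton \<Rightarrow> 'v \<Rightarrow> 'v \<Rightarrow> nat" where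
  "gdist X x y = (LEAST n. \<exists>p. walk_from_to X x p y \<and> length p = Suc n)"

definition geodesic :: "'v skeleton \<Rightarrow> 'v \<Rightarrow> 'v list \<Rightarrow> 'v \<Rightarrow> bool" where
  "geodesic X x p y \<longleftrightarrow> walk_from_to X x p y \<and> length p = Suc (gdist X x y)"

definition on_geodesic :: "'v skeleton \<Rightarrow> 'v \<Rightarrow> 'v \<Rightarrow> 'v \<Rightarrow> bool" where
  "on_geodesic X x y z \<longleftrightarrow> (\<exists>p. geodesic X x p y \<and> z \<in> set p)"

text \<open>The vertices of the model \<open>n\<close>-cube are the subsets of \<open>{..<n}\<close>.\<close>

definition cube :: "'v skeleton \<Rightarrow> nat \<Rightarrow> 'v set \<Rightarrow> bool" where
  "cube X n C \<longleftrightarrow> C \<subseteq> verts X \<and>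
     (\<exists>f. bij_betw f (Pow {..<n}) C \<and>
        (\<forall>A B. A \<subseteq> {..<n} \<and> B \<subseteq> {..<n} \<longrightarrow>
           ({f A, f B} \<in> edges X \<longleftrightarrow> card (sym_diff A B) = 1)))"

definition dimension :: "'v skeleton \<Rightarrow> enat" where
  "dimension X = Sup {enat n | n. \<exists>C. cube X n C}"

definition opposite :: "'v skeleton \<Rightarrow> 'v set \<Rightarrow> 'v set \<Rightarrow> bool" where
  "opposite X e f \<longleftrightarrow> e \<in> edges X \<and> f \<in> edges X \<and> e \<inter> f = {} \<and> cube X 2 (e \<union> f)"

text \<open>
  Simple connectivity is that of the cube complex, expressed by its edge-path group: walks are
  considered up to deleting or inserting backtracks and pushing two consecutive edges of a square
  to the two other edges.
\<close>

inductive homotopy_step :: "'v skeleton \<Rightarrow> 'v list \<Rightarrow> 'v list \<Rightarrow> bool" for X where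
  backtrack: "{u, w} \<in> edges X \<Longrightarrow> homotopy_step X (p @ [u, w, u] @ q) (p @ [u] @ q)"
| push: "opposite X {a, b} {c, d} \<Longrightarrow> opposite X {b, c} {d, a} \<Longrightarrow>
    homotopy_step X (p @ [a, b, c] @ q) (p @ [a, d, c] @ q)"

definition simply_connected_complex :: "'v skeleton \<Rightarrow> bool" where
  "simply_connected_complex X \<longleftrightarrow> verts X \<noteq> {} \<and> connected_graph X \<and>
     (\<forall>x p. walk_from_to X x p x \<longrightarrow> equivclp (homotopy_step X) p [x])"

text \<open>
  Vertices of the link of \<open>v\<close> are identified with the neighbours of \<open>v\<close>, and its simplices are
  the sets of neighbours of \<open>v\<close> lying in a common cube of the corresponding dimension.  The
  uniqueness requirement says that links are simplicial complexes (no two simplices have the same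
  vertices), the existence requirement that they are flag.
\<close>

definition flag_links :: "'v skeleton \<Rightarrow> bool" where
  "flag_links X \<longleftrightarrow>
     (\<forall>v\<in>verts X. \<forall>N. finite N \<and> (\<forall>a\<in>N. {v, a} \<in> edges X) \<and>
        (\<forall>a\<in>N. \<forall>b\<in>N. a \<noteq> b \<longrightarrow> (\<exists>S. cube X 2 S \<and> {v, a, b} \<subseteq> S)) \<longrightarrow>
        (\<exists>!C. cube X (card N) C \<and> v \<in> C \<and> N \<subseteq> C))"

text \<open>Gromov's criterion: simply connected, with links that are flag simplicial complexes.\<close>

definition CAT0_cube_complex :: "'v skeleton \<Rightarrow> bool" where
  "CAT0_cube_complex X \<longleftrightarrow> simple_graph X \<and> simply_connected_complex X \<and> flag_links X"

definition median :: "'v skeleton \<Rightarrow> 'v \<Rightarrow> 'v \<Rightarrow> 'v \<Rightarrow> 'v" where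
  "median X x y z =
     (THE m. on_geodesic X x y m \<and> on_geodesic X y z m \<and> on_geodesic X x z m)"

definition median_subalgebra :: "'v skeleton \<Rightarrow> 'v set \<Rightarrow> bool" where
  "median_subalgebra X S \<longleftrightarrow> S \<subseteq> verts X \<and> (\<forall>x\<in>S. \<forall>y\<in>S. \<forall>z\<in>S. median X x y z \<in> S)"


section \<open>Hyperplanes, orientations and cubical quotients\<close>

definition hyperplanes :: "'v skeleton \<Rightarrow> 'v set set set" where
  "hyperplanes X = (\<lambda>e. {f \<in> edges X. equivclp (opposite X) e f}) ` edges X"

definition halfspaces_of :: "'v skeleton \<Rightarrow> 'v set set \<Rightarrow> 'v set set" where
  "halfspaces_of X J = components (X\<lparr>edges := edges X - J\<rparr>)"

definition inverts :: "'v skeleton \<Rightarrow> ('v \<Rightarrow> 'v) \<Rightarrow> 'v set set \<Rightarrow> bool" where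
  "inverts X a J \<longleftrightarrow> (\<lambda>e. a ` e) ` J = J \<and>
     (\<exists>A B. A \<noteq> B \<and> halfspaces_of X J = {A, B} \<and> a ` A = B \<and> a ` B = A)"

text \<open>
  Orientations of a set \<open>W\<close> of walls, where a wall is the set of its two halfspaces.
\<close>

definition orientation :: "'v set set set \<Rightarrow> 'v set set \<Rightarrow> bool" where
  "orientation W \<sigma> \<longleftrightarrow> \<sigma> \<subseteq> \<Union>W \<and> (\<forall>w\<in>W. \<exists>!A. A \<in> w \<and> A \<in> \<sigma>) \<and>
     (\<forall>A\<in>\<sigma>. \<forall>B\<in>\<Union>W. A \<subseteq> B \<longrightarrow> B \<in> \<sigma>)"

definition principal :: "'v set set set \<Rightarrow> 'v \<Rightarrow> 'v set set" where
  "principal W x = {A \<in> \<Union>W. x \<in> A}"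

definition differing_walls :: "'v set set set \<Rightarrow> 'v set set \<Rightarrow> 'v set set \<Rightarrow> 'v set set set" where
  "differing_walls W \<sigma> \<tau> = {w \<in> W. \<sigma> \<inter> w \<noteq> \<tau> \<inter> w}"

definition quotient_walls :: "'v skeleton \<Rightarrow> 'v set set set \<Rightarrow> 'v set set set" where
  "quotient_walls X \<J> = halfspaces_of X ` (hyperplanes X - \<J>)"

definition cubical_quotient :: "'v skeleton \<Rightarrow> 'v set set set \<Rightarrow> 'v set set skeleton" where
  "cubical_quotient X \<J> =
     (let W = quotient_walls X \<J>;
          V = {\<sigma>. orientation W \<sigma> \<and> (\<exists>x\<in>verts X. finite (differing_walls W \<sigma> (principal W x)))}
      in \<lparr> verts = V,
           edges = {{\<sigma>, \<tau>} | \<sigma> \<tau>. \<sigma> \<in> V \<and> \<tau> \<in> V \<and> card (differing_walls W \<sigma> \<tau>) = 1} \<rparr>)"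

definition quotient_map :: "'v skeleton \<Rightarrow> 'v set set set \<Rightarrow> 'v \<Rightarrow> 'v set set" where
  "quotient_map X \<J> x = principal (quotient_walls X \<J>) x"

definition induced_isometry :: "('v \<Rightarrow> 'v) \<Rightarrow> 'v set set \<Rightarrow> 'v set set" where
  "induced_isometry a \<sigma> = (\<lambda>A. a ` A) ` \<sigma>"


section \<open>Group actions and isometries\<close>

definition cubical_action ::
    "('g, 'b) monoid_scheme \<Rightarrow> 'v skeleton \<Rightarrow> ('g \<Rightarrow> 'v \<Rightarrow> 'v) \<Rightarrow> bool" where
  "cubical_action G X \<phi> \<longleftrightarrow> group_action G (verts X) \<phi> \<and>
     (\<forall>h\<in>carrier G. \<forall>x\<in>verts X. \<forall>y\<in>verts X. {\<phi> h x, \<phi> h y} \<in> edges X \<longleftrightarrow> {x, y} \<in> edges X)"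

definition bi_infinite_geodesic :: "'v skeleton \<Rightarrow> (int \<Rightarrow> 'v) \<Rightarrow> bool" where
  "bi_infinite_geodesic X \<gamma> \<longleftrightarrow>
     (\<forall>i. \<gamma> i \<in> verts X \<and> {\<gamma> i, \<gamma> (i + 1)} \<in> edges X) \<and>
     (\<forall>i j. int (gdist X (\<gamma> i) (\<gamma> j)) = \<bar>i - j\<bar>)"

text \<open>Geodesics are parametrised in the direction of the translation.\<close>

definition translates_along :: "'v skeleton \<Rightarrow> ('v \<Rightarrow> 'v) \<Rightarrow> nat \<Rightarrow> (int \<Rightarrow> 'v) \<Rightarrow> bool" where
  "translates_along X a l \<gamma> \<longleftrightarrow> bi_infinite_geodesic X \<gamma> \<and> (\<forall>i. a (\<gamma> i) = \<gamma> (i + int l))"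

definition translation_length :: "'v skeleton \<Rightarrow> ('v \<Rightarrow> 'v) \<Rightarrow> nat" where
  "translation_length X a = (LEAST n. \<exists>x\<in>verts X. gdist X x (a x) = n)"

definition axis :: "'v skeleton \<Rightarrow> ('v \<Rightarrow> 'v) \<Rightarrow> (int \<Rightarrow> 'v) \<Rightarrow> bool" where
  "axis X a \<gamma> \<longleftrightarrow> translation_length X a > 0 \<and> translates_along X a (translation_length X a) \<gamma>"

definition axes_union :: "'v skeleton \<Rightarrow> ('v \<Rightarrow> 'v) \<Rightarrow> 'v set" where
  "axes_union X a = \<Union>{range \<gamma> | \<gamma>. axis X a \<gamma>}"

text \<open>Throughout, the powers of \<open>g\<close> are the elements of \<open>generate G {g}\<close>.\<close>

definition elliptic ::
    "('g, 'b) monoid_scheme \<Rightarrow> 'v skeleton \<Rightarrow> ('g \<Rightarrow> 'v \<Rightarrow> 'v) \<Rightarrow> 'g \<Rightarrow> bool" where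
  "elliptic G X \<phi> g \<longleftrightarrow> (\<forall>x\<in>verts X. \<exists>B. \<forall>h\<in>generate G {g}. gdist X x (\<phi> h x) \<le> B)"

definition inverted_hyperplanes ::
    "('g, 'b) monoid_scheme \<Rightarrow> 'v skeleton \<Rightarrow> ('g \<Rightarrow> 'v \<Rightarrow> 'v) \<Rightarrow> 'g \<Rightarrow> 'v set set set" where
  "inverted_hyperplanes G X \<phi> g =
     {J \<in> hyperplanes X. \<exists>h\<in>generate G {g}. inverts X (\<phi> h) J}"

definition inverting ::
    "('g, 'b) monoid_scheme \<Rightarrow> 'v skeleton \<Rightarrow> ('g \<Rightarrow> 'v \<Rightarrow> 'v) \<Rightarrow> 'g \<Rightarrow> bool" where
  "inverting G X \<phi> g \<longleftrightarrow> \<not> elliptic G X \<phi> g \<and> inverted_hyperplanes G X \<phi> g \<noteq> {}"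

definition loxodromic :: "'v skeleton \<Rightarrow> ('g \<Rightarrow> 'v \<Rightarrow> 'v) \<Rightarrow> 'g \<Rightarrow> bool" where
  "loxodromic X \<phi> g \<longleftrightarrow> (\<exists>\<gamma>. axis X (\<phi> g) \<gamma>)"

definition stabilised_cube :: "'v skeleton \<Rightarrow> ('v \<Rightarrow> 'v) set \<Rightarrow> nat \<Rightarrow> 'v set \<Rightarrow> bool" where
  "stabilised_cube X S n C \<longleftrightarrow> cube X n C \<and> (\<forall>a\<in>S. a ` C = C)"

definition min_stabilised_dim :: "'v skeleton \<Rightarrow> ('v \<Rightarrow> 'v) set \<Rightarrow> nat" where
  "min_stabilised_dim X S = (LEAST n. \<exists>C. stabilised_cube X S n C)"

text \<open>
  The last case of \<open>Med\<close> is the loxodromic one: an isometry that is neither elliptic nor inverting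
  is loxodromic.
\<close>

definition Med ::
    "('g, 'b) monoid_scheme \<Rightarrow> 'v skeleton \<Rightarrow> ('g \<Rightarrow> 'v \<Rightarrow> 'v) \<Rightarrow> 'g \<Rightarrow> 'v set" where
  "Med G X \<phi> g =
     (if elliptic G X \<phi> g then
        \<Union>{C. stabilised_cube X (\<phi> ` generate G {g})
               (min_stabilised_dim X (\<phi> ` generate G {g})) C}
      else if inverting G X \<phi> g then
        {x \<in> verts X. quotient_map X (inverted_hyperplanes G X \<phi> g) x
           \<in> axes_union (cubical_quotient X (inverted_hyperplanes G X \<phi> g))
                (induced_isometry (\<phi> g))}
      else axes_union X (\<phi> g))"


section \<open>Median algebras\<close>

definition median_algebra :: "'m set \<Rightarrow> ('m \<Rightarrow> 'm \<Rightarrow> 'm \<Rightarrow> 'm) \<Rightarrow> bool" where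
  "median_algebra M \<mu> \<longleftrightarrow>
     (\<forall>x\<in>M. \<forall>y\<in>M. \<forall>z\<in>M. \<mu> x y z \<in> M) \<and>
     (\<forall>x\<in>M. \<forall>y\<in>M. \<mu> x y y = y) \<and>
     (\<forall>x\<in>M. \<forall>y\<in>M. \<forall>z\<in>M. \<mu> x y z = \<mu> z x y \<and> \<mu> x y z = \<mu> x z y) \<and>
     (\<forall>x\<in>M. \<forall>y\<in>M. \<forall>z\<in>M. \<forall>w\<in>M. \<mu> (\<mu> x w y) w z = \<mu> x w (\<mu> y w z))"

definition median_iso ::
    "'m set \<Rightarrow> ('m \<Rightarrow> 'm \<Rightarrow> 'm \<Rightarrow> 'm) \<Rightarrow> 'n set \<Rightarrow> ('n \<Rightarrow> 'n \<Rightarrow> 'n \<Rightarrow> 'n) \<Rightarrow> ('m \<Rightarrow> 'n) \<Rightarrow> bool" where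
  "median_iso M \<mu> N \<nu> f \<longleftrightarrow> bij_betw f M N \<and>
     (\<forall>x\<in>M. \<forall>y\<in>M. \<forall>z\<in>M. f (\<mu> x y z) = \<nu> (f x) (f y) (f z))"

definition median_action ::
    "('g, 'b) monoid_scheme \<Rightarrow> 'm set \<Rightarrow> ('m \<Rightarrow> 'm \<Rightarrow> 'm \<Rightarrow> 'm) \<Rightarrow> ('g \<Rightarrow> 'm \<Rightarrow> 'm) \<Rightarrow> bool" where
  "median_action G M \<mu> \<alpha> \<longleftrightarrow>
     group_action G M \<alpha> \<and> (\<forall>h\<in>carrier G. median_iso M \<mu> M \<mu> (\<alpha> h))"

definition prod3_median ::
    "('a \<Rightarrow> 'a \<Rightarrow> 'a \<Rightarrow> 'a) \<Rightarrow> ('b \<Rightarrow> 'b \<Rightarrow> 'b \<Rightarrow> 'b) \<Rightarrow> ('c \<Rightarrow> 'c \<Rightarrow> 'c \<Rightarrow> 'c) \<Rightarrow>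
     'a \<times> 'b \<times> 'c \<Rightarrow> 'a \<times> 'b \<times> 'c \<Rightarrow> 'a \<times> 'b \<times> 'c \<Rightarrow> 'a \<times> 'b \<times> 'c" where
  "prod3_median \<mu>1 \<mu>2 \<mu>3 =
     (\<lambda>(x1, x2, x3) (y1, y2, y3) (z1, z2, z3). (\<mu>1 x1 y1 z1, \<mu>2 x2 y2 z2, \<mu>3 x3 y3 z3))"

definition cube_algebra :: "nat \<Rightarrow> (nat \<Rightarrow> bool) set" where
  "cube_algebra k = (\<Pi>\<^sub>E i\<in>{..<k}. UNIV)"

definition cube_median ::
    "nat \<Rightarrow> (nat \<Rightarrow> bool) \<Rightarrow> (nat \<Rightarrow> bool) \<Rightarrow> (nat \<Rightarrow> bool) \<Rightarrow> nat \<Rightarrow> bool" where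
  "cube_median k a b c = (\<lambda>i\<in>{..<k}. a i \<and> b i \<or> b i \<and> c i \<or> a i \<and> c i)"

definition finite_dimensional_cube :: "'m set \<Rightarrow> ('m \<Rightarrow> 'm \<Rightarrow> 'm \<Rightarrow> 'm) \<Rightarrow> bool" where
  "finite_dimensional_cube M \<mu> \<longleftrightarrow> (\<exists>k f. median_iso M \<mu> (cube_algebra k) (cube_median k) f)"

definition m_interval :: "'m set \<Rightarrow> ('m \<Rightarrow> 'm \<Rightarrow> 'm \<Rightarrow> 'm) \<Rightarrow> 'm \<Rightarrow> 'm \<Rightarrow> 'm set" where
  "m_interval M \<mu> x y = {z \<in> M. \<mu> x y z = z}"

definition m_convex :: "'m set \<Rightarrow> ('m \<Rightarrow> 'm \<Rightarrow> 'm \<Rightarrow> 'm) \<Rightarrow> 'm set \<Rightarrow> bool" where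
  "m_convex M \<mu> C \<longleftrightarrow> C \<subseteq> M \<and> (\<forall>x\<in>C. \<forall>y\<in>C. m_interval M \<mu> x y \<subseteq> C)"

definition m_discrete :: "'m set \<Rightarrow> ('m \<Rightarrow> 'm \<Rightarrow> 'm \<Rightarrow> 'm) \<Rightarrow> bool" where
  "m_discrete M \<mu> \<longleftrightarrow> (\<forall>x\<in>M. \<forall>y\<in>M. finite (m_interval M \<mu> x y))"

definition m_halfspace :: "'m set \<Rightarrow> ('m \<Rightarrow> 'm \<Rightarrow> 'm \<Rightarrow> 'm) \<Rightarrow> 'm set \<Rightarrow> bool" where
  "m_halfspace M \<mu> D \<longleftrightarrow> D \<noteq> {} \<and> M - D \<noteq> {} \<and> m_convex M \<mu> D \<and> m_convex M \<mu> (M - D)"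

definition m_walls :: "'m set \<Rightarrow> ('m \<Rightarrow> 'm \<Rightarrow> 'm \<Rightarrow> 'm) \<Rightarrow> 'm set set set" where
  "m_walls M \<mu> = {{D, M - D} | D. m_halfspace M \<mu> D}"

definition cubulation :: "'m set \<Rightarrow> ('m \<Rightarrow> 'm \<Rightarrow> 'm \<Rightarrow> 'm) \<Rightarrow> 'm skeleton" where
  "cubulation M \<mu> =
     \<lparr> verts = M,
       edges = {{x, y} | x y. x \<in> M \<and> y \<in> M \<and>
         card {w \<in> m_walls M \<mu>. \<exists>D\<in>w. x \<in> D \<and> y \<notin> D} = 1} \<rparr>"

definition m_dimension :: "'m set \<Rightarrow> ('m \<Rightarrow> 'm \<Rightarrow> 'm \<Rightarrow> 'm) \<Rightarrow> enat" where
  "m_dimension M \<mu> = dimension (cubulation M \<mu>)"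

definition roller_compactification :: "'m set \<Rightarrow> ('m \<Rightarrow> 'm \<Rightarrow> 'm \<Rightarrow> 'm) \<Rightarrow> 'm set set set" where
  "roller_compactification M \<mu> = {\<sigma>. orientation (m_walls M \<mu>) \<sigma>}"

definition roller_boundary :: "'m set \<Rightarrow> ('m \<Rightarrow> 'm \<Rightarrow> 'm \<Rightarrow> 'm) \<Rightarrow> 'm set set set" where
  "roller_boundary M \<mu> = roller_compactification M \<mu> - principal (m_walls M \<mu>) ` M"

definition roller_median :: "'m set set \<Rightarrow> 'm set set \<Rightarrow> 'm set set \<Rightarrow> 'm set set" where
  "roller_median \<sigma>1 \<sigma>2 \<sigma>3 = (\<sigma>1 \<inter> \<sigma>2) \<union> (\<sigma>2 \<inter> \<sigma>3) \<union> (\<sigma>1 \<inter> \<sigma>3)"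

definition median_flat :: "'m set \<Rightarrow> ('m \<Rightarrow> 'm \<Rightarrow> 'm \<Rightarrow> 'm) \<Rightarrow> bool" where
  "median_flat M \<mu> \<longleftrightarrow> M \<noteq> {} \<and> median_algebra M \<mu> \<and> m_discrete M \<mu> \<and> m_dimension M \<mu> \<noteq> \<infinity> \<and>
     (\<exists>\<zeta>\<in>roller_boundary M \<mu>. \<exists>\<xi>\<in>roller_boundary M \<mu>.
        principal (m_walls M \<mu>) ` M
          \<subseteq> m_interval (roller_compactification M \<mu>) roller_median \<zeta> \<xi>)"

definition acts_by_translations ::
    "'m set \<Rightarrow> ('m \<Rightarrow> 'm \<Rightarrow> 'm \<Rightarrow> 'm) \<Rightarrow> ('m \<Rightarrow> 'm) \<Rightarrow> nat \<Rightarrow> bool" where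
  "acts_by_translations F \<mu> a l \<longleftrightarrow>
     (\<forall>p\<in>F. \<exists>\<gamma>. translates_along (cubulation F \<mu>) a l \<gamma> \<and> p \<in> range \<gamma>)"

end

theory Submission
  imports Defs
begin

text \<open>
  Walks are reduced by pushes across squares and by shortcuts that replace one side of a ladder of
  squares by the other.  Uniqueness of squares and flagness of the links make this reduction
  confluent, so that simple connectivity gives the quadrangle condition for distances.  It follows
  that an edge \<open>uv\<close> bounds the halfspace \<open>{x. d u x < d v x}\<close>, that distances count separating
  halfspaces, and that a pairwise intersecting choice of one side of each wall is a vertex as soon
  as it differs from a vertex on finitely many walls; in particular medians are majority votes.

  A halfspace \<open>h\<close> is in \<open>Inv\<close> if a power of \<open>g\<close> swaps it with its complement, in \<open>Skew\<close> if every
  orbit of \<open>g\<close> runs from one side of \<open>h\<close> to the other, and in \<open>Triv\<close> otherwise.  In all three cases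
  \<open>Med(g)\<close> is the set \<open>M\<close> of vertices \<open>x\<close> for which the truth value of \<open>g\<^sup>n x \<in> h\<close> is monotone in \<open>n\<close>
  for every \<open>h \<notin> Inv\<close>; it is non-empty because a majority vote over a long window of an orbit
  yields such a vertex.  The three classes are invariant under the normaliser of \<open>\<langle>g\<rangle>\<close>, and on \<open>M\<close> two
  halfspaces of different classes always intersect, so a vertex of \<open>M\<close> amounts to three
  independent choices of sides: for \<open>Triv\<close>, giving \<open>T\<close>, for \<open>Skew\<close>, giving \<open>F\<close>, and for the finite
  set \<open>Inv\<close>, giving the cube \<open>Q\<close>.
\<close>

section \<open>Walks and distances in graphs\<close>

text \<open>The obstacle is \<open>Inv\<close>: a geodesic translated by \<open>g\<close> excludes
  inverted walls, so in the inverting case \<open>X\<close> has no axis. \<open>N\<close> counts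
  only the remaining walls; it is the distance of the cubical quotient, which lets the loxodromic
  and the inverting case share one argument. Non-emptiness of \<open>M\<close>: the orbit of
  \<open>x\<close> changes its side of \<open>h\<close> only when a translate of \<open>h\<close> or
  of its complement separates \<open>x\<close> from \<open>g x\<close>. If the translates of
  \<open>h\<close> are distinct, this happens finitely often and a vote works. A periodic
  \<open>h\<close> that changes at all changes infinitely often, so \<open>x\<close> is first
  projected to make the periodic halfspaces constant. One window serves all \<open>h\<close> because
  finitely many halfspaces separate \<open>x\<close> from \<open>g x\<close>. Independence: an orbit
  in \<open>M\<close> keeps its side of a \<open>Triv\<close> halfspace but visits every
  \<open>Skew\<close> and every \<open>Inv\<close> halfspace; \<open>Inv\<close> against
  \<open>Skew\<close> compares recurrent with eventual visits, and two members of \<open>Inv\<close>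
  are compared by the parity of exponents. Conjugation turns \<open>g\<close> into a power of
  \<open>g\<close>; the infinite orbit of a \<open>Skew\<close> halfspace forces the exponent 1 or
  -1, so that at most the direction of monotonicity is reversed.\<close>

lemma walk_iff_successively:
  "walk X p \<longleftrightarrow> p \<noteq> [] \<and> set p \<subseteq> verts X \<and> successively (\<lambda>a b. {a, b} \<in> edges X) p"
  by (simp add: walk_def successively_conv_nth)

lemma walk_from_to_append:
  assumes "walk_from_to X x p y" "walk_from_to X y' q z" "{y, y'} \<in> edges X"
  shows "walk_from_to X x (p @ q) z"
  using assms
  by (auto simp: walk_from_to_def walk_iff_successively successively_append_iff)

lemma walk_from_to_join:
  assumes "walk_from_to X x p y" "walk_from_to X y q z"
  shows "walk_from_to X x (p @ tl q) z"
proof (cases "tl q")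
  case Nil
  then have "q = [y]"
    using assms by (cases q) (auto simp: walk_from_to_def walk_def)
  then show ?thesis
    using assms by (auto simp: walk_from_to_def)
next
  case (Cons a r)
  then have "q = y # a # r"
    using assms by (cases q) (auto simp: walk_from_to_def walk_def)
  then have "walk_from_to X a (a # r) z" "{y, a} \<in> edges X" "tl q = a # r"
    using assms by (auto simp: walk_from_to_def walk_iff_successively)
  then show ?thesis
    using walk_from_to_append[OF assms(1)] by simp
qed

lemma walk_from_to_rev:
  assumes "walk_from_to X x p y"
  shows "walk_from_to X y (rev p) x"
  using assms
  by (auto simp: walk_from_to_def walk_iff_successively hd_rev last_rev successively_rev insert_commute)

lemma walk_from_to_sing: "x \<in> verts X \<Longrightarrow> walk_from_to X x [x] x"
  by (auto simp: walk_from_to_def walk_def)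

lemma walk_from_to_verts:
  "walk_from_to X x p y \<Longrightarrow> x \<in> verts X" "walk_from_to X x p y \<Longrightarrow> y \<in> verts X"
  by (auto simp: walk_from_to_def walk_def)

lemma gdist_walk:
  assumes "walk_from_to X x p y"
  shows "\<exists>q. walk_from_to X x q y \<and> length q = Suc (gdist X x y)"
proof -
  have "length p = Suc (length p - 1)"
    using assms by (cases p) (auto simp: walk_from_to_def walk_def)
  then have "\<exists>n. \<exists>p. walk_from_to X x p y \<and> length p = Suc n"
    using assms by blast
  then show ?thesis
    unfolding gdist_def by (rule LeastI_ex)
qed

lemma gdist_le:
  assumes "walk_from_to X x p y"
  shows "Suc (gdist X x y) \<le> length p"
proof -
  have "length p = Suc (length p - 1)"
    using assms by (cases p) (auto simp: walk_from_to_def walk_def)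
  then have "gdist X x y \<le> length p - 1"
    unfolding gdist_def using assms by (metis (mono_tags, lifting) Least_le)
  then show ?thesis
    using \<open>length p = Suc (length p - 1)\<close> by simp
qed

text \<open>Bounds graph distances from below in cubulations and in the cubical quotient. There
  \<open>\<delta>\<close> counts separating walls, and such a count, being subadditive and at most 1
  on edges, cannot exceed the number of edges of a walk. The \<open>Suc\<close> is there because
  lists count vertices.\<close>

lemma walk_length_ge:
  fixes \<delta> :: "'v \<Rightarrow> 'v \<Rightarrow> nat"
  assumes tri: "\<And>x y z. x \<in> verts X \<Longrightarrow> y \<in> verts X \<Longrightarrow> z \<in> verts X \<Longrightarrow> \<delta> x z \<le> \<delta> x y + \<delta> y z"
    and refl: "\<And>x. x \<in> verts X \<Longrightarrow> \<delta> x x = 0"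
    and edge: "\<And>x y. {x, y} \<in> edges X \<Longrightarrow> x \<in> verts X \<Longrightarrow> y \<in> verts X \<Longrightarrow> \<delta> x y \<le> 1"
    and p: "walk_from_to X x p y"
  shows "Suc (\<delta> x y) \<le> length p"
  using p
proof (induction p arbitrary: x)
  case Nil
  then show ?case by (simp add: walk_from_to_def walk_def)
next
  case (Cons a p)
  show ?case
  proof (cases p)
    case Nil
    then show ?thesis
      using Cons.prems refl by (auto simp: walk_from_to_def walk_def)
  next
    case (Cons b r)
    then have "walk_from_to X b p y" and ab: "{a, b} \<in> edges X" "a = x" "x \<in> verts X" "b \<in> verts X" "y \<in> verts X"
      using Cons.prems walk_from_to_verts(2)[OF Cons.prems]
      by (auto simp: walk_from_to_def walk_iff_successively)
    then have "Suc (\<delta> b y) \<le> length p"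
      using Cons.IH by blast
    moreover have "\<delta> x y \<le> \<delta> x b + \<delta> b y" "\<delta> x b \<le> 1"
      using ab tri edge by auto
    ultimately show ?thesis by simp
  qed
qed

text \<open>The model cube is homogeneous: symmetric difference with \<open>A0\<close> is an
  automorphism of it exchanging \<open>{}\<close> and \<open>A0\<close>. Precomposing with it places
  any chosen vertex at \<open>{}\<close>, the corner from which directions are read off.\<close>

lemma cube_based:
  assumes "cube Y n C" "v \<in> C"
  obtains f where "bij_betw f (Pow {..<n}) C" "f {} = v"
    "\<And>A B. A \<subseteq> {..<n} \<Longrightarrow> B \<subseteq> {..<n} \<Longrightarrow> {f A, f B} \<in> edges Y \<longleftrightarrow> card (sym_diff A B) = 1"
proof -
  obtain f where f: "bij_betw f (Pow {..<n}) C"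
    "\<And>A B. A \<subseteq> {..<n} \<Longrightarrow> B \<subseteq> {..<n} \<Longrightarrow> {f A, f B} \<in> edges Y \<longleftrightarrow> card (sym_diff A B) = 1"
  proof -
    have "\<exists>f. bij_betw f (Pow {..<n}) C \<and> (\<forall>A B. A \<subseteq> {..<n} \<and> B \<subseteq> {..<n} \<longrightarrow>
        ({f A, f B} \<in> edges Y \<longleftrightarrow> card (sym_diff A B) = 1))"
      using assms(1) unfolding cube_def by (rule conjunct2)
    then show ?thesis using that by (elim exE conjE) simp
  qed
  obtain A0 where A0: "A0 \<subseteq> {..<n}" "f A0 = v"
    using f(1) assms(2) by (metis PowD bij_betw_imp_surj_on imageE)
  define s where "s A = sym_diff A A0" for A
  have s: "s (s A) = A" "A \<subseteq> {..<n} \<Longrightarrow> s A \<subseteq> {..<n}" "sym_diff (s A) (s B) = sym_diff A B" for A B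
    using A0 by (auto simp: s_def)
  have "bij_betw s (Pow {..<n}) (Pow {..<n})"
    by (rule bij_betw_byWitness[where f' = s]) (use s in auto)
  then have "bij_betw (f \<circ> s) (Pow {..<n}) C"
    using f(1) bij_betw_trans by blast
  moreover have "(f \<circ> s) {} = v"
    using A0 by (simp add: s_def)
  moreover have "{(f \<circ> s) A, (f \<circ> s) B} \<in> edges Y \<longleftrightarrow> card (sym_diff A B) = 1"
    if "A \<subseteq> {..<n}" "B \<subseteq> {..<n}" for A B
    using f(2)[of "s A" "s B"] s that by simp
  ultimately show ?thesis using that by blast
qed

section \<open>Squares and cubes in a CAT(0) cube complex\<close>

locale CAT0 =
  fixes X :: "'v skeleton"
  assumes CAT0: "CAT0_cube_complex X"
begin

abbreviation V :: "'v set" where "V \<equiv> verts X"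
abbreviation d :: "'v \<Rightarrow> 'v \<Rightarrow> nat" where "d \<equiv> gdist X"

definition E :: "'v \<Rightarrow> 'v \<Rightarrow> bool" where
  "E u v \<longleftrightarrow> {u, v} \<in> edges X"

lemma E_sym: "E u v \<longleftrightarrow> E v u"
  by (simp add: E_def insert_commute)

lemma simple_graph: "simple_graph X"
  using CAT0 by (simp add: CAT0_cube_complex_def)

lemma edgeE:
  assumes "e \<in> edges X"
  obtains a b where "e = {a, b}" "E a b" "a \<in> V" "b \<in> V" "a \<noteq> b"
  using assms simple_graph unfolding simple_graph_def E_def by metis

lemma E_D: assumes "E u v" shows "u \<in> V" "v \<in> V" "u \<noteq> v"
proof -
  have "{u, v} \<in> edges X"
    using assms by (simp add: E_def)
  then obtain u' v' where "{u, v} = {u', v'}" "E u' v'" "u' \<in> V" "v' \<in> V" "u' \<noteq> v'"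
    by (rule edgeE)
  then show "u \<in> V" "v \<in> V" "u \<noteq> v"
    by (auto simp: doubleton_eq_iff)
qed

lemma walk_exists: "x \<in> V \<Longrightarrow> y \<in> V \<Longrightarrow> \<exists>p. walk_from_to X x p y"
  using CAT0
  unfolding CAT0_cube_complex_def simply_connected_complex_def connected_graph_def by blast

lemma closed_walk_null: "walk_from_to X x p x \<Longrightarrow> equivclp (homotopy_step X) p [x]"
  using CAT0 unfolding CAT0_cube_complex_def simply_connected_complex_def by blast

lemma V_nonempty: "V \<noteq> {}"
  using CAT0 unfolding CAT0_cube_complex_def simply_connected_complex_def by blast

lemma homotopy_step_parity: "homotopy_step X p q \<Longrightarrow> even (length p) = even (length q)"
  by (induction rule: homotopy_step.induct) auto

text \<open>Backtracks shorten a list by two and pushes keep its length, so parity is invariant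
  under homotopy, and \<open>[x]\<close> has odd length. As lists count vertices, this says that the
  graph is bipartite.\<close>

lemma closed_walk_odd:
  assumes "walk_from_to X x p x"
  shows "odd (length p)"
proof -
  have "equivclp (homotopy_step X) p q \<Longrightarrow> even (length p) = even (length q)" for q
    by (induction rule: equivclp_induct) (auto simp: homotopy_step_parity)
  from this[OF closed_walk_null[OF assms]] show ?thesis by simp
qed

lemma no_triangle: assumes "E a b" "E b c" shows "\<not> E a c"
proof
  assume "E a c"
  then have "walk_from_to X a [a, b, c, a] a"
    using assms E_D by (auto simp: walk_from_to_def walk_iff_successively E_def insert_commute)
  from closed_walk_odd[OF this] show False by simp
qed

lemma dist_refl [simp]: "x \<in> V \<Longrightarrow> d x x = 0"
  using gdist_le[OF walk_from_to_sing] by fastforce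

lemma dist_walk:
  assumes "x \<in> V" "y \<in> V"
  obtains p where "walk_from_to X x p y" "length p = Suc (d x y)"
  using walk_exists[OF assms] gdist_walk[of X x _ y] by metis

lemma dist_sym: assumes "x \<in> V" "y \<in> V" shows "d x y = d y x"
proof -
  have "d x y \<le> d y x" if xy: "x \<in> V" "y \<in> V" for x y
  proof -
    obtain p where "walk_from_to X y p x" "length p = Suc (d y x)"
      using dist_walk xy by blast
    then show ?thesis
      using gdist_le[OF walk_from_to_rev] by fastforce
  qed
  then show ?thesis using assms by (simp add: antisym)
qed

lemma dist_triangle: assumes "x \<in> V" "y \<in> V" "z \<in> V" shows "d x z \<le> d x y + d y z"
proof -
  obtain p q where "walk_from_to X x p y" "length p = Suc (d x y)"
    "walk_from_to X y q z" "length q = Suc (d y z)"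
    using dist_walk[OF assms(1,2)] dist_walk[OF assms(2,3)] by metis
  then show ?thesis
    using gdist_le[OF walk_from_to_join, of X x p y q z] by simp
qed

lemma dist_eq_0D: assumes "x \<in> V" "y \<in> V" "d x y = 0" shows "x = y"
proof -
  obtain p where p: "walk_from_to X x p y" "length p = 1"
    by (rule dist_walk[OF assms(1,2)]) (use assms(3) in auto)
  then obtain a where "p = [a]"
    by (cases p) auto
  then show ?thesis
    using p by (auto simp: walk_from_to_def)
qed

lemma dist_E: assumes "E u v" shows "d u v = 1"
proof -
  have "walk_from_to X u [u, v] v"
    using assms E_D[OF assms] by (auto simp: walk_from_to_def walk_iff_successively E_def)
  from gdist_le[OF this] have "d u v \<le> 1" by simp
  moreover have "d u v \<noteq> 0"
    using dist_eq_0D E_D[OF assms] by blast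
  ultimately show ?thesis by simp
qed

lemma E_iff_dist: assumes "x \<in> V" "y \<in> V" shows "E x y \<longleftrightarrow> d x y = 1"
proof
  assume "d x y = 1"
  obtain p where p: "walk_from_to X x p y" "length p = 2"
    by (rule dist_walk[OF assms]) (use \<open>d x y = 1\<close> in auto)
  then obtain a b where "p = [a, b]"
    by (auto simp: length_Suc_conv numeral_2_eq_2)
  then show "E x y"
    using p by (auto simp: walk_from_to_def walk_iff_successively E_def)
qed (rule dist_E)

lemma dist_parity: assumes "E u v" "x \<in> V" shows "odd (d x u + d x v)"
proof -
  obtain p q where p: "walk_from_to X x p u" "length p = Suc (d x u)"
    and q: "walk_from_to X x q v" "length q = Suc (d x v)"
    using dist_walk[OF assms(2) E_D(1)[OF assms(1)]] dist_walk[OF assms(2) E_D(2)[OF assms(1)]]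
    by metis
  have "walk_from_to X x (p @ rev q) x"
    using walk_from_to_append[OF p(1) walk_from_to_rev[OF q(1)]] assms by (simp add: E_def)
  from closed_walk_odd[OF this] show ?thesis
    using p q by simp
qed

lemma dist_edge_cases: assumes "E u v" "x \<in> V" shows "d x v = Suc (d x u) \<or> d x u = Suc (d x v)"
proof -
  have "d x u \<noteq> d x v"
    using dist_parity[OF assms] by auto
  moreover have "d x u \<le> d x v + 1" "d x v \<le> d x u + 1"
    using dist_triangle[of x v u] dist_triangle[of x u v] dist_E[OF assms(1)] dist_E[of v u]
      E_D[OF assms(1)] assms by (simp_all add: E_sym)
  ultimately show ?thesis by linarith
qed

lemma dist_step: assumes "x \<in> V" "y \<in> V" "d x y = Suc n"
  obtains z where "E x z" "d z y = n"
proof -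
  obtain p where p: "walk_from_to X x p y" "length p = Suc (Suc n)"
    by (rule dist_walk[OF assms(1,2)]) (use assms(3) in auto)
  then obtain a z r where pr: "p = a # z # r"
    by (auto simp: length_Suc_conv)
  then have xz: "E x z" and "walk_from_to X z (z # r) y"
    using p by (auto simp: walk_from_to_def walk_iff_successively E_def)
  then have "d z y \<le> n"
    using gdist_le[of X z "z # r" y] p pr by simp
  moreover have "d x y \<le> d x z + d z y"
    using dist_triangle assms E_D xz by blast
  ultimately have "d z y = n"
    using dist_E[OF xz] assms by simp
  then show ?thesis using that xz by blast
qed

text \<open>A 4-cycle with distinct opposite corners is enough to encode a square: bipartiteness
  excludes the diagonals, so the cycle is induced and is a 2-cube (\<open>sq_cube\<close>).\<close>

definition sq :: "'v \<Rightarrow> 'v \<Rightarrow> 'v \<Rightarrow> 'v \<Rightarrow> bool" where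
  "sq a b c e \<longleftrightarrow> E a b \<and> E b c \<and> E c e \<and> E e a \<and> a \<noteq> c \<and> b \<noteq> e"

lemma sq_flip: "sq a b c e \<Longrightarrow> sq a e c b"
  by (auto simp: sq_def E_sym)

lemma sq_rot: "sq a b c e \<Longrightarrow> sq b c e a"
  by (auto simp: sq_def E_sym)

lemma sq_cube: assumes "sq a b c e" shows "cube X 2 {a, b, c, e}"
proof -
  have E: "E a b" "E b c" "E c e" "E e a" "a \<noteq> c" "b \<noteq> e"
    using assms by (auto simp: sq_def)
  have ne: "a \<noteq> b" "b \<noteq> c" "c \<noteq> e" "e \<noteq> a"
    using E E_D(3) by blast+
  have E': "E b a" "E c b" "E e c" "E a e"
    using E by (simp_all add: E_sym)
  have nE: "\<not> E a c" "\<not> E b e"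
    using no_triangle E by blast+
  then have nE': "\<not> E c a" "\<not> E e b"
    using E_sym by blast+
  have nEr: "\<not> E x x" for x
    using E_D(3) by blast
  define f where "f A = (if A = {} then a else if A = {0} then b else if A = {1} then e else c)"
    for A :: "nat set"
  have pow: "Pow {..<2::nat} = {{}, {0}, {1}, {0, 1}}"
    by (auto simp: numeral_2_eq_2 lessThan_Suc)
  have "bij_betw f (Pow {..<2}) {a, b, c, e}"
    unfolding pow by (rule bij_betw_imageI) (use E ne in \<open>auto simp: f_def inj_on_def\<close>)
  moreover have "\<forall>A\<in>Pow {..<2}. \<forall>B\<in>Pow {..<2}. {f A, f B} \<in> edges X \<longleftrightarrow> card (sym_diff A B) = 1"
    unfolding E_def[symmetric] pow
    by (simp add: f_def insert_Diff_if E E' nE nE' nEr)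
  moreover have "{a, b, c, e} \<subseteq> V"
    using E_D(1)[OF E(1)] E_D(1)[OF E(2)] E_D[OF E(3)] by blast
  ultimately show ?thesis
    unfolding cube_def by (metis PowI)
qed

lemma cube_2_sq:
  assumes "cube X 2 S" "v \<in> S"
  obtains a b c where "S = {v, a, b, c}" "sq v a b c"
proof -
  obtain f :: "nat set \<Rightarrow> 'v" where f: "bij_betw f (Pow {..<2}) S" "f {} = v"
    "\<And>A B. A \<subseteq> {..<2} \<Longrightarrow> B \<subseteq> {..<2} \<Longrightarrow> {f A, f B} \<in> edges X \<longleftrightarrow> card (sym_diff A B) = 1"
    using cube_based[OF assms] by metis
  have pow: "Pow {..<2::nat} = {{}, {0}, {1}, {0, 1}}"
    by (auto simp: numeral_2_eq_2 lessThan_Suc)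
  have S: "S = {f {}, f {0}, f {0, 1}, f {1}}"
    using f(1) pow by (auto simp: bij_betw_def)
  have "inj_on f {{}, {0}, {1}, {0, 1}}"
    using f(1) pow by (simp add: bij_betw_def)
  then have "f {} \<noteq> f {0, 1}" "f {0} \<noteq> f {1}"
    by (auto simp: inj_on_def)
  then have "sq (f {}) (f {0}) (f {0, 1}) (f {1})"
    unfolding sq_def E_def by (simp add: f(3) insert_Diff_if)
  then show ?thesis
    using that S f(2) by blast
qed

lemma opposite_iff_sq:
  "opposite X {a, b} {c, e} \<and> opposite X {b, c} {e, a} \<longleftrightarrow> sq a b c e"
proof
  assume *: "opposite X {a, b} {c, e} \<and> opposite X {b, c} {e, a}"
  then have "{a, b} \<in> edges X" "{c, e} \<in> edges X" "{b, c} \<in> edges X" "{e, a} \<in> edges X"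
    "{a, b} \<inter> {c, e} = {}"
    unfolding opposite_def by blast+
  then show "sq a b c e"
    unfolding sq_def E_def by blast
next
  assume *: "sq a b c e"
  have "cube X 2 ({a, b} \<union> {c, e})" "cube X 2 ({b, c} \<union> {e, a})"
  proof -
    have "{a, b} \<union> {c, e} = {a, b, c, e}" "{b, c} \<union> {e, a} = {a, b, c, e}"
      by auto
    then show "cube X 2 ({a, b} \<union> {c, e})" "cube X 2 ({b, c} \<union> {e, a})"
      using sq_cube[OF *] by simp_all
  qed
  moreover have "{a, b} \<inter> {c, e} = {}" "{b, c} \<inter> {e, a} = {}"
    using * E_D(3)[of a b] E_D(3)[of b c] E_D(3)[of c e] E_D(3)[of e a] unfolding sq_def by blast+
  ultimately show "opposite X {a, b} {c, e} \<and> opposite X {b, c} {e, a}"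
    using * unfolding opposite_def sq_def E_def by blast
qed

lemma oppositeE:
  assumes "opposite X e f"
  obtains a b c c' where "e = {a, b}" "f = {c', c}" "sq a b c c'"
proof -
  have e: "e \<in> edges X" "f \<in> edges X" "e \<inter> f = {}" "cube X 2 (e \<union> f)"
    using assms by (auto simp: opposite_def)
  obtain a b where ab: "e = {a, b}" "E a b"
    using edgeE[OF e(1)] .
  obtain p q r where pqr: "e \<union> f = {a, p, q, r}" "sq a p q r"
    using cube_2_sq[OF e(4), of a] ab by auto
  have ne: "a \<noteq> p" "a \<noteq> q" "a \<noteq> r" "p \<noteq> q" "p \<noteq> r" "q \<noteq> r" "\<not> E a q"
    using pqr(2) E_D(3) no_triangle unfolding sq_def by metis+
  have "b \<in> {a, p, q, r}" "b \<noteq> a"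
    using ab pqr E_D(3) by blast+
  then have bpr: "b = p \<or> b = r"
    using ab(2) ne by blast
  have "f = (e \<union> f) - e"
    using e(3) by blast
  then have f: "f = {a, p, q, r} - {a, b}"
    unfolding pqr(1) unfolding ab(1) .
  from bpr show ?thesis
  proof
    assume 1: "b = p"
    then have "f = {r, q}"
      unfolding f using 1 ne by auto
    then show ?thesis
      using that[of a b r q] 1 ab pqr(2) by blast
  next
    assume 2: "b = r"
    then have "f = {p, q}"
      unfolding f using ne by auto
    then show ?thesis
      using that[of a b p q] 2 ab sq_flip[OF pqr(2)] by blast
  qed
qed

lemma flag:
  assumes "v \<in> V" "finite N" "\<And>a. a \<in> N \<Longrightarrow> E v a"
    "\<And>a b. a \<in> N \<Longrightarrow> b \<in> N \<Longrightarrow> a \<noteq> b \<Longrightarrow> \<exists>c. sq v a c b"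
  shows "\<exists>!C. cube X (card N) C \<and> v \<in> C \<and> N \<subseteq> C"
proof -
  have sqs: "\<forall>a\<in>N. \<forall>b\<in>N. a \<noteq> b \<longrightarrow> (\<exists>S. cube X 2 S \<and> {v, a, b} \<subseteq> S)"
  proof (intro ballI impI)
    fix a b assume "a \<in> N" "b \<in> N" "a \<noteq> b"
    then obtain c where "sq v a c b"
      using assms(4) by blast
    from sq_cube[OF this] show "\<exists>S. cube X 2 S \<and> {v, a, b} \<subseteq> S"
      by blast
  qed
  have nb: "\<forall>a\<in>N. {v, a} \<in> edges X"
    using assms(3) by (simp add: E_def)
  have fl: "flag_links X"
    using CAT0 by (simp add: CAT0_cube_complex_def)
  show ?thesis
    by (rule bspec[OF fl[unfolded flag_links_def] assms(1), THEN spec, THEN mp, OF conjI[OF assms(2) conjI[OF nb sqs]]])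
qed

text \<open>The uniqueness half of the link condition for the two neighbours \<open>a\<close> and
  \<open>b\<close>: both squares are 2-cubes at \<open>v\<close> through them, hence have the same
  vertices, and only one vertex is left besides \<open>v\<close>, \<open>a\<close>,
  \<open>b\<close>.\<close>

lemma sq_unique:
  assumes "sq v a c b" "sq v a c' b"
  shows "c = c'"
proof -
  have v: "v \<in> V" "E v a" "E v b" "a \<noteq> b"
    using assms E_D(1)[of v a] by (auto simp: sq_def E_sym)
  have "\<exists>!C. cube X (card {a, b}) C \<and> v \<in> C \<and> {a, b} \<subseteq> C"
    by (rule flag) (use v assms(1) sq_flip[OF assms(1)] in auto)
  moreover have "card {a, b} = 2"
    using v by simp
  ultimately have "\<exists>!C. cube X 2 C \<and> v \<in> C \<and> {a, b} \<subseteq> C"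
    by simp
  then have "{v, a, c, b} = {v, a, c', b}"
    by (rule ex1E) (use sq_cube[OF assms(1)] sq_cube[OF assms(2)] in auto)
  moreover have "c \<notin> {v, a, b}" "c' \<notin> {v, a, b}"
    using assms E_D(3) unfolding sq_def by blast+
  ultimately show ?thesis by blast
qed

text \<open>The existence half of the link condition for three neighbours. By
  \<open>sq_unique\<close> the faces at \<open>v\<close> of the resulting 3-cube are the given
  squares, so the vertex \<open>w\<close> opposite to \<open>v\<close> completes three further
  squares.\<close>

lemma sq_cube3:
  assumes "sq v a ab b" "sq v b bc c" "sq v a ac c"
  obtains w where "sq a ab w ac" "sq b ab w bc" "sq c ac w bc"
proof -
  have v: "v \<in> V" "E v a" "E v b" "E v c" "a \<noteq> b" "b \<noteq> c" "a \<noteq> c"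
    using assms E_D(1)[of v a] by (auto simp: sq_def E_sym)
  have "\<exists>!C. cube X (card {a, b, c}) C \<and> v \<in> C \<and> {a, b, c} \<subseteq> C"
    by (rule flag) (use v assms sq_flip[OF assms(1)] sq_flip[OF assms(2)] sq_flip[OF assms(3)] in auto)
  moreover have "card {a, b, c} = 3"
    using v by simp
  ultimately have "\<exists>!C. cube X 3 C \<and> v \<in> C \<and> {a, b, c} \<subseteq> C"
    by simp
  then obtain C where C: "cube X 3 C" "v \<in> C" "a \<in> C" "b \<in> C" "c \<in> C"
    by auto
  obtain f :: "nat set \<Rightarrow> 'v" where f: "bij_betw f (Pow {..<3}) C" "f {} = v"
    "\<And>A B. A \<subseteq> {..<3} \<Longrightarrow> B \<subseteq> {..<3} \<Longrightarrow> {f A, f B} \<in> edges X \<longleftrightarrow> card (sym_diff A B) = 1"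
    using cube_based[OF C(1,2)] by metis
  have nb: "\<exists>i<3. x = f {i}" if "x \<in> C" "E v x" for x
  proof -
    have "x \<in> f ` Pow {..<3}"
      using bij_betw_imp_surj_on[OF f(1)] that(1) by simp
    then obtain A where A: "A \<subseteq> {..<3}" "x = f A"
      by auto
    then have "card A = 1"
      using f(3)[of "{}" A] f(2) that by (simp add: E_def)
    then obtain i where "A = {i}"
      by (rule card_1_singletonE)
    then show ?thesis
      using A by auto
  qed
  obtain i j k where ijk: "i < 3" "j < 3" "k < 3" "a = f {i}" "b = f {j}" "c = f {k}"
    using nb[OF C(3) v(2)] nb[OF C(4) v(3)] nb[OF C(5) v(4)] by auto
  have ne: "i \<noteq> j" "j \<noteq> k" "i \<noteq> k"
    using ijk v by auto
  have inj: "f A = f B \<longleftrightarrow> A = B" if "A \<subseteq> {..<3}" "B \<subseteq> {..<3}" for A B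
    using inj_on_eq_iff[OF bij_betw_imp_inj_on[OF f(1)], of A B] that by simp
  have sqs: "sq (f A) (f (insert p A)) (f (insert p (insert q A))) (f (insert q A))"
    if "A \<subseteq> {..<3}" "p < 3" "q < 3" "p \<noteq> q" "p \<notin> A" "q \<notin> A" for A p q
  proof -
    have "sym_diff A (insert p A) = {p}" "sym_diff (insert p A) (insert p (insert q A)) = {q}"
      "sym_diff (insert p (insert q A)) (insert q A) = {p}" "sym_diff (insert q A) A = {q}"
      using that by auto
    then have "E (f A) (f (insert p A))" "E (f (insert p A)) (f (insert p (insert q A)))"
      "E (f (insert p (insert q A))) (f (insert q A))" "E (f (insert q A)) (f A)"
      unfolding E_def using f(3) that by simp_all
    moreover have "f A \<noteq> f (insert p (insert q A))" "f (insert p A) \<noteq> f (insert q A)"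
      using inj that by auto
    ultimately show ?thesis
      by (simp add: sq_def)
  qed
  have "sq v a (f {i, j}) b" "sq v b (f {j, k}) c" "sq v a (f {i, k}) c"
    using sqs[of "{}" i j] sqs[of "{}" j k] sqs[of "{}" i k] ijk ne f(2) by auto
  then have eqs: "ab = f {i, j}" "bc = f {j, k}" "ac = f {i, k}"
    using sq_unique assms by blast+
  show ?thesis
  proof (rule that)
    show "sq a ab (f {i, j, k}) ac"
      using sqs[of "{i}" j k] ijk ne eqs by (auto simp: insert_commute)
    show "sq b ab (f {i, j, k}) bc"
      using sqs[of "{j}" i k] ijk ne eqs by (auto simp: insert_commute)
    show "sq c ac (f {i, j, k}) bc"
      using sqs[of "{k}" i j] ijk ne eqs by (auto simp: insert_commute)
  qed
qed

end

context CAT0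
begin

section \<open>Reduction of walks\<close>

text \<open>Moves are defined by descent along the list and not with a context on both sides, so
  that comparing two moves at different places becomes a case analysis on the heads of the
  walks.\<close>

inductive push :: "'v list \<Rightarrow> 'v list \<Rightarrow> bool" where
  push_here: "sq a b c e \<Longrightarrow> push (a # b # c # y) (a # e # c # y)"
| push_later: "push p q \<Longrightarrow> push (x # p) (x # q)"

inductive backtrack :: "'v list \<Rightarrow> 'v list \<Rightarrow> bool" where
  backtrack_here: "E u w \<Longrightarrow> backtrack (u # w # u # y) (u # y)"
| backtrack_later: "backtrack p q \<Longrightarrow> backtrack (x # p) (x # q)"

text \<open>
  In \<open>strip\<close>, the walk \<open>p\<close> crosses the first rung of a ladder of squares, follows one side of the
  ladder and crosses the last rung back; \<open>q\<close> follows the other side instead.  Unlike backtracks,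
  such pairs of edges are preserved by pushes, which makes the reduction of walks confluent.
\<close>

inductive strip :: "'v list \<Rightarrow> 'v list \<Rightarrow> bool" where
  strip_base: "E u w \<Longrightarrow> strip (w # u # w # y) (w # y)"
| strip_step: "strip (w # u # r) (w # s) \<Longrightarrow> sq w0 u0 u w \<Longrightarrow> strip (w0 # u0 # u # r) (w0 # w # s)"

inductive shortcut :: "'v list \<Rightarrow> 'v list \<Rightarrow> bool" where
  shortcut_here: "strip p q \<Longrightarrow> shortcut p q"
| shortcut_later: "shortcut p q \<Longrightarrow> shortcut (x # p) (x # q)"

abbreviation pushes :: "'v list \<Rightarrow> 'v list \<Rightarrow> bool" where
  "pushes \<equiv> push\<^sup>*\<^sup>*"

inductive_cases push_ConsD: "push (x # p) q"
inductive_cases backtrack_ConsD: "backtrack (x # p) q"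
inductive_cases push_NilE: "push [] q"
inductive_cases backtrack_NilE: "backtrack [] q"
inductive_cases strip_ConsD: "strip (x # p) q"

lemmas push_ConsE = push_ConsD[consumes 1, case_names 1 2]
lemmas backtrack_ConsE = backtrack_ConsD[consumes 1, case_names 1 2]
lemmas strip_ConsE = strip_ConsD[consumes 1, case_names 1 2]

lemma sq_unique_last: "sq a b c e \<Longrightarrow> sq a b c e' \<Longrightarrow> e = e'"
  using sq_unique[of b a e c e'] sq_flip sq_rot by blast

lemma push_sym: "push p q \<Longrightarrow> push q p"
  by (induction rule: push.induct) (auto intro: push.intros sq_flip)

lemma pushes_sym: "pushes p q \<Longrightarrow> pushes q p"
  by (metis push_sym symp_rtranclp sympD sympI)

lemma pushes_Cons: "pushes p q \<Longrightarrow> pushes (x # p) (x # q)"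
  by (induction rule: rtranclp_induct) (auto intro: push_later rtranclp.rtrancl_into_rtrancl)

lemma push_Cons_D: "push (x # p) q \<Longrightarrow> \<exists>q'. q = x # q' \<and> length q' = length p"
  by (induction "x # p" q arbitrary: x p rule: push.induct) (auto elim: push.cases)

lemma push_length: "push p q \<Longrightarrow> length q = length p"
  by (induction rule: push.induct) auto

lemma pushes_length: "pushes p q \<Longrightarrow> length q = length p"
  by (induction rule: rtranclp_induct) (auto simp: push_length)

lemma backtrack_length: "backtrack p q \<Longrightarrow> length p = length q + 2"
  by (induction rule: backtrack.induct) auto

lemma backtrack_Cons_D: "backtrack (x # p) q \<Longrightarrow> \<exists>q'. q = x # q'"
  by (erule backtrack_ConsE) auto

lemma strip_shape: "strip p q \<Longrightarrow> \<exists>w u r s. p = w # u # r \<and> q = w # s \<and> r \<noteq> [] \<and> E u w"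
  by (induction rule: strip.induct) (auto simp: sq_def E_sym)

lemma shortcut_shape: "shortcut p q \<Longrightarrow> \<exists>x r s. p = x # r \<and> q = x # s"
  by (induction rule: shortcut.induct) (auto dest: strip_shape)

lemma backtrack_shortcut: "backtrack p q \<Longrightarrow> shortcut p q"
proof (induction rule: backtrack.induct)
  case (backtrack_here u w y)
  then have "E w u" by (simp add: E_sym)
  then show ?case by (intro shortcut_here strip_base)
qed (rule shortcut_later)

text \<open>A push on the long side never destroys a ladder. A square at its far end adds a rung, a
  square folding back over its end removes one, and a square meeting two consecutive squares of it
  spans a 3-cube with them, whose opposite faces carry a displaced ladder. Only in the last case
  does the short side change, by a single push.\<close>

lemma strip_push_tail:
  assumes "strip p q" "p = w # u # r" "push (u # r) (u # r')"
  shows "\<exists>q'. strip (w # u # r') q' \<and> push\<^sup>=\<^sup>= q q'"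
  using assms
proof (induction p q arbitrary: w u r r' rule: strip.induct)
  case (strip_base u0 w0 y)
  then have [simp]: "u0 = u" "w0 = w" "r = w # y" and E: "E u w" by auto
  from strip_base.prems(2) have "push (u # w # y) (u # r')" by simp
  then show ?case
  proof (cases rule: push_ConsE)
    case (1 b c e y')
    then have sq: "sq u w c e" and y: "y = c # y'" and r': "r' = e # c # y'" by auto
    \<comment> \<open>The pushed square becomes one more square at the far end of the ladder, with
      last rung \<open>e c\<close>. The short side stays the same.\<close>
    have "strip (c # e # c # y') (c # y')"
      using sq by (intro strip.strip_base) (auto simp: sq_def E_sym)
    moreover have "sq w u e c"
      using sq sq_flip sq_rot by blast
    ultimately have "strip (w # u # e # c # y') (w # c # y')"
      by (rule strip.strip_step)
    then show ?thesis
      using y r' by auto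
  next
    case (2 q)
    then have "push (w # y) r'" by simp
    moreover from this obtain y' where "r' = w # y'"
      using push_Cons_D by blast
    ultimately show ?thesis
      using strip.strip_base[OF E, of y'] by auto
  qed
next
  case (strip_step w1 u1 r1 s1 w0 u0)
  then have [simp]: "u0 = u" "w0 = w" "r = u1 # r1"
    and st: "strip (w1 # u1 # r1) (w1 # s1)" and sq: "sq w u u1 w1" by auto
  from strip_step.prems(2) have "push (u # u1 # r1) (u # r')" by simp
  then show ?case
  proof (cases rule: push_ConsE)
    case (1 b c e y)
    then have sq2: "sq u u1 c e" and r1: "r1 = c # y" and r': "r' = e # c # y" by auto
    from st show ?thesis
    proof (cases rule: strip_ConsE)
      case (1 u2 w2)
      then have c: "c = w1" and s1: "s1 = y"
        using r1 by auto
      \<comment> \<open>Both \<open>e\<close> and \<open>w\<close> complete the square on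
        \<open>u\<close>, \<open>u1\<close>, \<open>w1\<close>. So the push folds the last square of
        the ladder away and leaves a plain backtrack \<open>w u w\<close>.\<close>
      have "e = w"
      proof -
        have "sq u u1 w1 e" "sq u u1 w1 w"
          using sq2 sq c sq_rot by blast+
        then show ?thesis by (rule sq_unique_last)
      qed
      have "strip (w # u # w # w1 # y) (w # w1 # y)"
        by (rule strip.strip_base) (use sq in \<open>auto simp: sq_def E_sym\<close>)
      then show ?thesis
        using r' c s1 \<open>e = w\<close> by auto
    next
      case (2 w2 u2 r2 s2)
      then have st2: "strip (w2 # c # y) (w2 # s2)" and sq3: "sq w1 u1 c w2" and s1: "s1 = w2 # s2"
        using r1 by auto
      have a: "sq u1 u e c" "sq u1 u w w1" "sq u1 c w2 w1"
        using sq2 sq sq3 sq_rot sq_flip by blast+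
      \<comment> \<open>At \<open>u1\<close> the pushed square and two consecutive squares of the
        ladder span a 3-cube. Its vertex \<open>f\<close> opposite to \<open>u1\<close> is the
        corner of the displaced ladder, and the face \<open>w w1 w2 f\<close> is the push that the
        short side undergoes.\<close>
      obtain f where f: "sq u e f w" "sq c e f w2" "sq w1 w f w2"
        using sq_cube3[of u1 u e c w2 w1 w] a sq_flip by metis
      have "strip (f # e # c # y) (f # w2 # s2)"
        using strip.strip_step[OF st2, of f e] f(2) sq_rot sq_flip by blast
      then have "strip (w # u # e # c # y) (w # f # w2 # s2)"
        by (rule strip.strip_step) (use f(1) sq_rot sq_flip in blast)
      moreover have "sq w w1 w2 f"
        using f(3) sq_rot sq_flip by blast
      ultimately show ?thesis
        using r' s1 push_here[of w w1 w2 f s2] by auto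
    qed
  next
    case (2 q)
    then have "push (u1 # r1) r'" by simp
    moreover from this obtain r2 where r2: "r' = u1 # r2"
      using push_Cons_D by blast
    ultimately obtain q' where q': "strip (w1 # u1 # r2) q'" "push\<^sup>=\<^sup>= (w1 # s1) q'"
      using strip_step.IH[of w1 u1 r1 r2] by auto
    then obtain s2 where s2: "q' = w1 # s2"
      using strip_shape by fastforce
    have "strip (w # u # u1 # r2) (w # w1 # s2)"
      using q'(1) s2 sq by (auto intro: strip.strip_step)
    moreover have "push\<^sup>=\<^sup>= (w # w1 # s1) (w # w1 # s2)"
      using q'(2) s2 by (auto intro: push_later)
    ultimately show ?thesis
      using r2 by auto
  qed
qed

text \<open>What remains is a push involving the first rung. By uniqueness its square is the first
  square of the ladder, so the push only crosses this square and the rest of the ladder starts one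
  vertex later. This is why the conclusion has \<open>shortcut\<close> and not
  \<open>strip\<close>.\<close>

lemma strip_push:
  assumes "strip p q" "push p p'"
  shows "\<exists>q'. shortcut p' q' \<and> push\<^sup>=\<^sup>= q q'"
proof -
  obtain w u r where p: "p = w # u # r"
    using strip_shape assms(1) by blast
  from assms(2)[unfolded p] show ?thesis
  proof (cases rule: push_ConsE)
    case (1 b c e y)
    then have sq: "sq w u c e" and r: "r = c # y" and p': "p' = w # e # c # y" by auto
    from assms(1)[unfolded p] show ?thesis
    proof (cases rule: strip_ConsE)
      case (1 u2 w2)
      then show ?thesis
        using sq r by (auto simp: sq_def)
    next
      case (2 w2 u2 r2 s2)
      then have "sq w u c w2" "strip (w2 # c # y) (w2 # s2)" "q = w # w2 # s2"
        using r by auto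
      moreover from this have "e = w2"
        using sq sq_unique_last by blast
      ultimately show ?thesis
        using p' by (auto intro: shortcut.intros)
    qed
  next
    case (2 q2)
    then have "push (u # r) q2" "p' = w # q2" by auto
    moreover from this obtain r' where "q2 = u # r'"
      using push_Cons_D by blast
    ultimately show ?thesis
      using strip_push_tail[OF assms(1) p, of r'] by (auto intro: shortcut_here)
  qed
qed

text \<open>A push that begins one vertex before a ladder glues its square to the front of it; a
  push disjoint from the ladder commutes with the shortcut. Ladders thus survive pushes, which
  backtracks do not.\<close>

lemma shortcut_push:
  assumes "shortcut p q" "push p p'"
  shows "\<exists>q'. shortcut p' q' \<and> push\<^sup>=\<^sup>= q q'"
  using assms
proof (induction arbitrary: p' rule: shortcut.induct)
  case (shortcut_here p q)
  then show ?case using strip_push by blast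
next
  case (shortcut_later p q x)
  from shortcut_later.prems show ?case
  proof (cases rule: push_ConsE)
    case (1 b c e y)
    then have sq: "sq x b c e" and p: "p = b # c # y" and p': "p' = x # e # c # y" by auto
    from shortcut_later.hyps show ?thesis
    proof (cases rule: shortcut.cases)
      case shortcut_here
      then obtain s where q: "q = b # s"
        using strip_shape p by fastforce
      have "strip (x # e # c # y) (x # b # s)"
        using shortcut_here p q sq sq_flip by (blast intro: strip_step)
      then show ?thesis
        using q p' by (auto intro: shortcut.shortcut_here)
    next
      case (shortcut_later p1 q1 b')
      then have q: "q = b # q1" and s: "shortcut (c # y) q1"
        using p by auto
      then obtain s1 where s1: "q1 = c # s1"
        using shortcut_shape by fastforce
      have "shortcut p' (x # e # q1)"
        using p' s by (auto intro: shortcut.shortcut_later)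
      moreover have "push (x # q) (x # e # q1)"
        using q s1 sq by (auto intro: push_here)
      ultimately show ?thesis by auto
    qed
  next
    case (2 p1)
    then obtain q' where "shortcut p1 q'" "push\<^sup>=\<^sup>= q q'"
      using shortcut_later.IH by blast
    then show ?thesis
      using 2 by (intro exI[of _ "x # q'"]) (auto intro: shortcut.shortcut_later push_later)
  qed
qed

lemma shortcut_pushes:
  assumes "pushes p p'" "shortcut p q"
  shows "\<exists>q'. shortcut p' q' \<and> pushes q q'"
  using assms
proof (induction rule: rtranclp_induct)
  case base
  then show ?case by blast
next
  case (step p1 p2)
  then obtain q1 where "shortcut p1 q1" "pushes q q1" by blast
  moreover from this obtain q2 where q2: "shortcut p2 q2" "push\<^sup>=\<^sup>= q1 q2"
    using shortcut_push step.hyps by blast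
  moreover have "pushes q1 q2"
    using q2(2) by auto
  ultimately show ?case
    using rtranclp_trans[of push q q1 q2] by blast
qed

text \<open>Crossing the squares of the ladder one at a time moves the returning rung from one end
  of the ladder to the other. Hence a shortcut amounts to pushes followed by one backtrack.\<close>

lemma strip_slide:
  assumes "strip p q" "p = w # x # y" "q = w # s"
  shows "pushes (x # w # s) (x # y)"
  using assms
proof (induction arbitrary: w x y s rule: strip.induct)
  case (strip_base u w0 z)
  then show ?case by auto
next
  case (strip_step w1 u1 r1 s1 w0 u0)
  then have sq: "sq w x u1 w1" and [simp]: "s = w1 # s1" "y = u1 # r1" by auto
  have "push (x # w # w1 # s1) (x # u1 # w1 # s1)"
    by (rule push_here) (rule sq_flip[OF sq_rot[OF sq]])
  moreover have "pushes (u1 # w1 # s1) (u1 # r1)"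
    using strip_step.IH by blast
  ultimately show ?case
    using pushes_Cons[of "u1 # w1 # s1" "u1 # r1" x] by auto
qed

text \<open>If the backtrack uses the far rung, both results agree up to pushes. If it lies inside
  the ladder, uniqueness of squares makes the ladder retrace itself, so that the short side
  backtracks as well. Beyond the ladder the two moves commute.\<close>

lemma strip_back_tail:
  assumes "strip p q" "p = w # u # r" "q = w # s" "backtrack (u # r) (u # r')"
  shows "pushes (w # s) (w # u # r') \<or> (\<exists>s'. strip (w # u # r') (w # s') \<and> shortcut (w # s) (w # s'))"
  using assms
proof (induction arbitrary: w u r r' s rule: strip.induct)
  case (strip_base u0 w0 y)
  then have [simp]: "u0 = u" "w0 = w" "r = w # y" "s = y" and E: "E u w" by auto
  from strip_base.prems(3) have "backtrack (u # w # y) (u # r')" by simp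
  then show ?case
  proof (cases rule: backtrack_ConsE)
    case (1 w' y')
    then show ?thesis by auto
  next
    case (2 q)
    then have b: "backtrack (w # y) r'" by simp
    moreover from this obtain y' where y': "r' = w # y'"
      using backtrack_Cons_D by blast
    ultimately have "shortcut (w # y) (w # y')"
      using backtrack_shortcut by blast
    then show ?thesis
      using strip.strip_base[OF E, of y'] y' by auto
  qed
next
  case (strip_step w1 u1 r1 s1 w0 u0)
  then have [simp]: "u0 = u" "w0 = w" "r = u1 # r1" "s = w1 # s1"
    and st: "strip (w1 # u1 # r1) (w1 # s1)" and sq: "sq w u u1 w1" by auto
  from strip_step.prems(3) have "backtrack (u # u1 # r1) (u # r')" by simp
  then show ?case
  proof (cases rule: backtrack_ConsE)
    case (1 w' y)
    then have r1: "r1 = u # y" and r': "r' = y" by auto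
    from st show ?thesis
    proof (cases rule: strip_ConsE)
      case (1 u2 w2)
      then show ?thesis
        using r1 sq E_D(3) by (auto simp: sq_def)
    next
      case (2 w2 u2 r2 s2)
      then have st2: "strip (w2 # u # y) (w2 # s2)" and sq3: "sq w1 u1 u w2" and s1: "s1 = w2 # s2"
        using r1 by auto
      \<comment> \<open>The long side runs \<open>u u1 u\<close>, so two consecutive squares share
        three corners and coincide; the short side therefore runs \<open>w w1 w\<close>.\<close>
      have "sq u u1 w1 w" "sq u u1 w1 w2"
        using sq sq3 sq_rot sq_flip by blast+
      then have [simp]: "w2 = w"
        using sq_unique_last by blast
      have "E w w1"
        using sq by (auto simp: sq_def E_sym)
      then have "shortcut (w # w1 # w # s2) (w # s2)"
        by (intro backtrack_shortcut backtrack_here)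
      then show ?thesis
        using st2 s1 r' by auto
    qed
  next
    case (2 q)
    then have b: "backtrack (u1 # r1) r'" by simp
    then obtain r2 where r2: "r' = u1 # r2"
      using backtrack_Cons_D by blast
    from strip_step.IH[of w1 u1 r1 s1 r2] b r2
    have "pushes (w1 # s1) (w1 # u1 # r2) \<or>
        (\<exists>s'. strip (w1 # u1 # r2) (w1 # s') \<and> shortcut (w1 # s1) (w1 # s'))" by simp
    then show ?thesis
    proof
      assume "pushes (w1 # s1) (w1 # u1 # r2)"
      then have "pushes (w # w1 # s1) (w # w1 # u1 # r2)"
        by (rule pushes_Cons)
      moreover have "push (w # w1 # u1 # r2) (w # u # u1 # r2)"
        using sq sq_flip by (blast intro: push_here)
      ultimately show ?thesis
        using r2 by auto
    next
      assume "\<exists>s'. strip (w1 # u1 # r2) (w1 # s') \<and> shortcut (w1 # s1) (w1 # s')"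
      then obtain s' where "strip (w1 # u1 # r2) (w1 # s')" "shortcut (w1 # s1) (w1 # s')" by blast
      then have "strip (w # u # u1 # r2) (w # w1 # s')" "shortcut (w # w1 # s1) (w # w1 # s')"
        using sq by (auto intro: strip.strip_step shortcut_later)
      then show ?thesis
        using r2 by auto
    qed
  qed
qed

text \<open>Local confluence modulo pushes: after a shortcut and a backtrack from the same walk, the
  results either agree up to pushes or are joined by one further shortcut on each side.\<close>

lemma shortcut_back:
  assumes "shortcut p q" "backtrack p q1"
  shows "pushes q q1 \<or> (\<exists>r r1. shortcut q r \<and> shortcut q1 r1 \<and> pushes r r1)"
  using assms
proof (induction arbitrary: q1 rule: shortcut.induct)
  case (shortcut_here p q)
  then obtain w u r s where p: "p = w # u # r" "q = w # s"
    using strip_shape by blast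
  from shortcut_here.prems[unfolded p] show ?case
  proof (cases rule: backtrack_ConsE)
    case (1 w' y)
    then have r: "r = w # y" and q1: "q1 = w # y" by auto
    from shortcut_here.hyps[unfolded p] show ?thesis
    proof (cases rule: strip_ConsE)
      case (1 u2 w2)
      then show ?thesis
        using p r q1 by auto
    next
      case (2 w2 u2 r2 s2)
      then show ?thesis
        using r by (auto simp: sq_def)
    qed
  next
    case (2 q2)
    then have "backtrack (u # r) q2" "q1 = w # q2" by auto
    moreover from this obtain r' where "q2 = u # r'"
      using backtrack_Cons_D by blast
    ultimately show ?thesis
      using strip_back_tail[OF shortcut_here.hyps p, of r'] p(2)
      by (blast intro: shortcut.shortcut_here)
  qed
next
  case (shortcut_later p q x)
  from shortcut_later.prems show ?case
  proof (cases rule: backtrack_ConsE)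
    case (1 w y)
    then have p: "p = w # x # y" and q1: "q1 = x # y" and E: "E x w" by auto
    from shortcut_later.hyps show ?thesis
    proof (cases rule: shortcut.cases)
      case shortcut_here
      then obtain s where q: "q = w # s"
        using strip_shape p by fastforce
      show ?thesis
        using strip_slide[OF shortcut_here p q] q q1 by simp
    next
      case (shortcut_later p1 r b')
      then have q: "q = w # r" and s: "shortcut (x # y) r"
        using p by auto
      then obtain s1 where s1: "r = x # s1"
        using shortcut_shape by fastforce
      have "shortcut (x # q) (x # s1)"
        using q s1 E by (auto intro: backtrack_shortcut backtrack_here)
      moreover have "shortcut q1 (x # s1)"
        using s s1 q1 by simp
      ultimately show ?thesis by blast
    qed
  next
    case (2 p1)
    then have "pushes q p1 \<or> (\<exists>r r1. shortcut q r \<and> shortcut p1 r1 \<and> pushes r r1)"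
      using shortcut_later.IH by blast
    then show ?thesis
      using 2 by (auto intro: shortcut.shortcut_later pushes_Cons)
  qed
qed

section \<open>Normal forms of walks up to pushes\<close>

definition reduce :: "'v list \<Rightarrow> 'v list \<Rightarrow> bool" where
  "reduce p q \<longleftrightarrow> push p q \<or> backtrack p q"

text \<open>Pushes are reversible, so normal forms can only be unique up to pushes. For this reason
  the absence of backtracks is required of the whole push class.\<close>

definition reduced :: "'v list \<Rightarrow> bool" where
  "reduced p \<longleftrightarrow> (\<forall>p' q. pushes p p' \<longrightarrow> \<not> backtrack p' q)"

definition normal_form :: "'v list \<Rightarrow> 'v list \<Rightarrow> bool" where
  "normal_form p r \<longleftrightarrow> reduce\<^sup>*\<^sup>* p r \<and> reduced r"

lemma pushes_reduce: "pushes p q \<Longrightarrow> reduce\<^sup>*\<^sup>* p q"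
  by (rule mono_rtranclp[rule_format, of push]) (auto simp: reduce_def)

lemma reduce_Cons: "reduce\<^sup>*\<^sup>* p q \<Longrightarrow> reduce\<^sup>*\<^sup>* (x # p) (x # q)"
proof (induction rule: rtranclp_induct)
  case (step y z)
  then have "reduce (x # y) (x # z)"
    by (auto simp: reduce_def intro: push_later backtrack_later)
  then show ?case using step by simp
qed simp

lemma shortcut_reduce: "shortcut p q \<Longrightarrow> reduce\<^sup>*\<^sup>* p q"
proof (induction rule: shortcut.induct)
  case (shortcut_here p q)
  then obtain w u r s where p: "p = w # u # r" "q = w # s" "E u w"
    using strip_shape by blast
  have "pushes (u # r) (u # w # s)"
    using strip_slide[OF shortcut_here p(1,2)] by (rule pushes_sym)
  then have "reduce\<^sup>*\<^sup>* p (w # u # w # s)"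
    unfolding p(1) by (rule pushes_reduce[OF pushes_Cons])
  moreover have "reduce (w # u # w # s) q"
    using p E_sym by (auto simp: reduce_def intro: backtrack_here)
  ultimately show ?case by simp
qed (rule reduce_Cons)

lemma reduced_pushes: "reduced p \<Longrightarrow> pushes p q \<Longrightarrow> reduced q"
  unfolding reduced_def by (meson rtranclp_trans)

lemma normal_form_cases:
  assumes "normal_form p r"
  shows "(pushes p r \<and> reduced p) \<or> (\<exists>p1 q1. pushes p p1 \<and> backtrack p1 q1 \<and> normal_form q1 r)"
proof -
  have "reduce\<^sup>*\<^sup>* p r" "reduced r"
    using assms by (auto simp: normal_form_def)
  then show ?thesis
  proof (induction rule: converse_rtranclp_induct)
    case base
    then show ?case by blast
  next
    case (step y z)
    show ?case
    proof (cases "push y z")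
      case True
      then have yz: "pushes y z" by blast
      have IH: "(pushes z r \<and> reduced z) \<or> (\<exists>p1 q1. pushes z p1 \<and> backtrack p1 q1 \<and> normal_form q1 r)"
        using step by blast
      moreover have "reduced z \<Longrightarrow> reduced y"
        using yz pushes_sym reduced_pushes by blast
      ultimately show ?thesis
        using yz by (meson rtranclp_trans)
    next
      case False
      then have "backtrack y z"
        using step by (auto simp: reduce_def)
      moreover have "normal_form z r"
        using step by (auto simp: normal_form_def)
      ultimately show ?thesis by blast
    qed
  qed
qed

lemma reduce_normal_form: "reduce\<^sup>*\<^sup>* p q \<Longrightarrow> normal_form q r \<Longrightarrow> normal_form p r"
  by (auto simp: normal_form_def)

lemma normal_form_exists: "\<exists>r. normal_form p r"
proof (induction "length p" arbitrary: p rule: less_induct)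
  case less
  show ?case
  proof (cases "reduced p")
    case True
    then show ?thesis by (auto simp: normal_form_def)
  next
    case False
    then obtain p' q where pq: "pushes p p'" "backtrack p' q"
      by (auto simp: reduced_def)
    then have "length q < length p"
      using pushes_length backtrack_length by fastforce
    then obtain r where "normal_form q r"
      using less by blast
    moreover have "reduce\<^sup>*\<^sup>* p q"
      using pq pushes_reduce[OF pq(1)]
      by (auto simp: reduce_def intro: rtranclp.rtrancl_into_rtrancl)
    ultimately show ?thesis
      using reduce_normal_form by blast
  qed
qed

text \<open>Pushes keep the length and backtracks decrease it, so induction on the length applies.
  The first backtracks of the two reductions occur on different members of the push class of
  \<open>p\<close>; carrying one of them over as a shortcut puts both on the same walk, where
  \<open>shortcut_back\<close> applies.\<close>

lemma normal_form_unique: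
  "normal_form p r1 \<Longrightarrow> normal_form p r2 \<Longrightarrow> pushes r1 r2"
proof (induction "length p" arbitrary: p r1 r2 rule: less_induct)
  case less
  show ?case
  proof (cases "reduced p")
    case True
    then have "pushes p r1" "pushes p r2"
      using normal_form_cases less.prems by (metis reduced_def)+
    then show ?thesis
      using pushes_sym by (meson rtranclp_trans)
  next
    case False
    then obtain p1 q1 where 1: "pushes p p1" "backtrack p1 q1" "normal_form q1 r1"
      using normal_form_cases[OF less.prems(1)] by blast
    obtain p2 q2 where 2: "pushes p p2" "backtrack p2 q2" "normal_form q2 r2"
      using normal_form_cases[OF less.prems(2)] False by blast
    have len: "length q1 < length p" "length q2 < length p"
      using 1 2 backtrack_length pushes_length by fastforce+
    have "pushes p1 p2"
      using 1 2 pushes_sym by (meson rtranclp_trans)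
    then obtain q where q: "shortcut p2 q" "pushes q1 q"
      using shortcut_pushes backtrack_shortcut 1 by blast
    from shortcut_back[OF q(1) 2(2)] show ?thesis
    proof
      assume "pushes q q2"
      then have "normal_form q2 r1"
        using q 1 pushes_sym pushes_reduce reduce_normal_form by (meson rtranclp_trans)
      then show ?thesis
        using less.hyps len 2 by blast
    next
      assume "\<exists>r r1. shortcut q r \<and> shortcut q2 r1 \<and> pushes r r1"
      then obtain s s' where s: "shortcut q s" "shortcut q2 s'" "pushes s s'" by blast
      obtain t where t: "normal_form s' t"
        using normal_form_exists by blast
      have "normal_form q2 t"
        using t s shortcut_reduce reduce_normal_form by blast
      moreover have "normal_form q1 t"
        using t s q shortcut_reduce pushes_reduce reduce_normal_form by meson
      ultimately have "pushes r1 t" "pushes r2 t"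
        using less.hyps len 1 2 by blast+
      then show ?thesis
        using pushes_sym by (meson rtranclp_trans)
    qed
  qed
qed

section \<open>From homotopies to pushes between geodesics\<close>

lemma push_append: "push p q \<Longrightarrow> push (x @ p) (x @ q)"
  by (induction x) (auto intro: push_later)

lemma backtrack_append: "backtrack p q \<Longrightarrow> backtrack (x @ p) (x @ q)"
  by (induction x) (auto intro: backtrack_later)

lemma homotopy_step_reduce: "homotopy_step X p q \<Longrightarrow> reduce p q"
proof (induction rule: homotopy_step.induct)
  case (backtrack u w p q)
  then have "backtrack (p @ u # w # u # q) (p @ u # q)"
    by (intro backtrack_append backtrack_here) (simp add: E_def)
  then show ?case
    by (simp add: reduce_def)
next
  case (push a b c e p q)
  then have "sq a b c e"
    using opposite_iff_sq by blast
  then have "CAT0.push X (p @ a # b # c # q) (p @ a # e # c # q)"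
    by (intro push_append push_here)
  then show ?case
    by (simp add: reduce_def)
qed

lemma homotopic_normal_form:
  assumes "equivclp (homotopy_step X) p q" "normal_form p r" "normal_form q r'"
  shows "pushes r r'"
  using assms(1,3)
proof (induction arbitrary: r' rule: equivclp_induct)
  case base
  then show ?case using normal_form_unique assms(2) by blast
next
  case (step y z)
  have "reduce y z \<or> reduce z y"
    using step.hyps homotopy_step_reduce by blast
  then show ?case
  proof
    assume "reduce y z"
    then have "normal_form y r'"
      using step.prems reduce_normal_form by blast
    then show ?thesis using step.IH by blast
  next
    assume "reduce z y"
    obtain s where s: "normal_form y s"
      using normal_form_exists by blast
    then have "normal_form z s"
      using \<open>reduce z y\<close> reduce_normal_form by blast
    then have "pushes s r'"
      using step.prems normal_form_unique by blast
    moreover have "pushes r s"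
      using step.IH s by blast
    ultimately show ?thesis by simp
  qed
qed

lemma homotopic_append:
  assumes "equivclp (homotopy_step X) p q"
  shows "equivclp (homotopy_step X) (a @ p @ b) (a @ q @ b)"
proof -
  have step: "homotopy_step X (a @ p @ b) (a @ q @ b)" if "homotopy_step X p q" for p q
    using that
  proof cases
    case (backtrack u w x y)
    then show ?thesis
      using homotopy_step.backtrack[of u w X "a @ x" "y @ b"] by simp
  next
    case (push a' b' c e x y)
    then show ?thesis
      using homotopy_step.push[of X a' b' c e "a @ x" "y @ b"] by simp
  qed
  from assms show ?thesis
  proof (induction rule: equivclp_induct)
    case (step y z)
    then show ?case
      using \<open>\<And>p q. homotopy_step X p q \<Longrightarrow> homotopy_step X (a @ p @ b) (a @ q @ b)\<close>
      by (meson equivclp_into_equivclp)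
  qed simp
qed

lemma homotopic_cancel:
  assumes "successively E q" "q \<noteq> []"
  shows "equivclp (homotopy_step X) (rev q @ tl q) [last q]"
  using assms
proof (induction q rule: induct_list012)
  case (3 a b r)
  have "homotopy_step X (rev r @ [b, a, b] @ r) (rev r @ [b] @ r)"
    using 3 by (intro homotopy_step.backtrack) (auto simp: E_def insert_commute)
  moreover have "equivclp (homotopy_step X) (rev (b # r) @ tl (b # r)) [last (b # r)]"
    using 3 by simp
  ultimately show ?case
    by (simp add: r_into_equivclp equivclp_trans[OF r_into_equivclp])
qed auto

lemma walk_iff: "walk X p \<longleftrightarrow> p \<noteq> [] \<and> set p \<subseteq> V \<and> successively E p"
  by (simp add: walk_iff_successively E_def[abs_def])

lemma push_walk: "push p q \<Longrightarrow> walk X p \<Longrightarrow> walk X q \<and> hd q = hd p \<and> last q = last p"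
proof (induction rule: push.induct)
  case (push_here a b c e y)
  then show ?case
    using E_D(1)[of e a] by (auto simp: walk_iff sq_def E_sym)
next
  case (push_later p q x)
  obtain a p' where p: "p = a # p'"
    using push_later.hyps by (cases p) (auto elim: push_NilE)
  then obtain q' where q: "q = a # q'"
    using push_later.hyps push_Cons_D by blast
  show ?case
    using push_later p q by (auto simp: walk_iff)
qed

lemma backtrack_walk: "backtrack p q \<Longrightarrow> walk X p \<Longrightarrow> walk X q \<and> hd q = hd p \<and> last q = last p"
proof (induction rule: backtrack.induct)
  case (backtrack_here u w y)
  then show ?case
    by (auto simp: walk_iff)
next
  case (backtrack_later p q x)
  obtain a p' where p: "p = a # p'"
    using backtrack_later.hyps by (cases p) (auto elim: backtrack_NilE)
  then obtain q' where q: "q = a # q'"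
    using backtrack_later.hyps backtrack_Cons_D by blast
  show ?case
    using backtrack_later p q by (auto simp: walk_iff)
qed

lemma pushes_walk: "pushes p q \<Longrightarrow> walk_from_to X x p y \<Longrightarrow> walk_from_to X x q y"
  by (induction rule: rtranclp_induct) (auto simp: walk_from_to_def push_walk)

lemma geodesic_reduced:
  assumes "walk_from_to X x p y" "length p = Suc (d x y)"
  shows "normal_form p p"
proof -
  have "\<not> backtrack p' q" if "pushes p p'" for p' q
  proof
    assume b: "backtrack p' q"
    have "walk_from_to X x p' y"
      using that assms pushes_walk by blast
    then have "walk_from_to X x q y"
      using b backtrack_walk by (auto simp: walk_from_to_def)
    then show False
      using gdist_le[of X x q y] assms(2) backtrack_length[OF b] pushes_length[OF that] by simp
  qed
  then show ?thesis
    by (auto simp: normal_form_def reduced_def)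
qed

text \<open>The loop formed by \<open>p\<close> and the reverse of \<open>q\<close> is
  null-homotopic, so \<open>p\<close> and \<open>q\<close> are homotopic and have the same normal
  form up to pushes. A walk in the push class of a geodesic cannot backtrack, as this would give a
  shorter walk, so both are already normal.\<close>

lemma geodesics_pushes:
  assumes p: "walk_from_to X x p y" "length p = Suc (d x y)"
    and q: "walk_from_to X x q y" "length q = Suc (d x y)"
  shows "pushes p q"
proof -
  have ne: "p \<noteq> []" "q \<noteq> []" "hd q = x" "last p = y" "last q = y"
    using p q by (auto simp: walk_from_to_def walk_def)
  have "walk_from_to X x (p @ tl (rev q)) x"
    using walk_from_to_join[OF p(1) walk_from_to_rev[OF q(1)]] .
  from homotopic_append[OF closed_walk_null[OF this], of "[]" "tl q"]
  have "equivclp (homotopy_step X) (p @ tl (rev q) @ tl q) ([x] @ tl q)"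
    by simp
  moreover have "[x] @ tl q = q"
    using ne by (cases q) auto
  moreover have "p @ tl (rev q) @ tl q = butlast p @ (rev q @ tl q) @ []"
  proof -
    have "p = butlast p @ [y]"
      using ne by auto
    moreover have "rev q = y # tl (rev q)"
      using ne by (metis hd_rev list.collapse rev_is_Nil_conv)
    ultimately show ?thesis
      by (metis append.assoc append.right_neutral append_Cons append_Nil)
  qed
  moreover have "equivclp (homotopy_step X) (butlast p @ (rev q @ tl q) @ []) (butlast p @ [y] @ [])"
    using homotopic_append[OF homotopic_cancel[of q], of "butlast p" "[]"] q ne
    by (simp add: walk_from_to_def walk_iff)
  moreover have "butlast p @ [y] @ [] = p"
    using ne by auto
  ultimately have "equivclp (homotopy_step X) p q"
    by (metis equivclp_sym equivclp_trans)
  then show ?thesis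
    using homotopic_normal_form geodesic_reduced[OF p] geodesic_reduced[OF q] by blast
qed

lemma dist_edge_cases': "E u v \<Longrightarrow> x \<in> V \<Longrightarrow> d v x = Suc (d u x) \<or> d u x = Suc (d v x)"
  using dist_edge_cases[of u v x] dist_sym E_D by metis

text \<open>Geodesics from \<open>z\<close> to \<open>x\<close> through \<open>u\<close> and through
  \<open>v\<close> are related by pushes. A push at the start replaces the second vertex across a
  square at \<open>z\<close>, any other push keeps it. So \<open>u\<close> and \<open>v\<close> are
  joined by a chain of squares at \<open>z\<close>, and the chain has to be compressed to one
  square.\<close>

lemma quadrangle:
  assumes "x \<in> V" "d z x = Suc n" "E z u" "E z v" "d u x = n" "d v x = n" "u \<noteq> v"
  shows "\<exists>c. sq z u c v \<and> Suc (d c x) = n"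
  using assms(2-)
proof (induction n arbitrary: z u v)
  case 0
  then have "u = x" "v = x"
    using dist_eq_0D E_D(2) assms(1) by blast+
  then show ?case using 0 by blast
next
  case (Suc m)
  define n where "n = Suc m"
  define rel where "rel u v \<longleftrightarrow> u = v \<or> (\<exists>c. sq z u c v \<and> Suc (d c x) = n)" for u v
  \<comment> \<open>Let the two squares at \<open>z\<close> share the edge \<open>z u1\<close> and
    have \<open>a\<close>, \<open>b\<close> opposite to \<open>z\<close>. The induction hypothesis
    at \<open>u1\<close> gives the square \<open>u1 a c b\<close>, and the 3-cube spanned at
    \<open>u1\<close> contains the wanted square \<open>z u0 w u2\<close>. The distance of
    \<open>w\<close> to \<open>x\<close> is forced by its neighbours \<open>u0\<close> and
    \<open>c\<close>.\<close>
  have trans: "rel u0 u2"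
    if rel: "rel u0 u1" "rel u1 u2" and u: "d u0 x = n" "d u1 x = n" "d u2 x = n"
    for u0 u1 u2
  proof (cases "u0 = u1 \<or> u1 = u2 \<or> u0 = u2")
    case True
    then show ?thesis using rel by (auto simp: rel_def)
  next
    case False
    then obtain a b
      where a: "sq z u0 a u1" "Suc (d a x) = n" and b: "sq z u1 b u2" "Suc (d b x) = n"
      using rel by (auto simp: rel_def)
    show ?thesis
    proof (cases "a = b")
      case True
      then have "sq z u0 a u2"
        using a b False by (auto simp: sq_def)
      then show ?thesis
        using a by (auto simp: rel_def)
    next
      case False
      have "E u1 a" "E u1 b"
        using a b by (auto simp: sq_def E_sym)
      then obtain c where c: "sq u1 a c b" "Suc (d c x) = m"
        using Suc.IH[of u1 a b] False u a b by (auto simp: n_def)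
      have "sq u1 z u0 a" "sq u1 z u2 b"
        using a b sq_rot sq_flip by blast+
      then obtain w where w: "sq z u0 w u2" "sq a u0 w c" "sq b u2 w c"
        using sq_cube3[of u1 z u0 a c b u2] c(1) by metis
      have "E u0 w" "E c w"
        using w by (auto simp: sq_def E_sym)
      from dist_edge_cases'[OF this(1) assms(1)] dist_edge_cases'[OF this(2) assms(1)]
      have "Suc (d w x) = n"
        using u(1) c(2) n_def by linarith
      then show ?thesis
        using w by (auto simp: rel_def)
    qed
  qed
  have geo: "walk_from_to X z (z # p) x" "length (z # p) = Suc (d z x)"
    if "walk_from_to X u p x" "length p = Suc (d u x)" "E z u" "d u x = n" for u p
    using that Suc.prems E_D(1)[OF that(3)]
    by (auto simp: walk_from_to_def walk_iff n_def successively_Cons)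
  have uV: "u \<in> V" "v \<in> V"
    using Suc.prems E_D(2) by blast+
  obtain p where p: "walk_from_to X u p x" "length p = Suc (d u x)"
    using dist_walk[OF uV(1) assms(1)] .
  obtain q where q: "walk_from_to X v q x" "length q = Suc (d v x)"
    using dist_walk[OF uV(2) assms(1)] .
  have zp: "walk_from_to X z (z # p) x" "length (z # p) = Suc (d z x)"
    and zq: "walk_from_to X z (z # q) x" "length (z # q) = Suc (d z x)"
    using geo[OF p] geo[OF q] Suc.prems by (auto simp: n_def)
  have "pushes (z # p) (z # q)"
    using geodesics_pushes[OF zp zq] .
  moreover have "\<exists>u' r. t = z # u' # r \<and> walk_from_to X z t x \<and> length t = Suc (d z x) \<and>
      d u' x = n \<and> rel u u'" if "pushes (z # p) t" for t
    using that
  proof (induction rule: rtranclp_induct)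
    case base
    have "p = u # tl p"
      using p by (cases p) (auto simp: walk_from_to_def walk_def)
    then show ?case
      using zp Suc.prems unfolding n_def rel_def by blast
  next
    case (step t t')
    then obtain u' r where t: "t = z # u' # r" and t_walk: "walk_from_to X z t x"
      and t_len: "length t = Suc (d z x)" and u': "d u' x = n" "rel u u'" by blast
    have t'_walk: "walk_from_to X z t' x" and t'_len: "length t' = Suc (d z x)"
      using pushes_walk[of t t'] step.hyps t_walk t_len push_length by auto
    from step.hyps(2)[unfolded t] show ?case
    proof (cases rule: push_ConsE)
      case (1 b a u'' y)
      then have sq: "sq z u' a u''" and r: "r = a # y" and t': "t' = z # u'' # a # y" by auto
      have "walk_from_to X a (a # y) x" "walk_from_to X u'' (u'' # a # y) x"
        using t_walk t'_walk unfolding t r t' by (auto simp: walk_from_to_def walk_iff)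
      then have le: "Suc (d a x) \<le> n" "d u'' x \<le> n"
        using gdist_le[of X a "a # y" x] gdist_le[of X u'' "u'' # a # y" x] t'_len t' Suc.prems
        by (auto simp: n_def)
      have "E u' a" "E z u''"
        using sq by (auto simp: sq_def E_sym)
      from dist_edge_cases'[OF this(1) assms(1)] dist_edge_cases'[OF this(2) assms(1)]
      have "Suc (d a x) = n" "d u'' x = n"
        using u'(1) le Suc.prems(1) n_def by linarith+
      then have "rel u' u''" "d u'' x = n"
        using sq by (auto simp: rel_def)
      moreover from this have "rel u u''"
        using trans[of u u' u''] u' Suc.prems by (auto simp: n_def)
      ultimately show ?thesis
        using t' t'_walk t'_len by blast
    next
      case (2 s)
      then obtain r' where "t' = z # u' # r'"
        using push_Cons_D by blast
      then show ?thesis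
        using t'_walk t'_len u' by blast
    qed
  qed
  ultimately have "rel u (hd q)"
    by (metis list.sel(1) list.inject)
  moreover have "hd q = v"
    using q by (simp add: walk_from_to_def)
  ultimately show ?case
    using Suc.prems unfolding rel_def n_def by blast
qed

end

section \<open>Discrete spaces with halfspaces\<close>

text \<open>The interface through which most later arguments see the complex.
  \<open>H_complete\<close> is the principle for constructing vertices: choose one side of each
  wall, check that chosen sides meet pairwise and that only finitely many miss some vertex. Upward
  closure of the choice need not be listed, for it follows from pairwise meeting.\<close>

locale halfspaces =
  fixes V :: "'v set" and H :: "'v set set" and \<mu> :: "'v \<Rightarrow> 'v \<Rightarrow> 'v \<Rightarrow> 'v"
  assumes H_sub: "h \<in> H \<Longrightarrow> h \<subseteq> V"
    and H_compl: "h \<in> H \<Longrightarrow> V - h \<in> H"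
    and H_nonempty: "h \<in> H \<Longrightarrow> h \<noteq> {}"
    and H_finite: "x \<in> V \<Longrightarrow> y \<in> V \<Longrightarrow> finite {h \<in> H. x \<in> h \<and> y \<notin> h}"
    and H_separate: "x \<in> V \<Longrightarrow> y \<in> V \<Longrightarrow> x \<noteq> y \<Longrightarrow> \<exists>h\<in>H. x \<in> h \<and> y \<notin> h"
    and H_complete: "\<sigma> \<subseteq> H \<Longrightarrow> (\<And>h. h \<in> H \<Longrightarrow> V - h \<in> \<sigma> \<longleftrightarrow> h \<notin> \<sigma>) \<Longrightarrow>
      (\<And>h k. h \<in> \<sigma> \<Longrightarrow> k \<in> \<sigma> \<Longrightarrow> h \<inter> k \<noteq> {}) \<Longrightarrow> x \<in> V \<Longrightarrow> finite {h \<in> \<sigma>. x \<notin> h} \<Longrightarrow>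
      \<exists>v\<in>V. \<forall>h\<in>H. v \<in> h \<longleftrightarrow> h \<in> \<sigma>"
    and \<mu>_in: "x \<in> V \<Longrightarrow> y \<in> V \<Longrightarrow> z \<in> V \<Longrightarrow> \<mu> x y z \<in> V"
    and \<mu>_iff: "x \<in> V \<Longrightarrow> y \<in> V \<Longrightarrow> z \<in> V \<Longrightarrow> h \<in> H \<Longrightarrow>
      \<mu> x y z \<in> h \<longleftrightarrow> (x \<in> h \<and> y \<in> h \<or> y \<in> h \<and> z \<in> h \<or> x \<in> h \<and> z \<in> h)"
begin

definition D :: "'v \<Rightarrow> 'v \<Rightarrow> 'v set set" where
  "D x y = {h \<in> H. x \<in> h \<and> y \<notin> h}"

end

section \<open>Halfspaces of a CAT(0) cube complex\<close>

context CAT0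
begin

definition side :: "'v \<Rightarrow> 'v \<Rightarrow> 'v set" where
  "side u v = {x \<in> V. d u x < d v x}"

definition Hs :: "'v set set" where
  "Hs = {side u v | u v. E u v}"

lemma side_Hs: "E u v \<Longrightarrow> side u v \<in> Hs"
  by (auto simp: Hs_def)

lemma side_self: "E u v \<Longrightarrow> u \<in> side u v" "E u v \<Longrightarrow> v \<notin> side u v"
  using E_D[of u v] dist_E[of u v] dist_E[of v u] by (simp_all add: side_def E_sym)

lemma side_sub: "side u v \<subseteq> V"
  by (auto simp: side_def)

lemma side_compl: assumes "E u v" shows "V - side u v = side v u"
  using dist_edge_cases'[OF assms] by (fastforce simp: side_def)

text \<open>If \<open>x\<close> is nearer to \<open>u\<close> than to \<open>v\<close> but not
  nearer to \<open>u'\<close> than to \<open>v'\<close>, then \<open>u\<close> and \<open>v'\<close>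
  are both one step nearer to \<open>x\<close> than \<open>v\<close>. The quadrangle condition at
  \<open>v\<close> yields a fourth corner still nearer to \<open>x\<close>; by uniqueness it is
  \<open>u'\<close>, which however is as far away as \<open>v\<close>.\<close>

lemma side_sq_subset: assumes "sq u v v' u'" shows "side u v \<subseteq> side u' v'"
proof
  fix x assume "x \<in> side u v"
  then have x: "x \<in> V" "d u x < d v x" by (auto simp: side_def)
  have E: "E u v" "E v v'" "E v' u'" "E u u'" "E v u" "u \<noteq> v'"
    using assms by (auto simp: sq_def E_sym)
  show "x \<in> side u' v'"
  proof (rule ccontr)
    assume "x \<notin> side u' v'"
    then have "\<not> d u' x < d v' x"
      using x by (simp add: side_def)
    then have eq: "d v x = Suc (d u x)" "d v' x = d u x" "d u' x = Suc (d u x)"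
      using dist_edge_cases'[OF E(1) x(1)] dist_edge_cases'[OF E(2) x(1)]
        dist_edge_cases'[OF E(3) x(1)] dist_edge_cases'[OF E(4) x(1)] x(2) by linarith+
    obtain c where c: "sq v u c v'" "Suc (d c x) = d u x"
      using quadrangle[OF x(1) eq(1) E(5) E(2) refl eq(2) E(6)] by blast
    have "sq v u u' v'"
      using assms sq_flip sq_rot by blast
    then have "c = u'"
      using c(1) sq_unique by blast
    then show False using c eq by simp
  qed
qed

lemma side_sq: assumes "sq u v v' u'" shows "side u v = side u' v'"
proof
  have "sq u' v' v u"
    using sq_flip[OF sq_rot[OF sq_rot[OF sq_rot[OF assms]]]] sq_flip sq_rot assms by blast
  then show "side u' v' \<subseteq> side u v" by (rule side_sq_subset)
qed (rule side_sq_subset[OF assms])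

definition sides :: "'v set \<Rightarrow> 'v set set" where
  "sides e = {side u v | u v. e = {u, v}}"

lemma sides_edge: "sides {u, v} = {side u v, side v u}"
  by (auto simp: sides_def doubleton_eq_iff)

lemma sides_opposite: assumes "opposite X e f" shows "sides e = sides f"
proof -
  obtain a b c c' where "e = {a, b}" "f = {c', c}" "sq a b c c'"
    using oppositeE[OF assms] .
  moreover from this(3) have "sq b a c' c"
    using sq_flip sq_rot by blast
  ultimately show ?thesis
    by (simp add: sides_edge side_sq)
qed

lemma sides_parallel: "equivclp (opposite X) e f \<Longrightarrow> sides e = sides f"
  by (induction rule: equivclp_induct) (auto dest: sides_opposite)

text \<open>The edge \<open>a b\<close> is slid towards \<open>u v\<close>. Let \<open>b'\<close> be
  a neighbour of \<open>b\<close> nearer to \<open>v\<close>; the quadrangle condition at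
  \<open>b\<close>, with distances to \<open>u\<close>, gives a square in which \<open>a b\<close>
  is opposite to an edge \<open>c b'\<close> one step nearer to \<open>u v\<close>.\<close>

lemma parallel_if_crosses:
  assumes "E u v" "E a b" "a \<in> side u v" "b \<in> side v u"
  shows "equivclp (opposite X) {u, v} {a, b}"
  using assms(2-)
proof (induction "d a u" arbitrary: a b)
  case 0
  have V: "u \<in> V" "v \<in> V" "a \<in> V" "b \<in> V"
    using E_D assms(1) 0 by blast+
  then have "a = u"
    using 0 dist_eq_0D by simp
  moreover have "d v b < d u b" "d u b \<le> 1"
    using 0 \<open>a = u\<close> dist_E by (auto simp: side_def)
  then have "v = b"
    using V dist_eq_0D by simp
  ultimately show ?case by simp
next
  case (Suc m)
  have V: "u \<in> V" "v \<in> V" "a \<in> V" "b \<in> V"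
    using E_D assms(1) Suc by blast+
  have lt: "d a u < d a v" "d b v < d b u"
    using Suc.prems V by (auto simp: side_def dist_sym)
  have eq: "d a v = Suc (Suc m)" "d b v = Suc m" "d b u = Suc (Suc m)"
    using lt Suc.hyps(2) dist_edge_cases'[OF Suc.prems(1) V(1)] dist_edge_cases'[OF Suc.prems(1) V(2)]
      dist_edge_cases[OF assms(1) V(3)] dist_edge_cases[OF assms(1) V(4)] by linarith+
  obtain b' where b': "E b b'" "d b' v = m"
    using dist_step[OF V(4,2) eq(2)] .
  have b'V: "b' \<in> V" using b' E_D by blast
  have b'u: "d b' u = Suc m"
    using dist_edge_cases'[OF b'(1) V(1)] dist_edge_cases[OF assms(1) b'V] b'(2) eq by linarith
  have "b' \<noteq> a" "E b a"
    using b' eq Suc.prems E_sym by auto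
  then obtain c where c: "sq b a c b'" "Suc (d c u) = Suc m"
    using quadrangle[OF V(1) eq(3), of a b'] b'(1) b'u Suc.hyps(2) by metis
  have cE: "E a c" "E c b'" "c \<in> V"
    using c E_D by (auto simp: sq_def)
  have "d c v > m"
    using dist_edge_cases'[OF cE(1) V(2)] eq by linarith
  then have "c \<in> side u v" "b' \<in> side v u"
    using c(2) b' b'u cE(3) b'V V by (auto simp: side_def dist_sym)
  then have "equivclp (opposite X) {u, v} {c, b'}"
    using Suc.hyps(1)[of c b'] c(2) cE by simp
  moreover have "opposite X {c, b'} {a, b}"
    using opposite_iff_sq[of c b' b a] sq_rot[OF sq_rot[OF c(1)]] by (simp add: insert_commute)
  ultimately show ?case
    by (simp add: equivclp_into_equivclp)
qed

lemma hyperplane_eq: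
  assumes "E u v"
  shows "{f \<in> edges X. equivclp (opposite X) {u, v} f} = {{a, b} | a b. E a b \<and> a \<in> side u v \<and> b \<notin> side u v}"
proof safe
  fix f assume f: "f \<in> edges X" "equivclp (opposite X) {u, v} f"
  obtain a b where ab: "f = {a, b}" "E a b"
    using edgeE[OF f(1)] .
  have "{side u v, side v u} = {side a b, side b a}"
    using sides_parallel[OF f(2)] ab sides_edge by simp
  then have "side u v = side a b \<or> side u v = side b a" by blast
  then show "\<exists>a b. f = {a, b} \<and> E a b \<and> a \<in> side u v \<and> b \<notin> side u v"
  proof
    assume "side u v = side a b"
    then show ?thesis using ab side_self by blast
  next
    assume "side u v = side b a"
    then show ?thesis using ab side_self[of b a] E_sym by (metis insert_commute)
  qed
next
  fix a b assume ab: "E a b" "a \<in> side u v" "b \<notin> side u v"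
  then show "{a, b} \<in> edges X" by (simp add: E_def)
  have "b \<in> side v u"
    using ab E_D side_compl[OF assms] by blast
  then show "equivclp (opposite X) {u, v} {a, b}"
    using parallel_if_crosses assms ab by blast
qed

definition crossing :: "'v set \<Rightarrow> 'v set set" where
  "crossing h = {{a, b} | a b. E a b \<and> a \<in> h \<and> b \<notin> h}"

lemma hyperplanes_eq: "hyperplanes X = crossing ` Hs"
proof -
  have 1: "{f \<in> edges X. equivclp (opposite X) {u, v} f} = crossing (side u v)" if "E u v" for u v
    using hyperplane_eq[OF that] by (simp add: crossing_def)
  show ?thesis
  proof safe
    fix J assume "J \<in> hyperplanes X"
    then obtain e where e: "e \<in> edges X" "J = {f \<in> edges X. equivclp (opposite X) e f}"
      by (auto simp: hyperplanes_def)
    obtain u v where "e = {u, v}" "E u v"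
      using edgeE[OF e(1)] .
    then show "J \<in> crossing ` Hs"
      using e 1 side_Hs by auto
  next
    fix h assume "h \<in> Hs"
    then obtain u v where "h = side u v" "E u v"
      by (auto simp: Hs_def)
    then show "crossing h \<in> hyperplanes X"
      using 1[of u v, symmetric] by (auto simp: hyperplanes_def E_def)
  qed
qed

lemma Hs_compl: "h \<in> Hs \<Longrightarrow> V - h \<in> Hs"
  unfolding Hs_def using side_compl E_sym by fastforce

lemma Hs_sub: "h \<in> Hs \<Longrightarrow> h \<subseteq> V"
  using side_sub by (auto simp: Hs_def)

lemma Hs_nonempty: "h \<in> Hs \<Longrightarrow> h \<noteq> {}"
  using side_self by (fastforce simp: Hs_def)

lemma crossing_compl: "h \<in> Hs \<Longrightarrow> crossing (V - h) = crossing h"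
  unfolding crossing_def using E_D(1,2) Hs_sub E_sym by (auto; metis insert_commute)

text \<open>A geodesic to \<open>u\<close> never leaves the side of \<open>u\<close>: each step
  lowers the distance to \<open>u\<close> by one and the distance to \<open>v\<close> by at most
  one, so \<open>u\<close> remains the nearer end.\<close>

lemma side_connected:
  assumes "E u v" "x \<in> side u v"
  shows "\<exists>p. walk_from_to (X\<lparr>edges := edges X - crossing (side u v)\<rparr>) x p u"
  using assms(2)
proof (induction "d x u" arbitrary: x)
  case 0
  then have "x = u"
    using dist_eq_0D[of x u] E_D(1)[OF assms(1)] by (auto simp: side_def)
  then show ?case
    using E_D assms(1) by (intro exI[of _ "[x]"]) (auto simp: walk_from_to_def walk_def)
next
  case (Suc n)
  have V: "x \<in> V" "u \<in> V" "v \<in> V"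
    using Suc.prems side_sub E_D assms(1) by blast+
  obtain z where z: "E x z" "d z u = n"
    using dist_step[OF V(1,2) Suc.hyps(2)[symmetric]] .
  have zV: "z \<in> V" using z E_D by blast
  have "d u x < d v x"
    using Suc.prems by (simp add: side_def)
  then have zs: "z \<in> side u v"
    using dist_edge_cases'[OF z(1) V(3)] z(2) Suc.hyps(2) V zV by (auto simp: side_def dist_sym)
  then obtain p where p: "walk_from_to (X\<lparr>edges := edges X - crossing (side u v)\<rparr>) z p u"
    using Suc.hyps(1) z by blast
  have "{x, z} \<notin> crossing (side u v)"
    using zs Suc.prems by (auto simp: crossing_def doubleton_eq_iff)
  then have "walk_from_to (X\<lparr>edges := edges X - crossing (side u v)\<rparr>) x ([x] @ p) u"
    by (intro walk_from_to_append[OF walk_from_to_sing p]) (use V z in \<open>auto simp: E_def\<close>)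
  then show ?case by blast
qed

lemma walk_avoiding_same_side:
  assumes "walk_from_to (X\<lparr>edges := edges X - crossing h\<rparr>) x p y"
  shows "x \<in> h \<longleftrightarrow> y \<in> h"
  using assms
proof (induction p arbitrary: x)
  case Nil
  then show ?case by (simp add: walk_from_to_def walk_def)
next
  case (Cons a p)
  show ?case
  proof (cases p)
    case Nil
    then show ?thesis
      using Cons.prems by (auto simp: walk_from_to_def)
  next
    case (Cons b r)
    then have w: "walk_from_to (X\<lparr>edges := edges X - crossing h\<rparr>) b p y"
      and ab: "E a b" "{a, b} \<notin> crossing h" "a = x"
      using Cons.prems by (auto simp: walk_from_to_def walk_iff_successively E_def)
    have "{a, b} \<in> crossing h" if "a \<in> h" "b \<notin> h"
      using ab that by (auto simp: crossing_def)
    moreover have "{b, a} \<in> crossing h" if "b \<in> h" "a \<notin> h"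
      using ab(1) that E_sym by (auto simp: crossing_def)
    ultimately have "a \<in> h \<longleftrightarrow> b \<in> h"
      using ab(2) by (auto simp: insert_commute)
    then show ?thesis
      using Cons.IH[OF w] ab by simp
  qed
qed

lemma component_side:
  assumes "E u v" "x \<in> side u v"
  shows "{y. \<exists>p. walk_from_to (X\<lparr>edges := edges X - crossing (side u v)\<rparr>) x p y} = side u v"
proof safe
  fix y p assume "walk_from_to (X\<lparr>edges := edges X - crossing (side u v)\<rparr>) x p y"
  then show "y \<in> side u v"
    using walk_avoiding_same_side assms by blast
next
  fix y assume y: "y \<in> side u v"
  obtain p q where "walk_from_to (X\<lparr>edges := edges X - crossing (side u v)\<rparr>) x p u"
    "walk_from_to (X\<lparr>edges := edges X - crossing (side u v)\<rparr>) y q u"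
    using side_connected[OF assms(1)] assms(2) y by metis
  then show "\<exists>p. walk_from_to (X\<lparr>edges := edges X - crossing (side u v)\<rparr>) x p y"
    using walk_from_to_join walk_from_to_rev by metis
qed

lemma halfspaces_of_crossing:
  assumes "h \<in> Hs"
  shows "halfspaces_of X (crossing h) = {h, V - h}"
proof -
  obtain u v where uv: "h = side u v" "E u v" "E v u"
    using assms E_sym by (auto simp: Hs_def)
  define K
    where "K x = {y. \<exists>p. walk_from_to (X\<lparr>edges := edges X - crossing (side u v)\<rparr>) x p y}" for x
  have 1: "K x = h" if "x \<in> h" for x
    using component_side[OF uv(2)] that uv by (simp add: K_def)
  have "crossing (side v u) = crossing (side u v)"
    using crossing_compl[OF side_Hs[OF uv(2)]] side_compl[OF uv(2)] by simp
  then have 2: "K x = V - h" if "x \<in> V - h" for x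
    using component_side[OF uv(3), of x] that uv side_compl[OF uv(2)] by (simp add: K_def)
  have "halfspaces_of X (crossing h) = K ` V"
    by (simp add: halfspaces_of_def components_def K_def uv)
  also have "\<dots> = K ` h \<union> K ` (V - h)"
    using Hs_sub[OF assms] by blast
  also have "K ` h = {h}"
    using 1 Hs_nonempty[OF assms] by auto
  also have "K ` (V - h) = {V - h}"
    using 2 Hs_nonempty[OF Hs_compl[OF assms]] by auto
  finally show ?thesis by blast
qed

section \<open>Distances as numbers of separating halfspaces\<close>

definition sep :: "'v \<Rightarrow> 'v \<Rightarrow> 'v set set" where
  "sep x y = {h \<in> Hs. x \<in> h \<and> y \<notin> h}"

lemma sep_edge: assumes "E x z" shows "sep x z = {side x z}"
proof -
  have "h = side x z" if h: "h \<in> sep x z" for h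
  proof -
    obtain u v where uv: "h = side u v" "E u v"
      using h by (auto simp: sep_def Hs_def)
    have "x \<in> side u v" "z \<in> side v u"
      using h uv side_compl[OF uv(2)] E_D assms by (auto simp: sep_def)
    then have "sides {u, v} = sides {x, z}"
      using parallel_if_crosses uv assms sides_parallel by blast
    then have "side u v = side x z \<or> side u v = side z x"
      unfolding sides_edge by blast
    then show ?thesis
      using \<open>x \<in> side u v\<close> side_self assms E_sym uv by blast
  qed
  moreover have "side x z \<in> sep x z"
    using side_Hs side_self assms by (auto simp: sep_def)
  ultimately show ?thesis by blast
qed

text \<open>An edge is crossed by one wall only (\<open>sep_edge\<close>). The wall of the first
  edge \<open>x z\<close> of a geodesic to \<open>y\<close> has \<open>z\<close> and
  \<open>y\<close> on the same side, so prepending this edge adds exactly one separating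
  halfspace.\<close>

lemma sep_card: "x \<in> V \<Longrightarrow> y \<in> V \<Longrightarrow> finite (sep x y) \<and> card (sep x y) = d x y"
proof (induction "d x y" arbitrary: x)
  case 0
  then have "x = y" using dist_eq_0D by simp
  then show ?case using 0 by (simp add: sep_def)
next
  case (Suc n)
  obtain z where z: "E x z" "d z y = n"
    using dist_step[OF Suc.prems Suc.hyps(2)[symmetric]] .
  have zV: "z \<in> V" "E z x" using z E_D E_sym by blast+
  have IH: "finite (sep z y)" "card (sep z y) = n"
    using Suc z zV by auto
  have y: "y \<notin> side x z" "y \<in> side z x"
    using z Suc by (auto simp: side_def)
  have "sep x y = insert (side x z) (sep z y)"
  proof (intro equalityI subsetI)
    fix h assume h: "h \<in> sep x y"
    show "h \<in> insert (side x z) (sep z y)"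
    proof (cases "z \<in> h")
      case True
      then show ?thesis using h by (auto simp: sep_def)
    next
      case False
      then have "h \<in> sep x z" using h by (auto simp: sep_def)
      then show ?thesis using sep_edge z by auto
    qed
  next
    fix h assume "h \<in> insert (side x z) (sep z y)"
    then show "h \<in> sep x y"
    proof
      assume "h = side x z"
      then show ?thesis
        using y side_self side_Hs z by (auto simp: sep_def)
    next
      assume h: "h \<in> sep z y"
      have "x \<in> h"
      proof (rule ccontr)
        assume "x \<notin> h"
        then have "h \<in> sep z x" using h by (auto simp: sep_def)
        then have "h = side z x" using sep_edge zV by auto
        then show False using h y by (auto simp: sep_def)
      qed
      then show ?thesis using h by (auto simp: sep_def)
    qed
  qed
  moreover have "side x z \<notin> sep z y"
    using side_self z by (auto simp: sep_def)
  ultimately show ?case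
    using IH Suc.hyps by simp
qed

lemma Hs_separate: assumes "x \<in> V" "y \<in> V" "x \<noteq> y" shows "\<exists>h\<in>Hs. x \<in> h \<and> y \<notin> h"
proof -
  have "card (sep x y) \<noteq> 0"
    using sep_card assms dist_eq_0D by metis
  then have "sep x y \<noteq> {}" by auto
  then show ?thesis by (auto simp: sep_def)
qed

section \<open>Convexity, medians, gates and orientations\<close>

lemma Hs_convex:
  assumes "h \<in> Hs" "x \<in> h" "y \<in> h" "z \<in> V" "d x z + d z y = d x y"
  shows "z \<in> h"
proof (rule ccontr)
  assume z: "z \<notin> h"
  have V: "x \<in> V" "y \<in> V" using assms Hs_sub by auto
  have fin: "finite (sep x z)" "finite (sep z y)" using sep_card V assms by auto
  have hD: "h \<in> sep x z" using z assms by (auto simp: sep_def)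
  have "sep x y \<subseteq> (sep x z - {h}) \<union> sep z y"
    using assms by (auto simp: sep_def)
  then have "card (sep x y) \<le> card ((sep x z - {h}) \<union> sep z y)"
    using fin by (intro card_mono) auto
  also have "\<dots> \<le> card (sep x z - {h}) + card (sep z y)"
    by (rule card_Un_le)
  also have "\<dots> < card (sep x z) + card (sep z y)"
    using card_Diff1_less[OF fin(1) hD] by simp
  finally show False
    using sep_card V assms by simp
qed

text \<open>Induction on the distance from \<open>y\<close> to \<open>z\<close>, going back along a
  geodesic. If the detour is visible already at the predecessor \<open>z'\<close> of
  \<open>z\<close>, the induction hypothesis applies to \<open>z'\<close>. Otherwise the distance to
  \<open>x\<close> first drops at the last edge, and a quadrangle at \<open>z'\<close> replaces
  \<open>z\<close> by a neighbour \<open>w\<close> nearer to both \<open>x\<close> and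
  \<open>y\<close>.\<close>

lemma not_geodesic_step:
  assumes "x \<in> V" "y \<in> V" "z \<in> V" "d x z < d x y + d y z"
  shows "\<exists>y'. E y y' \<and> Suc (d y' x) = d y x \<and> Suc (d y' z) = d y z"
  using assms(3,4)
proof (induction "d y z" arbitrary: z rule: less_induct)
  case less
  note V = assms(1,2) less.prems(1)
  have "d y z \<noteq> 0"
    using less.prems dist_eq_0D[OF V(2,3)] by (metis add.right_neutral less_irrefl)
  then obtain r where r: "d z y = Suc r"
    using dist_sym V by (metis not0_implies_Suc)
  obtain z' where z': "E z z'" "d z' y = r"
    using dist_step[OF V(3,2) r] .
  have z'V: "z' \<in> V" "E z' z" using z' E_D E_sym by blast+
  show ?case
  proof (cases "d x z' < d x y + d y z'")
    case True
    then obtain y' where y': "E y y'" "Suc (d y' x) = d y x" "Suc (d y' z') = d y z'"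
      using less.hyps[of z'] r z' z'V V dist_sym by auto
    have y'V: "y' \<in> V" using y' E_D by blast
    have "d y' z \<le> d y' z' + 1"
      using dist_triangle[OF y'V z'V(1) V(3)] dist_E[OF z'V(2)] by simp
    moreover have "d y z \<le> 1 + d y' z"
      using dist_triangle[OF V(2) y'V V(3)] dist_E[OF y'(1)] by simp
    ultimately have "Suc (d y' z) = d y z"
      using y'(3) r z' dist_sym V z'V by simp
    then show ?thesis using y' by blast
  next
    case False
    define N where "N = d x y + r"
    have yz': "d y z' = r" "d y z = Suc r"
      using r z' dist_sym V z'V by auto
    have xz': "d x z' = N"
      using False yz' dist_triangle[OF V(1,2) z'V(1)] by (simp add: N_def)
    have xz: "Suc (d x z) = N"
      using dist_edge_cases[OF z'(1) V(1)] less.prems(2) xz' yz' by (auto simp: N_def)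
    show ?thesis
    proof (cases r)
      case 0
      then have "z' = y"
        using z' dist_eq_0D V z'V by auto
      then show ?thesis
        using z'V xz xz' yz' 0 V dist_sym by (intro exI[of _ z]) auto
    next
      case (Suc r')
      then have "d z' y = Suc r'" using z' by simp
      then obtain z'' where z'': "E z' z''" "d z'' y = r'"
        using dist_step[OF z'V(1) V(2)] by blast
      have z''V: "z'' \<in> V" using z'' E_D by blast
      have xz'': "Suc (d x z'') = N"
        using dist_edge_cases[OF z''(1) V(1)] dist_triangle[OF V(1,2) z''V] xz' z'' dist_sym[OF V(2) z''V] Suc
        by (auto simp: N_def)
      have "z \<noteq> z''"
        using r z'' Suc by auto
      moreover obtain n where n: "N = Suc n"
        using xz by auto
      ultimately obtain w where w: "sq z' z'' w z" "Suc (d w x) = n"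
        using quadrangle[OF V(1), of z' n z'' z] z'' z'V xz xz' xz'' dist_sym V z''V by auto
      have wE: "E z'' w" "E w z" "w \<in> V"
        using w E_D by (auto simp: sq_def)
      have "d w y = r"
        using dist_edge_cases'[OF wE(1) V(2)] dist_edge_cases'[OF wE(2) V(2)] r z'' Suc by linarith
      then have dw: "d y w = r" "d x w = d w x"
        using dist_sym V wE by auto
      have "d x w < d x y + d y w"
        using dw w n by (simp add: N_def)
      then obtain y' where y': "E y y'" "Suc (d y' x) = d y x" "Suc (d y' w) = d y w"
        using less.hyps[of w] dw yz' wE by auto
      have y'V: "y' \<in> V" using y' E_D by blast
      have "d y' z \<le> d y' w + 1"
        using dist_triangle[OF y'V wE(3) V(3)] dist_E[OF wE(2)] by simp
      moreover have "d y z \<le> 1 + d y' z"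
        using dist_triangle[OF V(2) y'V V(3)] dist_E[OF y'(1)] by simp
      ultimately have "Suc (d y' z) = d y z"
        using y'(3) yz' dw by simp
      then show ?thesis using y' by blast
    qed
  qed
qed

text \<open>A vertex minimising the sum of the three distances works: if it were off the geodesics
  between two of the points, \<open>not_geodesic_step\<close> would give a neighbour that is nearer
  to both of these and at most one step farther from the third, with a smaller sum.\<close>

lemma median_exists:
  assumes "x \<in> V" "y \<in> V" "z \<in> V"
  shows "\<exists>m\<in>V. d x m + d m y = d x y \<and> d y m + d m z = d y z \<and> d x m + d m z = d x z"
proof -
  define S where "S m = d m x + d m y + d m z" for m
  obtain m where m: "m \<in> V" "\<And>m'. m' \<in> V \<Longrightarrow> S m \<le> S m'"
    using ex_has_least_nat[of "\<lambda>m. m \<in> V" x S] assms by blast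
  have *: "d a m + d m b = d a b"
    if abc: "a \<in> V" "b \<in> V" "c \<in> V" "\<And>m. S m = d m a + d m b + d m c" for a b c
  proof (rule ccontr)
    assume "d a m + d m b \<noteq> d a b"
    then have "d a b < d a m + d m b"
      using dist_triangle[OF abc(1) m(1) abc(2)] by simp
    then obtain m' where m': "E m m'" "Suc (d m' a) = d m a" "Suc (d m' b) = d m b"
      using not_geodesic_step[OF abc(1) m(1) abc(2)] by blast
    moreover have "d m' c \<le> Suc (d m c)"
      using dist_edge_cases'[OF m'(1) abc(3)] by auto
    moreover have "S m \<le> S m'"
      using m m' E_D by blast
    ultimately show False
      using abc(4)[of m] abc(4)[of m'] by linarith
  qed
  show ?thesis
    using m(1) *[of x y z] *[of y z x] *[of x z y] assms by (auto simp: S_def)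
qed

text \<open>A median of \<open>x\<close>, \<open>y\<close>, \<open>z\<close> lies in
  \<open>h\<close> by convexity and on a geodesic from \<open>x\<close> to \<open>y\<close>, so it
  is \<open>y\<close> because \<open>y\<close> is nearest.\<close>

lemma gate:
  assumes "h \<in> Hs" "x \<in> V" "y \<in> h" "\<And>y'. y' \<in> h \<Longrightarrow> d x y \<le> d x y'" "z \<in> h"
  shows "d x y + d y z = d x z"
proof -
  have V: "y \<in> V" "z \<in> V" using assms Hs_sub by auto
  obtain m where m: "m \<in> V" "d x m + d m y = d x y" "d y m + d m z = d y z" "d x m + d m z = d x z"
    using median_exists[OF assms(2) V] by blast
  have "m \<in> h"
    using Hs_convex[OF assms(1,3,5) m(1,3)] .
  then have "d m y = 0"
    using assms(4) m(2) by force
  then have "m = y"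
    using dist_eq_0D m V by blast
  then show ?thesis using m by simp
qed

text \<open>Induction on the number of members of \<open>\<sigma>\<close> that miss
  \<open>x\<close>. The vertex is moved to a nearest \<open>y\<close> lying in one of these members;
  the point is that \<open>y\<close> is adjacent to \<open>x\<close>, so that the move corrects one
  wall and alters no other.\<close>

lemma orientation_vertex:
  assumes "\<sigma> \<subseteq> Hs" "\<And>h. h \<in> Hs \<Longrightarrow> V - h \<in> \<sigma> \<longleftrightarrow> h \<notin> \<sigma>"
    "\<And>h k. h \<in> \<sigma> \<Longrightarrow> k \<in> \<sigma> \<Longrightarrow> h \<inter> k \<noteq> {}" "x \<in> V" "finite {h \<in> \<sigma>. x \<notin> h}"
  shows "\<exists>v\<in>V. \<forall>h\<in>Hs. v \<in> h \<longleftrightarrow> h \<in> \<sigma>"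
  using assms(4,5)
proof (induction "card {h \<in> \<sigma>. x \<notin> h}" arbitrary: x rule: less_induct)
  case less
  show ?case
  proof (cases "{h \<in> \<sigma>. x \<notin> h} = {}")
    case True
    then have "x \<in> h \<longleftrightarrow> h \<in> \<sigma>" if "h \<in> Hs" for h
      using assms(2)[OF that] by blast
    then show ?thesis using less.prems by blast
  next
    case False
    define P where "P y \<longleftrightarrow> (\<exists>A\<in>\<sigma>. x \<notin> A \<and> y \<in> A)" for y
    have "\<exists>y. P y"
    proof -
      obtain A where "A \<in> \<sigma>" "x \<notin> A" using False by blast
      moreover from this have "A \<noteq> {}" using assms(1) Hs_nonempty by blast
      ultimately show ?thesis unfolding P_def by blast
    qed
    then obtain y where y: "P y" "\<And>y'. P y' \<Longrightarrow> d x y \<le> d x y'"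
      using ex_has_least_nat[of P _ "d x"] by blast
    then obtain A where A: "A \<in> \<sigma>" "x \<notin> A" "y \<in> A"
      by (auto simp: P_def)
    have AH: "A \<in> Hs" using A assms by blast
    have yV: "y \<in> V" using A AH Hs_sub by blast
    have "d x y \<noteq> 0"
      using dist_eq_0D less.prems(1) yV A by blast
    then obtain n where n: "d x y = Suc n"
      using not0_implies_Suc by blast
    obtain x1 where x1: "E x x1" "d x1 y = n"
      using dist_step[OF less.prems(1) yV n] .
    have x1V: "x1 \<in> V" "E x1 x" using x1 E_D E_sym by blast+
    \<comment> \<open>Otherwise the first step \<open>x1\<close> towards \<open>y\<close> lies in no
      member of \<open>\<sigma>\<close> that misses \<open>x\<close>, so \<open>side x x1\<close>
      belongs to \<open>\<sigma>\<close> and meets \<open>A\<close>. But \<open>y\<close> is the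
      gate of \<open>A\<close>, so every vertex of \<open>A\<close> is nearer to \<open>x1\<close>
      than to \<open>x\<close>.\<close>
    have "n = 0"
    proof (rule ccontr)
      assume "n \<noteq> 0"
      then have "\<not> P x1"
        using y(2)[of x1] n dist_E[OF x1(1)] by auto
      then have "side x1 x \<notin> \<sigma>"
        using side_self x1V by (auto simp: P_def)
      then have "side x x1 \<in> \<sigma>"
        using assms(2)[OF side_Hs[OF x1(1)]] side_compl[OF x1(1)] by auto
      then obtain z where z: "z \<in> A" "z \<in> side x x1"
        using assms(3) A by blast
      have zV: "z \<in> V" using z side_sub by blast
      have "d x y + d y z = d x z"
        using gate[OF AH less.prems(1) A(3) _ z(1)] y(2) A by (auto simp: P_def)
      moreover have "d x1 z \<le> d x1 y + d y z"
        using dist_triangle x1V yV zV by blast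
      ultimately show False
        using z(2) n x1 by (simp add: side_def)
    qed
    then have xy: "E x y"
      using n E_iff_dist less.prems yV by simp
    have "A \<in> sep y x"
      using A AH by (simp add: sep_def)
    then have Aeq: "A = side y x"
      using sep_edge[of y x] xy E_sym by auto
    have sub: "{h \<in> \<sigma>. y \<notin> h} \<subseteq> {h \<in> \<sigma>. x \<notin> h} - {A}"
    proof safe
      fix h assume h: "h \<in> \<sigma>" "y \<notin> h" "x \<in> h"
      then have "h \<in> sep x y" using assms(1) by (auto simp: sep_def)
      then have "h = V - A"
        using sep_edge[OF xy] Aeq side_compl[of y x] xy E_sym by auto
      then show False using h A assms(2)[OF AH] by auto
    qed (use A in auto)
    have "card {h \<in> \<sigma>. y \<notin> h} \<le> card ({h \<in> \<sigma>. x \<notin> h} - {A})"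
      using sub less.prems by (intro card_mono) auto
    also have "\<dots> < card {h \<in> \<sigma>. x \<notin> h}"
      using less.prems A by (intro card_Diff1_less) auto
    finally show ?thesis
      using less.hyps[of y] yV finite_subset[OF sub] less.prems by auto
  qed
qed

lemma on_geodesic_iff:
  assumes "x \<in> V" "y \<in> V"
  shows "on_geodesic X x y m \<longleftrightarrow> m \<in> V \<and> d x m + d m y = d x y"
proof
  assume "on_geodesic X x y m"
  then obtain p where p: "walk_from_to X x p y" "length p = Suc (d x y)" "m \<in> set p"
    by (auto simp: on_geodesic_def geodesic_def)
  then obtain p1 p2 where p12: "p = p1 @ m # p2"
    by (meson split_list)
  have mV: "m \<in> V" using p by (auto simp: walk_from_to_def walk_def)
  have "walk_from_to X x (p1 @ [m]) m" "walk_from_to X m (m # p2) y"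
    using p(1) unfolding p12
    by (auto simp: walk_from_to_def walk_iff successively_append_iff hd_append)
  then have "d x m \<le> length p1" "d m y \<le> length p2"
    using gdist_le by fastforce+
  then show "m \<in> V \<and> d x m + d m y = d x y"
    using p(2) p12 dist_triangle[OF assms(1) mV assms(2)] mV by simp
next
  assume m: "m \<in> V \<and> d x m + d m y = d x y"
  obtain p where p: "walk_from_to X x p m" "length p = Suc (d x m)"
    using dist_walk[OF assms(1)] m by blast
  obtain q where q: "walk_from_to X m q y" "length q = Suc (d m y)"
    using dist_walk[OF _ assms(2)] m by blast
  have "geodesic X x (p @ tl q) y"
    using walk_from_to_join[OF p(1) q(1)] p q m by (simp add: geodesic_def)
  moreover have "m \<in> set (p @ tl q)"
    using p by (auto simp: walk_from_to_def walk_def)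
  ultimately show "on_geodesic X x y m"
    unfolding on_geodesic_def by blast
qed

text \<open>Two of the three points on one side put \<open>m\<close> there by convexity; applied to
  \<open>h\<close> and to its complement this gives both directions, since one of the two sides
  always has a majority.\<close>

lemma median_iff_majority:
  assumes "x \<in> V" "y \<in> V" "z \<in> V" "m \<in> V"
    "d x m + d m y = d x y" "d y m + d m z = d y z" "d x m + d m z = d x z" "h \<in> Hs"
  shows "m \<in> h \<longleftrightarrow> (x \<in> h \<and> y \<in> h \<or> y \<in> h \<and> z \<in> h \<or> x \<in> h \<and> z \<in> h)"
proof -
  have *: "x \<in> k \<and> y \<in> k \<or> y \<in> k \<and> z \<in> k \<or> x \<in> k \<and> z \<in> k \<Longrightarrow> m \<in> k" if "k \<in> Hs" for k
    using Hs_convex[OF that, of x y m] Hs_convex[OF that, of y z m] Hs_convex[OF that, of x z m] assms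
    by blast
  show ?thesis
    using *[OF assms(8)] *[OF Hs_compl[OF assms(8)]] assms by blast
qed

lemma median_spec:
  assumes "x \<in> V" "y \<in> V" "z \<in> V"
  shows "median X x y z \<in> V" "h \<in> Hs \<Longrightarrow>
    median X x y z \<in> h \<longleftrightarrow> (x \<in> h \<and> y \<in> h \<or> y \<in> h \<and> z \<in> h \<or> x \<in> h \<and> z \<in> h)"
proof -
  define M where "M m \<longleftrightarrow> on_geodesic X x y m \<and> on_geodesic X y z m \<and> on_geodesic X x z m" for m
  have M: "M m \<longleftrightarrow> m \<in> V \<and> d x m + d m y = d x y \<and> d y m + d m z = d y z \<and> d x m + d m z = d x z" for m
    using on_geodesic_iff assms unfolding M_def by blast
  obtain m where m: "M m"
    using median_exists[OF assms] M by blast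
  have "m' = m" if m': "M m'" for m'
  proof (rule ccontr)
    assume "m' \<noteq> m"
    then obtain h where h: "h \<in> Hs" "m' \<in> h" "m \<notin> h"
      using Hs_separate m m' M by blast
    show False
      using median_iff_majority[OF assms, of m h] median_iff_majority[OF assms, of m' h] m m' M h
      by blast
  qed
  then have "median X x y z = m"
    unfolding median_def M_def[symmetric] using m by blast
  then show "median X x y z \<in> V" "h \<in> Hs \<Longrightarrow>
    median X x y z \<in> h \<longleftrightarrow> (x \<in> h \<and> y \<in> h \<or> y \<in> h \<and> z \<in> h \<or> x \<in> h \<and> z \<in> h)"
    using m M median_iff_majority[OF assms, of m h] by blast+
qed

sublocale halfspaces V Hs "median X"
proof
  fix x y assume "x \<in> V" "y \<in> V"
  then show "finite {h \<in> Hs. x \<in> h \<and> y \<notin> h}"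
    using sep_card unfolding sep_def by blast
qed (use Hs_sub Hs_compl Hs_nonempty Hs_separate median_spec orientation_vertex in \<open>auto simp del: not_ex\<close>)

lemma sep_eq: "sep = D"
  by (simp add: fun_eq_iff sep_def D_def)

end

section \<open>Majority votes along a sequence\<close>

text \<open>
  A sequence that is eventually constant at both ends is made monotone by replacing each value by
  the majority over a long enough window: the counts in two consecutive windows differ by the two
  entries at the ends of the windows, and these cannot both lie in the irregular part.
\<close>

lemma window_finite: "finite {i \<in> {m..n::int}. P i}"
  by (rule finite_subset[of _ "{m..n}"]) auto

lemma window_complement:
  fixes k :: int
  assumes "0 \<le> k"
  shows "card {i \<in> {-k..k}. \<not> s (n + i)} > nat k \<longleftrightarrow> \<not> card {i \<in> {-k..k}. s (n + i)} > nat k"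
proof -
  have "{i \<in> {-k..k}. s (n + i)} \<union> {i \<in> {-k..k}. \<not> s (n + i)} = {-k..k}" by auto
  moreover have "card ({i \<in> {-k..k}. s (n + i)} \<union> {i \<in> {-k..k}. \<not> s (n + i)})
      = card {i \<in> {-k..k}. s (n + i)} + card {i \<in> {-k..k}. \<not> s (n + i)}"
    by (rule card_Un_disjoint[OF window_finite window_finite]) auto
  ultimately have "card {i \<in> {-k..k}. s (n + i)} + card {i \<in> {-k..k}. \<not> s (n + i)} = nat (2 * k + 1)"
    by simp
  then show ?thesis using assms by linarith
qed

lemma window_shift: "card {i \<in> {-k..k::int}. s (n + i)} = card {j \<in> {n-k..n+k}. s j}"
proof (rule bij_betw_same_card)
  show "bij_betw (\<lambda>i. n + i) {i \<in> {-k..k}. s (n + i)} {j \<in> {n-k..n+k}. s j}"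
    by (rule bij_betw_byWitness[where f' = "\<lambda>j. j - n"]) auto
qed

lemma window_mono:
  fixes c k :: int
  assumes "\<And>n. n > c \<Longrightarrow> s n" "\<And>n. n < -c \<Longrightarrow> \<not> s n" "0 \<le> c" "2 * c + 1 \<le> k"
    and "card {i \<in> {-k..k}. s (n + i)} > m"
  shows "card {i \<in> {-k..k}. s (n + 1 + i)} > m"
proof -
  define A where "A = {j \<in> {n+1-k..n+k}. s j}"
  have fin: "finite A" unfolding A_def by (rule window_finite)
  have "card {j \<in> {n-k..n+k}. s j} \<le> card {j \<in> {n+1-k..n+1+k}. s j}"
  proof (cases "s (n - k)")
    case False
    have "j \<noteq> n - k" if "s j" for j using False that by auto
    then show ?thesis
      by (intro card_mono window_finite) (auto, smt (verit))
  next
    case True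
    \<comment> \<open>The entry leaving on the left is true, hence not before \<open>-c\<close>. The
      window is so long that the entry coming in on the right is then beyond \<open>c\<close>, hence
      true as well, and the count does not drop.\<close>
    then have "n - k \<ge> -c" using assms(2) by force
    then have s: "s (n + 1 + k)" using assms(1,3,4) by simp
    have "card {j \<in> {n-k..n+k}. s j} \<le> card (insert (n - k) A)"
      using fin unfolding A_def by (intro card_mono) auto
    also have "\<dots> \<le> Suc (card A)"
      using card_insert_if[OF fin] by simp
    also have "\<dots> = card (insert (n + 1 + k) A)"
      using fin by (simp add: A_def)
    also have "\<dots> \<le> card {j \<in> {n+1-k..n+1+k}. s j}"
      using s assms(3,4) unfolding A_def by (intro card_mono window_finite) auto
    finally show ?thesis .
  qed
  then show ?thesis
    using assms(5) unfolding window_shift by linarith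
qed

text \<open>True entries lie between \<open>-c\<close> and \<open>c\<close>, so there are at most
  \<open>2 * c + 1 \<le> k\<close> of them, while a majority of the \<open>2 * k + 1\<close> entries
  needs more than \<open>k\<close>.\<close>

lemma window_constant:
  fixes c k :: int
  assumes "\<And>n. n > c \<Longrightarrow> \<not> s n" "\<And>n. n < -c \<Longrightarrow> \<not> s n" "0 \<le> c" "2 * c + 1 \<le> k"
  shows "\<not> card {i \<in> {-k..k}. s (n + i)} > nat k"
proof -
  have "{j \<in> {n-k..n+k}. s j} \<subseteq> {-c..c}"
    using assms(1,2) by (auto; meson not_less)
  then have "card {j \<in> {n-k..n+k}. s j} \<le> card {-c..c}"
    by (intro card_mono) auto
  then show ?thesis
    using assms(3,4) unfolding window_shift by simp
qed

lemma window_monotone: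
  fixes c k :: int
  assumes "\<And>n. n > c \<Longrightarrow> s n = p" "\<And>n. n < -c \<Longrightarrow> s n = q" "0 \<le> c" "2 * c + 1 \<le> k"
  defines "t \<equiv> \<lambda>n. card {i \<in> {-k..k}. s (n + i)} > nat k"
  shows "(\<forall>n. t n \<longrightarrow> t (n + 1)) \<or> (\<forall>n. t (n + 1) \<longrightarrow> t n)"
proof -
  have k: "0 \<le> k" using assms by simp
  have t: "t n \<longleftrightarrow> \<not> card {i \<in> {-k..k}. \<not> s (n + i)} > nat k" for n
    using window_complement[OF k, of s n] by (simp add: t_def)
  show ?thesis
  proof (cases p)
    case p: True
    show ?thesis
    proof (cases q)
      case True
      then show ?thesis
        using window_constant[of c "\<lambda>n. \<not> s n" k] assms p t by simp
    next
      case False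
      then show ?thesis
        using window_mono[of c s k "nat k"] assms p unfolding t_def by simp
    qed
  next
    case p: False
    show ?thesis
    proof (cases q)
      case False
      then show ?thesis
        using window_constant[of c s k] assms p unfolding t_def by simp
    next
      case True
      then have "\<not> t n \<longrightarrow> \<not> t (n + 1)" for n
        using window_mono[of c "\<lambda>n. \<not> s n" k "nat k" n] assms p unfolding t by simp
      then show ?thesis by blast
    qed
  qed
qed

lemma int_step_constant:
  fixes P :: "int \<Rightarrow> bool"
  assumes "\<And>n. P n \<longleftrightarrow> P (n + 1)"
  shows "P n \<longleftrightarrow> P m"
proof -
  have "P n \<longleftrightarrow> P 0" for n
  proof (induction n rule: int_induct[where k = 0])
    case (step2 i)
    then show ?case using assms[of "i - 1"] by simp
  qed (use assms in auto)
  then show ?thesis by blast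
qed

lemma int_step_mono:
  fixes P :: "int \<Rightarrow> bool"
  assumes "\<And>n. P n \<Longrightarrow> P (n + 1)" "P n" "n \<le> m"
  shows "P m"
  using assms(3,2) by (induction m rule: int_ge_induct) (use assms(1) in auto)

lemma int_step_antimono:
  fixes P :: "int \<Rightarrow> bool"
  assumes "\<And>n. P (n + 1) \<Longrightarrow> P n" "P m" "n \<le> m"
  shows "P n"
  using assms(3,2)
proof (induction n rule: int_le_induct)
  case (step i)
  then show ?case using assms(1)[of "i - 1"] by simp
qed

section \<open>Vertices of a halfspace space\<close>

context halfspaces
begin

lemma D_iff: "h \<in> D x y \<longleftrightarrow> h \<in> H \<and> x \<in> h \<and> y \<notin> h"
  by (simp add: D_def)

lemma D_finite: "x \<in> V \<Longrightarrow> y \<in> V \<Longrightarrow> finite (D x y)"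
  unfolding D_def by (rule H_finite)

lemma H_compl_compl: "h \<in> H \<Longrightarrow> V - (V - h) = h"
  using H_sub by blast

lemma vertex_eqI:
  assumes "x \<in> V" "y \<in> V" "\<And>h. h \<in> H \<Longrightarrow> x \<in> h \<Longrightarrow> y \<in> h"
  shows "x = y"
  using H_separate assms by blast

lemma D_compl: "x \<in> V \<Longrightarrow> y \<in> V \<Longrightarrow> bij_betw (\<lambda>h. V - h) (D x y) (D y x)"
  by (rule bij_betw_byWitness[where f' = "\<lambda>h. V - h"])
    (auto simp: D_iff H_compl H_compl_compl)

text \<open>Replacing the side \<open>h\<close> of \<open>x\<close> by its complement gives a vertex
  once \<open>V - h\<close> meets all other sides of \<open>x\<close>. A side \<open>k\<close>
  disjoint from \<open>V - h\<close> is contained in \<open>h\<close> and so also separates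
  \<open>x\<close> from \<open>y\<close>; choosing \<open>h\<close> minimal excludes it.\<close>

lemma D_neighbour:
  assumes "x \<in> V" "y \<in> V" "D x y \<noteq> {}"
  obtains z h where "z \<in> V" "h \<in> D x y" "D x z = {h}" "D z y = D x y - {h}"
    "\<And>k. k \<in> H \<Longrightarrow> k \<noteq> h \<Longrightarrow> k \<noteq> V - h \<Longrightarrow> z \<in> k \<longleftrightarrow> x \<in> k"
proof -
  obtain h where h: "h \<in> D x y" "\<And>k. k \<in> D x y \<Longrightarrow> k \<subseteq> h \<Longrightarrow> h = k"
    using finite_has_minimal[OF D_finite[OF assms(1,2)] assms(3)] by metis
  have hH: "h \<in> H" "x \<in> h" "y \<notin> h" using h by (auto simp: D_iff)
  define \<sigma> where "\<sigma> = insert (V - h) ({k \<in> H. x \<in> k} - {h})"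
  have "\<exists>v\<in>V. \<forall>k\<in>H. v \<in> k \<longleftrightarrow> k \<in> \<sigma>"
  proof (rule H_complete[OF _ _ _ assms(1)])
    show "\<sigma> \<subseteq> H" using hH H_compl by (auto simp: \<sigma>_def)
    show "V - k \<in> \<sigma> \<longleftrightarrow> k \<notin> \<sigma>" if k: "k \<in> H" for k
    proof -
      have "V - k \<in> \<sigma> \<longleftrightarrow> k = h \<or> (x \<notin> k \<and> k \<noteq> V - h)"
        using H_compl[OF k] H_compl_compl[OF k] H_compl_compl[OF hH(1)] assms(1)
        unfolding \<sigma>_def by auto
      moreover have "k \<in> \<sigma> \<longleftrightarrow> k = V - h \<or> (x \<in> k \<and> k \<noteq> h)"
        using k unfolding \<sigma>_def by auto
      ultimately show ?thesis using hH by auto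
    qed
    have 1: "(V - h) \<inter> k \<noteq> {}" if "k \<in> H" "x \<in> k" "k \<noteq> h" for k
    proof
      assume "(V - h) \<inter> k = {}"
      then have "k \<subseteq> h" using H_sub that by blast
      moreover from this have "k \<in> D x y" using that hH by (auto simp: D_iff)
      ultimately show False using h(2) that by blast
    qed
    show "k \<inter> l \<noteq> {}" if "k \<in> \<sigma>" "l \<in> \<sigma>" for k l
    proof -
      have "V - h \<noteq> {}" using H_nonempty H_compl hH by blast
      then show ?thesis using that 1[of k] 1[of l] unfolding \<sigma>_def by blast
    qed
    have "{k \<in> \<sigma>. x \<notin> k} \<subseteq> {V - h}" by (auto simp: \<sigma>_def)
    then show "finite {k \<in> \<sigma>. x \<notin> k}" by (rule finite_subset) simp
  qed
  then obtain z where z: "z \<in> V" "\<And>k. k \<in> H \<Longrightarrow> z \<in> k \<longleftrightarrow> k \<in> \<sigma>" by blast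
  have agree: "z \<in> k \<longleftrightarrow> x \<in> k" if "k \<in> H" "k \<noteq> h" "k \<noteq> V - h" for k
    using z(2)[OF that(1)] that by (auto simp: \<sigma>_def)
  have zh: "z \<notin> h" "z \<in> V - h"
    using z(2)[OF hH(1)] z(2)[OF H_compl[OF hH(1)]] hH by (auto simp: \<sigma>_def)
  show ?thesis
  proof (rule that[of z h])
    have "k = h" if "k \<in> H" "x \<in> k" "z \<notin> k" for k
      using agree[OF that(1)] that zh hH by blast
    then show "D x z = {h}"
      unfolding D_def using zh hH by blast
    have "z \<in> k \<longleftrightarrow> x \<in> k \<and> k \<noteq> h" if "k \<in> H" "y \<notin> k" for k
      using agree[OF that(1)] that zh hH assms(2) by blast
    then show "D z y = D x y - {h}"
      unfolding D_def by blast
  qed (use z h agree in auto)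
qed

text \<open>The gate projection of \<open>x\<close> to the intersection of the family
  \<open>F\<close>, written as a choice of sides: a wall with a side containing a member of
  \<open>F\<close> is forced, all others keep the side of \<open>x\<close>.\<close>

lemma vertex_project:
  assumes x: "x \<in> V" and F: "F \<subseteq> H" "\<And>A B. A \<in> F \<Longrightarrow> B \<in> F \<Longrightarrow> A \<inter> B \<noteq> {}"
    and fin: "finite {A \<in> F. x \<notin> A}"
  obtains y where "y \<in> V"
    "\<And>k. k \<in> H \<Longrightarrow> y \<in> k \<longleftrightarrow> (\<exists>A\<in>F. A \<subseteq> k) \<or> (x \<in> k \<and> (\<forall>A\<in>F. k \<inter> A \<noteq> {}))"
proof -
  define \<sigma> where "\<sigma> = {k \<in> H. (\<exists>A\<in>F. A \<subseteq> k) \<or> (x \<in> k \<and> (\<forall>A\<in>F. k \<inter> A \<noteq> {}))}"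
  have "\<exists>v\<in>V. \<forall>k\<in>H. v \<in> k \<longleftrightarrow> k \<in> \<sigma>"
  proof (rule H_complete[OF _ _ _ x])
    show "\<sigma> \<subseteq> H" by (auto simp: \<sigma>_def)
    show "V - k \<in> \<sigma> \<longleftrightarrow> k \<notin> \<sigma>" if k: "k \<in> H" for k
    proof -
      have kV: "k \<subseteq> V" using k H_sub by blast
      have FV: "A \<subseteq> V" if "A \<in> F" for A using that F(1) H_sub by blast
      have 1: "\<not> (A \<subseteq> k \<and> B \<inter> k = {})" if "A \<in> F" "B \<in> F" for A B
        using F(2)[OF that] by blast
      have in1: "k \<in> \<sigma> \<longleftrightarrow> (\<exists>A\<in>F. A \<subseteq> k) \<or> (x \<in> k \<and> (\<forall>A\<in>F. \<not> A \<inter> k = {}))"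
        using k unfolding \<sigma>_def by (auto simp: Int_commute)
      have "A \<subseteq> V - k \<longleftrightarrow> A \<inter> k = {}" "(V - k) \<inter> A = {} \<longleftrightarrow> A \<subseteq> k" if "A \<in> F" for A
        using FV[OF that] by blast+
      then have "V - k \<in> \<sigma> \<longleftrightarrow> (\<exists>A\<in>F. A \<inter> k = {}) \<or> (x \<notin> k \<and> (\<forall>A\<in>F. \<not> A \<subseteq> k))"
        using H_compl[OF k] x unfolding \<sigma>_def by auto
      then show ?thesis using in1 1 by blast
    qed
    show "k \<inter> l \<noteq> {}" if "k \<in> \<sigma>" "l \<in> \<sigma>" for k l
    proof -
      have l: "l \<in> H" "(\<exists>A\<in>F. A \<subseteq> l) \<or> (x \<in> l \<and> (\<forall>A\<in>F. l \<inter> A \<noteq> {}))"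
        and k: "(\<exists>A\<in>F. A \<subseteq> k) \<or> (x \<in> k \<and> (\<forall>A\<in>F. k \<inter> A \<noteq> {}))"
        using that by (simp_all add: \<sigma>_def)
      from k show ?thesis
      proof
        assume "\<exists>A\<in>F. A \<subseteq> k"
        then obtain A where A: "A \<in> F" "A \<subseteq> k" by blast
        then have "l \<inter> A \<noteq> {}" using l(2) F(2)[OF _ A(1)] by blast
        then show ?thesis using A by blast
      next
        assume kx: "x \<in> k \<and> (\<forall>A\<in>F. k \<inter> A \<noteq> {})"
        then show ?thesis using l(2) by blast
      qed
    qed
    \<comment> \<open>A wall that changes sides is forced by some \<open>A\<close> missing
      \<open>x\<close> and thus separates \<open>x\<close> from every point of \<open>A\<close>. One
      chosen point for each of the finitely many such \<open>A\<close> bounds all of them.\<close>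
    have sub: "{k \<in> \<sigma>. x \<notin> k} \<subseteq> (\<Union>A\<in>{A \<in> F. x \<notin> A}. D (SOME p. p \<in> A) x)"
    proof
      fix k assume "k \<in> {k \<in> \<sigma>. x \<notin> k}"
      then obtain A where A: "A \<in> F" "A \<subseteq> k" "x \<notin> k" "k \<in> H"
        by (auto simp: \<sigma>_def)
      have "A \<noteq> {}" using A F H_nonempty by blast
      then have "(SOME p. p \<in> A) \<in> A" by (simp add: some_in_eq)
      then have "k \<in> D (SOME p. p \<in> A) x" using A by (auto simp: D_iff)
      then show "k \<in> (\<Union>A\<in>{A \<in> F. x \<notin> A}. D (SOME p. p \<in> A) x)" using A by blast
    qed
    have finD: "finite (D (SOME p. p \<in> A) x)" if "A \<in> F" for A
    proof -
      have "A \<noteq> {}" using that F H_nonempty by blast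
      then have "(SOME p. p \<in> A) \<in> A" by (simp add: some_in_eq)
      then have "(SOME p. p \<in> A) \<in> V" using that F(1) H_sub by blast
      then show ?thesis using x D_finite by blast
    qed
    show "finite {k \<in> \<sigma>. x \<notin> k}"
      by (rule finite_subset[OF sub finite_UN_I[OF fin]]) (simp add: finD)
  qed
  then obtain v where v: "v \<in> V" "\<forall>k\<in>H. v \<in> k \<longleftrightarrow> k \<in> \<sigma>" ..
  show ?thesis
  proof (rule that[OF v(1)])
    fix k assume "k \<in> H"
    then show "v \<in> k \<longleftrightarrow> (\<exists>A\<in>F. A \<subseteq> k) \<or> (x \<in> k \<and> (\<forall>A\<in>F. k \<inter> A \<noteq> {}))"
      using v(2) by (simp add: \<sigma>_def)
  qed
qed

end

section \<open>Actions of the integers\<close>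

locale halfspaces_int = halfspaces +
  fixes a :: "int \<Rightarrow> 'a \<Rightarrow> 'a"
  assumes a_in: "x \<in> V \<Longrightarrow> a n x \<in> V"
    and a_add: "x \<in> V \<Longrightarrow> a (m + n) x = a m (a n x)"
    and a_zero: "x \<in> V \<Longrightarrow> a 0 x = x"
    and a_H: "h \<in> H \<Longrightarrow> a n ` h \<in> H"
    and V_nonempty: "V \<noteq> {}"
begin

lemma mem_shift: "x \<in> V \<Longrightarrow> h \<in> H \<Longrightarrow> x \<in> a n ` h \<longleftrightarrow> a (- n) x \<in> h"
proof
  assume x: "x \<in> V" "h \<in> H" "x \<in> a n ` h"
  then obtain y where "y \<in> h" "y \<in> V" "x = a n y" using H_sub by blast
  then show "a (- n) x \<in> h" using a_add[of y "-n" n] a_zero by simp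
next
  assume x: "x \<in> V" "h \<in> H" "a (- n) x \<in> h"
  moreover have "x = a n (a (- n) x)" using a_add[of x n "-n"] a_zero x by simp
  ultimately show "x \<in> a n ` h" by blast
qed

lemma a_mem: "x \<in> V \<Longrightarrow> h \<in> H \<Longrightarrow> a n x \<in> h \<longleftrightarrow> x \<in> a (- n) ` h"
  by (simp add: mem_shift)

lemma a_mem_shift: "x \<in> V \<Longrightarrow> h \<in> H \<Longrightarrow> a m x \<in> a n ` h \<longleftrightarrow> a (m - n) x \<in> h"
  by (simp add: mem_shift a_in a_add[symmetric])

lemma shift_eqI: "h \<in> H \<Longrightarrow> k \<subseteq> V \<Longrightarrow> (\<And>x. x \<in> V \<Longrightarrow> a (- n) x \<in> h \<longleftrightarrow> x \<in> k) \<Longrightarrow> a n ` h = k"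
  using mem_shift a_H H_sub by (metis subsetI subset_antisym subsetD)

lemma shift_add: "h \<in> H \<Longrightarrow> a m ` a n ` h = a (m + n) ` h"
  unfolding image_image by (rule image_cong[OF refl]) (metis H_sub a_add subsetD)

lemma shift_zero: "h \<in> H \<Longrightarrow> a 0 ` h = h"
  using H_sub a_zero by force

lemma shift_compl: assumes "h \<in> H" shows "a n ` (V - h) = V - a n ` h"
proof (rule shift_eqI[OF H_compl[OF assms]])
  show "a (- n) x \<in> V - h \<longleftrightarrow> x \<in> V - a n ` h" if "x \<in> V" for x
    using that assms mem_shift a_in by simp
qed simp

lemma shift_subset: "h \<in> H \<Longrightarrow> k \<in> H \<Longrightarrow> a n ` h \<subseteq> k \<longleftrightarrow> h \<subseteq> a (- n) ` k"
  using shift_add[of k n "-n"] shift_add[of h "-n" n] shift_zero image_mono[of h "a (-n) ` k" "a n"]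
    image_mono[of "a n ` h" k "a (-n)"] by auto

lemma shift_inter: "h \<in> H \<Longrightarrow> k \<in> H \<Longrightarrow> a n ` h \<inter> k = {} \<longleftrightarrow> h \<inter> a (- n) ` k = {}"
proof -
  assume hk: "h \<in> H" "k \<in> H"
  have "a n ` h \<inter> k = {} \<longleftrightarrow> a n ` h \<subseteq> V - k"
    using H_sub[OF a_H[OF hk(1)]] by blast
  also have "\<dots> \<longleftrightarrow> h \<subseteq> V - a (- n) ` k"
    using shift_subset[OF hk(1) H_compl[OF hk(2)]] shift_compl[OF hk(2)] by simp
  also have "\<dots> \<longleftrightarrow> h \<inter> a (- n) ` k = {}"
    using H_sub[OF hk(1)] by blast
  finally show ?thesis .
qed

definition Inv :: "'a set set" where
  "Inv = {h \<in> H. \<exists>n. a n ` h = V - h}"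

definition monotone_at :: "'a \<Rightarrow> 'a set \<Rightarrow> bool" where
  "monotone_at x h \<longleftrightarrow> (\<forall>n. a n x \<in> h \<longrightarrow> a (n + 1) x \<in> h) \<or> (\<forall>n. a (n + 1) x \<in> h \<longrightarrow> a n x \<in> h)"

definition M :: "'a set" where
  "M = {x \<in> V. \<forall>h\<in>H - Inv. monotone_at x h}"

text \<open>Membership in \<open>h\<close> along every orbit ends true and starts false, so
  \<open>h\<close> is attracting for \<open>g\<close>. The bound \<open>N\<close> may depend on
  \<open>x\<close>; by \<open>posI\<close> a single orbit decides for all.\<close>

definition pos :: "'a set \<Rightarrow> bool" where
  "pos h \<longleftrightarrow> h \<in> H \<and> (\<forall>x\<in>V. \<exists>N. \<forall>n\<ge>N. a n x \<in> h \<and> a (- n) x \<notin> h)"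

definition Skew :: "'a set set" where
  "Skew = {h \<in> H. pos h \<or> pos (V - h)}"

definition Triv :: "'a set set" where
  "Triv = H - Inv - Skew"

section \<open>The three classes and their invariance under translation\<close>

lemma classes_sub: "Inv \<subseteq> H" "Skew \<subseteq> H" "Triv \<subseteq> H"
  by (auto simp: Inv_def Skew_def Triv_def)

lemma Inv_compl: "h \<in> Inv \<Longrightarrow> V - h \<in> Inv"
proof -
  assume "h \<in> Inv"
  then obtain n where "h \<in> H" "a n ` h = V - h" by (auto simp: Inv_def)
  then have "V - h \<in> H" "a n ` (V - h) = V - (V - h)"
    using H_compl shift_compl by auto
  then show ?thesis unfolding Inv_def by blast
qed

lemma Inv_shift: assumes "h \<in> Inv" shows "a n ` h \<in> Inv"
proof -
  obtain m where m: "h \<in> H" "a m ` h = V - h" using assms by (auto simp: Inv_def)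
  have "a m ` (a n ` h) = a n ` (a m ` h)"
    using m(1) by (simp add: shift_add add.commute)
  also have "\<dots> = V - a n ` h"
    using m shift_compl by simp
  finally show ?thesis using m a_H by (auto simp: Inv_def)
qed

lemma pos_shift: assumes "pos h" shows "pos (a n ` h)"
  unfolding pos_def
proof (intro conjI ballI)
  show "a n ` h \<in> H" using assms a_H by (simp add: pos_def)
  fix x assume x: "x \<in> V"
  have h: "h \<in> H" using assms by (simp add: pos_def)
  obtain N where N: "\<And>m. m \<ge> N \<Longrightarrow> a m x \<in> h \<and> a (- m) x \<notin> h"
    using assms x by (auto simp: pos_def)
  have "a m x \<in> a n ` h \<and> a (- m) x \<notin> a n ` h" if "m \<ge> N + \<bar>n\<bar>" for m
    using N[of "m - n"] N[of "m + n"] that by (simp add: a_mem_shift[OF x h])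
  then show "\<exists>N. \<forall>m\<ge>N. a m x \<in> a n ` h \<and> a (- m) x \<notin> a n ` h" by blast
qed

lemma Skew_compl: "h \<in> Skew \<Longrightarrow> V - h \<in> Skew"
  unfolding Skew_def using H_compl H_compl_compl by auto

lemma Skew_shift: "h \<in> Skew \<Longrightarrow> a n ` h \<in> Skew"
  unfolding Skew_def using a_H pos_shift shift_compl by (metis (mono_tags, lifting) mem_Collect_eq)

lemma pos_not_Inv: "pos h \<Longrightarrow> h \<notin> Inv"
proof
  assume p: "pos h" "h \<in> Inv"
  have h: "h \<in> H" using p by (simp add: pos_def)
  obtain m where m: "a m ` h = V - h" using p by (auto simp: Inv_def)
  obtain x where x: "x \<in> V" using V_nonempty by blast
  obtain N where N: "\<And>m. m \<ge> N \<Longrightarrow> a m x \<in> h"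
    using p x unfolding pos_def by meson
  have "a (N + \<bar>m\<bar>) x \<in> a m ` h"
    using N[of "N + \<bar>m\<bar> - m"] a_mem_shift[OF x h] by simp
  then show False using m N[of "N + \<bar>m\<bar>"] by simp
qed

lemma Skew_Inv: "Skew \<inter> Inv = {}"
  unfolding Skew_def using pos_not_Inv Inv_compl by blast

lemma Triv_compl: "h \<in> Triv \<Longrightarrow> V - h \<in> Triv"
  unfolding Triv_def using H_compl Inv_compl Skew_compl H_compl_compl by (metis Diff_iff)

lemma Triv_shift: assumes "h \<in> Triv" shows "a n ` h \<in> Triv"
proof -
  have h: "h \<in> H" "h \<notin> Inv" "h \<notin> Skew" using assms by (auto simp: Triv_def)
  have "a (- n) ` a n ` h = h" using h shift_add shift_zero by simp
  then show ?thesis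
    using h a_H Inv_shift[of "a n ` h" "- n"] Skew_shift[of "a n ` h" "- n"]
    by (auto simp: Triv_def)
qed

lemma H_cases: "h \<in> H \<Longrightarrow> h \<in> Triv \<or> h \<in> Skew \<or> h \<in> Inv"
  by (auto simp: Triv_def)

text \<open>Two equal translates would make the truth value of \<open>a n x \<in> h\<close> periodic
  in \<open>n\<close>, but it is false for all small and true for all large
  \<open>n\<close>.\<close>

lemma orbit_inj:
  assumes x: "x \<in> V" and h: "h \<in> H" and up: "\<And>n. n \<ge> N \<Longrightarrow> a n x \<in> h" and down: "\<And>n. n \<le> N' \<Longrightarrow> a n x \<notin> h"
  shows "inj (\<lambda>n. a n ` h)"
proof (rule injI, rule ccontr)
  fix m n :: int assume eq: "a m ` h = a n ` h" and ne: "m \<noteq> n"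
  define p where "p = m - n"
  have step: "a i x \<in> h \<longleftrightarrow> a (i + p) x \<in> h" for i
    using a_mem_shift[OF x h, of "i + m" m] a_mem_shift[OF x h, of "i + m" n] eq
    by (simp add: p_def algebra_simps)
  have per: "a i x \<in> h \<longleftrightarrow> a (i + j * p) x \<in> h" for i j
    using int_step_constant[of "\<lambda>j. a (i + j * p) x \<in> h" 0 j] step[of "i + _ * p"]
    by (simp add: algebra_simps)
  \<comment> \<open>The sign of \<open>p\<close> enters \<open>r\<close> to make
    \<open>r * p\<close> non-negative and large enough to lead from \<open>N\<close> down to
    \<open>N'\<close> or below.\<close>
  define r where "r = (\<bar>N\<bar> + \<bar>N'\<bar>) * sgn p"
  have "r * p = (\<bar>N\<bar> + \<bar>N'\<bar>) * \<bar>p\<bar>"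
    by (simp add: r_def abs_sgn algebra_simps)
  moreover have "\<bar>p\<bar> \<ge> 1" using ne by (simp add: p_def)
  ultimately have "r * p \<ge> \<bar>N\<bar> + \<bar>N'\<bar>"
    by (metis abs_ge_zero add_nonneg_nonneg mult.right_neutral mult_left_mono)
  then have "a N x \<in> h" "a (N + (- r) * p) x \<notin> h"
    using up down[of "N + (- r) * p"] by auto
  then show False using per by blast
qed

text \<open>The translates of \<open>h\<close> are distinct and only finitely many halfspaces
  separate \<open>x\<close> from \<open>y\<close>. So the two orbits lie on different sides of
  \<open>h\<close> at finitely many times only, and the ends of the orbit of \<open>y\<close> behave
  like those of \<open>x\<close>.\<close>

lemma posI:
  assumes x: "x \<in> V" and h: "h \<in> H" and up: "\<And>n. n \<ge> N \<Longrightarrow> a n x \<in> h" and down: "\<And>n. n \<le> N' \<Longrightarrow> a n x \<notin> h"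
  shows "pos h"
  unfolding pos_def
proof (intro conjI ballI h)
  fix y assume y: "y \<in> V"
  have inj: "inj (\<lambda>n. a n ` h)" using orbit_inj assms by blast
  define S where "S = {n. (a n x \<in> h) \<noteq> (a n y \<in> h)}"
  have "S \<subseteq> (\<lambda>n. - n) ` ((\<lambda>n. a n ` h) -` (D x y \<union> D y x))"
  proof
    fix n assume "n \<in> S"
    then have "a (- n) ` h \<in> D x y \<union> D y x"
      using a_mem[OF x h] a_mem[OF y h] a_H[OF h] by (auto simp: S_def D_iff)
    then show "n \<in> (\<lambda>n. - n) ` ((\<lambda>n. a n ` h) -` (D x y \<union> D y x))"
      by (intro image_eqI[of _ _ "- n"]) auto
  qed
  moreover have "finite ((\<lambda>n. a n ` h) -` (D x y \<union> D y x))"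
    using D_finite x y inj by (intro finite_vimageI) auto
  ultimately have "finite S"
    by (meson finite_imageI finite_subset)
  then obtain K where K: "\<And>n. n \<in> S \<Longrightarrow> \<bar>n\<bar> \<le> K"
    by (metis abs_le_iff finite_imageI image_eqI Max_ge)
  have "a n y \<in> h \<and> a (- n) y \<notin> h" if "n \<ge> \<bar>N\<bar> + \<bar>N'\<bar> + \<bar>K\<bar> + 1" for n
  proof -
    have "n \<notin> S" "- n \<notin> S" using K that by force+
    moreover have "a n x \<in> h" "a (- n) x \<notin> h" using up down that by auto
    ultimately show ?thesis by (auto simp: S_def)
  qed
  then show "\<exists>N. \<forall>n\<ge>N. a n y \<in> h \<and> a (- n) y \<notin> h" by blast
qed

section \<open>Monotone orbits\<close>

lemma M_in: "x \<in> M \<Longrightarrow> x \<in> V"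
  by (simp add: M_def)

lemma monotone_at_compl: "x \<in> V \<Longrightarrow> h \<in> H \<Longrightarrow> monotone_at x (V - h) \<longleftrightarrow> monotone_at x h"
  unfolding monotone_at_def using a_in by auto

lemma monotone_at_shift: assumes "x \<in> V" "h \<in> H" shows "monotone_at x (a n ` h) \<longleftrightarrow> monotone_at x h"
proof -
  have 1: "monotone_at x (a n ` h)" if "monotone_at x h" "h \<in> H" for n h
  proof -
    have "a (m + 1) x \<in> a n ` h \<longleftrightarrow> a (m - n + 1) x \<in> h" for m
      using a_mem_shift[OF assms(1) that(2), of "m + 1"] by (simp add: algebra_simps)
    then show ?thesis
      using that(1) a_mem_shift[OF assms(1) that(2)] unfolding monotone_at_def by auto
  qed
  show ?thesis
    using 1[of h n] 1[of "a n ` h" "- n"] assms a_H shift_add shift_zero by auto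
qed

lemma monotone_cases:
  assumes "x \<in> V" "h \<in> H" "monotone_at x h"
  shows "(\<forall>n. a n x \<in> h \<longleftrightarrow> x \<in> h) \<or> pos h \<or> pos (V - h)"
proof (cases "\<forall>n. a n x \<in> h \<longleftrightarrow> a (n + 1) x \<in> h")
  case True
  then have "a n x \<in> h \<longleftrightarrow> a 0 x \<in> h" for n
    using int_step_constant[of "\<lambda>n. a n x \<in> h"] by blast
  then show ?thesis using a_zero assms by simp
next
  case False
  then obtain m where m: "(a m x \<in> h) \<noteq> (a (m + 1) x \<in> h)" by blast
  from assms(3) show ?thesis
    unfolding monotone_at_def
  proof
    assume up: "\<forall>n. a n x \<in> h \<longrightarrow> a (n + 1) x \<in> h"
    then have m': "a m x \<notin> h" "a (m + 1) x \<in> h" using m by blast+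
    have "a n x \<in> h" if "n \<ge> m + 1" for n
      using int_step_mono[of "\<lambda>n. a n x \<in> h" "m + 1" n] up m' that by blast
    moreover have "a n x \<notin> h" if "n \<le> m" for n
      using int_step_mono[of "\<lambda>n. a n x \<in> h" n m] up m' that by blast
    ultimately show ?thesis using posI[OF assms(1,2)] by blast
  next
    assume dn: "\<forall>n. a (n + 1) x \<in> h \<longrightarrow> a n x \<in> h"
    then have m': "a m x \<in> h" "a (m + 1) x \<notin> h" using m by blast+
    have "a n x \<in> V - h" if "n \<ge> m + 1" for n
      using int_step_antimono[of "\<lambda>n. a n x \<in> h" n "m + 1"] dn m' that a_in assms(1) by blast
    moreover have "a n x \<notin> V - h" if "n \<le> m" for n
      using int_step_antimono[of "\<lambda>n. a n x \<in> h" m n] dn m' that by blast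
    ultimately show ?thesis using posI[OF assms(1) H_compl[OF assms(2)]] by blast
  qed
qed

lemma Triv_constant: assumes "x \<in> M" "h \<in> Triv" shows "a n x \<in> h \<longleftrightarrow> x \<in> h"
  using monotone_cases[of x h] assms unfolding M_def Triv_def Skew_def by blast

text \<open>Since \<open>h\<close> is attracting, a decreasing orbit would belong to
  \<open>h\<close> at all times, so either alternative of monotonicity gives the claim. In
  particular the direction is dictated by \<open>h\<close> and is common to all of
  \<open>M\<close>.\<close>

lemma pos_step: assumes "x \<in> M" "pos h" "a n x \<in> h" "n \<le> m" shows "a m x \<in> h"
proof -
  have h: "h \<in> H" "h \<notin> Inv" using assms pos_not_Inv by (auto simp: pos_def)
  then have "monotone_at x h" using assms by (auto simp: M_def)
  then show ?thesis
    unfolding monotone_at_def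
  proof
    assume "\<forall>n. a n x \<in> h \<longrightarrow> a (n + 1) x \<in> h"
    then show ?thesis
      using int_step_mono[of "\<lambda>n. a n x \<in> h" n m] assms by blast
  next
    assume dn: "\<forall>n. a (n + 1) x \<in> h \<longrightarrow> a n x \<in> h"
    obtain N where N: "\<And>n. n \<ge> N \<Longrightarrow> a n x \<in> h"
      using assms(2) M_in[OF assms(1)] unfolding pos_def by meson
    show ?thesis
      using int_step_antimono[of "\<lambda>n. a n x \<in> h" "max m N" m] dn N by simp
  qed
qed

lemma pos_reach: assumes "x \<in> V" "pos h"
  shows "\<exists>n\<ge>m. a n x \<in> h" "\<exists>n\<le>m. a n x \<notin> h"
proof -
  obtain N where N: "\<And>n. n \<ge> N \<Longrightarrow> a n x \<in> h \<and> a (- n) x \<notin> h"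
    using assms unfolding pos_def by meson
  show "\<exists>n\<ge>m. a n x \<in> h" using N[of "max m N"] by (intro exI[of _ "max m N"]) auto
  show "\<exists>n\<le>m. a n x \<notin> h" using N[of "max (- m) N"] by (intro exI[of _ "- max (- m) N"]) auto
qed

lemma pos_crossing: assumes "x \<in> V" "pos h" obtains n where "a n x \<notin> h" "a (n + 1) x \<in> h"
proof -
  obtain n0 where n0: "n0 \<le> 0" "a n0 x \<notin> h" using pos_reach(2)[OF assms] by blast
  obtain n1 where n1: "n1 \<ge> n0" "a n1 x \<in> h" using pos_reach(1)[OF assms] by blast
  show ?thesis
  proof (rule ccontr)
    assume "\<not> ?thesis"
    then have "a n x \<notin> h \<Longrightarrow> a (n + 1) x \<notin> h" for n using that by blast
    then show False using int_step_mono[of "\<lambda>n. a n x \<notin> h" n0 n1] n0 n1 by blast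
  qed
qed

subsection \<open>Non-emptiness of the median set\<close>

lemma shift_iterate:
  assumes "h \<in> H" "h \<subseteq> a q ` h"
  shows "h \<subseteq> a (int n * q) ` h"
proof (induction n)
  case 0
  then show ?case using shift_zero assms by simp
next
  case (Suc n)
  have "a q ` h \<subseteq> a q ` a (int n * q) ` h"
    using Suc by (rule image_mono)
  also have "\<dots> = a (int (Suc n) * q) ` h"
    using shift_add[OF assms(1)] by (simp add: algebra_simps)
  finally show ?case using assms(2) by blast
qed

lemma periodic_iterate:
  assumes "h \<in> H" "a m ` h = h"
  shows "a (m * q) ` h = h"
proof -
  have "x \<in> a (m * q) ` h \<longleftrightarrow> x \<in> h" if x: "x \<in> V" for x
  proof -
    have "a (- m * i) x \<in> h \<longleftrightarrow> a (- m * (i + 1)) x \<in> h" for i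
    proof -
      have "- m * i - m = - m * (i + 1)" by (simp add: algebra_simps)
      then show ?thesis
        using a_mem_shift[OF x assms(1), of "- m * i" m] assms(2) by simp
    qed
    from int_step_constant[of "\<lambda>i. a (- m * i) x \<in> h", OF this, of q 0]
    show ?thesis using mem_shift[OF x assms(1)] a_zero x by simp
  qed
  then show ?thesis using H_sub assms(1) a_H by blast
qed

text \<open>If both alternatives failed, \<open>h\<close> would be disjoint from its translate by
  some \<open>p\<close>, and \<open>V - h\<close> would be contained in the translate of
  \<open>h\<close> by some \<open>q\<close>. Then \<open>h\<close> lies in the complement of its
  \<open>p\<close>-translate and this in the \<open>(p + q)\<close>-translate of \<open>h\<close>.
  Periodicity closes the chain into equalities, so \<open>h\<close> would be inverted.\<close>

lemma orbit_pairwise: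
  assumes h: "h \<in> H" "h \<notin> Inv" and m: "m > 0" "a m ` h = h"
  shows "(\<forall>i j. a i ` h \<inter> a j ` h \<noteq> {}) \<or> (\<forall>i j. a i ` (V - h) \<inter> a j ` (V - h) \<noteq> {})"
proof (rule ccontr)
  assume "\<not> ?thesis"
  then obtain i j k l where e: "a i ` h \<inter> a j ` h = {}" "a k ` (V - h) \<inter> a l ` (V - h) = {}"
    by (simp only: de_Morgan_disj not_all not_not) (elim conjE exE)
  define p q where "p = j - i" and "q = l - k"
  have "h \<inter> a p ` h = {}"
    using shift_inter[OF h(1) a_H[OF h(1)], of i j] e(1) shift_add[OF h(1)]
    by (simp add: p_def add.commute)
  then have 1: "h \<subseteq> V - a p ` h" using H_sub h by blast
  have "(V - h) \<inter> a q ` (V - h) = {}"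
    using shift_inter[OF H_compl[OF h(1)] a_H[OF H_compl[OF h(1)]], of k l] e(2) shift_add[OF H_compl[OF h(1)]]
    by (simp add: q_def add.commute)
  then have 2: "V - h \<subseteq> a q ` h" using shift_compl[OF h(1)] by blast
  have "V - a p ` h \<subseteq> a (p + q) ` h"
    using image_mono[OF 2, of "a p"] shift_compl[OF h(1)] shift_add[OF h(1)] by simp
  then have 3: "h \<subseteq> a (p + q) ` h" using 1 by blast
  \<comment> \<open>Iterating the inclusion \<open>m\<close> times leads back to \<open>h\<close>;
    the factor \<open>nat m - 1\<close> leaves one iteration for the shift in front.\<close>
  have "a (p + q) ` h \<subseteq> a (p + q) ` a (int (nat m - 1) * (p + q)) ` h"
    using shift_iterate[OF h(1) 3] by (rule image_mono)
  also have "\<dots> = a (m * (p + q)) ` h"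
    using shift_add[OF h(1)] m(1) by (simp add: algebra_simps of_nat_diff)
  also have "\<dots> = h" using periodic_iterate[OF h(1) m(2)] .
  finally have "V - a p ` h \<subseteq> h"
    using \<open>V - a p ` h \<subseteq> a (p + q) ` h\<close> by blast
  then have "a p ` h = V - h" using 1 H_sub[OF a_H[OF h(1), of p]] by blast
  then show False using h by (auto simp: Inv_def)
qed

definition periodic :: "'a set \<Rightarrow> bool" where
  "periodic h \<longleftrightarrow> (\<exists>m>0. a m ` h = h)"

lemma periodic_orbit_finite: assumes "h \<in> H" "periodic h" shows "finite (range (\<lambda>n. a n ` h))"
proof -
  obtain m where m: "m > 0" "a m ` h = h" using assms by (auto simp: periodic_def)
  have "a n ` h = a (n mod m) ` h" for n
  proof -
    have "a (n mod m) ` a (m * (n div m)) ` h = a n ` h"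
      using shift_add[OF assms(1)] by (simp add: add.commute)
    then show ?thesis using periodic_iterate[OF assms(1) m(2)] by simp
  qed
  moreover have "n mod m \<in> {0..<m}" for n
    using m(1) by simp
  ultimately have "range (\<lambda>n. a n ` h) \<subseteq> (\<lambda>n. a n ` h) ` {0..<m}"
    by (intro image_subsetI image_eqI)
  then show ?thesis by (rule finite_subset) simp
qed

lemma periodic_shift: assumes "h \<in> H" "periodic h" shows "periodic (a n ` h)"
proof -
  obtain m where m: "m > 0" "a m ` h = h" using assms by (auto simp: periodic_def)
  have "a m ` a n ` h = a n ` a m ` h" using shift_add[OF assms(1)] by (simp add: add.commute)
  then show ?thesis using m by (auto simp: periodic_def)
qed

lemma periodic_compl: assumes "h \<in> H" "periodic h" shows "periodic (V - h)"
proof -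
  obtain m where m: "m > 0" "a m ` h = h" using assms by (auto simp: periodic_def)
  have "a m ` (V - h) = V - h" unfolding shift_compl[OF assms(1)] m(2) ..
  then show ?thesis using m(1) by (auto simp: periodic_def)
qed

text \<open>Descent on the number of offending halfspaces. If \<open>g\<close> moves
  \<open>x\<close> out of a periodic \<open>h\<close>, then by \<open>orbit_pairwise\<close> the
  orbit of \<open>h\<close> or that of its complement meets pairwise, and projecting
  \<open>x\<close> to the intersection of this orbit repairs \<open>h\<close> without creating new
  offenders.\<close>

lemma exists_constant_on_periodic:
  "\<exists>x\<in>V. \<forall>h\<in>H - Inv. periodic h \<longrightarrow> (\<forall>n. a n x \<in> h \<longleftrightarrow> x \<in> h)"
proof -
  \<comment> \<open>Only one step of the orbit and only leaving is counted: applied to translates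
    and complements, an empty \<open>B x\<close> already yields constancy along the whole orbit. The
    set is finite since its members separate \<open>x\<close> from \<open>a 1 x\<close>.\<close>
  define B where "B x = {h \<in> H - Inv. periodic h \<and> x \<in> h \<and> a 1 x \<notin> h}" for x
  obtain x where x: "x \<in> V" "\<And>y. y \<in> V \<Longrightarrow> card (B x) \<le> card (B y)"
    using ex_has_least_nat[of "\<lambda>x. x \<in> V" _ "\<lambda>x. card (B x)"] V_nonempty by blast
  have fin: "finite (B y)" if "y \<in> V" for y
    using D_finite[OF that a_in[OF that]] by (rule rev_finite_subset) (auto simp: B_def D_iff)
  have "B x = {}"
  proof (rule ccontr)
    assume "B x \<noteq> {}"
    then obtain h where h: "h \<in> H" "h \<notin> Inv" "periodic h" "x \<in> h" "a 1 x \<notin> h" by (auto simp: B_def)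
    obtain m where "m > 0" "a m ` h = h"
      using h(3) unfolding periodic_def by (elim exE conjE)
    from orbit_pairwise[OF h(1,2) this]
    obtain k where k: "k = h \<or> k = V - h" "\<And>i j. a i ` k \<inter> a j ` k \<noteq> {}"
      by metis
    have kH: "k \<in> H" "periodic k" using k h H_compl periodic_compl by auto
    \<comment> \<open>The whole orbit is taken so that the family is invariant under translation; a
      wall and its translates are then forced together.\<close>
    define F where "F = range (\<lambda>n. a n ` k)"
    have F_sub: "F \<subseteq> H" using a_H kH by (auto simp: F_def)
    have F_shift: "a n ` A \<in> F" if "A \<in> F" for A n
      using that shift_add[OF kH(1)] by (auto simp: F_def)
    have "k \<in> F" using shift_zero[OF kH(1)] by (force simp: F_def)
    have pw: "A \<inter> B \<noteq> {}" if AB: "A \<in> F" "B \<in> F" for A B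
    proof -
      obtain i j where "A = a i ` k" "B = a j ` k" using AB unfolding F_def by (elim imageE)
      then show ?thesis using k(2) by simp
    qed
    have fin': "finite {A \<in> F. x \<notin> A}" using periodic_orbit_finite[OF kH] by (simp add: F_def)
    obtain y where y: "y \<in> V"
      "\<And>c. c \<in> H \<Longrightarrow> y \<in> c \<longleftrightarrow> (\<exists>A\<in>F. A \<subseteq> c) \<or> (x \<in> c \<and> (\<forall>A\<in>F. c \<inter> A \<noteq> {}))"
      by (rule vertex_project[OF x(1) F_sub _ fin'], erule (1) pw, erule that, simp)
    have yF: "y \<in> A" if "A \<in> F" for A
      using y(2)[of A] that F_sub by blast
    \<comment> \<open>If a member of \<open>F\<close> were contained in \<open>c\<close>, a
      translate of it would lie in \<open>c'\<close> and put \<open>y\<close> there. So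
      \<open>y\<close> has kept the side of \<open>x\<close> at \<open>c\<close>, and, as all
      members of \<open>F\<close> meet \<open>c'\<close>, at \<open>c'\<close> too.\<close>
    have "B y \<subseteq> B x"
    proof
      fix c assume "c \<in> B y"
      then have c: "c \<in> H" "c \<notin> Inv" "periodic c" "y \<in> c" "a 1 y \<notin> c" by (auto simp: B_def)
      define c' where "c' = a (- 1) ` c"
      have c': "c' \<in> H" "y \<notin> c'" using c a_H a_mem[OF y(1) c(1), of 1] by (auto simp: c'_def)
      have no: "\<not> A \<subseteq> c" if "A \<in> F" for A
      proof
        assume "A \<subseteq> c"
        then have "a (- 1) ` A \<subseteq> c'" unfolding c'_def by (rule image_mono)
        then show False using y(2)[OF c'(1)] c'(2) F_shift[OF that] by blast
      qed
      then have xc: "x \<in> c" and meet: "\<And>A. A \<in> F \<Longrightarrow> c \<inter> A \<noteq> {}" using y(2)[OF c(1)] c(4) by auto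
      have "c' \<inter> A \<noteq> {}" if "A \<in> F" for A
        using shift_inter[OF c(1), of A "- 1"] meet[OF F_shift[OF that, of 1]] that F_sub
        by (auto simp: c'_def)
      then have "x \<notin> c'" using y(2)[OF c'(1)] c'(2) by blast
      then have "a 1 x \<notin> c" using a_mem[OF x(1) c(1), of 1] by (simp add: c'_def)
      then show "c \<in> B x" using c xc by (auto simp: B_def)
    qed
    moreover have "h \<notin> B y"
    proof (cases "k = h")
      case True
      then have "y \<in> a (- 1) ` h" using yF \<open>k \<in> F\<close> F_shift by blast
      then show ?thesis using a_mem[OF y(1) h(1), of 1] by (auto simp: B_def)
    next
      case False
      then show ?thesis using k yF[OF \<open>k \<in> F\<close>] by (auto simp: B_def)
    qed
    moreover have "h \<in> B x" using h by (auto simp: B_def)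
    ultimately have "card (B y) < card (B x)" using fin[OF x(1)] by (intro psubset_card_mono) auto
    then show False using x(2)[OF y(1)] by simp
  qed
  have step: "a n x \<in> h \<Longrightarrow> a (n + 1) x \<in> h" if h: "h \<in> H - Inv" "periodic h" for h n
  proof -
    assume "a n x \<in> h"
    define k where "k = a (- n) ` h"
    have "k \<in> H" "periodic k" "x \<in> k"
      using h a_H periodic_shift a_mem[OF x(1)] \<open>a n x \<in> h\<close> by (auto simp: k_def)
    moreover have "k \<notin> Inv"
      using Inv_shift[of k n] h shift_add shift_zero by (auto simp: k_def)
    ultimately have "a 1 x \<in> k" using \<open>B x = {}\<close> by (auto simp: B_def)
    then show ?thesis using a_mem_shift[OF x(1), of h 1 "- n"] h by (simp add: k_def add.commute)
  qed
  have "a n x \<in> h \<longleftrightarrow> x \<in> h" if h: "h \<in> H - Inv" "periodic h" for h n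
  proof -
    have "V - h \<in> H - Inv" "periodic (V - h)"
      using h H_compl periodic_compl Inv_compl H_compl_compl by (metis Diff_iff)+
    then have "a n x \<in> h \<longleftrightarrow> a (n + 1) x \<in> h" for n
      using step[OF h] step[of "V - h"] a_in[OF x(1)] by blast
    from int_step_constant[of "\<lambda>n. a n x \<in> h", OF this, of n 0] show ?thesis
      using a_zero x(1) by simp
  qed
  then show ?thesis using x(1) by blast
qed

text \<open>Two halfspaces each visited more than \<open>k\<close> times in a window of
  \<open>2 * k + 1\<close> times are visited simultaneously once, so chosen sides meet. Only walls
  separating \<open>x\<close> from the finitely many orbit points in the window can change.\<close>

lemma majority_vertex:
  assumes "x \<in> V" "0 \<le> k"
  obtains y where "y \<in> V" "\<And>h. h \<in> H \<Longrightarrow> y \<in> h \<longleftrightarrow> card {i \<in> {-k..k}. a i x \<in> h} > nat k"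
proof -
  define \<sigma> where "\<sigma> = {h \<in> H. card {i \<in> {-k..k}. a i x \<in> h} > nat k}"
  have "\<exists>v\<in>V. \<forall>h\<in>H. v \<in> h \<longleftrightarrow> h \<in> \<sigma>"
  proof (rule H_complete[OF _ _ _ assms(1)])
    show "\<sigma> \<subseteq> H" by (auto simp: \<sigma>_def)
    show "V - h \<in> \<sigma> \<longleftrightarrow> h \<notin> \<sigma>" if "h \<in> H" for h
      using window_complement[OF assms(2), of "\<lambda>i. a i x \<in> h" 0] that H_compl a_in[OF assms(1)]
      unfolding \<sigma>_def by simp
    show "h \<inter> l \<noteq> {}" if hl: "h \<in> \<sigma>" "l \<in> \<sigma>" for h l
    proof
      assume "h \<inter> l = {}"
      then have disj: "{i \<in> {-k..k}. a i x \<in> h} \<inter> {i \<in> {-k..k}. a i x \<in> l} = {}" by blast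
      have "card ({i \<in> {-k..k}. a i x \<in> h} \<union> {i \<in> {-k..k}. a i x \<in> l}) \<le> card {-k..k}"
        by (intro card_mono) auto
      then have "card {i \<in> {-k..k}. a i x \<in> h} + card {i \<in> {-k..k}. a i x \<in> l} \<le> nat (2 * k + 1)"
        by (subst (asm) card_Un_disjoint[OF window_finite window_finite disj]) simp
      then show False using hl assms(2) unfolding \<sigma>_def by auto
    qed
    have "{h \<in> \<sigma>. x \<notin> h} \<subseteq> (\<Union>i\<in>{-k..k}. D (a i x) x)"
    proof
      fix h assume h: "h \<in> {h \<in> \<sigma>. x \<notin> h}"
      then have "card {i \<in> {-k..k}. a i x \<in> h} \<noteq> 0" unfolding \<sigma>_def by simp
      then have "{i \<in> {-k..k}. a i x \<in> h} \<noteq> {}" by (metis card.empty)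
      then show "h \<in> (\<Union>i\<in>{-k..k}. D (a i x) x)" using h by (auto simp: \<sigma>_def D_iff)
    qed
    then show "finite {h \<in> \<sigma>. x \<notin> h}"
      using D_finite a_in assms(1) by (meson finite_UN_I finite_atLeastAtMost_int finite_subset)
  qed
  then obtain v where v: "v \<in> V" "\<forall>h\<in>H. v \<in> h \<longleftrightarrow> h \<in> \<sigma>" ..
  show ?thesis
    by (rule that[OF v(1)]) (use v(2) in \<open>simp add: \<sigma>_def\<close>)
qed

lemma aperiodic_inj:
  assumes "h \<in> H" "\<not> periodic h"
  shows "inj (\<lambda>n. a n ` h)"
proof (rule injI, rule ccontr)
  fix m n :: int assume eq: "a m ` h = a n ` h" "m \<noteq> n"
  have 1: "a (m - n) ` h = h" if "a m ` h = a n ` h" for m n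
    using arg_cong[OF that, of "\<lambda>k. a (- n) ` k"] shift_add[OF assms(1)] shift_zero[OF assms(1)]
    by (simp add: add.commute)
  have "a \<bar>m - n\<bar> ` h = h" using 1[OF eq(1)] 1[OF eq(1)[symmetric]] by (simp add: abs_if)
  then show False using assms(2) eq(2) by (auto simp: periodic_def)
qed

text \<open>Start at a vertex constant on the periodic halfspaces. For any other \<open>h\<close>
  outside \<open>Inv\<close> the translates are distinct and each change of side along the orbit
  puts one of them into the finite set \<open>W\<close>, so there are finitely many changes and the
  majority vote makes \<open>h\<close> monotone.\<close>

lemma M_nonempty: "M \<noteq> {}"
proof -
  obtain x where x: "x \<in> V" and const: "\<And>h n. h \<in> H - Inv \<Longrightarrow> periodic h \<Longrightarrow> a n x \<in> h \<longleftrightarrow> x \<in> h"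
    using exists_constant_on_periodic by blast
  define W where "W = D x (a 1 x) \<union> D (a 1 x) x"
  have finW: "finite W" using D_finite a_in x by (simp add: W_def)
  have W: "a (- n) ` h \<in> W" if "h \<in> H" "(a n x \<in> h) \<noteq> (a (n + 1) x \<in> h)" for h n
    using that a_mem[OF x that(1), of n] a_mem_shift[OF x that(1), of 1 "- n"] a_H
    by (auto simp: W_def D_iff add.commute)
  define ends
    where "ends h c \<longleftrightarrow> 0 \<le> c \<and> (\<exists>p q. (\<forall>n>c. (a n x \<in> h) = p) \<and> (\<forall>n< -c. (a n x \<in> h) = q))" for h c
  have "\<exists>c. ends h c" if h: "h \<in> H - Inv" for h
  proof (cases "periodic h")
    case True
    then show ?thesis using const[OF h] unfolding ends_def by (intro exI[of _ 0]) auto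
  next
    case False
    have hH: "h \<in> H" using h by simp
    define S where "S = {n. (a n x \<in> h) \<noteq> (a (n + 1) x \<in> h)}"
    have "S \<subseteq> (\<lambda>n. - n) ` ((\<lambda>n. a n ` h) -` W)"
    proof
      fix n assume "n \<in> S"
      then have "a (- n) ` h \<in> W" using W[OF hH] by (simp add: S_def)
      then show "n \<in> (\<lambda>n. - n) ` ((\<lambda>n. a n ` h) -` W)"
        by (intro image_eqI[of _ _ "- n"]) auto
    qed
    moreover have "finite ((\<lambda>n. a n ` h) -` W)"
      using finW aperiodic_inj[OF hH False] by (rule finite_vimageI)
    ultimately have "finite S" by (meson finite_imageI finite_subset)
    then obtain K where K: "\<And>n. n \<in> S \<Longrightarrow> \<bar>n\<bar> \<le> K"
      by (metis abs_le_iff finite_imageI image_eqI Max_ge)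
    define c where "c = \<bar>K\<bar> + 1"
    have st: "(a n x \<in> h) = (a (n + 1) x \<in> h)" if "\<bar>n\<bar> \<ge> c" for n
      using K[of n] that unfolding S_def c_def by force
    have "(a n x \<in> h) = (a c x \<in> h)" if "n > c" for n
    proof -
      have "n \<ge> c" using that by simp
      then show ?thesis
      proof (induction n rule: int_ge_induct)
        case (step i)
        then show ?case using st[of i] by (simp add: c_def)
      qed simp
    qed
    moreover have "(a n x \<in> h) = (a (- c) x \<in> h)" if "n < - c" for n
    proof -
      have "n \<le> - c" using that by simp
      then show ?thesis
      proof (induction n rule: int_le_induct)
        case (step i)
        then show ?case using st[of "i - 1"] by (simp add: c_def)
      qed simp
    qed
    ultimately have "ends h c" unfolding ends_def c_def by auto
    then show ?thesis by blast
  qed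
  then obtain c where c: "\<And>h. h \<in> H - Inv \<Longrightarrow> ends h (c h)" by metis
  \<comment> \<open>The bounds \<open>c h\<close> are not uniform in \<open>h\<close>, but it
    suffices to treat \<open>W\<close>: an \<open>h\<close> whose side changes has a translate in
    \<open>W\<close>, and monotonicity is invariant under translation. The form
    \<open>2 * _ + 1\<close> is what \<open>window_monotone\<close> asks for, and \<open>0\<close>
    keeps \<open>Max\<close> defined when \<open>W - Inv\<close> is empty.\<close>
  define k where "k = 2 * Max (insert 0 (c ` (W - Inv))) + 1"
  have k: "2 * c h + 1 \<le> k" if "h \<in> W - Inv" for h
  proof -
    have "c h \<le> Max (insert 0 (c ` (W - Inv)))"
      using that finW by (intro Max_ge) auto
    then show ?thesis by (simp add: k_def)
  qed
  have "0 \<le> Max (insert 0 (c ` (W - Inv)))"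
    using finW by (intro Max_ge) auto
  then have k0: "0 \<le> k" by (simp add: k_def)
  obtain y where y: "y \<in> V" "\<And>h. h \<in> H \<Longrightarrow> y \<in> h \<longleftrightarrow> card {i \<in> {-k..k}. a i x \<in> h} > nat k"
    by (rule majority_vertex[OF x k0]) (rule that)
  have ay: "a n y \<in> h \<longleftrightarrow> card {i \<in> {-k..k}. a (n + i) x \<in> h} > nat k" if "h \<in> H" for h n
    using y(2)[OF a_H[OF that, of "- n"]] a_mem[OF y(1) that, of n] a_mem_shift[OF x that]
    by (simp add: add.commute)
  have W_mono: "monotone_at y h" if h: "h \<in> W - Inv" for h
  proof -
    have hH: "h \<in> H - Inv" using h by (auto simp: W_def D_iff)
    from c[OF hH] obtain p q
      where pq: "\<And>n. n > c h \<Longrightarrow> (a n x \<in> h) = p" "\<And>n. n < - c h \<Longrightarrow> (a n x \<in> h) = q" "0 \<le> c h"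
      unfolding ends_def by blast
    show ?thesis
      using window_monotone[of "c h" "\<lambda>n. a n x \<in> h" p q k] pq k[OF h] ay[of h] hH
      unfolding monotone_at_def by simp
  qed
  have "monotone_at y h" if h: "h \<in> H - Inv" for h
  proof (cases "\<forall>n. (a n x \<in> h) = (a (n + 1) x \<in> h)")
    case True
    then have "a n x \<in> h \<longleftrightarrow> a 0 x \<in> h" for n
      using int_step_constant[of "\<lambda>n. a n x \<in> h"] by blast
    then have "card {i \<in> {-k..k}. a (n + i) x \<in> h} = card {i \<in> {-k..k}. a (0 + i) x \<in> h}" for n
      by (intro arg_cong[where f = card]) blast
    moreover have hH: "h \<in> H" using h by simp
    ultimately have "a n y \<in> h \<longleftrightarrow> a 0 y \<in> h" for n unfolding ay[OF hH] by simp
    then show ?thesis unfolding monotone_at_def by blast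
  next
    case False
    then obtain n where n: "(a n x \<in> h) \<noteq> (a (n + 1) x \<in> h)" by blast
    have "a (- n) ` h \<in> W" using W n h by blast
    moreover have "a (- n) ` h \<notin> Inv"
      using Inv_shift[of "a (- n) ` h" n] h shift_add shift_zero by auto
    ultimately have "monotone_at y (a (- n) ` h)" using W_mono by blast
    then show ?thesis using monotone_at_shift y(1) h by blast
  qed
  then show ?thesis using y(1) unfolding M_def by blast
qed

end

context halfspaces_int
begin

subsection \<open>Inverted halfspaces\<close>

lemma flip_iterate:
  assumes "h \<in> H" "a m ` h = V - h"
  shows "a (m * q) ` h = (if even q then h else V - h)"
proof -
  have "a (m + m) ` h = h"
    using shift_add[OF assms(1), of m m] shift_compl[OF assms(1), of m] assms(2) H_compl_compl[OF assms(1)]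
    by simp
  from periodic_iterate[OF assms(1) this] have per: "a ((m + m) * r) ` h = h" for r .
  show ?thesis
  proof (cases "even q")
    case True
    then obtain r where "q = 2 * r" ..
    then have "m * q = (m + m) * r" by (simp add: algebra_simps)
    then show ?thesis using per True by (simp only: if_True)
  next
    case False
    then obtain r where "q = 2 * r + 1" by (rule oddE)
    then have "m * q = m + (m + m) * r" by (simp add: algebra_simps)
    then show ?thesis using per shift_add[OF assms(1), of m "(m + m) * r"] assms(2) False by simp
  qed
qed

lemma H_not_self_compl: "h \<in> H \<Longrightarrow> h \<noteq> V - h"
  using H_nonempty H_sub by blast

text \<open>A common multiple \<open>l\<close> of the inverting exponents \<open>m\<close> and
  \<open>n\<close> acts on \<open>h\<close> and on \<open>k\<close> by parity, and after cancelling
  the gcd at least one of the two is flipped. If \<open>h\<close> and \<open>k\<close> were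
  disjoint, so would be their images; flipping one makes the other empty, flipping both makes
  \<open>h\<close> the complement of \<open>k\<close>.\<close>

lemma Inv_transverse:
  assumes "h \<in> Inv" "k \<in> Inv" "h \<noteq> V - k"
  shows "h \<inter> k \<noteq> {}"
proof
  assume disj: "h \<inter> k = {}"
  obtain m n where hk: "h \<in> H" "k \<in> H" and m: "a m ` h = V - h" and n: "a n ` k = V - k"
    using assms(1,2) unfolding Inv_def by auto
  have sub: "h \<subseteq> V" "k \<subseteq> V" "h \<noteq> {}" "k \<noteq> {}" using hk H_sub H_nonempty by auto
  have "m \<noteq> 0" using m shift_zero[OF hk(1)] H_not_self_compl[OF hk(1)] by auto
  \<comment> \<open>Cancelling the gcd is essential: coprime cofactors cannot both be even, which
    excludes the case in which \<open>l\<close> flips neither halfspace.\<close>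
  then obtain m' n' where co: "m = gcd m n * m'" "n = gcd m n * n'" "coprime m' n'"
    by (metis gcd_coprime_exists gcd_eq_0_iff mult.commute)
  define l where "l = m * n'"
  have l: "l = n * m'" unfolding l_def by (subst co(1), subst (2) co(2)) simp
  have lh: "a l ` h = (if even n' then h else V - h)"
    unfolding l_def by (rule flip_iterate[OF hk(1) m])
  have lk: "a l ` k = (if even m' then k else V - k)"
    unfolding l by (rule flip_iterate[OF hk(2) n])
  have "inj_on (a l) V"
    by (rule inj_on_inverseI[where g = "a (- l)"]) (simp add: a_add[symmetric] a_zero)
  then have "a l ` h \<inter> a l ` k = {}"
    using disj sub inj_on_image_Int[of "a l" V h k] by simp
  then have d2: "(if even n' then h else V - h) \<inter> (if even m' then k else V - k) = {}"
    using lh lk by simp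
  have "\<not> (even m' \<and> even n')"
    using co(3) coprime_common_divisor[of m' n' 2] by auto
  then consider "odd m'" "odd n'" | "even m'" "odd n'" | "odd m'" "even n'" by blast
  then show False
  proof cases
    case 1
    then have "(V - h) \<inter> (V - k) = {}" using d2 by simp
    then have "h = V - k" using disj sub by blast
    then show False using assms(3) by blast
  next
    case 2
    then have "(V - h) \<inter> k = {}" using d2 by simp
    then show False using disj sub by blast
  next
    case 3
    then have "h \<inter> (V - k) = {}" using d2 by simp
    then show False using disj sub by blast
  qed
qed

lemma Inv_crosses:
  assumes "x \<in> V" "h \<in> Inv"
  obtains n where "a n x \<in> h"
proof (cases "x \<in> h")
  case True
  then show ?thesis using that[of 0] a_zero assms by simp
next
  case False
  obtain m where m: "h \<in> H" "a m ` h = V - h" using assms(2) by (auto simp: Inv_def)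
  have "a (- m) x \<in> h" using mem_shift[OF assms(1) m(1), of m] m(2) False assms(1) by simp
  then show ?thesis by (rule that)
qed

text \<open>Every orbit visits both sides of an inverted halfspace, so a translate of it separates
  \<open>x\<close> from \<open>a 1 x\<close> in one direction or the other. This leaves finitely
  many orbits, each finite because the square of an inversion fixes the halfspace.\<close>

lemma Inv_finite: "finite Inv"
proof -
  obtain x where x: "x \<in> V" using V_nonempty by blast
  define W where "W = (D x (a 1 x) \<union> D (a 1 x) x) \<inter> Inv"
  have "finite W" using D_finite a_in x by (simp add: W_def)
  moreover have "finite (range (\<lambda>n. a n ` w))" if w: "w \<in> W" for w
  proof (rule periodic_orbit_finite)
    obtain m where m: "w \<in> H" "a m ` w = V - w" using w by (auto simp: W_def Inv_def)
    then show "w \<in> H" by simp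
    have "m \<noteq> 0" using m shift_zero[OF m(1)] H_not_self_compl[OF m(1)] by auto
    \<comment> \<open>An even multiple of \<open>m\<close> that is positive whatever the sign of
      \<open>m\<close>.\<close>
    then have "0 < m * (2 * m)" by (auto simp: zero_less_mult_iff)
    moreover have "a (m * (2 * m)) ` w = w" using flip_iterate[OF m, of "2 * m"] by simp
    ultimately show "periodic w" unfolding periodic_def by (intro exI conjI)
  qed
  ultimately have "finite (\<Union>w\<in>W. range (\<lambda>n. a n ` w))" by blast
  moreover have "Inv \<subseteq> (\<Union>w\<in>W. range (\<lambda>n. a n ` w))"
  proof
    fix h assume h: "h \<in> Inv"
    then have hH: "h \<in> H" by (simp add: Inv_def)
    obtain n where n: "(a n x \<in> h) \<noteq> (a (n + 1) x \<in> h)"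
    proof (rule ccontr)
      assume "\<not> thesis"
      then have "a n x \<in> h \<longleftrightarrow> a (n + 1) x \<in> h" for n using that by blast
      from int_step_constant[of "\<lambda>n. a n x \<in> h", OF this] have c: "a n x \<in> h \<longleftrightarrow> a m x \<in> h" for n m .
      obtain i where i: "a i x \<in> h" using Inv_crosses[OF x h] .
      obtain j where j: "a j x \<in> V - h" using Inv_crosses[OF x Inv_compl[OF h]] .
      show False using c[of i j] i j by blast
    qed
    define w where "w = a (- n) ` h"
    have "w \<in> Inv" using Inv_shift[OF h] by (simp add: w_def)
    moreover have "(x \<in> w) \<noteq> (a 1 x \<in> w)"
      using n a_mem[OF x hH, of n] a_mem_shift[OF x hH, of 1 "- n"] by (simp add: w_def add.commute)
    ultimately have "w \<in> W" using x a_in[OF x, of 1] by (auto simp: W_def D_iff Inv_def)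
    moreover have "h = a n ` w" using shift_add[OF hH] shift_zero[OF hH] by (simp add: w_def)
    ultimately show "h \<in> (\<Union>w\<in>W. range (\<lambda>n. a n ` w))" by blast
  qed
  ultimately show ?thesis by (rule rev_finite_subset)
qed

subsection \<open>Independence of the three classes of halfspaces\<close>

text \<open>The orbit of \<open>y\<close> returns to \<open>h\<close> at all times
  \<open>i + m * (2 * r)\<close>, arbitrarily late and arbitrarily early, whereas it lies in
  \<open>k\<close> at all sufficiently late or at all sufficiently early times.\<close>

lemma Inv_Skew_transverse:
  assumes "y \<in> M" "h \<in> Inv" "k \<in> Skew"
  shows "h \<inter> k \<noteq> {}"
proof -
  have yV: "y \<in> V" using assms M_in by blast
  obtain m where m: "h \<in> H" "a m ` h = V - h" using assms(2) by (auto simp: Inv_def)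
  obtain i where i: "a i y \<in> h" using Inv_crosses[OF yV assms(2)] .
  have "m \<noteq> 0" using m shift_zero[OF m(1)] H_not_self_compl[OF m(1)] by auto
  have per: "a (i + m * (2 * r)) y \<in> h" for r
    using a_mem_shift[OF yV m(1), of "i + m * (2 * r)" "m * (2 * r)"] flip_iterate[OF m, of "2 * r"] i
    by simp
  have kH: "k \<in> H" using assms(3) classes_sub by blast
  have "\<exists>N. (\<forall>n\<ge>N. a n y \<in> k) \<or> (\<forall>n\<ge>N. a (- n) y \<in> k)"
  proof -
    have "pos k \<or> pos (V - k)" using assms(3) by (simp add: Skew_def)
    then show ?thesis
    proof
      assume "pos k"
      then obtain N where "\<And>n. n \<ge> N \<Longrightarrow> a n y \<in> k \<and> a (- n) y \<notin> k"
        using yV unfolding pos_def by meson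
      then show ?thesis by blast
    next
      assume "pos (V - k)"
      then obtain N where "\<And>n. n \<ge> N \<Longrightarrow> a n y \<in> V - k \<and> a (- n) y \<notin> V - k"
        using yV unfolding pos_def by meson
      then show ?thesis using a_in[OF yV] by blast
    qed
  qed
  then obtain N where N: "(\<forall>n\<ge>N. a n y \<in> k) \<or> (\<forall>n\<ge>N. a (- n) y \<in> k)" by blast
  have m2: "m * m \<ge> 1"
    using \<open>m \<noteq> 0\<close>
    by (metis mult_eq_0_iff zero_le_square zero_less_iff_neq_zero int_one_le_iff_zero_less order_le_imp_less_or_eq)
  \<comment> \<open>The factor \<open>m\<close> makes the time shift \<open>m * (2 * r)\<close>
    non-negative for either sign of \<open>m\<close>; \<open>r\<close> reaches beyond
    \<open>N\<close> forwards and \<open>- r\<close> backwards.\<close>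
  define r where "r = m * (\<bar>N\<bar> + \<bar>i\<bar>)"
  have "m * (2 * r) = 2 * ((m * m) * (\<bar>N\<bar> + \<bar>i\<bar>))" by (simp add: r_def algebra_simps)
  moreover have "(m * m) * (\<bar>N\<bar> + \<bar>i\<bar>) \<ge> 1 * (\<bar>N\<bar> + \<bar>i\<bar>)"
    using m2 by (intro mult_right_mono) auto
  moreover have "0 \<le> \<bar>N\<bar> + \<bar>i\<bar>" by simp
  ultimately have big: "m * (2 * r) \<ge> \<bar>N\<bar> + \<bar>i\<bar>" by presburger
  have "i + m * (2 * r) \<ge> N" "- (i + m * (2 * (- r))) \<ge> N"
    using big by auto
  then have "a (i + m * (2 * r)) y \<in> k \<or> a (i + m * (2 * (- r))) y \<in> k"
    using N by (metis minus_minus)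
  then show ?thesis using per by blast
qed

lemma Skew_reach:
  assumes "y \<in> V" "k \<in> Skew"
  obtains n where "a n y \<in> k"
proof -
  have k: "pos k \<or> pos (V - k)" "k \<in> H" using assms(2) by (auto simp: Skew_def)
  from k(1) show ?thesis
  proof
    assume "pos k"
    then show ?thesis using pos_reach(1)[OF assms(1), of k 0] that by blast
  next
    assume "pos (V - k)"
    then show ?thesis using pos_reach(2)[OF assms(1), of "V - k" 0] that a_in[OF assms(1)] by blast
  qed
qed

text \<open>The product structure comes from here. Sides of different classes meet because the orbit
  of \<open>x\<close> stays in its \<open>Triv\<close> sides and visits every \<open>Skew\<close>
  and \<open>Inv\<close> halfspace, and because of \<open>Inv_Skew_transverse\<close>. The choice
  differs from \<open>x\<close> only on walls separating \<open>x\<close> from \<open>y\<close> and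
  on the finite \<open>Inv\<close>. As the classes are invariant, the new orbit copies that of
  \<open>x\<close> on \<open>Triv\<close> and that of \<open>y\<close> on \<open>Skew\<close>, hence
  is monotone.\<close>

lemma combine:
  assumes x: "x \<in> M" and y: "y \<in> M" and \<rho>: "\<rho> \<subseteq> Inv" "\<And>h. h \<in> Inv \<Longrightarrow> V - h \<in> \<rho> \<longleftrightarrow> h \<notin> \<rho>"
  obtains v where "v \<in> M" "\<And>h. h \<in> Triv \<Longrightarrow> v \<in> h \<longleftrightarrow> x \<in> h" "\<And>h. h \<in> Skew \<Longrightarrow> v \<in> h \<longleftrightarrow> y \<in> h"
    "\<And>h. h \<in> Inv \<Longrightarrow> v \<in> h \<longleftrightarrow> h \<in> \<rho>"
proof -
  have xV: "x \<in> V" and yV: "y \<in> V" using x y M_in by auto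
  define A where "A = {h \<in> Triv. x \<in> h}"
  define B where "B = {h \<in> Skew. y \<in> h}"
  define \<sigma> where "\<sigma> = A \<union> B \<union> \<rho>"
  have in_T: "h \<in> \<sigma> \<longleftrightarrow> x \<in> h" if "h \<in> Triv" for h
    using that \<rho>(1) unfolding \<sigma>_def A_def B_def Triv_def by auto
  have in_S: "h \<in> \<sigma> \<longleftrightarrow> y \<in> h" if "h \<in> Skew" for h
    using that \<rho>(1) Skew_Inv unfolding \<sigma>_def A_def B_def Triv_def by auto
  have in_I: "h \<in> \<sigma> \<longleftrightarrow> h \<in> \<rho>" if "h \<in> Inv" for h
    using that Skew_Inv unfolding \<sigma>_def A_def B_def Triv_def by auto
  have AB: "h \<inter> k \<noteq> {}" if "h \<in> A" "k \<in> B" for h k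
  proof -
    obtain n where "a n x \<in> k" using Skew_reach[OF xV] \<open>k \<in> B\<close> unfolding B_def by blast
    moreover have "a n x \<in> h" using Triv_constant[OF x] \<open>h \<in> A\<close> unfolding A_def by blast
    ultimately show ?thesis by blast
  qed
  have AR: "h \<inter> k \<noteq> {}" if "h \<in> A" "k \<in> \<rho>" for h k
  proof -
    obtain n where "a n x \<in> k" using Inv_crosses[OF xV] \<open>k \<in> \<rho>\<close> \<rho>(1) by blast
    moreover have "a n x \<in> h" using Triv_constant[OF x] \<open>h \<in> A\<close> unfolding A_def by blast
    ultimately show ?thesis by blast
  qed
  have BR: "h \<inter> k \<noteq> {}" if "h \<in> B" "k \<in> \<rho>" for h k
    using Inv_Skew_transverse[OF y, of k h] that \<rho>(1) unfolding B_def by blast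
  have RR: "h \<inter> k \<noteq> {}" if "h \<in> \<rho>" "k \<in> \<rho>" for h k
  proof (rule Inv_transverse)
    show "h \<in> Inv" "k \<in> Inv" using that \<rho>(1) by auto
    then show "h \<noteq> V - k" using that \<rho>(2)[of k] by auto
  qed
  have "\<exists>v\<in>V. \<forall>h\<in>H. v \<in> h \<longleftrightarrow> h \<in> \<sigma>"
  proof (rule H_complete[OF _ _ _ xV])
    show "\<sigma> \<subseteq> H" using \<rho>(1) classes_sub unfolding \<sigma>_def A_def B_def by auto
    show "V - h \<in> \<sigma> \<longleftrightarrow> h \<notin> \<sigma>" if "h \<in> H" for h
      using H_cases[OF that]
    proof (elim disjE)
      assume h: "h \<in> Triv"
      show ?thesis using in_T[OF h] in_T[OF Triv_compl[OF h]] xV by simp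
    next
      assume h: "h \<in> Skew"
      show ?thesis using in_S[OF h] in_S[OF Skew_compl[OF h]] yV by simp
    next
      assume h: "h \<in> Inv"
      show ?thesis using in_I[OF h] in_I[OF Inv_compl[OF h]] \<rho>(2)[OF h] by simp
    qed
    show "h \<inter> k \<noteq> {}" if hk: "h \<in> \<sigma>" "k \<in> \<sigma>" for h k
    proof -
      have AA: "h \<inter> k \<noteq> {}" if "h \<in> A" "k \<in> A" using that unfolding A_def by blast
      have BB: "h \<inter> k \<noteq> {}" if "h \<in> B" "k \<in> B" using that unfolding B_def by blast
      consider "h \<in> A" | "h \<in> B" | "h \<in> \<rho>" using hk unfolding \<sigma>_def by auto
      moreover consider "k \<in> A" | "k \<in> B" | "k \<in> \<rho>" using hk unfolding \<sigma>_def by auto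
      ultimately show ?thesis
        using AA BB AB AR BR RR AB[of k h] AR[of k h] BR[of k h] Int_commute[of h k] by metis
    qed
    have "{h \<in> \<sigma>. x \<notin> h} \<subseteq> D y x \<union> Inv"
      using \<rho>(1) classes_sub unfolding \<sigma>_def A_def B_def D_def by auto
    then show "finite {h \<in> \<sigma>. x \<notin> h}"
      using D_finite[OF yV xV] Inv_finite finite_subset by blast
  qed
  then obtain v where v: "v \<in> V" "\<forall>h\<in>H. v \<in> h \<longleftrightarrow> h \<in> \<sigma>" ..
  have vT: "v \<in> h \<longleftrightarrow> x \<in> h" if "h \<in> Triv" for h using v(2) in_T[OF that] that classes_sub by auto
  have vS: "v \<in> h \<longleftrightarrow> y \<in> h" if "h \<in> Skew" for h using v(2) in_S[OF that] that classes_sub by auto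
  have vI: "v \<in> h \<longleftrightarrow> h \<in> \<rho>" if "h \<in> Inv" for h using v(2) in_I[OF that] that classes_sub by auto
  have orbT: "a n v \<in> h \<longleftrightarrow> a n x \<in> h" if "h \<in> Triv" for n h
    using a_mem[OF v(1), of h n] a_mem[OF xV, of h n] vT[OF Triv_shift[OF that, of "- n"]] that classes_sub
    by auto
  have orbS: "a n v \<in> h \<longleftrightarrow> a n y \<in> h" if "h \<in> Skew" for n h
    using a_mem[OF v(1), of h n] a_mem[OF yV, of h n] vS[OF Skew_shift[OF that, of "- n"]] that classes_sub
    by auto
  have "monotone_at v h" if h: "h \<in> H - Inv" for h
  proof -
    have "h \<in> Triv \<or> h \<in> Skew" using h H_cases by blast
    moreover have "monotone_at x h" "monotone_at y h"
      using x y h unfolding M_def by blast+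
    ultimately show ?thesis
      using orbT[of h] orbS[of h] \<open>h \<in> Triv \<or> h \<in> Skew\<close> unfolding monotone_at_def by presburger
  qed
  then have "v \<in> M" using v(1) unfolding M_def by blast
  then show ?thesis using that vT vS vI by blast
qed

subsection \<open>Distances in the median set\<close>

text \<open>Its cardinality is the distance in the cubical quotient by the inverted hyperplanes
  (\<open>Y_dist\<close>), and the distance in \<open>X\<close> when nothing is inverted.\<close>

definition N :: "'a \<Rightarrow> 'a \<Rightarrow> 'a set set" where
  "N x y = {h \<in> H - Inv. x \<in> h \<and> y \<notin> h}"

lemma N_iff: "h \<in> N x y \<longleftrightarrow> h \<in> H \<and> h \<notin> Inv \<and> x \<in> h \<and> y \<notin> h"
  by (auto simp: N_def)

lemma N_subset: "N x y \<subseteq> D x y"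
  by (auto simp: N_def D_def)

lemma N_finite: "x \<in> V \<Longrightarrow> y \<in> V \<Longrightarrow> finite (N x y)"
  using finite_subset[OF N_subset D_finite] .

lemma card_D_le: "x \<in> V \<Longrightarrow> y \<in> V \<Longrightarrow> card (D x y) \<le> card (N x y) + card Inv"
proof -
  assume "x \<in> V" "y \<in> V"
  have "D x y \<subseteq> N x y \<union> Inv" by (auto simp: N_def D_def)
  then have "card (D x y) \<le> card (N x y \<union> Inv)"
    using N_finite[OF \<open>x \<in> V\<close> \<open>y \<in> V\<close>] Inv_finite by (intro card_mono) auto
  then show ?thesis using card_Un_le[of "N x y" Inv] by linarith
qed

lemma card_N_le: "x \<in> V \<Longrightarrow> y \<in> V \<Longrightarrow> card (N x y) \<le> card (D x y)"
  by (intro card_mono D_finite N_subset)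

lemma N_refl [simp]: "N x x = {}"
  by (auto simp: N_def)

lemma N_triangle:
  assumes "x \<in> V" "y \<in> V" "z \<in> V"
  shows "card (N x z) \<le> card (N x y) + card (N y z)"
proof -
  have "N x z \<subseteq> N x y \<union> N y z" by (auto simp: N_def)
  then have "card (N x z) \<le> card (N x y \<union> N y z)"
    using N_finite assms by (intro card_mono) auto
  then show ?thesis using card_Un_le[of "N x y" "N y z"] by linarith
qed

lemma D_triangle:
  assumes "x \<in> V" "y \<in> V" "z \<in> V"
  shows "card (D x z) \<le> card (D x y) + card (D y z)"
proof -
  have "D x z \<subseteq> D x y \<union> D y z" by (auto simp: D_def)
  then have "card (D x z) \<le> card (D x y \<union> D y z)"
    using D_finite assms by (intro card_mono) auto
  then show ?thesis using card_Un_le[of "D x y" "D y z"] by linarith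
qed

lemma D_sym: "x \<in> V \<Longrightarrow> y \<in> V \<Longrightarrow> card (D x y) = card (D y x)"
  using bij_betw_same_card[OF D_compl] .

lemma N_sym: assumes "x \<in> V" "y \<in> V" shows "card (N x y) = card (N y x)"
proof (rule bij_betw_same_card)
  have "V - h \<in> N y x" if "h \<in> N x y" "x \<in> V" "y \<in> V" for h x y
    using that H_compl[of h] Inv_compl[of "V - h"] H_compl_compl[of h] by (auto simp: N_iff)
  then show "bij_betw (\<lambda>h. V - h) (N x y) (N y x)"
    using assms
    by (intro bij_betw_byWitness[where f' = "\<lambda>h. V - h"]) (auto simp: N_iff H_compl_compl)
qed

lemma shift_unshift: "h \<in> H \<Longrightarrow> a n ` a (- n) ` h = h" "h \<in> H \<Longrightarrow> a (- n) ` a n ` h = h"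
  using shift_add shift_zero by auto

lemma Inv_shift_iff: "h \<in> H \<Longrightarrow> a n ` h \<in> Inv \<longleftrightarrow> h \<in> Inv"
  using Inv_shift[of h n] Inv_shift[of "a n ` h" "- n"] shift_unshift(2) by auto

lemma D_shift: assumes "x \<in> V" "y \<in> V" shows "card (D (a n x) (a n y)) = card (D x y)"
proof (rule bij_betw_same_card)
  show "bij_betw (\<lambda>h. a (- n) ` h) (D (a n x) (a n y)) (D x y)"
  proof (rule bij_betw_byWitness[where f' = "\<lambda>h. a n ` h"])
    show "(\<lambda>h. a (- n) ` h) ` D (a n x) (a n y) \<subseteq> D x y"
    proof (rule image_subsetI)
      fix h assume "h \<in> D (a n x) (a n y)"
      then show "a (- n) ` h \<in> D x y" using a_mem[of _ h n] assms a_H by (simp add: D_iff)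
    qed
    show "(\<lambda>h. a n ` h) ` D x y \<subseteq> D (a n x) (a n y)"
    proof (rule image_subsetI)
      fix h assume "h \<in> D x y"
      then show "a n ` h \<in> D (a n x) (a n y)"
        using a_mem_shift[of _ h n n] assms a_H a_zero by (simp add: D_iff)
    qed
  qed (auto simp: D_iff shift_unshift)
qed

lemma N_shift: assumes "x \<in> V" "y \<in> V" shows "card (N (a n x) (a n y)) = card (N x y)"
proof (rule bij_betw_same_card)
  show "bij_betw (\<lambda>h. a (- n) ` h) (N (a n x) (a n y)) (N x y)"
  proof (rule bij_betw_byWitness[where f' = "\<lambda>h. a n ` h"])
    show "(\<lambda>h. a (- n) ` h) ` N (a n x) (a n y) \<subseteq> N x y"
    proof (rule image_subsetI)
      fix h assume "h \<in> N (a n x) (a n y)"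
      then show "a (- n) ` h \<in> N x y"
        using a_mem[of _ h n] assms a_H Inv_shift_iff by (simp add: N_iff)
    qed
    show "(\<lambda>h. a n ` h) ` N x y \<subseteq> N (a n x) (a n y)"
    proof (rule image_subsetI)
      fix h assume "h \<in> N x y"
      then show "a n ` h \<in> N (a n x) (a n y)"
        using a_mem_shift[of _ h n n] assms a_H a_zero Inv_shift_iff by (simp add: N_iff)
    qed
  qed (auto simp: N_iff shift_unshift)
qed

text \<open>Along an orbit in \<open>M\<close> each counted wall is crossed at most once, so the
  sets for consecutive steps are disjoint and add up, and each step contributes equally by
  invariance.\<close>

lemma card_N_orbit:
  assumes x: "x \<in> M" and ik: "i \<le> k"
  shows "card (N (a i x) (a k x)) = nat (k - i) * card (N x (a 1 x))"
  using ik
proof (induction k rule: int_ge_induct)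
  case base
  then show ?case by simp
next
  case (step k)
  have xV: "x \<in> V" using x M_in by blast
  have split: "N (a i x) (a (k + 1) x) = N (a i x) (a k x) \<union> N (a k x) (a (k + 1) x)"
  proof (intro equalityI subsetI)
    fix h assume "h \<in> N (a i x) (a (k + 1) x)"
    then show "h \<in> N (a i x) (a k x) \<union> N (a k x) (a (k + 1) x)" by (auto simp: N_iff)
  next
    fix h assume h: "h \<in> N (a i x) (a k x) \<union> N (a k x) (a (k + 1) x)"
    then have "monotone_at x h" using x by (auto simp: M_def N_iff)
    moreover have "\<not> (\<forall>n. a n x \<in> h \<longrightarrow> a (n + 1) x \<in> h)"
    proof
      assume up: "\<forall>n. a n x \<in> h \<longrightarrow> a (n + 1) x \<in> h"
      have "a i x \<in> h \<Longrightarrow> a k x \<in> h"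
        using int_step_mono[of "\<lambda>n. a n x \<in> h" i k] up step.hyps by blast
      then show False using h up by (auto simp: N_iff)
    qed
    ultimately have dn: "\<And>n. a (n + 1) x \<in> h \<Longrightarrow> a n x \<in> h" by (auto simp: monotone_at_def)
    have "a k x \<in> h \<Longrightarrow> a i x \<in> h"
      using int_step_antimono[of "\<lambda>n. a n x \<in> h" k i] dn step.hyps by blast
    then show "h \<in> N (a i x) (a (k + 1) x)" using h dn[of k] by (auto simp: N_iff)
  qed
  have "card (N (a k x) (a (k + 1) x)) = card (N x (a 1 x))"
    using N_shift[OF xV a_in[OF xV, of 1], of k] a_add[OF xV, of k 1] by simp
  moreover have "N (a i x) (a k x) \<inter> N (a k x) (a (k + 1) x) = {}" by (auto simp: N_iff)
  ultimately have "card (N (a i x) (a (k + 1) x)) = card (N (a i x) (a k x)) + card (N x (a 1 x))"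
    unfolding split using card_Un_disjoint[OF N_finite N_finite] a_in[OF xV] by simp
  moreover have "nat (k + 1 - i) = Suc (nat (k - i))" using step.hyps by simp
  ultimately show ?case using step.IH by simp
qed

text \<open>Leaving a counted halfspace and entering it again would make the counts for two
  consecutive stretches add up to more than the count for their union.\<close>

lemma M_if_geodesic:
  assumes x: "x \<in> V" and eq: "\<And>i k. i \<le> k \<Longrightarrow> card (N (a i x) (a k x)) = nat (k - i) * L"
  shows "x \<in> M"
proof -
  have no: "\<not> (a i x \<in> h \<and> a j x \<notin> h \<and> a k x \<in> h)" if "i \<le> j" "j \<le> k" "h \<in> H - Inv" for i j k h
  proof
    assume h: "a i x \<in> h \<and> a j x \<notin> h \<and> a k x \<in> h"
    have hN: "h \<in> N (a i x) (a j x)" using h that by (auto simp: N_iff)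
    have fin: "finite (N (a i x) (a j x))" "finite (N (a j x) (a k x))"
      using N_finite a_in x by auto
    have "N (a i x) (a k x) \<subseteq> (N (a i x) (a j x) - {h}) \<union> N (a j x) (a k x)"
      using h by (auto simp: N_iff)
    then have "card (N (a i x) (a k x)) \<le> card ((N (a i x) (a j x) - {h}) \<union> N (a j x) (a k x))"
      using fin by (intro card_mono) auto
    also have "\<dots> \<le> card (N (a i x) (a j x) - {h}) + card (N (a j x) (a k x))"
      by (rule card_Un_le)
    also have "\<dots> < card (N (a i x) (a j x)) + card (N (a j x) (a k x))"
      using card_Diff1_less[OF fin(1) hN] by simp
    also have "\<dots> = (nat (j - i) + nat (k - j)) * L"
      using eq[OF that(1)] eq[OF that(2)] by (simp add: algebra_simps)
    also have "nat (j - i) + nat (k - j) = nat (k - i)" using that by simp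
    finally show False using eq[of i k] that by simp
  qed
  have "monotone_at x h" if h: "h \<in> H - Inv" for h
  proof (rule ccontr)
    assume "\<not> monotone_at x h"
    then obtain n m where n: "a n x \<in> h" "a (n + 1) x \<notin> h" and m: "a (m + 1) x \<in> h" "a m x \<notin> h"
      unfolding monotone_at_def by blast
    have h': "V - h \<in> H - Inv" using h H_compl Inv_compl[of "V - h"] H_compl_compl by auto
    have "n \<noteq> m" using n m by auto
    then consider "n \<le> m" | "m \<le> n" by linarith
    then show False
    proof cases
      case 1
      then show ?thesis using no[of n m "m + 1" h] n m h by simp
    next
      case 2
      then show ?thesis using no[of m n "n + 1" "V - h"] n m h' a_in[OF x] by simp
    qed
  qed
  then show ?thesis using x unfolding M_def by blast
qed

text \<open>Compare orbits over a long time: going from \<open>x\<close> along the orbit of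
  \<open>y\<close> costs at most \<open>n * m\<close> plus a constant \<open>2 * D\<close>, while
  the orbit of \<open>x\<close> needs \<open>n * l\<close>. A smaller step at \<open>y\<close> would
  win eventually.\<close>

lemma translation_min:
  assumes x: "x \<in> M" and y: "y \<in> V"
  shows "card (N x (a 1 x)) \<le> card (N y (a 1 y))"
proof (rule ccontr)
  define l m D where "l = card (N x (a 1 x))" and "m = card (N y (a 1 y))" and "D = card (N x y)"
  assume "\<not> ?thesis"
  then have lm: "m < l" by (simp add: l_def m_def)
  have xV: "x \<in> V" using x M_in by blast
  have ny: "card (N y (a (int n) y)) \<le> n * m" for n
  proof (induction n)
    case 0
    then show ?case using y a_zero by simp
  next
    case (Suc n)
    have e: "int (Suc n) = int n + 1" by simp
    have "card (N (a (int n) y) (a (int n + 1) y)) = m"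
      unfolding m_def
      using N_shift[OF y a_in[OF y, of 1], of "int n"] a_add[OF y, of "int n" 1] by simp
    moreover have "card (N y (a (int n + 1) y)) \<le> card (N y (a (int n) y)) + card (N (a (int n) y) (a (int n + 1) y))"
      using y a_in N_triangle by blast
    ultimately show ?case using Suc unfolding e by simp
  qed
  \<comment> \<open>The least number of steps exceeding the constant error
    \<open>2 * D\<close>.\<close>
  define n where "n = 2 * D + 1"
  have "n * l = card (N x (a (int n) x))"
    using card_N_orbit[OF x, of 0 "int n"] a_zero xV by (simp add: l_def)
  also have "\<dots> \<le> card (N x y) + card (N y (a (int n) x))"
    using xV y a_in N_triangle by blast
  also have "card (N y (a (int n) x)) \<le> card (N y (a (int n) y)) + card (N (a (int n) y) (a (int n) x))"
    using xV y a_in N_triangle by blast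
  also have "card (N (a (int n) y) (a (int n) x)) = D"
    using N_shift[OF y xV] N_sym[OF xV y] by (simp add: D_def)
  finally have "n * l \<le> 2 * D + n * m" using ny[of n] by (simp add: D_def)
  moreover have "n * (m + 1) \<le> n * l" using lm by (intro mult_le_mono2) simp
  ultimately have "n * (m + 1) \<le> 2 * D + n * m" by linarith
  then show False by (simp add: n_def)
qed

lemma Skew_crossing:
  assumes x: "x \<in> V" and h: "h \<in> Skew"
  obtains n where "a n ` h \<in> D x (a 1 x) \<or> a n ` (V - h) \<in> D x (a 1 x)"
proof -
  have hH: "h \<in> H" using h classes_sub by blast
  have *: "\<exists>n. a n ` (V - k) \<in> D x (a 1 x)" if k: "pos k" for k
  proof -
    have kH: "k \<in> H" using k by (simp add: pos_def)
    obtain n where n: "a n x \<notin> k" "a (n + 1) x \<in> k" using pos_crossing[OF x k] .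
    have "a (- n) ` (V - k) \<in> D x (a 1 x)"
      using n a_mem[OF x kH, of n] a_mem_shift[OF x kH, of 1 "- n"] a_H[OF H_compl[OF kH]] x
      by (simp add: D_iff shift_compl[OF kH] add.commute)
    then show ?thesis by blast
  qed
  have "pos h \<or> pos (V - h)" using h by (simp add: Skew_def)
  then show ?thesis
    using *[of h] *[of "V - h"] H_compl_compl[OF hH] that by auto
qed

lemma N_Skew: assumes "x \<in> M" shows "N x (a n x) \<subseteq> Skew"
proof
  fix h assume "h \<in> N x (a n x)"
  then show "h \<in> Skew"
    using Triv_constant[OF assms, of h n] H_cases[of h] by (auto simp: N_iff)
qed

lemma translation_pos_iff: assumes "x \<in> M" shows "0 < card (N x (a 1 x)) \<longleftrightarrow> Skew \<noteq> {}"
proof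
  assume "0 < card (N x (a 1 x))"
  then have "N x (a 1 x) \<noteq> {}" by force
  then show "Skew \<noteq> {}" using N_Skew[OF assms, of 1] by blast
next
  have xV: "x \<in> V" using assms M_in by blast
  assume "Skew \<noteq> {}"
  then obtain h where h: "h \<in> Skew" by blast
  obtain n where "a n ` h \<in> D x (a 1 x) \<or> a n ` (V - h) \<in> D x (a 1 x)"
    using Skew_crossing[OF xV h] .
  moreover have "a n ` h \<in> Skew" "a n ` (V - h) \<in> Skew"
    using h Skew_shift Skew_compl by auto
  ultimately obtain k where "k \<in> D x (a 1 x)" "k \<in> Skew" by blast
  then have "k \<in> N x (a 1 x)"
    using Skew_Inv by (auto simp: N_iff D_iff)
  then show "0 < card (N x (a 1 x))"
    using N_finite[OF xV a_in[OF xV]] card_gt_0_iff by blast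
qed

text \<open>Orbits in \<open>M\<close> cross only \<open>Skew\<close> and \<open>Inv\<close> walls.
  Without \<open>Skew\<close> the displacement there is at most \<open>card Inv\<close>, and other
  orbits stay at constant distance; with \<open>Skew\<close> the counted displacement grows
  linearly.\<close>

lemma bounded_orbits_iff:
  "(\<forall>x\<in>V. \<exists>B. \<forall>n. card (D x (a n x)) \<le> B) \<longleftrightarrow> Skew = {}"
proof
  assume bd: "\<forall>x\<in>V. \<exists>B. \<forall>n. card (D x (a n x)) \<le> B"
  obtain x where x: "x \<in> M" using M_nonempty by blast
  then have xV: "x \<in> V" by (rule M_in)
  obtain B where B: "\<And>n. card (D x (a n x)) \<le> B" using bd xV by blast
  show "Skew = {}"
  proof (rule ccontr)
    assume "Skew \<noteq> {}"
    then have l: "0 < card (N x (a 1 x))" using translation_pos_iff[OF x] by blast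
    have "card (N x (a (int (Suc B)) x)) = Suc B * card (N x (a 1 x))"
      using card_N_orbit[OF x, of 0 "int (Suc B)"] a_zero[OF xV] by (simp del: of_nat_Suc)
    moreover have "card (N x (a (int (Suc B)) x)) \<le> B"
      using B card_N_le[OF xV a_in[OF xV]] le_trans by blast
    ultimately have "Suc B * card (N x (a 1 x)) \<le> B" by metis
    moreover have "Suc B * 1 \<le> Suc B * card (N x (a 1 x))" using l by (intro mult_le_mono2) simp
    ultimately show False by (metis Suc_n_not_le_n le_trans nat_mult_1_right)
  qed
next
  assume S: "Skew = {}"
  obtain x where x: "x \<in> M" using M_nonempty by blast
  then have xV: "x \<in> V" by (rule M_in)
  show "\<forall>y\<in>V. \<exists>B. \<forall>n. card (D y (a n y)) \<le> B"
  proof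
    fix y assume y: "y \<in> V"
    have "card (D y (a n y)) \<le> card (D y x) + card Inv + card (D x y)" for n
    proof -
      have "N x (a n x) = {}" using N_Skew[OF x] S by blast
      then have "card (D x (a n x)) \<le> card Inv" using card_D_le[OF xV a_in[OF xV, of n]] by simp
      moreover have "card (D y (a n y)) \<le> card (D y x) + card (D x (a n y))"
        "card (D x (a n y)) \<le> card (D x (a n x)) + card (D (a n x) (a n y))"
        using D_triangle xV y a_in by blast+
      moreover have "card (D (a n x) (a n y)) = card (D x y)" using D_shift[OF xV y] .
      ultimately show ?thesis by linarith
    qed
    then show "\<exists>B. \<forall>n. card (D y (a n y)) \<le> B" by blast
  qed
qed

text \<open>Replacing \<open>D\<close> by \<open>N\<close> costs at most \<open>card Inv\<close>,
  and moving the base point from \<open>x\<close> to \<open>y\<close> at most twice their distance.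
  On \<open>M\<close> the count is exactly linear, so the quotient by \<open>n\<close>
  converges.\<close>

lemma stable_length:
  assumes x: "x \<in> M" and y: "y \<in> V"
  shows "(\<lambda>n. real (card (D y (a (int n) y))) / real n) \<longlonglongrightarrow> real (card (N x (a 1 x)))"
proof -
  define l C where "l = card (N x (a 1 x))" and "C = card Inv + 2 * card (D x y)"
  have xV: "x \<in> V" using x by (rule M_in)
  have bd: "\<bar>real (card (D y (a (int n) y))) - real n * real l\<bar> \<le> real C" for n
  proof -
    have N: "card (N x (a (int n) x)) = n * l"
      using card_N_orbit[OF x, of 0 "int n"] a_zero xV by (simp add: l_def)
    have D1: "n * l \<le> card (D x (a (int n) x))" "card (D x (a (int n) x)) \<le> n * l + card Inv"
      using card_N_le[OF xV a_in[OF xV, of "int n"]] card_D_le[OF xV a_in[OF xV, of "int n"]] N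
      by auto
    have "card (D y (a (int n) y)) \<le> card (D y x) + card (D x (a (int n) y))"
      "card (D x (a (int n) y)) \<le> card (D x (a (int n) x)) + card (D (a (int n) x) (a (int n) y))"
      "card (D x (a (int n) x)) \<le> card (D x y) + card (D y (a (int n) x))"
      "card (D y (a (int n) x)) \<le> card (D y (a (int n) y)) + card (D (a (int n) y) (a (int n) x))"
      using D_triangle xV y a_in by blast+
    moreover have "card (D (a (int n) x) (a (int n) y)) = card (D x y)"
      "card (D (a (int n) y) (a (int n) x)) = card (D x y)" "card (D y x) = card (D x y)"
      using D_shift[OF xV y] D_shift[OF y xV] D_sym[OF xV y] by auto
    ultimately have "card (D y (a (int n) y)) \<le> n * l + C" "n * l \<le> card (D y (a (int n) y)) + C"
      using D1 by (auto simp: C_def)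
    then have "real (card (D y (a (int n) y))) \<le> real n * real l + real C"
      "real n * real l \<le> real (card (D y (a (int n) y))) + real C"
      by (metis of_nat_add of_nat_le_iff of_nat_mult)+
    then show ?thesis by (simp add: abs_le_iff)
  qed
  have "(\<lambda>n. real (card (D y (a (int n) y))) / real n - real l) \<longlonglongrightarrow> 0"
  proof (rule tendsto_0_le[where K = 1])
    show "\<forall>\<^sub>F n in sequentially. norm (real (card (D y (a (int n) y))) / real n - real l) \<le> norm (real C / real n) * 1"
    proof (rule eventually_sequentiallyI[of 1])
      fix n :: nat assume n: "1 \<le> n"
      have "real (card (D y (a (int n) y))) / real n - real l = (real (card (D y (a (int n) y))) - real n * real l) / real n"
        using n by (simp add: field_simps)
      then show "norm (real (card (D y (a (int n) y))) / real n - real l) \<le> norm (real C / real n) * 1"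
        using bd[of n] n by (simp add: divide_right_mono)
    qed
    show "(\<lambda>n. real C / real n) \<longlonglongrightarrow> 0" by (rule lim_const_over_n)
  qed
  then show ?thesis unfolding l_def[symmetric] by (simp add: LIM_zero_iff)
qed

lemma flip_Inv:
  assumes x: "x \<in> M" and S: "S \<subseteq> {h \<in> Inv. x \<in> h}"
  obtains v where "v \<in> M" "D x v = S" "\<And>h. h \<in> H - Inv \<Longrightarrow> v \<in> h \<longleftrightarrow> x \<in> h"
proof -
  have xV: "x \<in> V" using x by (rule M_in)
  define \<rho> where "\<rho> = {h \<in> Inv. (x \<in> h \<and> h \<notin> S) \<or> (x \<notin> h \<and> V - h \<in> S)}"
  have compl: "V - h \<in> \<rho> \<longleftrightarrow> h \<notin> \<rho>" if h: "h \<in> Inv" for h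
  proof -
    have hH: "h \<in> H" using h classes_sub by blast
    show ?thesis
      using h Inv_compl[OF h] H_compl_compl[OF hH] xV S unfolding \<rho>_def by auto
  qed
  obtain v where v: "v \<in> M" "\<And>h. h \<in> Triv \<Longrightarrow> v \<in> h \<longleftrightarrow> x \<in> h" "\<And>h. h \<in> Skew \<Longrightarrow> v \<in> h \<longleftrightarrow> x \<in> h"
    "\<And>h. h \<in> Inv \<Longrightarrow> v \<in> h \<longleftrightarrow> h \<in> \<rho>"
  proof (rule combine[OF x x, of \<rho>])
    show "\<rho> \<subseteq> Inv" by (auto simp: \<rho>_def)
  qed (use compl that in blast)+
  have agree: "v \<in> h \<longleftrightarrow> x \<in> h" if "h \<in> H - Inv" for h
    using H_cases[of h] v that by blast
  have "h \<in> D x v \<longleftrightarrow> h \<in> S" for h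
  proof (cases "h \<in> Inv")
    case True
    then show ?thesis
      using v(4)[OF True] S classes_sub(1) by (auto simp: D_iff \<rho>_def)
  next
    case False
    then show ?thesis using agree[of h] S by (auto simp: D_iff)
  qed
  then have "D x v = S" by blast
  then show ?thesis using that v(1) agree by blast
qed

subsection \<open>Axes\<close>

text \<open>A geodesic expressed by halfspaces alone, obtained by iterating
  \<open>D_neighbour\<close>. The last clause keeps it in the interval between its ends, which later
  transfers properties of the ends to the whole path.\<close>

lemma geodesic_between:
  assumes "x \<in> V" "y \<in> V"
  obtains c :: "nat \<Rightarrow> 'a" where "c 0 = x" "c (card (D x y)) = y" "\<And>i. i \<le> card (D x y) \<Longrightarrow> c i \<in> V"
    "\<And>i. i < card (D x y) \<Longrightarrow> card (D (c i) (c (Suc i))) = 1"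
    "\<And>i. i < card (D x y) \<Longrightarrow> D (c i) (c (Suc i)) \<subseteq> D x y"
    "\<And>i h. i \<le> card (D x y) \<Longrightarrow> h \<in> H \<Longrightarrow> x \<in> h \<Longrightarrow> y \<in> h \<Longrightarrow> c i \<in> h"
proof -
  define P where "P n x c \<longleftrightarrow> c 0 = x \<and> c n = y \<and> (\<forall>i\<le>n. c i \<in> V) \<and>
    (\<forall>i<n. card (D (c i) (c (Suc i))) = 1 \<and> D (c i) (c (Suc i)) \<subseteq> D x y) \<and>
    (\<forall>i\<le>n. \<forall>h\<in>H. x \<in> h \<longrightarrow> y \<in> h \<longrightarrow> c i \<in> h)" for n x and c :: "nat \<Rightarrow> 'a"
  have "\<exists>c. P (card (D x y)) x c"
    using assms(1)
  proof (induction "card (D x y)" arbitrary: x)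
    case 0
    then have "D x y = {}" using D_finite assms(2) by simp
    then have "x = y" using vertex_eqI[OF 0(2) assms(2)] by (auto simp: D_def)
    then show ?case using 0 by (intro exI[of _ "\<lambda>_. x"]) (auto simp: P_def)
  next
    case (Suc n)
    then have "D x y \<noteq> {}" by force
    then obtain z h where z: "z \<in> V" "h \<in> D x y" "D x z = {h}" "D z y = D x y - {h}"
      using D_neighbour[OF Suc.prems assms(2)] by metis
    have n: "n = card (D z y)"
      using Suc.hyps(2) z D_finite[OF Suc.prems assms(2)] by simp
    obtain c where "P n z c"
      using Suc.hyps(1)[OF n z(1)] unfolding n[symmetric] ..
    then have c: "c 0 = z" "c n = y" "\<And>i. i \<le> n \<Longrightarrow> c i \<in> V"
      "\<And>i. i < n \<Longrightarrow> card (D (c i) (c (Suc i))) = 1 \<and> D (c i) (c (Suc i)) \<subseteq> D z y"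
      "\<And>i h. i \<le> n \<Longrightarrow> h \<in> H \<Longrightarrow> z \<in> h \<Longrightarrow> y \<in> h \<Longrightarrow> c i \<in> h"
      by (simp_all add: P_def)
    have zin: "z \<in> k" if "k \<in> H" "x \<in> k" "y \<in> k" for k
    proof (rule ccontr)
      assume "z \<notin> k"
      then have "k \<in> D x z" using that by (simp add: D_iff)
      then show False using z that by (auto simp: D_iff)
    qed
    define c' where "c' i = (if i = 0 then x else c (i - 1))" for i
    have c'_Suc: "c' (Suc i) = c i" for i by (simp add: c'_def)
    have "c' i \<in> V" if "i \<le> Suc n" for i
      using c(3)[of "i - 1"] Suc.prems that by (auto simp: c'_def)
    moreover have "card (D (c' i) (c' (Suc i))) = 1 \<and> D (c' i) (c' (Suc i)) \<subseteq> D x y"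
      if "i < Suc n" for i
    proof (cases i)
      case 0
      then show ?thesis using z c(1) by (simp add: c'_def)
    next
      case (Suc j)
      then show ?thesis using c(4)[of j] that z by (auto simp: c'_Suc)
    qed
    moreover have "c' i \<in> k" if "i \<le> Suc n" "k \<in> H" "x \<in> k" "y \<in> k" for i k
      using c(5)[of "i - 1" k] zin[of k] that by (auto simp: c'_def)
    ultimately show ?case
      unfolding Suc.hyps(2)[symmetric] P_def
      using c(2) c'_Suc by (intro exI[of _ c']) (simp add: c'_def)
  qed
  then obtain c where "P (card (D x y)) x c" ..
  then show ?thesis by (intro that[of c]) (simp_all add: P_def)
qed

lemma M_shift: assumes "y \<in> M" shows "a n y \<in> M"
proof -
  have yV: "y \<in> V" using assms by (rule M_in)
  have "monotone_at (a n y) h" if h: "h \<in> H - Inv" for h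
  proof -
    have "a m (a n y) = a (m + n) y" "a (m + 1) (a n y) = a ((m + n) + 1) y" for m
      using a_add[OF yV, of m n] a_add[OF yV, of "m + 1" n] by (simp_all add: algebra_simps)
    moreover have "monotone_at y h" using assms h by (simp add: M_def)
    ultimately show ?thesis unfolding monotone_at_def by auto
  qed
  then show ?thesis using a_in[OF yV] by (simp add: M_def)
qed

lemma agree_on_neither:
  assumes "x \<in> V" "x' \<in> V" "y \<in> V" "\<And>h. h \<in> H - Inv \<Longrightarrow> x \<in> h \<longleftrightarrow> x' \<in> h"
  shows "N x y = N x' y" "N y x = N y x'"
  using assms by (auto simp: N_def)

text \<open>Translates of a path from \<open>x\<close> to \<open>a 1 x\<close> would cross
  \<open>Inv\<close> walls again and again. The path is therefore led to a vertex \<open>q\<close>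
  that looks like \<open>a 1 x\<close> outside \<open>Inv\<close> and like \<open>x\<close> on
  \<open>Inv\<close>. Its translates fit together up to \<open>Inv\<close>, which is enough for
  \<open>N\<close>.\<close>

lemma axis_exists:
  assumes x: "x \<in> M" and l: "0 < card (N x (a 1 x))"
  obtains c :: "int \<Rightarrow> 'a"
    where "c 0 = x" "\<And>i. c i \<in> M" "\<And>i. c (i + int (card (N x (a 1 x)))) = a 1 (c i)"
    "\<And>i. card (N (c i) (c (i + 1))) = 1" "\<And>i j. int (card (N (c i) (c j))) = \<bar>i - j\<bar>"
    "\<And>i h. h \<in> Triv \<Longrightarrow> c i \<in> h \<longleftrightarrow> x \<in> h"
proof -
  define l where "l = card (N x (a 1 x))"
  have xV: "x \<in> V" using x by (rule M_in)
  have ax: "a 1 x \<in> M" using M_shift[OF x] .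
  \<comment> \<open>With this end point the ordinary distance from \<open>x\<close> equals the
    counted one, so that an ordinary geodesic to \<open>q\<close> has exactly \<open>l\<close> edges
    and crosses no \<open>Inv\<close> wall.\<close>
  obtain q where q: "q \<in> M" "\<And>h. h \<in> Triv \<Longrightarrow> q \<in> h \<longleftrightarrow> x \<in> h" "\<And>h. h \<in> Skew \<Longrightarrow> q \<in> h \<longleftrightarrow> a 1 x \<in> h"
    "\<And>h. h \<in> Inv \<Longrightarrow> q \<in> h \<longleftrightarrow> x \<in> h"
  proof (rule combine[OF x ax, of "{h \<in> Inv. x \<in> h}"])
    show "V - h \<in> {h \<in> Inv. x \<in> h} \<longleftrightarrow> h \<notin> {h \<in> Inv. x \<in> h}" if "h \<in> Inv" for h
      using Inv_compl[OF that] that xV by auto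
  next
    fix v assume "v \<in> M" "\<And>h. h \<in> Triv \<Longrightarrow> (v \<in> h) = (x \<in> h)" "\<And>h. h \<in> Skew \<Longrightarrow> (v \<in> h) = (a 1 x \<in> h)"
      "\<And>h. h \<in> Inv \<Longrightarrow> (v \<in> h) = (h \<in> {h \<in> Inv. x \<in> h})"
    then show thesis using that by simp
  qed auto
  have qV: "q \<in> V" using q(1) by (rule M_in)
  have q_ax: "q \<in> h \<longleftrightarrow> a 1 x \<in> h" if "h \<in> H - Inv" for h
    using H_cases[of h] q(2,3)[of h] Triv_constant[OF x, of h 1] that by auto
  have Dxq: "D x q = N x (a 1 x)"
  proof -
    have "h \<in> D x q \<longleftrightarrow> h \<in> N x (a 1 x)" if "h \<in> H" for h
      using q_ax[of h] q(4)[of h] that by (cases "h \<in> Inv") (auto simp: D_iff N_iff)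
    then have "h \<in> D x q \<longleftrightarrow> h \<in> N x (a 1 x)" for h using D_iff N_iff by metis
    then show ?thesis by blast
  qed
  have DxqS: "D x q \<subseteq> Skew" using Dxq N_Skew[OF x] by simp
  have cardD: "card (D x q) = l" using Dxq by (simp add: l_def)
  obtain b :: "nat \<Rightarrow> 'a" where b: "b 0 = x" "b l = q" "\<And>i. i \<le> l \<Longrightarrow> b i \<in> V"
    "\<And>i. i < l \<Longrightarrow> card (D (b i) (b (Suc i))) = 1" "\<And>i. i < l \<Longrightarrow> D (b i) (b (Suc i)) \<subseteq> D x q"
    "\<And>i h. i \<le> l \<Longrightarrow> h \<in> H \<Longrightarrow> x \<in> h \<Longrightarrow> q \<in> h \<Longrightarrow> b i \<in> h"
    using geodesic_between[OF xV qV] unfolding cardD by metis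
  have b_agree: "b i \<in> h \<longleftrightarrow> x \<in> h" if "i \<le> l" "h \<in> H" "h \<notin> Skew" for i h
  proof -
    have "q \<in> h \<longleftrightarrow> x \<in> h" using H_cases[OF that(2)] that(3) q by blast
    then show ?thesis
      using b(6)[OF that(1,2)] b(6)[OF that(1) H_compl[OF that(2)]] xV qV b(3)[OF that(1)] by blast
  qed
  have b_between: "x \<in> h \<or> q \<in> h" if "i \<le> l" "h \<in> H" "b i \<in> h" for i h
    using b(6)[OF that(1) H_compl[OF that(2)]] xV qV that(3) by blast
  \<comment> \<open>The point \<open>b i\<close> lies between \<open>x\<close> and \<open>q\<close>.
    If it is in \<open>k\<close>, one of these is, hence \<open>a 1 x\<close> and then
    \<open>a 2 x\<close> are in \<open>k\<close>; so both \<open>x\<close> and \<open>q\<close> lie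
    in the translate of \<open>k\<close> by -1, and by betweenness so does
    \<open>b i\<close>.\<close>
  have b_step: "b i \<in> k \<Longrightarrow> a 1 (b i) \<in> k" if k: "pos k" and i: "i \<le> l" for i k
  proof -
    assume bk: "b i \<in> k"
    have kH: "k \<in> H" "k \<in> Skew" using k by (auto simp: pos_def Skew_def)
    have qa: "q \<in> h \<longleftrightarrow> a 1 x \<in> h" if "h \<in> Skew" for h using q(3)[OF that] .
    have "a 0 x \<in> k \<or> a 1 x \<in> k" using b_between[OF i kH(1) bk] qa[OF kH(2)] a_zero[OF xV] by simp
    then have ax: "a 1 x \<in> k" using pos_step[OF x k, of 0 1] by auto
    then have "a 2 x \<in> k" using pos_step[OF x k, of 1 2] by simp
    then have "a 1 x \<in> a (- 1) ` k" using a_mem_shift[OF xV kH(1), of 1 "- 1"] by simp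
    then have "q \<in> a (- 1) ` k" using qa[OF Skew_shift[OF kH(2), of "- 1"]] by simp
    moreover have "x \<in> a (- 1) ` k" using a_mem[OF xV kH(1), of 1] ax by simp
    ultimately have "b i \<in> a (- 1) ` k" using b(6)[OF i a_H[OF kH(1)]] by blast
    then show "a 1 (b i) \<in> k" using a_mem[OF b(3)[OF i] kH(1), of 1] by simp
  qed
  have bM: "b i \<in> M" if i: "i \<le> l" for i
  proof -
    have biV: "b i \<in> V" using b(3)[OF i] .
    have posm: "a n (b i) \<in> k \<Longrightarrow> a (n + 1) (b i) \<in> k" if k: "pos k" for k n
    proof -
      have kH: "k \<in> H" using k by (simp add: pos_def)
      assume "a n (b i) \<in> k"
      then have "b i \<in> a (- n) ` k" using a_mem[OF biV kH] by simp
      then have "a 1 (b i) \<in> a (- n) ` k" using b_step[OF pos_shift[OF k] i] by blast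
      then show ?thesis using a_mem_shift[OF biV kH, of 1 "- n"] by (simp add: add.commute)
    qed
    have "monotone_at (b i) h" if h: "h \<in> H - Inv" for h
    proof -
      consider "h \<in> Triv" | "pos h" | "pos (V - h)" using H_cases[of h] h by (auto simp: Skew_def)
      then show ?thesis
      proof cases
        case 1
        have "a n (b i) \<in> h \<longleftrightarrow> x \<in> h" for n
        proof -
          have T: "a (- n) ` h \<in> Triv" using Triv_shift[OF 1] .
          have "a n (b i) \<in> h \<longleftrightarrow> b i \<in> a (- n) ` h" using a_mem[OF biV, of h n] h by simp
          also have "\<dots> \<longleftrightarrow> x \<in> a (- n) ` h"
            using b_agree[OF i, of "a (- n) ` h"] T classes_sub(3) by (auto simp: Triv_def)
          also have "\<dots> \<longleftrightarrow> a n x \<in> h" using a_mem[OF xV, of h n] h by simp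
          finally show ?thesis using Triv_constant[OF x 1] by simp
        qed
        then show ?thesis by (simp add: monotone_at_def)
      next
        case 2
        then show ?thesis using posm unfolding monotone_at_def by blast
      next
        case 3
        then have "monotone_at (b i) (V - h)" using posm unfolding monotone_at_def by blast
        then show ?thesis using monotone_at_compl[OF biV, of h] h by simp
      qed
    qed
    then show ?thesis using biV by (simp add: M_def)
  qed
  have l0: "0 < int l" using l by (simp add: l_def)
  \<comment> \<open>The path \<open>b\<close> is repeated along the orbit;
    \<open>i div int l\<close> selects the translate and the remainder the position in it. At
    multiples of \<open>l\<close> the value is an orbit point of \<open>x\<close>.\<close>
  define c where "c i = a (i div int l) (b (nat (i mod int l)))" for i
  have r: "nat (i mod int l) < l" for i using l0 by (simp add: nat_less_iff)
  have cM: "c i \<in> M" for i using M_shift bM r unfolding c_def by (meson less_imp_le)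
  then have cV: "c i \<in> V" for i using M_in by blast
  have c0: "c 0 = x" using b(1) a_zero[OF xV] by (simp add: c_def)
  have c_shift: "c (i + int l) = a 1 (c i)" for i
    using l0 a_add[OF b(3)[of "nat (i mod int l)"], of 1 "i div int l"] r[of i] unfolding c_def
    by (simp add: add.commute)
  have c_step: "card (N (c i) (c (i + 1))) = 1" for i
  proof -
    define e where "e = i div int l"
    define m where "m = nat (i mod int l)"
    have m: "m < l" "int m = i mod int l" using r l0 by (auto simp: m_def)
    have N1: "card (N (b m) (b (Suc m))) = 1"
    proof -
      have "D (b m) (b (Suc m)) \<inter> Inv = {}" using b(5)[OF m(1)] DxqS Skew_Inv by blast
      then have "N (b m) (b (Suc m)) = D (b m) (b (Suc m))" by (auto simp: N_def D_def)
      then show ?thesis using b(4)[OF m(1)] by simp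
    qed
    have bV: "b m \<in> V" "b (Suc m) \<in> V" using b(3) m by auto
    have i: "i = e * int l + int m" using m by (simp add: e_def)
    show ?thesis
    proof (cases "Suc m < l")
      case True
      have "(i + 1) div int l = e" "(i + 1) mod int l = int m + 1"
        by (rule int_div_pos_eq[where r = "int m + 1"] int_mod_pos_eq[where q = e],
            use i True in \<open>simp_all add: algebra_simps\<close>)+
      then have "c (i + 1) = a e (b (Suc m))" by (simp add: c_def nat_add_distrib)
      moreover have "c i = a e (b m)" by (simp add: c_def e_def m_def)
      ultimately show ?thesis using N_shift[OF bV] N1 by simp
    next
      case False
      then have Sm: "Suc m = l" using m by simp
      have i1: "i + 1 = (e + 1) * int l" unfolding i using Sm by (simp add: algebra_simps)
      have "c (i + 1) = a (e + 1) x" unfolding i1 c_def using l0 b(1) by simp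
      then have "c (i + 1) = a e (a 1 x)" using a_add[OF xV] by simp
      moreover have "c i = a e (b m)" by (simp add: c_def e_def m_def)
      moreover have "N (b m) (a 1 x) = N (b m) q"
        using agree_on_neither(2)[OF a_in[OF xV, of 1] qV bV(1)] q_ax by blast
      ultimately show ?thesis
        using N_shift[OF bV(1) a_in[OF xV, of 1], of e] N1 b(2) Sm by simp
    qed
  qed
  have c_le: "int (card (N (c i) (c j))) \<le> j - i" if "i \<le> j" for i j
    using that
  proof (induction j rule: int_ge_induct)
    case (step j)
    have "card (N (c i) (c (j + 1))) \<le> card (N (c i) (c j)) + card (N (c j) (c (j + 1)))"
      using N_triangle cV by blast
    then show ?case using step c_step[of j] by simp
  qed simp
  \<comment> \<open>Both indices are placed between \<open>- n * l\<close> and \<open>n * l\<close>,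
    where \<open>c\<close> meets the orbit of \<open>x\<close> and the count is known exactly.
    Subadditivity bounds each of the three stretches by its length, so all bounds are
    equalities.\<close>
  have c_eq: "int (card (N (c i) (c j))) = j - i" if ij: "i \<le> j" for i j
  proof -
    define n where "n = \<bar>i\<bar> + \<bar>j\<bar>"
    have cn: "c (e * int l) = a e x" for e using b(1) l0 by (simp add: c_def)
    have "n * 1 \<le> n * int l" using l0 by (intro mult_left_mono) (auto simp: n_def)
    moreover have "- i \<le> n" "j \<le> n" by (auto simp: n_def)
    moreover have "(- n) * int l = - (n * int l)" by simp
    ultimately have b1: "(- n) * int l \<le> i" "j \<le> n * int l" by linarith+
    have "int (card (N (a (- n) x) (a n x))) = (2 * n) * int l"
      using card_N_orbit[OF x, of "- n" n] by (simp add: l_def n_def)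
    then have "(2 * n) * int l = int (card (N (c ((- n) * int l)) (c (n * int l))))"
      unfolding cn by simp
    also have "\<dots> \<le> int (card (N (c ((- n) * int l)) (c i))) + int (card (N (c i) (c (n * int l))))"
      using N_triangle[OF cV cV cV, of "(- n) * int l" "n * int l" i] by linarith
    also have "int (card (N (c i) (c (n * int l)))) \<le> int (card (N (c i) (c j))) + int (card (N (c j) (c (n * int l))))"
      using N_triangle[OF cV cV cV, of i "n * int l" j] by linarith
    finally have "(2 * n) * int l \<le> (i - (- n) * int l) + (int (card (N (c i) (c j))) + (n * int l - j))"
      using c_le[OF b1(1)] c_le[OF b1(2)] by linarith
    then have "j - i \<le> int (card (N (c i) (c j)))" by (simp add: algebra_simps)
    then show ?thesis using c_le[OF ij] by linarith
  qed
  have c_dist: "int (card (N (c i) (c j))) = \<bar>i - j\<bar>" for i j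
  proof (cases "i \<le> j")
    case True
    then show ?thesis using c_eq by simp
  next
    case False
    then show ?thesis using c_eq[of j i] N_sym[OF cV cV, of i j] by simp
  qed
  have c_Triv: "c i \<in> h \<longleftrightarrow> x \<in> h" if h: "h \<in> Triv" for i h
  proof -
    have m: "nat (i mod int l) \<le> l" using r less_imp_le by blast
    have "c i \<in> h \<longleftrightarrow> b (nat (i mod int l)) \<in> h"
      unfolding c_def using Triv_constant[OF bM[OF m] h] by simp
    also have "\<dots> \<longleftrightarrow> x \<in> h" using b_agree[OF m, of h] h by (auto simp: Triv_def)
    finally show ?thesis .
  qed
  show ?thesis
    using that[of c] c0 cM c_shift c_step c_dist c_Triv unfolding l_def by blast
qed

end

lemma walk_along:
  assumes "\<And>i. \<gamma> i \<in> verts X" "\<And>i. {\<gamma> i, \<gamma> (i + 1)} \<in> edges X" "i \<le> j"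
  shows "walk_from_to X (\<gamma> i) (map \<gamma> [i..j]) (\<gamma> j)"
  using assms(3)
proof (induction j rule: int_ge_induct)
  case base
  show ?case by (simp add: walk_from_to_sing[OF assms(1)])
next
  case (step j)
  have "[i..j + 1] = [i..j] @ [j + 1]" using upto_rec2[of i "j + 1"] step.hyps by simp
  then show ?case
    using walk_from_to_append[OF step.IH walk_from_to_sing[OF assms(1)], of "j + 1"] assms(2)
    by simp
qed

text \<open>The edges of \<open>\<gamma>\<close> bound graph distances from above and
  \<open>\<delta>\<close> bounds them from below, so the graph metric itself need not be
  computed.\<close>

lemma bi_infinite_geodesicI:
  fixes \<delta> :: "'v \<Rightarrow> 'v \<Rightarrow> nat"
  assumes tri: "\<And>x y z. x \<in> verts X \<Longrightarrow> y \<in> verts X \<Longrightarrow> z \<in> verts X \<Longrightarrow> \<delta> x z \<le> \<delta> x y + \<delta> y z"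
    and refl: "\<And>x. x \<in> verts X \<Longrightarrow> \<delta> x x = 0"
    and edge: "\<And>x y. {x, y} \<in> edges X \<Longrightarrow> x \<in> verts X \<Longrightarrow> y \<in> verts X \<Longrightarrow> \<delta> x y \<le> 1"
    and \<gamma>: "\<And>i. \<gamma> i \<in> verts X" "\<And>i. {\<gamma> i, \<gamma> (i + 1)} \<in> edges X"
      "\<And>i j. int (\<delta> (\<gamma> i) (\<gamma> j)) = \<bar>i - j\<bar>"
  shows "bi_infinite_geodesic X \<gamma>"
proof -
  have w: "\<exists>p. walk_from_to X (\<gamma> i) p (\<gamma> j) \<and> int (length p) = \<bar>i - j\<bar> + 1" for i j
  proof (cases "i \<le> j")
    case True
    then show ?thesis
      using walk_along[of \<gamma> X, OF \<gamma>(1,2) True] by (intro exI[of _ "map \<gamma> [i..j]"]) simp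
  next
    case False
    then have "j \<le> i" by simp
    from walk_from_to_rev[OF walk_along[of \<gamma> X, OF \<gamma>(1,2) this]] False show ?thesis
      by (intro exI[of _ "rev (map \<gamma> [j..i])"]) simp
  qed
  have "int (gdist X (\<gamma> i) (\<gamma> j)) = \<bar>i - j\<bar>" for i j
  proof -
    obtain p where p: "walk_from_to X (\<gamma> i) p (\<gamma> j)" "int (length p) = \<bar>i - j\<bar> + 1" using w by blast
    obtain q where q: "walk_from_to X (\<gamma> i) q (\<gamma> j)" "length q = Suc (gdist X (\<gamma> i) (\<gamma> j))"
      using gdist_walk[OF p(1)] by blast
    have "Suc (\<delta> (\<gamma> i) (\<gamma> j)) \<le> length q"
      using walk_length_ge[of X \<delta>, OF tri refl edge q(1)] by simp
    then show ?thesis using gdist_le[OF p(1)] p(2) q(2) \<gamma>(3)[of i j] by linarith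
  qed
  then show ?thesis using \<gamma> by (simp add: bi_infinite_geodesic_def)
qed

section \<open>Median subalgebras and their cubulations\<close>

context halfspaces
begin

lemma \<mu>_eqI:
  assumes "x \<in> V" "y \<in> V" "z \<in> V" "v \<in> V"
    "\<And>h. h \<in> H \<Longrightarrow> v \<in> h \<longleftrightarrow> (x \<in> h \<and> y \<in> h \<or> y \<in> h \<and> z \<in> h \<or> x \<in> h \<and> z \<in> h)"
  shows "\<mu> x y z = v"
  by (rule vertex_eqI) (use assms \<mu>_in \<mu>_iff in auto)

definition submedian :: "'v set \<Rightarrow> bool" where
  "submedian S \<longleftrightarrow> S \<subseteq> V \<and> (\<forall>x\<in>S. \<forall>y\<in>S. \<forall>z\<in>S. \<mu> x y z \<in> S)"

lemma submedian_algebra: assumes "submedian S" shows "median_algebra S \<mu>"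
proof -
  have S: "x \<in> V" if "x \<in> S" for x using assms that by (auto simp: submedian_def)
  have 1: "\<mu> x y y = y" if "x \<in> S" "y \<in> S" for x y
    by (rule \<mu>_eqI) (use that S in auto)
  have 2: "\<mu> x y z = \<mu> z x y" "\<mu> x y z = \<mu> x z y" if "x \<in> S" "y \<in> S" "z \<in> S" for x y z
    by (rule \<mu>_eqI; use that S in \<open>auto simp: \<mu>_in \<mu>_iff\<close>)+
  have 3: "\<mu> (\<mu> x w y) w z = \<mu> x w (\<mu> y w z)" if "x \<in> S" "y \<in> S" "z \<in> S" "w \<in> S" for x y z w
    by (rule \<mu>_eqI) (use that S in \<open>auto simp: \<mu>_in \<mu>_iff\<close>)
  show ?thesis
    unfolding median_algebra_def using 1 2 3 assms by (simp add: submedian_def)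
qed

lemma m_interval_iff:
  assumes "submedian S" "x \<in> S" "y \<in> S"
  shows "z \<in> m_interval S \<mu> x y \<longleftrightarrow> z \<in> S \<and> (\<forall>h\<in>H. x \<in> h \<longrightarrow> y \<in> h \<longrightarrow> z \<in> h)"
proof
  assume "z \<in> m_interval S \<mu> x y"
  then have z: "z \<in> S" "\<mu> x y z = z" by (auto simp: m_interval_def)
  have V: "x \<in> V" "y \<in> V" "z \<in> V" using assms z by (auto simp: submedian_def)
  have "z \<in> h" if h: "h \<in> H" "x \<in> h" "y \<in> h" for h
    using \<mu>_iff[OF V h(1)] z(2) h by simp
  then show "z \<in> S \<and> (\<forall>h\<in>H. x \<in> h \<longrightarrow> y \<in> h \<longrightarrow> z \<in> h)" using z by blast
next
  assume z: "z \<in> S \<and> (\<forall>h\<in>H. x \<in> h \<longrightarrow> y \<in> h \<longrightarrow> z \<in> h)"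
  have V: "x \<in> V" "y \<in> V" "z \<in> V" using assms z by (auto simp: submedian_def)
  have "\<mu> x y z = z"
  proof (rule \<mu>_eqI[OF V V(3)])
    fix h assume h: "h \<in> H"
    have "x \<in> h \<Longrightarrow> y \<in> h \<Longrightarrow> z \<in> h" using z h by blast
    moreover have "x \<in> V - h \<Longrightarrow> y \<in> V - h \<Longrightarrow> z \<in> V - h"
      using z[THEN conjunct2, THEN bspec, OF H_compl[OF h]] by blast
    then have "x \<notin> h \<Longrightarrow> y \<notin> h \<Longrightarrow> z \<notin> h" using V by simp
    ultimately show "z \<in> h \<longleftrightarrow> (x \<in> h \<and> y \<in> h \<or> y \<in> h \<and> z \<in> h \<or> x \<in> h \<and> z \<in> h)" by blast
  qed
  then show "z \<in> m_interval S \<mu> x y" using z by (simp add: m_interval_def)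
qed

text \<open>A point of the interval is determined by its sides on the finitely many walls between
  the end points, as on all other walls it must agree with both.\<close>

lemma submedian_discrete: assumes "submedian S" shows "m_discrete S \<mu>"
  unfolding m_discrete_def
proof (intro ballI)
  fix x y assume xy: "x \<in> S" "y \<in> S"
  have V: "x \<in> V" "y \<in> V" using assms xy by (auto simp: submedian_def)
  have "inj_on (\<lambda>z. {h \<in> D x y. z \<in> h}) (m_interval S \<mu> x y)"
  proof (rule inj_onI)
    fix z w assume z: "z \<in> m_interval S \<mu> x y" and w: "w \<in> m_interval S \<mu> x y"
      and eq: "{h \<in> D x y. z \<in> h} = {h \<in> D x y. w \<in> h}"
    have zw: "z \<in> V" "w \<in> V" using z w assms by (auto simp: m_interval_def submedian_def)
    have zI: "\<And>h. h \<in> H \<Longrightarrow> x \<in> h \<Longrightarrow> y \<in> h \<Longrightarrow> z \<in> h" and wI: "\<And>h. h \<in> H \<Longrightarrow> x \<in> h \<Longrightarrow> y \<in> h \<Longrightarrow> w \<in> h"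
      using z w m_interval_iff[OF assms xy] by blast+
    have on_D: "z \<in> h \<longleftrightarrow> w \<in> h" if "h \<in> D x y" for h using eq that by blast
    show "z = w"
    proof (rule vertex_eqI[OF zw])
      fix h assume h: "h \<in> H" "z \<in> h"
      have hc: "V - h \<in> H" using H_compl h by blast
      show "w \<in> h"
      proof (cases "x \<in> h")
        case True
        then show ?thesis using on_D[of h] wI[of h] h by (cases "y \<in> h") (auto simp: D_iff)
      next
        case False
        then have "y \<in> h" using zI[OF hc] h V by blast
        then have "V - h \<notin> D x y \<or> (z \<in> V - h \<longleftrightarrow> w \<in> V - h)" using on_D by blast
        moreover have "V - h \<in> D y x \<or> V - h \<in> D x y" using hc False V \<open>y \<in> h\<close> by (auto simp: D_iff)
        ultimately show ?thesis using h zw V False \<open>y \<in> h\<close> by (auto simp: D_iff)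
      qed
    qed
  qed
  moreover have "(\<lambda>z. {h \<in> D x y. z \<in> h}) ` m_interval S \<mu> x y \<subseteq> Pow (D x y)" by auto
  ultimately show "finite (m_interval S \<mu> x y)"
    using D_finite[OF V] by (meson finite_Pow_iff finite_imageD finite_subset)
qed

lemma trace_halfspace:
  assumes S: "submedian S" and h: "h \<in> H" "S \<inter> h \<noteq> {}" "S - h \<noteq> {}"
  shows "m_halfspace S \<mu> (S \<inter> h)"
proof -
  have 1: "m_convex S \<mu> (S \<inter> k)" if k: "k \<in> H" for k
    unfolding m_convex_def using m_interval_iff[OF S] k by auto
  have "S - S \<inter> h = S \<inter> (V - h)" using S by (auto simp: submedian_def)
  then show ?thesis
    using 1[OF h(1)] 1[OF H_compl[OF h(1)]] h(2,3) unfolding m_halfspace_def by auto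
qed

text \<open>Take a closest pair of points \<open>x\<close> in \<open>A\<close> and \<open>y\<close>
  outside, and any \<open>h\<close> between them. The median \<open>m\<close> of \<open>x\<close>,
  \<open>y\<close> and \<open>z\<close> stays on the side of \<open>A\<close> on which
  \<open>z\<close> is, so by minimality it cannot be separated from \<open>x\<close> or from
  \<open>y\<close> respectively. Since \<open>m\<close> follows \<open>z\<close> at
  \<open>h\<close>, the two sides match.\<close>

lemma halfspace_trace:
  assumes S: "submedian S" and A: "m_halfspace S \<mu> A"
  obtains h where "h \<in> H" "A = S \<inter> h"
proof -
  have AS: "A \<subseteq> S" "A \<noteq> {}" "S - A \<noteq> {}" "m_convex S \<mu> A" "m_convex S \<mu> (S - A)"
    using A by (auto simp: m_halfspace_def m_convex_def)
  have SV: "\<And>x. x \<in> S \<Longrightarrow> x \<in> V" and S\<mu>: "\<And>x y z. x \<in> S \<Longrightarrow> y \<in> S \<Longrightarrow> z \<in> S \<Longrightarrow> \<mu> x y z \<in> S"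
    using S by (auto simp: submedian_def)
  define P where "P p \<longleftrightarrow> fst p \<in> A \<and> snd p \<in> S - A" for p
  have "\<exists>p. P p" using AS by (auto simp: P_def)
  then obtain p where p: "P p" "\<And>q. P q \<Longrightarrow> card (D (fst p) (snd p)) \<le> card (D (fst q) (snd q))"
    using ex_has_least_nat[of P _ "\<lambda>p. card (D (fst p) (snd p))"] by blast
  define x y where "x = fst p" and "y = snd p"
  have xy: "x \<in> A" "y \<in> S - A" using p(1) by (auto simp: P_def x_def y_def)
  have min: "card (D x y) \<le> card (D x' y')" if "x' \<in> A" "y' \<in> S - A" for x' y'
    using p(2)[of "(x', y')"] that by (simp add: P_def x_def y_def)
  have xyV: "x \<in> V" "y \<in> V" "x \<in> S" "y \<in> S" using xy AS SV by auto
  have "x \<noteq> y" using xy by auto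
  then obtain h where h: "h \<in> H" "x \<in> h" "y \<notin> h" using H_separate xyV by blast
  have convA: "m_interval S \<mu> u v \<subseteq> A" if "u \<in> A" "v \<in> A" for u v
    using AS(4) that by (simp add: m_convex_def)
  have convB: "m_interval S \<mu> u v \<subseteq> S - A" if "u \<in> S - A" "v \<in> S - A" for u v
    using AS(5) that by (simp add: m_convex_def)
  have "z \<in> A \<longleftrightarrow> z \<in> h" if z: "z \<in> S" for z
  proof -
    define m where "m = \<mu> x y z"
    have zV: "z \<in> V" using SV z .
    have mS: "m \<in> S" using S\<mu> xyV z by (simp add: m_def)
    have mV: "m \<in> V" using SV mS .
    have m: "m \<in> k \<longleftrightarrow> (x \<in> k \<and> y \<in> k \<or> y \<in> k \<and> z \<in> k \<or> x \<in> k \<and> z \<in> k)" if "k \<in> H" for k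
      using \<mu>_iff[OF xyV(1,2) zV that] by (simp add: m_def)
    have Dsplit: "D x y = D x m \<union> D m y" "D x m \<inter> D m y = {}"
      using m by (auto simp: D_iff)
    then have card: "card (D x y) = card (D x m) + card (D m y)"
      using card_Un_disjoint[OF D_finite D_finite] xyV mV by simp
    show ?thesis
    proof
      assume zA: "z \<in> A"
      have "m \<in> m_interval S \<mu> x z"
        using m_interval_iff[OF S xyV(3) z] mS m by blast
      then have "m \<in> A" using convA[OF xy(1) zA] by blast
      then have "card (D x m) = 0" using min[of m y] xy card by simp
      then have "D x m = {}" using D_finite xyV mV by simp
      then have "m \<in> h" using h by (auto simp: D_iff)
      then show "z \<in> h" using m[OF h(1)] h by simp
    next
      assume zh: "z \<in> h"
      show "z \<in> A"
      proof (rule ccontr)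
        assume zA: "z \<notin> A"
        have "m \<in> m_interval S \<mu> y z"
          using m_interval_iff[OF S xyV(4) z] mS m by blast
        then have "m \<in> S - A" using convB[OF xy(2), of z] zA z by blast
        then have "card (D m y) = 0" using min[of x m] xy card by simp
        then have "D m y = {}" using D_finite xyV mV by simp
        then have "m \<notin> h" using h by (auto simp: D_iff)
        then show False using m[OF h(1)] h zh by simp
      qed
    qed
  qed
  then have "A = S \<inter> h" using AS by blast
  then show ?thesis using that h by blast
qed

text \<open>
  \<open>K\<close> is the set of halfspaces cutting \<open>S\<close>; as each of them is dual to an edge with endpoints in
  \<open>S\<close>, distinct halfspaces in \<open>K\<close> have distinct traces on \<open>S\<close>.
\<close>

definition dual_edges :: "'v set \<Rightarrow> 'v set set \<Rightarrow> bool" where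
  "dual_edges S K \<longleftrightarrow> submedian S \<and> (\<forall>x\<in>S. \<forall>y\<in>S. D x y \<subseteq> K) \<and> (\<forall>h\<in>K. \<exists>u\<in>S. \<exists>v\<in>S. D u v = {h})"

text \<open>Walls of \<open>S\<close> are traces of halfspaces; the dual edge makes the trace map
  injective, since a second halfspace with the same trace would cross that edge as well. Hence
  separating walls of \<open>S\<close> and members of \<open>D x y\<close> are equally many.\<close>

lemma cubulation_edges:
  assumes K: "dual_edges S K" and xy: "x \<in> S" "y \<in> S"
  shows "{x, y} \<in> edges (cubulation S \<mu>) \<longleftrightarrow> card (D x y) = 1"
proof -
  have S: "submedian S" and SV: "\<And>x. x \<in> S \<Longrightarrow> x \<in> V" and DK: "\<And>x y. x \<in> S \<Longrightarrow> y \<in> S \<Longrightarrow> D x y \<subseteq> K"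
    and dual: "\<And>h. h \<in> K \<Longrightarrow> \<exists>u\<in>S. \<exists>v\<in>S. D u v = {h}"
    using K by (auto simp: dual_edges_def submedian_def)
  define W where "W x y = {w \<in> m_walls S \<mu>. \<exists>A\<in>w. x \<in> A \<and> y \<notin> A}" for x y
  have card: "card (W x y) = card (D x y)" if xy: "x \<in> S" "y \<in> S" for x y
  proof -
    define f where "f h = {S \<inter> h, S - S \<inter> h}" for h
    have "inj_on f (D x y)"
    proof (rule inj_onI)
      fix h k assume h: "h \<in> D x y" and k: "k \<in> D x y" and eq: "f h = f k"
      have "x \<in> S \<inter> h" "x \<in> S \<inter> k" using h k xy by (auto simp: D_iff)
      then have tr: "S \<inter> h = S \<inter> k" using eq unfolding f_def doubleton_eq_iff by blast
      have "h \<in> K" using h DK xy by blast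
      then obtain u v where uv: "u \<in> S" "v \<in> S" "D u v = {h}" using dual by blast
      have "u \<in> h" "v \<notin> h" using uv(3) by (auto simp: D_def)
      then have "u \<in> k" "v \<notin> k" using tr uv by auto
      then have "k \<in> D u v" using k by (simp add: D_iff)
      then show "h = k" using uv by simp
    qed
    moreover have "f ` D x y = W x y"
    proof (intro equalityI subsetI)
      fix w assume "w \<in> f ` D x y"
      then obtain h where h: "h \<in> H" "x \<in> h" "y \<notin> h" "w = f h" by (auto simp: D_iff)
      have "m_halfspace S \<mu> (S \<inter> h)" using trace_halfspace[OF S h(1)] h xy by blast
      moreover have "w = {S \<inter> h, S - S \<inter> h}" using h(4) by (simp add: f_def)
      ultimately have "w \<in> m_walls S \<mu>" unfolding m_walls_def by (intro CollectI exI conjI)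
      moreover have "x \<in> S \<inter> h" "y \<notin> S \<inter> h" "S \<inter> h \<in> w" using h xy by (auto simp: f_def)
      ultimately show "w \<in> W x y" unfolding W_def by (intro CollectI conjI bexI[of _ "S \<inter> h"])
    next
      fix w assume "w \<in> W x y"
      then obtain A B where w: "w = {B, S - B}" "m_halfspace S \<mu> B" and A: "A \<in> w" "x \<in> A" "y \<notin> A"
        by (auto simp: W_def m_walls_def)
      have BS: "B \<subseteq> S" using w(2) by (auto simp: m_halfspace_def m_convex_def)
      have "m_halfspace S \<mu> A"
      proof (cases "A = B")
        case False
        then have "A = S - B" using A w by blast
        then show ?thesis using w(2) BS by (auto simp: m_halfspace_def double_diff)
      qed (use w in simp)
      then obtain h where h: "h \<in> H" "A = S \<inter> h" using halfspace_trace[OF S] by blast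
      have "h \<in> D x y" using h A xy by (auto simp: D_iff)
      moreover have "w = f h"
      proof (cases "A = B")
        case True
        then show ?thesis using w h by (simp add: f_def)
      next
        case False
        then have "A = S - B" using A w by blast
        then have "S - A = B" using BS by blast
        then show ?thesis using w \<open>A = S - B\<close> h(2) by (auto simp: f_def)
      qed
      ultimately show "w \<in> f ` D x y" by blast
    qed
    ultimately show ?thesis using card_image by metis
  qed
  have "{x, y} \<in> edges (cubulation S \<mu>) \<longleftrightarrow> (\<exists>u v. {x, y} = {u, v} \<and> u \<in> S \<and> v \<in> S \<and> card (W u v) = 1)"
    by (simp add: cubulation_def W_def)
  also have "\<dots> \<longleftrightarrow> card (D x y) = 1"
  proof
    assume "\<exists>u v. {x, y} = {u, v} \<and> u \<in> S \<and> v \<in> S \<and> card (W u v) = 1"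
    then obtain u v where uv: "{x, y} = {u, v}" "card (D u v) = 1" using card by auto
    then have "card (D x y) = 1 \<or> card (D y x) = 1" by (auto simp: doubleton_eq_iff)
    then show "card (D x y) = 1"
      using bij_betw_same_card[OF D_compl[OF SV[OF xy(1)] SV[OF xy(2)]]] by simp
  next
    assume "card (D x y) = 1"
    then show "\<exists>u v. {x, y} = {u, v} \<and> u \<in> S \<and> v \<in> S \<and> card (W u v) = 1"
      using card[OF xy] xy by (intro exI[of _ x] exI[of _ y]) simp
  qed
  finally show ?thesis .
qed

section \<open>Cubes described by the walls they cross\<close>

lemma cubulation_verts [simp]: "verts (cubulation S \<nu>) = S"
  by (simp add: cubulation_def)

text \<open>Holds for \<open>X\<close> as well as for the cubulations of the factors, so that the
  results on cubes below are proved once for both.\<close>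

definition wall_graph :: "'v skeleton \<Rightarrow> bool" where
  "wall_graph Y \<longleftrightarrow> verts Y \<subseteq> V \<and>
    (\<forall>x\<in>verts Y. \<forall>y\<in>verts Y. {x, y} \<in> edges Y \<longleftrightarrow> card (D x y) = 1)"

lemma cubulation_wall_graph: "dual_edges S K \<Longrightarrow> wall_graph (cubulation S \<mu>)"
  unfolding wall_graph_def using cubulation_edges by (auto simp: dual_edges_def submedian_def)

lemma same_D_eq:
  assumes "x \<in> V" "x' \<in> V" "y \<in> V" "D x y = {h}" "D x' y = {h}"
  shows "x = x'"
proof (rule vertex_eqI[OF assms(1,2)], rule ccontr)
  fix k assume k: "k \<in> H" "x \<in> k" "x' \<notin> k"
  show False
  proof (cases "y \<in> k")
    case True
    then have "V - k \<in> D x' y" unfolding D_iff using k H_compl assms(2) by simp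
    then have "h = V - k" using assms(5) by simp
    then show False using k assms(4) by (auto simp: D_def)
  next
    case False
    then have "k = h" using k assms(4) by (auto simp: D_def)
    then show False using k assms(5) by (auto simp: D_def)
  qed
qed

lemma same_D_eq':
  assumes "x \<in> V" "x' \<in> V" "y \<in> V" "D y x = {h}" "D y x' = {h}"
  shows "x = x'"
proof (rule same_D_eq[OF assms(1-3)])
  have img: "D z y = (\<lambda>h. V - h) ` D y z" if "z \<in> V" for z
    using D_compl[OF assms(3) that] by (simp add: bij_betw_def)
  show "D x y = {V - h}" "D x' y = {V - h}" using img assms by simp_all
qed

text \<open>Opposite edges of a square cross the same halfspace, and induction on \<open>A\<close>
  carries this from the corner \<open>{}\<close> across the cube.\<close>

lemma cube_directions:
  fixes n :: nat
  assumes Y: "wall_graph Y" and C: "C \<subseteq> verts Y" and f: "bij_betw f (Pow {..<n}) C"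
    "\<And>A B. A \<subseteq> {..<n} \<Longrightarrow> B \<subseteq> {..<n} \<Longrightarrow> {f A, f B} \<in> edges Y \<longleftrightarrow> card (sym_diff A B) = 1"
    and h: "\<And>i. i < n \<Longrightarrow> D (f {}) (f {i}) = {h i}"
  shows "A \<subseteq> {..<n} \<Longrightarrow> i < n \<Longrightarrow> i \<notin> A \<Longrightarrow> D (f A) (f (insert i A)) = {h i}"
proof (induction "card A" arbitrary: A i)
  case 0
  then have "A = {}" using finite_subset[OF 0(2) finite_lessThan] by simp
  then show ?case using h 0 by simp
next
  case (Suc m)
  have finA: "finite A" using finite_subset[OF Suc.prems(1) finite_lessThan] .
  obtain j where j: "j \<in> A" using Suc.hyps(2) by force
  define B where "B = A - {j}"
  have B: "A = insert j B" "j \<notin> B" "m = card B" "B \<subseteq> {..<n}" "j < n" "i \<notin> B" "i \<noteq> j"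
    using j Suc finA by (auto simp: B_def)
  have inV: "f S \<in> V" "f S \<in> verts Y" if "S \<subseteq> {..<n}" for S
    using f(1) C Y that by (auto simp: bij_betw_def wall_graph_def)
  have subs: "B \<subseteq> {..<n}" "insert i B \<subseteq> {..<n}" "insert j B \<subseteq> {..<n}" "insert i (insert j B) \<subseteq> {..<n}"
    using B Suc.prems by auto
  define x y z w
    where "x = f B" and "y = f (insert i B)" and "z = f (insert j B)" and "w = f (insert i (insert j B))"
  have V: "x \<in> V" "y \<in> V" "z \<in> V" "w \<in> V" and Yv: "x \<in> verts Y" "y \<in> verts Y" "z \<in> verts Y" "w \<in> verts Y"
    using inV subs by (auto simp: x_def y_def z_def w_def)
  have inj: "f S = f T \<longleftrightarrow> S = T" if "S \<subseteq> {..<n}" "T \<subseteq> {..<n}" for S T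
    using inj_on_eq_iff[OF bij_betw_imp_inj_on[OF f(1)], of S T] that by simp
  have ne: "y \<noteq> z" "x \<noteq> w"
    unfolding x_def y_def z_def w_def using inj subs B by auto
  have Dxy: "D x y = {h i}" "D x z = {h j}"
    using Suc.hyps(1)[OF B(3,4)] B Suc.prems by (auto simp: x_def y_def z_def)
  have sd: "sym_diff (insert i (insert j B)) (insert i B) = {j}" "sym_diff (insert j B) (insert i (insert j B)) = {i}"
    using B by auto
  have "{w, y} \<in> edges Y" "{z, w} \<in> edges Y"
    unfolding x_def y_def z_def w_def
    using f(2)[OF subs(4) subs(2)] f(2)[OF subs(3) subs(4)] sd by simp_all
  then have c: "card (D w y) = 1" "card (D z w) = 1"
    using Y Yv by (auto simp: wall_graph_def)
  have hi: "h i \<in> H" "x \<in> h i" "y \<notin> h i" using Dxy by (auto simp: D_def)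
  \<comment> \<open>The wall of \<open>x y\<close> must separate \<open>z\<close> from
    \<open>w\<close>: otherwise it would also be the wall of \<open>x z\<close> or of
    \<open>w y\<close>, and two edges at one vertex crossing the same halfspace in the same
    direction have the same other end, which gives \<open>y = z\<close> or
    \<open>x = w\<close>.\<close>
  have "z \<in> h i"
  proof (rule ccontr)
    assume "z \<notin> h i"
    then have "h i \<in> D x z" using hi by (simp add: D_iff)
    then have "h i = h j" using Dxy by simp
    then show False using same_D_eq'[OF V(2,3,1)] Dxy ne by simp
  qed
  moreover have "w \<notin> h i"
  proof
    assume "w \<in> h i"
    then have "h i \<in> D w y" using hi by (simp add: D_iff)
    then have "D w y = {h i}" using c(1) by (metis card_1_singletonE singletonD)
    then show False using same_D_eq[OF V(1,4,2)] Dxy ne by simp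
  qed
  ultimately have "h i \<in> D z w" using hi by (simp add: D_iff)
  then have "D z w = {h i}" using c(2) by (metis card_1_singletonE singletonD)
  then show ?case unfolding z_def w_def B(1) .
qed

lemma cube_structure:
  assumes Y: "wall_graph Y" and C: "cube Y n C" and v: "v \<in> C"
  obtains f h where "bij_betw f (Pow {..<n}) C" "f {} = v" "inj_on h {..<n}"
    "\<And>A. A \<subseteq> {..<n} \<Longrightarrow> D v (f A) = h ` A"
proof -
  have CY: "C \<subseteq> verts Y" using C by (simp add: cube_def)
  obtain f where f: "bij_betw f (Pow {..<n}) C" "f {} = v"
    "\<And>A B. A \<subseteq> {..<n} \<Longrightarrow> B \<subseteq> {..<n} \<Longrightarrow> {f A, f B} \<in> edges Y \<longleftrightarrow> card (sym_diff A B) = 1"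
    using cube_based[OF C v] by metis
  have inY: "f S \<in> V" "f S \<in> verts Y" if "S \<subseteq> {..<n}" for S
    using f(1) CY Y that by (auto simp: bij_betw_def wall_graph_def)
  have "\<exists>h. D (f {}) (f {i}) = {h}" if "i < n" for i
  proof -
    have "{f {}, f {i}} \<in> edges Y" using f(3)[of "{}" "{i}"] that by simp
    then have "card (D (f {}) (f {i})) = 1"
      using inY[of "{}"] inY[of "{i}"] Y that by (auto simp: wall_graph_def)
    then show ?thesis by (rule card_1_singletonE) blast
  qed
  then obtain h where h: "\<And>i. i < n \<Longrightarrow> D (f {}) (f {i}) = {h i}" by metis
  have step: "D (f A) (f (insert i A)) = {h i}" if "A \<subseteq> {..<n}" "i < n" "i \<notin> A" for A i
    using cube_directions[OF Y CY f(1,3) h that] .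
  have "inj_on h {..<n}"
  proof (rule inj_onI)
    fix i j assume ij: "i \<in> {..<n}" "j \<in> {..<n}" "h i = h j"
    then have "f {i} = f {j}"
      using same_D_eq'[OF inY(1) inY(1) inY(1), of "{i}" "{j}" "{}" "h i"] h[of i] h[of j] by simp
    then show "i = j"
      using inj_on_eq_iff[OF bij_betw_imp_inj_on[OF f(1)], of "{i}" "{j}"] ij by simp
  qed
  moreover have "D v (f A) = h ` A" if "A \<subseteq> {..<n}" for A
  proof -
    have "finite A" using that finite_subset by blast
    then show ?thesis using that
    proof (induction A rule: finite_induct)
      case empty
      then show ?case using f(2) by (simp add: D_def)
    next
      case (insert i A)
      have D1: "D (f A) (f (insert i A)) = {h i}" using step[of A i] insert by simp
      have IH: "D v (f A) = h ` A" using insert by simp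
      have hi: "h i \<in> H" "v \<in> h i" using h[of i] insert f(2) by (auto simp: D_def)
      have hi': "f A \<in> h i" "f (insert i A) \<notin> h i" using D1 by (auto simp: D_def)
      have V: "v \<in> V" "f A \<in> V" "f (insert i A) \<in> V"
        using inY(1)[of "{}"] inY(1)[of A] inY(1)[of "insert i A"] insert f(2) by auto
      have D2: "D (f (insert i A)) (f A) = {V - h i}"
        using D_compl[OF V(2,3)] D1 by (simp add: bij_betw_def)
      have "k \<in> D v (f (insert i A)) \<longleftrightarrow> k = h i \<or> k \<in> D v (f A)" for k
      proof (cases "k \<in> H \<and> v \<in> k")
        case True
        have "f A \<in> k \<Longrightarrow> f (insert i A) \<notin> k \<Longrightarrow> k = h i" using D1 True by (auto simp: D_def)
        moreover have "f (insert i A) \<in> k \<Longrightarrow> f A \<notin> k \<Longrightarrow> k = V - h i"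
          using D2 True by (auto simp: D_def)
        moreover have "k \<noteq> V - h i" using True hi by blast
        ultimately show ?thesis using hi' True by (auto simp: D_iff)
      next
        case False
        then show ?thesis using hi by (auto simp: D_iff)
      qed
      then show ?case using IH by auto
    qed
  qed
  ultimately show ?thesis using that f by blast
qed

text \<open>Converse of \<open>cube_structure\<close>: once every subset of \<open>K\<close> can be
  flipped at \<open>x\<close>, distances among the resulting vertices are sizes of symmetric
  differences. A wall in \<open>T - S\<close> appears as itself and one in \<open>S - T\<close> as
  its complement.\<close>

lemma cube_build:
  assumes Y: "wall_graph Y" and K: "finite K" "K \<subseteq> {h \<in> H. x \<in> h}" and x: "x \<in> V"
    and w: "\<And>S. S \<subseteq> K \<Longrightarrow> w S \<in> verts Y" "\<And>S. S \<subseteq> K \<Longrightarrow> D x (w S) = S"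
  shows "cube Y (card K) (w ` Pow K)"
proof -
  obtain e where e: "bij_betw e {..<card K} K"
    using K(1) ex_bij_betw_nat_finite[of K] by (auto simp: atLeast0LessThan)
  define f where "f A = w (e ` A)" for A
  have eK: "e ` A \<subseteq> K" if "A \<subseteq> {..<card K}" for A using e that by (auto simp: bij_betw_def)
  have e_inj: "inj_on e {..<card K}" using e by (simp add: bij_betw_def)
  have wV: "w S \<in> V" if "S \<subseteq> K" for S using w(1)[OF that] Y by (auto simp: wall_graph_def)
  have w_inj: "inj_on w (Pow K)" using w(2) by (intro inj_on_inverseI[where g = "D x"]) auto
  have cardD: "card (D (w S) (w T)) = card (sym_diff S T)" if ST: "S \<subseteq> K" "T \<subseteq> K" for S T
  proof -
    have mem: "w S \<in> k \<longleftrightarrow> k \<notin> S" if "k \<in> H" "x \<in> k" "S \<subseteq> K" for k S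
      using w(2)[OF that(3)] that(1,2) by (auto simp: D_def)
    have mem': "w S \<in> V - k \<longleftrightarrow> k \<in> S" if "k \<in> H" "x \<in> k" "S \<subseteq> K" for k S
      using mem[OF that] wV[OF that(3)] by simp
    have "D (w S) (w T) = (T - S) \<union> (\<lambda>k. V - k) ` (S - T)"
    proof (intro equalityI subsetI)
      fix k assume "k \<in> D (w S) (w T)"
      then have k: "k \<in> H" "w S \<in> k" "w T \<notin> k" by (auto simp: D_iff)
      show "k \<in> (T - S) \<union> (\<lambda>k. V - k) ` (S - T)"
      proof (cases "x \<in> k")
        case True
        then show ?thesis using mem[OF k(1)] ST k by blast
      next
        case False
        then have kc: "V - k \<in> H" "x \<in> V - k" using H_compl k x by auto
        have "V - k \<in> S - T" using mem[OF kc] ST k wV by auto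
        then show ?thesis
          using H_compl_compl[OF k(1)] by (intro UnI2 image_eqI[of _ _ "V - k"]) auto
      qed
    next
      fix k assume "k \<in> (T - S) \<union> (\<lambda>k. V - k) ` (S - T)"
      then consider "k \<in> T - S" | l where "l \<in> S - T" "k = V - l" by blast
      then show "k \<in> D (w S) (w T)"
      proof cases
        case 1
        then have "k \<in> H" "x \<in> k" using ST K by auto
        then show ?thesis using mem 1 ST by (auto simp: D_iff)
      next
        case 2
        then have "l \<in> H" "x \<in> l" using ST K by auto
        then show ?thesis using mem' 2 ST H_compl by (auto simp: D_iff)
      qed
    qed
    moreover have "(T - S) \<inter> (\<lambda>k. V - k) ` (S - T) = {}"
    proof -
      have "x \<in> k" if "k \<in> T - S" for k using that ST K by auto
      moreover have "x \<notin> k" if "k \<in> (\<lambda>k. V - k) ` (S - T)" for k using that ST K by auto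
      ultimately show ?thesis by blast
    qed
    moreover have "inj_on (\<lambda>k. V - k) (S - T)"
    proof (rule inj_on_inverseI[where g = "\<lambda>k. V - k"])
      fix k assume "k \<in> S - T"
      then have "k \<in> H" using ST K by auto
      then show "V - (V - k) = k" by (rule H_compl_compl)
    qed
    moreover have fin: "finite (T - S)" "finite (S - T)" using ST K finite_subset by blast+
    ultimately have "card (D (w S) (w T)) = card (T - S) + card (S - T)"
      by (simp add: card_Un_disjoint card_image)
    also have "\<dots> = card (sym_diff S T)"
      using fin by (subst card_Un_disjoint) auto
    finally show ?thesis .
  qed
  have "bij_betw f (Pow {..<card K}) (w ` Pow K)"
  proof -
    have "bij_betw (\<lambda>A. e ` A) (Pow {..<card K}) (Pow K)" using e by (rule bij_betw_Pow)
    moreover have "bij_betw w (Pow K) (w ` Pow K)" using w_inj by (rule inj_on_imp_bij_betw)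
    ultimately have "bij_betw (w \<circ> (\<lambda>A. e ` A)) (Pow {..<card K}) (w ` Pow K)"
      by (rule bij_betw_trans)
    moreover have "w \<circ> (\<lambda>A. e ` A) = f" by (simp add: fun_eq_iff f_def)
    ultimately show ?thesis by simp
  qed
  moreover have "{f A, f B} \<in> edges Y \<longleftrightarrow> card (sym_diff A B) = 1"
    if AB: "A \<subseteq> {..<card K}" "B \<subseteq> {..<card K}" for A B
  proof -
    have "sym_diff (e ` A) (e ` B) = e ` sym_diff A B"
    proof -
      have "e ` (A - B) = e ` A - e ` B" "e ` (B - A) = e ` B - e ` A"
        by (rule inj_on_image_set_diff[OF e_inj]; use AB in auto)+
      then show ?thesis by (simp add: image_Un)
    qed
    moreover have "inj_on e (sym_diff A B)" using e_inj by (rule inj_on_subset) (use AB in auto)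
    ultimately have "card (sym_diff (e ` A) (e ` B)) = card (sym_diff A B)"
      by (simp add: card_image)
    moreover have "{f A, f B} \<in> edges Y \<longleftrightarrow> card (D (f A) (f B)) = 1"
      using Y w(1) eK AB by (auto simp: wall_graph_def f_def)
    ultimately show ?thesis using cardD[OF eK[OF AB(1)] eK[OF AB(2)]] by (simp add: f_def)
  qed
  moreover have "w ` Pow K \<subseteq> verts Y" using w(1) by auto
  ultimately show ?thesis unfolding cube_def by blast
qed

end

section \<open>The three factors of the median set\<close>

context halfspaces_int
begin

lemma pos_inj: assumes "pos h" shows "inj (\<lambda>n. a n ` h)"
proof -
  obtain x where x: "x \<in> V" using V_nonempty by blast
  obtain N where N: "\<And>n. n \<ge> N \<Longrightarrow> a n x \<in> h \<and> a (- n) x \<notin> h"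
    using assms x unfolding pos_def by meson
  have "a n x \<notin> h" if "n \<le> - N" for n using N[of "- n"] that by simp
  then show ?thesis using orbit_inj[OF x, of h N "- N"] N assms by (auto simp: pos_def)
qed

lemma M_iff:
  "x \<in> M \<longleftrightarrow> x \<in> V \<and> (\<forall>h\<in>Triv. \<forall>n. a n x \<in> h \<longleftrightarrow> x \<in> h) \<and>
    (\<forall>h. pos h \<longrightarrow> (\<forall>n. a n x \<in> h \<longrightarrow> a (n + 1) x \<in> h))"
proof
  assume x: "x \<in> M"
  show "x \<in> V \<and> (\<forall>h\<in>Triv. \<forall>n. a n x \<in> h \<longleftrightarrow> x \<in> h) \<and>
    (\<forall>h. pos h \<longrightarrow> (\<forall>n. a n x \<in> h \<longrightarrow> a (n + 1) x \<in> h))"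
    using M_in[OF x] Triv_constant[OF x] pos_step[OF x] by auto
next
  assume x: "x \<in> V \<and> (\<forall>h\<in>Triv. \<forall>n. a n x \<in> h \<longleftrightarrow> x \<in> h) \<and>
    (\<forall>h. pos h \<longrightarrow> (\<forall>n. a n x \<in> h \<longrightarrow> a (n + 1) x \<in> h))"
  have "monotone_at x h" if h: "h \<in> H - Inv" for h
  proof -
    consider "h \<in> Triv" | "pos h" | "pos (V - h)" using H_cases[of h] h by (auto simp: Skew_def)
    then show ?thesis
    proof cases
      case 1
      then show ?thesis using x by (simp add: monotone_at_def)
    next
      case 2
      then show ?thesis using x by (simp add: monotone_at_def)
    next
      case 3
      then have "\<forall>n. a n x \<in> V - h \<longrightarrow> a (n + 1) x \<in> V - h" using x by blast
      then have "monotone_at x (V - h)" unfolding monotone_at_def ..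
      then show ?thesis using monotone_at_compl x h by simp
    qed
  qed
  then show "x \<in> M" using x by (simp add: M_def)
qed

lemma a_median:
  assumes "x \<in> V" "y \<in> V" "z \<in> V" "h \<in> H"
  shows "a n (\<mu> x y z) \<in> h \<longleftrightarrow> (a n x \<in> h \<and> a n y \<in> h \<or> a n y \<in> h \<and> a n z \<in> h \<or> a n x \<in> h \<and> a n z \<in> h)"
  using a_mem[OF _ assms(4)] \<mu>_in[OF assms(1-3)] \<mu>_iff[OF assms(1-3) a_H[OF assms(4)]] assms(1-3)
  by simp

text \<open>A majority of increasing truth values is increasing. This needs all orbits in
  \<open>M\<close> to move in the same direction at a given attracting halfspace, which is
  \<open>pos_step\<close>.\<close>

lemma M_submedian: "submedian M"
  unfolding submedian_def
proof (intro conjI ballI)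
  show "M \<subseteq> V" using M_in by blast
  fix x y z assume xyz: "x \<in> M" "y \<in> M" "z \<in> M"
  have V: "x \<in> V" "y \<in> V" "z \<in> V" using xyz M_in by auto
  show "\<mu> x y z \<in> M"
    unfolding M_iff
  proof (intro conjI ballI allI impI)
    show "\<mu> x y z \<in> V" using V by (rule \<mu>_in)
    show "a n (\<mu> x y z) \<in> h \<longleftrightarrow> \<mu> x y z \<in> h" if "h \<in> Triv" for h n
    proof -
      have "h \<in> H" using that classes_sub by blast
      then show ?thesis
        using a_median[OF V, of h n] \<mu>_iff[OF V, of h] Triv_constant that xyz by simp
    qed
    fix h n assume h: "pos h" "a n (\<mu> x y z) \<in> h"
    have hH: "h \<in> H" using h by (simp add: pos_def)
    have "a n w \<in> h \<Longrightarrow> a (n + 1) w \<in> h" if "w \<in> M" for w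
      using pos_step[OF that h(1), of n "n + 1"] by simp
    then show "a (n + 1) (\<mu> x y z) \<in> h"
      using h(2) xyz unfolding a_median[OF V hH] by blast
  qed
qed

definition is_class :: "'a set set \<Rightarrow> bool" where
  "is_class K \<longleftrightarrow> K = Triv \<or> K = Skew \<or> K = Inv"

text \<open>The factor belonging to the class \<open>K\<close>, realised inside \<open>M\<close> as
  the fibre through a base point \<open>b\<close>. This makes it a median subalgebra to which the
  results on \<open>submedian\<close> sets apply; \<open>pr\<close> replaces all choices outside
  \<open>K\<close> by those of \<open>b\<close>.\<close>

definition Fac :: "'a \<Rightarrow> 'a set set \<Rightarrow> 'a set" where
  "Fac b K = {x \<in> M. \<forall>h\<in>H - K. x \<in> h \<longleftrightarrow> b \<in> h}"

definition pr :: "'a \<Rightarrow> 'a set set \<Rightarrow> 'a \<Rightarrow> 'a" where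
  "pr b K x = (THE v. v \<in> Fac b K \<and> (\<forall>h\<in>K. v \<in> h \<longleftrightarrow> x \<in> h))"

lemma is_class_simps [simp]: "is_class Triv" "is_class Skew" "is_class Inv"
  by (auto simp: is_class_def)

lemma Fac_M: "x \<in> Fac b K \<Longrightarrow> x \<in> M"
  by (simp add: Fac_def)

lemma Fac_V: "x \<in> Fac b K \<Longrightarrow> x \<in> V"
  using Fac_M M_in by blast

lemma base_in_Fac: "b \<in> M \<Longrightarrow> b \<in> Fac b K"
  by (simp add: Fac_def)

lemma Fac_agree: "x \<in> Fac b K \<Longrightarrow> h \<in> H \<Longrightarrow> h \<notin> K \<Longrightarrow> x \<in> h \<longleftrightarrow> b \<in> h"
  by (simp add: Fac_def)

lemma combine3:
  assumes "x \<in> M" "y \<in> M" "z \<in> M"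
  obtains v where "v \<in> M" "\<And>h. h \<in> Triv \<Longrightarrow> v \<in> h \<longleftrightarrow> x \<in> h" "\<And>h. h \<in> Skew \<Longrightarrow> v \<in> h \<longleftrightarrow> y \<in> h"
    "\<And>h. h \<in> Inv \<Longrightarrow> v \<in> h \<longleftrightarrow> z \<in> h"
proof -
  have zV: "z \<in> V" using assms M_in by blast
  have compl: "V - h \<in> {h \<in> Inv. z \<in> h} \<longleftrightarrow> h \<notin> {h \<in> Inv. z \<in> h}" if "h \<in> Inv" for h
    using Inv_compl[OF that] that zV by auto
  show ?thesis
  proof (rule combine[OF assms(1,2), of "{h \<in> Inv. z \<in> h}"])
    show "{h \<in> Inv. z \<in> h} \<subseteq> Inv" by auto
    show "V - h \<in> {h \<in> Inv. z \<in> h} \<longleftrightarrow> h \<notin> {h \<in> Inv. z \<in> h}" if "h \<in> Inv" for h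
      using compl[OF that] .
  next
    fix v assume "v \<in> M" "\<And>h. h \<in> Triv \<Longrightarrow> (v \<in> h) = (x \<in> h)" "\<And>h. h \<in> Skew \<Longrightarrow> (v \<in> h) = (y \<in> h)"
      "\<And>h. h \<in> Inv \<Longrightarrow> (v \<in> h) = (h \<in> {h \<in> Inv. z \<in> h})"
    then show thesis using that[of v] by simp
  qed
qed

lemma Fac_eqI:
  assumes "v \<in> Fac b K" "w \<in> Fac b K" "\<And>h. h \<in> K \<Longrightarrow> v \<in> h \<Longrightarrow> w \<in> h"
  shows "v = w"
proof (rule vertex_eqI)
  show "v \<in> V" "w \<in> V" using assms Fac_V by auto
  show "w \<in> h" if "h \<in> H" "v \<in> h" for h
    using that assms Fac_agree by (cases "h \<in> K") auto
qed

lemma pr_exists: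
  assumes b: "b \<in> M" and K: "is_class K" and x: "x \<in> M"
  shows "\<exists>v. v \<in> Fac b K \<and> (\<forall>h\<in>K. v \<in> h \<longleftrightarrow> x \<in> h)"
proof -
  define p where "p L = (if L = K then x else b)" for L
  have p: "p L \<in> M" for L using b x by (simp add: p_def)
  obtain v where v: "v \<in> M" "\<And>h. h \<in> Triv \<Longrightarrow> v \<in> h \<longleftrightarrow> p Triv \<in> h" "\<And>h. h \<in> Skew \<Longrightarrow> v \<in> h \<longleftrightarrow> p Skew \<in> h"
    "\<And>h. h \<in> Inv \<Longrightarrow> v \<in> h \<longleftrightarrow> p Inv \<in> h"
    by (rule combine3[OF p[of Triv] p[of Skew] p[of Inv]]) (erule that; simp)
  have "v \<in> h \<longleftrightarrow> b \<in> h" if h: "h \<in> H - K" for h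
  proof -
    consider "h \<in> Triv" | "h \<in> Skew" | "h \<in> Inv" using H_cases[of h] h by blast
    then show ?thesis
    proof cases
      case 1
      then have "K \<noteq> Triv" using h by blast
      then show ?thesis using v(2)[OF 1] by (simp add: p_def)
    next
      case 2
      then have "K \<noteq> Skew" using h by blast
      then show ?thesis using v(3)[OF 2] by (simp add: p_def)
    next
      case 3
      then have "K \<noteq> Inv" using h by blast
      then show ?thesis using v(4)[OF 3] by (simp add: p_def)
    qed
  qed
  moreover have "v \<in> h \<longleftrightarrow> x \<in> h" if "h \<in> K" for h
    using K v that unfolding is_class_def p_def by auto
  ultimately show ?thesis using v(1) by (auto simp: Fac_def)
qed

lemma pr_eqI:
  assumes "v \<in> Fac b K" "\<And>h. h \<in> K \<Longrightarrow> v \<in> h \<longleftrightarrow> x \<in> h"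
  shows "pr b K x = v"
  unfolding pr_def
proof (rule the_equality)
  show "v \<in> Fac b K \<and> (\<forall>h\<in>K. v \<in> h \<longleftrightarrow> x \<in> h)" using assms by blast
  show "w = v" if "w \<in> Fac b K \<and> (\<forall>h\<in>K. w \<in> h \<longleftrightarrow> x \<in> h)" for w
    using that assms by (intro Fac_eqI[of w b K v]) auto
qed

lemma pr_spec:
  assumes "b \<in> M" "is_class K" "x \<in> M"
  shows "pr b K x \<in> Fac b K" "h \<in> K \<Longrightarrow> pr b K x \<in> h \<longleftrightarrow> x \<in> h"
proof -
  obtain v where v: "v \<in> Fac b K" "\<forall>h\<in>K. v \<in> h \<longleftrightarrow> x \<in> h" using pr_exists[OF assms] by blast
  have "pr b K x = v" using pr_eqI[of v b K x] v by blast
  then show "pr b K x \<in> Fac b K" "h \<in> K \<Longrightarrow> pr b K x \<in> h \<longleftrightarrow> x \<in> h" using v by auto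
qed

lemma pr_id: "x \<in> Fac b K \<Longrightarrow> pr b K x = x"
  by (rule pr_eqI) auto

lemma class_sub: "is_class K \<Longrightarrow> K \<subseteq> H"
  using classes_sub by (auto simp: is_class_def)

lemma Fac_submedian: assumes "b \<in> M" shows "submedian (Fac b K)"
  unfolding submedian_def
proof (intro conjI ballI)
  show "Fac b K \<subseteq> V" using Fac_V by blast
  fix x y z assume xyz: "x \<in> Fac b K" "y \<in> Fac b K" "z \<in> Fac b K"
  have V: "x \<in> V" "y \<in> V" "z \<in> V" using xyz Fac_V by auto
  have "\<mu> x y z \<in> M" using M_submedian xyz Fac_M by (auto simp: submedian_def)
  moreover have "\<mu> x y z \<in> h \<longleftrightarrow> b \<in> h" if "h \<in> H - K" for h
    using \<mu>_iff[OF V, of h] that xyz Fac_agree by auto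
  ultimately show "\<mu> x y z \<in> Fac b K" by (simp add: Fac_def)
qed

lemma D_Fac: "x \<in> Fac b K \<Longrightarrow> y \<in> Fac b K \<Longrightarrow> D x y \<subseteq> K"
proof
  fix h assume "x \<in> Fac b K" "y \<in> Fac b K" "h \<in> D x y"
  then show "h \<in> K" using Fac_agree[of x b K h] Fac_agree[of y b K h] unfolding D_def by blast
qed

lemma pr_median:
  assumes b: "b \<in> M" and K: "is_class K" and x: "x \<in> M" "y \<in> M" "z \<in> M"
  shows "pr b K (\<mu> x y z) = \<mu> (pr b K x) (pr b K y) (pr b K z)"
proof (rule pr_eqI)
  have P: "pr b K x \<in> Fac b K" "pr b K y \<in> Fac b K" "pr b K z \<in> Fac b K"
    using pr_spec(1)[OF b K] x by auto
  then show "\<mu> (pr b K x) (pr b K y) (pr b K z) \<in> Fac b K"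
    using Fac_submedian[OF b] by (auto simp: submedian_def)
  fix h assume h: "h \<in> K"
  then have hH: "h \<in> H" using class_sub K by blast
  show "\<mu> (pr b K x) (pr b K y) (pr b K z) \<in> h \<longleftrightarrow> \<mu> x y z \<in> h"
    using \<mu>_iff[OF Fac_V[OF P(1)] Fac_V[OF P(2)] Fac_V[OF P(3)] hH] \<mu>_iff[OF M_in[OF x(1)] M_in[OF x(2)] M_in[OF x(3)] hH]
      pr_spec(2)[OF b K _ h] x by simp
qed

definition split :: "'a \<Rightarrow> 'a \<Rightarrow> 'a \<times> 'a \<times> 'a" where
  "split b x = (pr b Triv x, pr b Skew x, pr b Inv x)"

lemma split_median_iso:
  assumes b: "b \<in> M"
  shows "median_iso M \<mu> (Fac b Triv \<times> Fac b Skew \<times> Fac b Inv) (prod3_median \<mu> \<mu> \<mu>) (split b)"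
  unfolding median_iso_def
proof (intro conjI ballI)
  show "bij_betw (split b) M (Fac b Triv \<times> Fac b Skew \<times> Fac b Inv)"
  proof (rule bij_betw_imageI)
    show "inj_on (split b) M"
    proof (rule inj_onI)
      fix x y assume xy: "x \<in> M" "y \<in> M" "split b x = split b y"
      show "x = y"
      proof (rule vertex_eqI)
        show "x \<in> V" "y \<in> V" using xy M_in by auto
        fix h assume h: "h \<in> H" "x \<in> h"
        show "y \<in> h"
          using H_cases[OF h(1)]
        proof (elim disjE)
          assume "h \<in> Triv"
          then show ?thesis
            using pr_spec(2)[OF b _ xy(1), of Triv h] pr_spec(2)[OF b _ xy(2), of Triv h] xy(3) h
            by (simp add: split_def)
        next
          assume "h \<in> Skew"
          then show ?thesis
            using pr_spec(2)[OF b _ xy(1), of Skew h] pr_spec(2)[OF b _ xy(2), of Skew h] xy(3) h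
            by (simp add: split_def)
        next
          assume "h \<in> Inv"
          then show ?thesis
            using pr_spec(2)[OF b _ xy(1), of Inv h] pr_spec(2)[OF b _ xy(2), of Inv h] xy(3) h
            by (simp add: split_def)
        qed
      qed
    qed
    show "split b ` M = Fac b Triv \<times> Fac b Skew \<times> Fac b Inv"
    proof (intro equalityI subsetI)
      fix p assume "p \<in> split b ` M"
      then show "p \<in> Fac b Triv \<times> Fac b Skew \<times> Fac b Inv"
        using pr_spec(1)[OF b] by (auto simp: split_def)
    next
      fix p assume "p \<in> Fac b Triv \<times> Fac b Skew \<times> Fac b Inv"
      then obtain t f q where p: "p = (t, f, q)" "t \<in> Fac b Triv" "f \<in> Fac b Skew" "q \<in> Fac b Inv"
        by auto
      obtain v where v: "v \<in> M" "\<And>h. h \<in> Triv \<Longrightarrow> v \<in> h \<longleftrightarrow> t \<in> h" "\<And>h. h \<in> Skew \<Longrightarrow> v \<in> h \<longleftrightarrow> f \<in> h"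
        "\<And>h. h \<in> Inv \<Longrightarrow> v \<in> h \<longleftrightarrow> q \<in> h"
        by (rule combine3[OF Fac_M[OF p(2)] Fac_M[OF p(3)] Fac_M[OF p(4)]]) (erule that; simp)
      have "pr b Triv v = t" "pr b Skew v = f" "pr b Inv v = q" using pr_eqI p v by auto
      then have "split b v = p" using p by (simp add: split_def)
      then show "p \<in> split b ` M" using v(1) by blast
    qed
  qed
  show "split b (\<mu> x y z) = prod3_median \<mu> \<mu> \<mu> (split b x) (split b y) (split b z)"
    if "x \<in> M" "y \<in> M" "z \<in> M" for x y z
    using pr_median[OF b _ that] by (simp add: split_def prod3_median_def)
qed

subsection \<open>The cube factor\<close>

lemma D_swap: "x \<in> V \<Longrightarrow> y \<in> V \<Longrightarrow> D x y = (\<lambda>h. V - h) ` D y x"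
  using D_compl[of y x] by (simp add: bij_betw_def)

lemma flip_Fac:
  assumes "b \<in> M" "S \<subseteq> {h \<in> Inv. b \<in> h}"
  shows "\<exists>v\<in>Fac b Inv. D b v = S"
proof -
  obtain v where "v \<in> M" "D b v = S" "\<And>h. h \<in> H - Inv \<Longrightarrow> v \<in> h \<longleftrightarrow> b \<in> h"
    by (rule flip_Inv[OF assms]) (erule that; simp)
  then show ?thesis by (auto simp: Fac_def)
qed

lemma dual_edges_Inv: assumes b: "b \<in> M" shows "dual_edges (Fac b Inv) Inv"
  unfolding dual_edges_def
proof (intro conjI ballI)
  show "submedian (Fac b Inv)" using Fac_submedian b .
  show "D x y \<subseteq> Inv" if "x \<in> Fac b Inv" "y \<in> Fac b Inv" for x y using D_Fac that .
  fix h assume h: "h \<in> Inv"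
  have bV: "b \<in> V" "b \<in> Fac b Inv" using b M_in base_in_Fac by auto
  have hH: "h \<in> H" using h classes_sub by blast
  show "\<exists>u\<in>Fac b Inv. \<exists>v\<in>Fac b Inv. D u v = {h}"
  proof (cases "b \<in> h")
    case True
    then show ?thesis using flip_Fac[OF b, of "{h}"] h bV by auto
  next
    case False
    then obtain v where v: "v \<in> Fac b Inv" "D b v = {V - h}"
      using flip_Fac[OF b, of "{V - h}"] Inv_compl[OF h] bV by auto
    then have "D v b = {h}" using D_swap[OF Fac_V[OF v(1)] bV(1)] H_compl_compl[OF hH] by simp
    then show ?thesis using v bV by blast
  qed
qed

text \<open>Both sets contain one side of every inverted wall, so passing to the complement where
  necessary maps one injectively into the other.\<close>

lemma card_Inv_containing:
  assumes "v \<in> V" "b \<in> V"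
  shows "card {h \<in> Inv. v \<in> h} \<le> card {h \<in> Inv. b \<in> h}"
proof (rule card_inj_on_le[where f = "\<lambda>h. if b \<in> h then h else V - h"])
  show "inj_on (\<lambda>h. if b \<in> h then h else V - h) {h \<in> Inv. v \<in> h}"
  proof (rule inj_onI)
    fix h k assume hk: "h \<in> {h \<in> Inv. v \<in> h}" "k \<in> {h \<in> Inv. v \<in> h}"
      and eq: "(if b \<in> h then h else V - h) = (if b \<in> k then k else V - k)"
    have hk': "h \<in> H" "k \<in> H" using hk classes_sub by auto
    have "V - (V - h) = h" "V - (V - k) = k"
      by (rule H_compl_compl[OF hk'(1)], rule H_compl_compl[OF hk'(2)])
    moreover have "h \<noteq> V - k" "k \<noteq> V - h" using hk by auto
    ultimately show "h = k" using eq by (metis)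
  qed
  show "(\<lambda>h. if b \<in> h then h else V - h) ` {h \<in> Inv. v \<in> h} \<subseteq> {h \<in> Inv. b \<in> h}"
    using assms Inv_compl by auto
  show "finite {h \<in> Inv. b \<in> h}" using Inv_finite by simp
qed

lemma cube_in_Fac:
  assumes b: "b \<in> M" and Y: "wall_graph Y" "Fac b Inv \<subseteq> verts Y"
  obtains C where "cube Y (card {h \<in> Inv. b \<in> h}) C" "b \<in> C" "C = Fac b Inv"
proof -
  define K where "K = {h \<in> Inv. b \<in> h}"
  have bV: "b \<in> V" using b M_in by blast
  obtain w where w: "\<And>S. S \<subseteq> K \<Longrightarrow> w S \<in> Fac b Inv \<and> D b (w S) = S"
    using flip_Fac[OF b] unfolding K_def by metis
  have "cube Y (card K) (w ` Pow K)"
  proof (rule cube_build[OF Y(1) _ _ bV])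
    show "finite K" using Inv_finite by (simp add: K_def)
    show "K \<subseteq> {h \<in> H. b \<in> h}" using classes_sub by (auto simp: K_def)
  qed (use w Y in auto)
  moreover have "w ` Pow K = Fac b Inv"
  proof (intro equalityI subsetI)
    fix x assume x: "x \<in> Fac b Inv"
    define S where "S = D b x"
    have S: "S \<subseteq> K" using D_Fac[OF base_in_Fac[OF b] x] by (auto simp: S_def K_def D_iff)
    have "w S = x"
    proof (rule Fac_eqI[of _ b Inv])
      fix h assume h: "h \<in> Inv" "w S \<in> h"
      have hH: "h \<in> H" "V - h \<in> H" using h classes_sub H_compl by auto
      have wV: "w S \<in> V" "x \<in> V" using w[OF S] x Fac_V by auto
      show "x \<in> h"
      proof (rule ccontr)
        assume "x \<notin> h"
        show False
        proof (cases "b \<in> h")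
          case True
          then have "h \<in> S" using \<open>x \<notin> h\<close> hH by (simp add: S_def D_iff)
          then have "h \<in> D b (w S)" using w[OF S] by simp
          then show False using h by (simp add: D_iff)
        next
          case False
          then have "V - h \<in> D b (w S)" using hH bV h wV by (auto simp: D_iff)
          then have "V - h \<in> D b x" using w[OF S] by (simp add: S_def)
          then show False using \<open>x \<notin> h\<close> wV by (simp add: D_iff)
        qed
      qed
    qed (use w[OF S] x in auto)
    then show "x \<in> w ` Pow K" using S by blast
  qed (use w in auto)
  ultimately show ?thesis using that[of "Fac b Inv"] base_in_Fac[OF b] by (simp add: K_def)
qed

text \<open>The directions of a cube at \<open>v\<close> are distinct inverted halfspaces containing
  \<open>v\<close>, which bounds its dimension; the bound is attained because the whole factor is a
  cube.\<close>

lemma cube_factor_dimension: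
  assumes b: "b \<in> M"
  shows "m_dimension (Fac b Inv) \<mu> = enat (card {h \<in> Inv. b \<in> h})"
proof -
  define Y where "Y = cubulation (Fac b Inv) \<mu>"
  have Y: "wall_graph Y" unfolding Y_def using cubulation_wall_graph[OF dual_edges_Inv[OF b]] .
  have bV: "b \<in> V" using b M_in by blast
  have le: "n \<le> card {h \<in> Inv. b \<in> h}" if C: "cube Y n C" for n C
  proof -
    have "C \<noteq> {}" using C by (auto simp: cube_def bij_betw_def)
    then obtain v where v: "v \<in> C" by blast
    obtain f h
      where fh: "bij_betw f (Pow {..<n}) C" "inj_on h {..<n}" "\<And>A. A \<subseteq> {..<n} \<Longrightarrow> D v (f A) = h ` A"
      using cube_structure[OF Y C v] by metis
    have CF: "C \<subseteq> Fac b Inv" using C by (simp add: cube_def Y_def)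
    have "f {..<n} \<in> C" using fh(1) by (auto simp: bij_betw_def)
    then have "D v (f {..<n}) \<subseteq> Inv" using D_Fac v CF by blast
    then have "h ` {..<n} \<subseteq> {h \<in> Inv. v \<in> h}" using fh(3)[of "{..<n}"] by (auto simp: D_def)
    then have "card (h ` {..<n}) \<le> card {h \<in> Inv. v \<in> h}" using Inv_finite by (intro card_mono) auto
    also have "\<dots> \<le> card {h \<in> Inv. b \<in> h}" using card_Inv_containing[OF Fac_V bV] v CF by blast
    finally show ?thesis using card_image[OF fh(2)] by simp
  qed
  obtain C where "cube Y (card {h \<in> Inv. b \<in> h}) C"
    using cube_in_Fac[OF b Y] by (auto simp: Y_def)
  then have "enat (card {h \<in> Inv. b \<in> h}) \<in> {enat n |n. \<exists>C. cube Y n C}" by blast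
  moreover have "x \<le> enat (card {h \<in> Inv. b \<in> h})" if "x \<in> {enat n |n. \<exists>C. cube Y n C}" for x
    using that le by auto
  ultimately show ?thesis
    unfolding m_dimension_def dimension_def Y_def[symmetric] by (intro antisym Sup_least Sup_upper)
qed

lemma cube_factor_finite_dimensional:
  assumes b: "b \<in> M"
  shows "finite_dimensional_cube (Fac b Inv) \<mu>"
proof -
  define K where "K = {h \<in> Inv. b \<in> h}"
  have bV: "b \<in> V" using b M_in by blast
  have K: "finite K" "K \<subseteq> H" "K \<subseteq> Inv" using Inv_finite classes_sub by (auto simp: K_def)
  obtain e where e: "bij_betw e {..<card K} K"
    using K(1) ex_bij_betw_nat_finite[of K] by (auto simp: atLeast0LessThan)
  have eK: "e i \<in> K" if "i < card K" for i using e that by (auto simp: bij_betw_def)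
  define f where "f x = (\<lambda>i\<in>{..<card K}. x \<in> e i)" for x
  have "bij_betw f (Fac b Inv) (cube_algebra (card K))"
  proof (rule bij_betw_imageI)
    show "inj_on f (Fac b Inv)"
    proof (rule inj_onI)
      fix x y assume xy: "x \<in> Fac b Inv" "y \<in> Fac b Inv" "f x = f y"
      have on_K: "x \<in> h \<longleftrightarrow> y \<in> h" if "h \<in> K" for h
      proof -
        have "h \<in> e ` {..<card K}" using bij_betw_imp_surj_on[OF e] that by simp
        then obtain i where i: "i < card K" "h = e i" by auto
        then show ?thesis using fun_cong[OF xy(3), of i] by (simp add: f_def)
      qed
      show "x = y"
      proof (rule Fac_eqI[OF xy(1,2)])
        fix h assume h: "h \<in> Inv" "x \<in> h"
        show "y \<in> h"
        proof (cases "b \<in> h")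
          case True
          then show ?thesis using on_K h by (simp add: K_def)
        next
          case False
          then have "V - h \<in> K" using Inv_compl[OF h(1)] bV by (simp add: K_def)
          then show ?thesis using on_K[of "V - h"] h xy Fac_V by blast
        qed
      qed
    qed
    show "f ` Fac b Inv = cube_algebra (card K)"
    proof (intro equalityI subsetI)
      fix p assume p: "p \<in> cube_algebra (card K)"
      define S where "S = {e i | i. i < card K \<and> \<not> p i}"
      have "S \<subseteq> {h \<in> Inv. b \<in> h}" using eK by (auto simp: S_def K_def)
      then obtain v where v: "v \<in> Fac b Inv" "D b v = S" using flip_Fac[OF b] by blast
      have "f v = p"
      proof (rule ext)
        fix i
        show "f v i = p i"
        proof (cases "i < card K")
          case True
          have "e i \<in> H" "b \<in> e i" using eK[OF True] K by (auto simp: K_def)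
          then have "v \<in> e i \<longleftrightarrow> e i \<notin> S" using v(2) by (auto simp: D_def)
          moreover have "e i \<in> S \<longleftrightarrow> \<not> p i"
            using bij_betw_imp_inj_on[OF e] True by (auto simp: S_def inj_on_def)
          ultimately show ?thesis using True by (simp add: f_def)
        next
          case False
          then show ?thesis using p by (simp add: f_def cube_algebra_def PiE_def extensional_def)
        qed
      qed
      then show "p \<in> f ` Fac b Inv" using v by blast
    qed (auto simp: f_def cube_algebra_def)
  qed
  moreover have "f (\<mu> x y z) = cube_median (card K) (f x) (f y) (f z)"
    if xyz: "x \<in> Fac b Inv" "y \<in> Fac b Inv" "z \<in> Fac b Inv" for x y z
  proof (rule ext)
    fix i
    show "f (\<mu> x y z) i = cube_median (card K) (f x) (f y) (f z) i"
    proof (cases "i < card K")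
      case True
      then have "e i \<in> H" using eK K by blast
      then show ?thesis
        using \<mu>_iff[OF Fac_V[OF xyz(1)] Fac_V[OF xyz(2)] Fac_V[OF xyz(3)], of "e i"] True
        by (simp add: f_def cube_median_def)
    qed (simp add: f_def cube_median_def)
  qed
  ultimately show ?thesis
    unfolding finite_dimensional_cube_def median_iso_def by blast
qed

subsection \<open>The flat factor\<close>

lemma translation_const: "x \<in> M \<Longrightarrow> y \<in> M \<Longrightarrow> card (N x (a 1 x)) = card (N y (a 1 y))"
  using translation_min M_in by (meson antisym)

text \<open>The axis through \<open>x\<close> need not stay in the fibre, as its \<open>Inv\<close>
  sides may vary. Projecting it to the fibre keeps the counted distances, because the
  \<open>Triv\<close> sides are constant along the axis and only \<open>Skew\<close> walls are
  counted on it.\<close>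

lemma axis_in_Fac:
  assumes b: "b \<in> M" and x: "x \<in> Fac b Skew" and S: "Skew \<noteq> {}"
  obtains \<gamma> :: "int \<Rightarrow> 'a" where "\<gamma> 0 = x" "\<And>i. \<gamma> i \<in> Fac b Skew"
    "\<And>i. pr b Skew (a 1 (\<gamma> i)) = \<gamma> (i + int (card (N b (a 1 b))))"
    "\<And>i j. int (card (D (\<gamma> i) (\<gamma> j))) = \<bar>i - j\<bar>"
    "\<And>e h. h \<in> Skew \<Longrightarrow> \<gamma> (e * int (card (N b (a 1 b)))) \<in> h \<longleftrightarrow> a e x \<in> h"
proof -
  have xM: "x \<in> M" using x Fac_M by blast
  have l: "card (N x (a 1 x)) = card (N b (a 1 b))" using translation_const xM b .
  have l0: "0 < card (N x (a 1 x))" using translation_pos_iff[OF xM] S by blast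
  obtain c :: "int \<Rightarrow> 'a"
    where c: "c 0 = x" "\<And>i. c i \<in> M" "\<And>i. c (i + int (card (N b (a 1 b)))) = a 1 (c i)"
    "\<And>i j. int (card (N (c i) (c j))) = \<bar>i - j\<bar>" "\<And>i h. h \<in> Triv \<Longrightarrow> c i \<in> h \<longleftrightarrow> x \<in> h"
    using axis_exists[OF xM l0] unfolding l by metis
  define \<gamma> where "\<gamma> i = pr b Skew (c i)" for i
  have \<gamma>F: "\<gamma> i \<in> Fac b Skew" and \<gamma>_iff: "h \<in> Skew \<Longrightarrow> \<gamma> i \<in> h \<longleftrightarrow> c i \<in> h" for i h
    using pr_spec[OF b is_class_simps(2) c(2)] by (auto simp: \<gamma>_def)
  have cl: "c (e * int (card (N b (a 1 b)))) = a e x" for e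
  proof (induction e rule: int_induct[where k = 0])
    case base
    then show ?case using c(1) a_zero M_in[OF xM] by simp
  next
    case (step1 i)
    then show ?case using c(3)[of "i * int (card (N b (a 1 b)))"] a_add[OF M_in[OF xM], of 1 i]
      by (simp add: algebra_simps)
  next
    case (step2 i)
    define y where "y = c ((i - 1) * int (card (N b (a 1 b))))"
    have yV: "y \<in> V" using c(2) M_in by (simp add: y_def)
    have "a 1 y = a i x"
      using c(3)[of "(i - 1) * int (card (N b (a 1 b)))"] step2 by (simp add: y_def algebra_simps)
    then have "a (- 1) (a 1 y) = a (- 1) (a i x)" by simp
    then show ?case
      using a_add[OF yV, of "- 1" 1] a_zero[OF yV] a_add[OF M_in[OF xM], of "- 1" i]
      by (simp add: y_def)
  qed
  have "pr b Skew (a 1 (\<gamma> i)) = \<gamma> (i + int (card (N b (a 1 b))))" for i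
  proof (rule pr_eqI[OF \<gamma>F])
    fix h assume h: "h \<in> Skew"
    have hH: "h \<in> H" using h classes_sub by blast
    have "\<gamma> (i + int (card (N b (a 1 b)))) \<in> h \<longleftrightarrow> a 1 (c i) \<in> h" using \<gamma>_iff[OF h] c(3) by simp
    also have "\<dots> \<longleftrightarrow> c i \<in> a (- 1) ` h" using a_mem[OF M_in[OF c(2)] hH] .
    also have "\<dots> \<longleftrightarrow> \<gamma> i \<in> a (- 1) ` h" using \<gamma>_iff[OF Skew_shift[OF h]] by simp
    also have "\<dots> \<longleftrightarrow> a 1 (\<gamma> i) \<in> h" using a_mem[OF Fac_V[OF \<gamma>F] hH, of 1] by simp
    finally show "\<gamma> (i + int (card (N b (a 1 b)))) \<in> h \<longleftrightarrow> a 1 (\<gamma> i) \<in> h" .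
  qed
  moreover have "D (\<gamma> i) (\<gamma> j) = N (c i) (c j)" for i j
  proof (intro equalityI subsetI)
    fix h assume h: "h \<in> D (\<gamma> i) (\<gamma> j)"
    then have "h \<in> Skew" using D_Fac[OF \<gamma>F \<gamma>F] by blast
    then show "h \<in> N (c i) (c j)" using h \<gamma>_iff[of h] Skew_Inv by (auto simp: D_iff N_iff)
  next
    fix h assume h: "h \<in> N (c i) (c j)"
    then have "h \<in> Skew" using H_cases[of h] c(5)[of h] by (auto simp: N_iff)
    then show "h \<in> D (\<gamma> i) (\<gamma> j)" using h \<gamma>_iff[of h] by (auto simp: D_iff N_iff)
  qed
  moreover have "\<gamma> 0 = x" using c(1) pr_id[OF x] by (simp add: \<gamma>_def)
  moreover have "\<gamma> (e * int (card (N b (a 1 b)))) \<in> h \<longleftrightarrow> a e x \<in> h" if "h \<in> Skew" for e h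
    using \<gamma>_iff[OF that] cl by simp
  ultimately show ?thesis using that[of \<gamma>] \<gamma>F c(4) by simp
qed

text \<open>The projected axis through \<open>b\<close> follows the orbit of \<open>b\<close>, hence
  passes from one side of each \<open>Skew\<close> halfspace to the other. The edge at which this
  happens has both ends in the fibre and crosses a single wall.\<close>

lemma dual_edges_Skew: assumes b: "b \<in> M" and S: "Skew \<noteq> {}" shows "dual_edges (Fac b Skew) Skew"
  unfolding dual_edges_def
proof (intro conjI ballI)
  show "submedian (Fac b Skew)" using Fac_submedian b .
  show "D x y \<subseteq> Skew" if "x \<in> Fac b Skew" "y \<in> Fac b Skew" for x y using D_Fac that .
  fix h assume h: "h \<in> Skew"
  have bV: "b \<in> V" using b M_in by blast
  define l where "l = card (N b (a 1 b))"
  obtain \<gamma> :: "int \<Rightarrow> 'a"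
    where g: "\<And>i. \<gamma> i \<in> Fac b Skew" "\<And>i j. int (card (D (\<gamma> i) (\<gamma> j))) = \<bar>i - j\<bar>"
    "\<And>e h. h \<in> Skew \<Longrightarrow> \<gamma> (e * int l) \<in> h \<longleftrightarrow> a e b \<in> h"
    using axis_in_Fac[OF b base_in_Fac[OF b] S] unfolding l_def[symmetric] by metis
  have hH: "h \<in> H" using h classes_sub by blast
  have *: "\<exists>i. \<gamma> i \<notin> k \<and> \<gamma> (i + 1) \<in> k" if k: "pos k" for k
  proof -
    have kS: "k \<in> Skew" using k by (simp add: Skew_def pos_def)
    obtain m where m: "m \<le> 0" "a m b \<notin> k" using pos_reach(2)[OF bV k] by blast
    obtain n where n: "n \<ge> 0" "a n b \<in> k" using pos_reach(1)[OF bV k] by blast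
    have out: "\<gamma> (m * int l) \<notin> k" and inn: "\<gamma> (n * int l) \<in> k" using g(3)[OF kS] m n by auto
    have "m * int l \<le> 0" "0 \<le> n * int l" using m n by (auto simp: mult_nonpos_nonneg)
    then have le: "m * int l \<le> n * int l" by linarith
    show ?thesis
    proof (rule ccontr)
      assume "\<not> ?thesis"
      then have "\<And>i. \<gamma> i \<notin> k \<Longrightarrow> \<gamma> (i + 1) \<notin> k" by blast
      then show False
        using int_step_mono[of "\<lambda>i. \<gamma> i \<notin> k" "m * int l" "n * int l"] out inn le by blast
    qed
  qed
  have single: "D (\<gamma> i) (\<gamma> j) = {h}" if "\<gamma> i \<in> h" "\<gamma> j \<notin> h" "\<bar>i - j\<bar> = 1" for i j
  proof -
    have "card (D (\<gamma> i) (\<gamma> j)) = 1" using g(2)[of i j] that by simp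
    moreover have "h \<in> D (\<gamma> i) (\<gamma> j)" using that hH by (simp add: D_iff)
    ultimately show ?thesis by (metis card_1_singletonE singletonD)
  qed
  have "pos h \<or> pos (V - h)" using h by (simp add: Skew_def)
  then show "\<exists>u\<in>Fac b Skew. \<exists>v\<in>Fac b Skew. D u v = {h}"
  proof
    assume "pos h"
    then obtain i where "\<gamma> i \<notin> h" "\<gamma> (i + 1) \<in> h" using * by blast
    then have "D (\<gamma> (i + 1)) (\<gamma> i) = {h}" by (intro single) auto
    then show ?thesis using g(1) by blast
  next
    assume "pos (V - h)"
    then obtain i where "\<gamma> i \<notin> V - h" "\<gamma> (i + 1) \<in> V - h" using * by blast
    then have "D (\<gamma> i) (\<gamma> (i + 1)) = {h}" using Fac_V[OF g(1)] by (intro single) auto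
    then show ?thesis using g(1) by blast
  qed
qed

lemma flat_translation:
  assumes b: "b \<in> M" and S: "Skew \<noteq> {}" and x: "x \<in> Fac b Skew"
    and f: "\<And>y. y \<in> Fac b Skew \<Longrightarrow> f y = pr b Skew (a 1 y)"
  shows "\<exists>\<gamma>. translates_along (cubulation (Fac b Skew) \<mu>) f (card (N b (a 1 b))) \<gamma> \<and> x \<in> range \<gamma>"
proof -
  define Y where "Y = cubulation (Fac b Skew) \<mu>"
  have K: "dual_edges (Fac b Skew) Skew" using dual_edges_Skew b S .
  have verts: "verts Y = Fac b Skew" by (simp add: Y_def)
  have edge: "{u, v} \<in> edges Y \<longleftrightarrow> card (D u v) = 1" if "u \<in> verts Y" "v \<in> verts Y" for u v
    using cubulation_edges[OF K] that by (simp add: Y_def)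
  obtain \<gamma> :: "int \<Rightarrow> 'a" where g: "\<gamma> 0 = x" "\<And>i. \<gamma> i \<in> Fac b Skew"
    "\<And>i. pr b Skew (a 1 (\<gamma> i)) = \<gamma> (i + int (card (N b (a 1 b))))" "\<And>i j. int (card (D (\<gamma> i) (\<gamma> j))) = \<bar>i - j\<bar>"
    using axis_in_Fac[OF b x S] by metis
  have gY: "\<gamma> i \<in> verts Y" for i using g(2) verts by simp
  have "bi_infinite_geodesic Y \<gamma>"
  proof (rule bi_infinite_geodesicI[of Y "\<lambda>x y. card (D x y)"])
    show "card (D u w) \<le> card (D u v) + card (D v w)"
      if "u \<in> verts Y" "v \<in> verts Y" "w \<in> verts Y" for u v w
      using D_triangle that Fac_V unfolding verts by blast
    show "card (D u u) = 0" for u by (simp add: D_def)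
    show "card (D u v) \<le> 1" if "{u, v} \<in> edges Y" "u \<in> verts Y" "v \<in> verts Y" for u v
      using edge that by simp
    show "{\<gamma> i, \<gamma> (i + 1)} \<in> edges Y" for i
      using edge[OF gY gY, of i "i + 1"] g(4)[of i "i + 1"] by simp
  qed (use gY g(4) in auto)
  then have "translates_along Y f (card (N b (a 1 b))) \<gamma>"
    unfolding translates_along_def using f[OF g(2)] g(3) by simp
  moreover have "x \<in> range \<gamma>" using g(1) by (metis rangeI)
  ultimately show ?thesis unfolding Y_def by blast
qed

text \<open>Every \<open>Skew\<close> halfspace or its complement has a translate separating
  \<open>b\<close> from \<open>a 1 b\<close>. Different directions of a cube cannot be translates of
  each other in the same sense, for such translates are nested on \<open>M\<close>, while all
  combinations of sides occur in a cube. So the directions inject into a set whose size is the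
  translation length.\<close>

lemma flat_dimension_le:
  assumes b: "b \<in> M" and S: "Skew \<noteq> {}" and C: "cube (cubulation (Fac b Skew) \<mu>) n C"
  shows "n \<le> card (N b (a 1 b))"
proof -
  define Y where "Y = cubulation (Fac b Skew) \<mu>"
  have Y: "wall_graph Y" unfolding Y_def using cubulation_wall_graph[OF dual_edges_Skew[OF b S]] .
  have bV: "b \<in> V" using b M_in by blast
  have "C \<noteq> {}" using C by (auto simp: cube_def bij_betw_def)
  then obtain v where v: "v \<in> C" by blast
  obtain f h
    where fh: "bij_betw f (Pow {..<n}) C" "f {} = v" "inj_on h {..<n}" "\<And>A. A \<subseteq> {..<n} \<Longrightarrow> D v (f A) = h ` A"
    using cube_structure[OF Y C[folded Y_def] v] by metis
  have CF: "C \<subseteq> Fac b Skew" using C by (simp add: cube_def)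
  have fC: "f A \<in> Fac b Skew" if "A \<subseteq> {..<n}" for A using fh(1) that CF by (auto simp: bij_betw_def)
  have hS: "h i \<in> Skew" and vh: "v \<in> h i" if "i < n" for i
  proof -
    have "D v (f {i}) = {h i}" using fh(4)[of "{i}"] that by simp
    then show "h i \<in> Skew" "v \<in> h i"
      using D_Fac[of v b Skew "f {i}"] v CF fC[of "{i}"] that by (auto simp: D_def)
  qed
  have f_mem: "f A \<in> h i \<longleftrightarrow> i \<notin> A" if "A \<subseteq> {..<n}" "i < n" for A i
  proof -
    have "h i \<in> H" using hS[OF that(2)] classes_sub by blast
    then have "f A \<in> h i \<longleftrightarrow> h i \<notin> h ` A" using fh(4)[OF that(1)] vh[OF that(2)] by (auto simp: D_def)
    also have "\<dots> \<longleftrightarrow> i \<notin> A" using fh(3) that by (auto simp: inj_on_def)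
    finally show ?thesis .
  qed
  \<comment> \<open>All directions are turned the same way, with attracting complement. This makes
    translates nested and places them in \<open>N b (a 1 b)\<close> and not in the reversed
    set.\<close>
  define k where "k i = (if pos (h i) then V - h i else h i)" for i
  have k: "k i \<in> Skew" "pos (V - k i)" if "i < n" for i
    using hS[OF that] Skew_compl H_compl_compl classes_sub(2) unfolding k_def Skew_def by auto
  have k_mem: "f A \<in> k i \<longleftrightarrow> (i \<in> A) = pos (h i)" if "A \<subseteq> {..<n}" "i < n" for A i
    using f_mem[OF that] Fac_V[OF fC[OF that(1)]] by (auto simp: k_def)
  have "\<exists>m. a m ` k i \<in> N b (a 1 b)" if i: "i < n" for i
  proof -
    have kH: "k i \<in> H" using k(1)[OF i] classes_sub by blast
    obtain m where m: "a m b \<notin> V - k i" "a (m + 1) b \<in> V - k i"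
      using pos_crossing[OF bV k(2)[OF i]] .
    have "a (- m) ` k i \<in> Skew" using Skew_shift[OF k(1)[OF i]] .
    moreover have "b \<in> a (- m) ` k i" "a 1 b \<notin> a (- m) ` k i"
      using m a_in[OF bV] a_mem[OF bV kH, of m] a_mem_shift[OF bV kH, of 1 "- m"]
      by (auto simp: add.commute)
    ultimately have "a (- m) ` k i \<in> N b (a 1 b)" using Skew_Inv classes_sub by (auto simp: N_iff)
    then show ?thesis by blast
  qed
  then obtain m where m: "\<And>i. i < n \<Longrightarrow> a (m i) ` k i \<in> N b (a 1 b)" by metis
  have anti: "z \<in> k i \<Longrightarrow> 0 \<le> p \<Longrightarrow> a (- p) z \<in> k i" if z: "z \<in> M" and i: "i < n" for z p i
  proof -
    assume zk: "z \<in> k i" "0 \<le> p"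
    have zV: "z \<in> V" using z M_in by blast
    show "a (- p) z \<in> k i"
    proof (rule ccontr)
      assume "a (- p) z \<notin> k i"
      then have "a (- p) z \<in> V - k i" using a_in[OF zV] by blast
      then have "a 0 z \<in> V - k i" using pos_step[OF z k(2)[OF i], of "- p" 0] zk by simp
      then show False using zk a_zero[OF zV] by simp
    qed
  qed
  \<comment> \<open>The vertex \<open>f A\<close> of the cube is chosen inside \<open>k i\<close>
    and outside \<open>k j\<close>. As the translate of \<open>k i\<close> by a non-negative
    \<open>p\<close> contains all points of \<open>M\<close> lying in \<open>k i\<close>, it cannot
    equal \<open>k j\<close>.\<close>
  have nested: False if ij: "i < n" "j < n" "i \<noteq> j" "k j = a p ` k i" "0 \<le> p" for i j p
  proof -
    define A where "A = (if pos (h i) then {i} else {}) \<union> (if pos (h j) then {} else {j})"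
    have A: "A \<subseteq> {..<n}" using ij by (auto simp: A_def)
    have "f A \<in> k i" "f A \<notin> k j"
      using k_mem[OF A ij(1)] k_mem[OF A ij(2)] ij(3) by (auto simp: A_def)
    moreover have "a (- p) (f A) \<in> k i" using anti[OF Fac_M[OF fC[OF A]] ij(1) \<open>f A \<in> k i\<close> ij(5)] .
    moreover have "k i \<in> H" using k(1)[OF ij(1)] classes_sub by blast
    ultimately show False using mem_shift[OF Fac_V[OF fC[OF A]], of "k i" p] ij(4) by simp
  qed
  have "inj_on (\<lambda>i. a (m i) ` k i) {..<n}"
  proof (rule inj_onI, rule ccontr)
    fix i j assume ij: "i \<in> {..<n}" "j \<in> {..<n}" "a (m i) ` k i = a (m j) ` k j" "i \<noteq> j"
    have kH: "k i \<in> H" "k j \<in> H" using k(1) classes_sub ij by auto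
    have 1: "k j = a (m i - m j) ` k i"
      using arg_cong[OF ij(3), of "\<lambda>s. a (- m j) ` s"] shift_add[OF kH(1)] shift_add[OF kH(2)] shift_zero[OF kH(2)]
      by (simp add: add.commute)
    have 2: "k i = a (m j - m i) ` k j"
      using arg_cong[OF ij(3), of "\<lambda>s. a (- m i) ` s"] shift_add[OF kH(1)] shift_add[OF kH(2)] shift_zero[OF kH(1)]
      by (simp add: add.commute)
    show False
    proof (cases "m j \<le> m i")
      case True
      show False by (rule nested[OF _ _ ij(4) 1]) (use ij True in auto)
    next
      case False
      show False by (rule nested[OF _ _ ij(4)[symmetric] 2]) (use ij False in auto)
    qed
  qed
  then have "card {..<n} \<le> card (N b (a 1 b))"
    by (rule card_inj_on_le) (use m N_finite[OF bV a_in[OF bV]] in auto)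
  then show ?thesis by simp
qed

text \<open>The boundary points are the two limits of the orbit of \<open>b\<close>, projected to
  the factor. Each halfspace of the factor is a trace of a \<open>Skew\<close> halfspace, so it
  contains exactly one of the two ends of the orbit.\<close>

lemma flat_median_flat:
  assumes b: "b \<in> M" and S: "Skew \<noteq> {}"
  shows "median_flat (Fac b Skew) \<mu>"
proof -
  define F where "F = Fac b Skew"
  define W where "W = m_walls F \<mu>"
  have bV: "b \<in> V" using b M_in by blast
  have sub: "submedian F" using Fac_submedian[OF b] by (simp add: F_def)
  have FV: "x \<in> V" if "x \<in> F" for x using that Fac_V by (simp add: F_def)
  have FM: "x \<in> M" if "x \<in> F" for x using that Fac_M by (simp add: F_def)
  have bF: "b \<in> F" using base_in_Fac[OF b] by (simp add: F_def)
  have hs_compl: "m_halfspace F \<mu> (F - A)" if "m_halfspace F \<mu> A" for A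
    using that by (auto simp: m_halfspace_def m_convex_def double_diff)
  have UW: "A \<in> \<Union>W \<longleftrightarrow> m_halfspace F \<mu> A" for A
  proof
    assume "A \<in> \<Union>W"
    then obtain B where "m_halfspace F \<mu> B" "A = B \<or> A = F - B" by (auto simp: W_def m_walls_def)
    then show "m_halfspace F \<mu> A" using hs_compl by auto
  qed (auto simp: W_def m_walls_def)
  have dim: "m_dimension F \<mu> \<noteq> \<infinity>"
  proof -
    have "dimension (cubulation F \<mu>) \<le> enat (card (N b (a 1 b)))"
      unfolding dimension_def
      using flat_dimension_le[OF b S] by (intro Sup_least) (auto simp: F_def)
    then show ?thesis unfolding m_dimension_def by (metis enat_ord_simps(5) infinity_ileE)
  qed
  \<comment> \<open>The orbit of \<open>b\<close> leaves the fibre in general; its projection is on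
    the same side of each \<open>Skew\<close> halfspace, and these are the ones that cut the
    factor.\<close>
  define q where "q n = pr b Skew (a n b)" for n :: int
  have qF: "q n \<in> F" and q_iff: "h \<in> Skew \<Longrightarrow> q n \<in> h \<longleftrightarrow> a n b \<in> h" for n h
    using pr_spec[OF b is_class_simps(2) M_shift[OF b]] by (auto simp: q_def F_def)
  define up where "up A \<longleftrightarrow> (\<exists>N. \<forall>n\<ge>N. q n \<in> A)" for A
  define dn where "dn A \<longleftrightarrow> (\<exists>N. \<forall>n\<ge>N. q (- n) \<in> A)" for A
  have trace: "(up A \<and> dn (F - A)) \<or> (up (F - A) \<and> dn A)" if A: "m_halfspace F \<mu> A" for A
  proof -
    obtain h where h: "h \<in> H" "A = F \<inter> h" using halfspace_trace[OF sub A] .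
    obtain x y where "x \<in> A" "y \<in> F - A" using A by (auto simp: m_halfspace_def)
    then have "h \<in> D x y" "x \<in> F" "y \<in> F" using h by (auto simp: D_iff)
    then have hS: "h \<in> Skew" using D_Fac unfolding F_def by blast
    have qA: "q n \<in> A \<longleftrightarrow> a n b \<in> h" "q n \<in> F - A \<longleftrightarrow> a n b \<in> V - h" for n
      using q_iff[OF hS] qF h a_in[OF bV] by auto
    have "pos h \<or> pos (V - h)" using hS by (simp add: Skew_def)
    then show ?thesis
    proof
      assume "pos h"
      then obtain N where "\<forall>n\<ge>N. a n b \<in> h \<and> a (- n) b \<notin> h" using bV unfolding pos_def by meson
      then have "up A" "dn (F - A)" unfolding up_def dn_def qA using a_in[OF bV] by blast+
      then show ?thesis by blast
    next
      assume "pos (V - h)"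
      then obtain N where "\<forall>n\<ge>N. a n b \<in> V - h \<and> a (- n) b \<notin> V - h"
        using bV unfolding pos_def by meson
      then have "up (F - A)" "dn A" unfolding up_def dn_def qA using a_in[OF bV] by blast+
      then show ?thesis by blast
    qed
  qed
  have up_excl: "\<not> (up A \<and> up B)" if AB: "A \<inter> B = {}" for A B
  proof
    assume "up A \<and> up B"
    then obtain n1 n2 where "\<forall>n\<ge>n1. q n \<in> A" "\<forall>n\<ge>n2. q n \<in> B" by (auto simp: up_def)
    then have "q (max n1 n2) \<in> A" "q (max n1 n2) \<in> B" by auto
    then show False using AB by blast
  qed
  have dn_excl: "\<not> (dn A \<and> dn B)" if AB: "A \<inter> B = {}" for A B
  proof
    assume "dn A \<and> dn B"
    then obtain n1 n2 where "\<forall>n\<ge>n1. q (- n) \<in> A" "\<forall>n\<ge>n2. q (- n) \<in> B" by (auto simp: dn_def)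
    then have "q (- max n1 n2) \<in> A" "q (- max n1 n2) \<in> B" by auto
    then show False using AB by blast
  qed
  have or: "orientation W {A \<in> \<Union>W. P A}"
    if ex: "\<And>A. m_halfspace F \<mu> A \<Longrightarrow> P A \<or> P (F - A)" and excl: "\<And>A. \<not> (P A \<and> P (F - A))"
      and mono: "\<And>A B. A \<subseteq> B \<Longrightarrow> P A \<Longrightarrow> P B" for P
    unfolding orientation_def
  proof (intro conjI ballI impI)
    fix w assume "w \<in> W"
    then obtain B where B: "m_halfspace F \<mu> B" "w = {B, F - B}" by (auto simp: W_def m_walls_def)
    have "B \<in> \<Union>W" "F - B \<in> \<Union>W" using UW B hs_compl by auto
    then show "\<exists>!A. A \<in> w \<and> A \<in> {A \<in> \<Union>W. P A}"
      using ex[OF B(1)] excl[of B] B(2) by auto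
  qed (use mono in blast)+
  define \<zeta> where "\<zeta> = {A \<in> \<Union>W. up A}"
  define \<xi> where "\<xi> = {A \<in> \<Union>W. dn A}"
  have "orientation W \<zeta>" unfolding \<zeta>_def
  proof (rule or)
    show "up A \<or> up (F - A)" if "m_halfspace F \<mu> A" for A using trace[OF that] by blast
    show "\<not> (up A \<and> up (F - A))" for A by (rule up_excl) blast
    show "up B" if "A \<subseteq> B" "up A" for A B using that unfolding up_def by blast
  qed
  moreover have "orientation W \<xi>" unfolding \<xi>_def
  proof (rule or)
    show "dn A \<or> dn (F - A)" if "m_halfspace F \<mu> A" for A using trace[OF that] by blast
    show "\<not> (dn A \<and> dn (F - A))" for A by (rule dn_excl) blast
    show "dn B" if "A \<subseteq> B" "dn A" for A B using that unfolding dn_def by blast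
  qed
  moreover have or_p: "orientation W (principal W p)" if p: "p \<in> F" for p
  proof -
    have "orientation W {A \<in> \<Union>W. p \<in> A}" by (rule or) (use p in auto)
    then show ?thesis by (simp add: principal_def)
  qed
  have pos_trace: "m_halfspace F \<mu> (F \<inter> h) \<and> up (F \<inter> h) \<and> dn (F - h)" if h: "pos h" for h
  proof -
    have hS: "h \<in> Skew" "h \<in> H" using h by (auto simp: Skew_def pos_def)
    obtain N where N: "\<forall>n\<ge>N. a n b \<in> h \<and> a (- n) b \<notin> h" using h bV unfolding pos_def by meson
    have u: "q n \<in> F \<inter> h" "q (- n) \<in> F - h" if "n \<ge> N" for n
      using N that q_iff[OF hS(1)] qF by auto
    have "F \<inter> h \<noteq> {}" "F - h \<noteq> {}" using u[of N] by auto
    then have "m_halfspace F \<mu> (F \<inter> h)" using trace_halfspace[OF sub hS(2)] by blast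
    then show ?thesis using u unfolding up_def dn_def by blast
  qed
  obtain k where k: "pos k" using S H_compl by (auto simp: Skew_def)
  \<comment> \<open>Every vertex \<open>p\<close> lies outside some translate of an attracting
    halfspace, but the forward end lies in the traces of all of them. For \<open>\<xi>\<close> the
    roles are exchanged.\<close>
  have "\<zeta> \<noteq> principal W p" if p: "p \<in> F" for p
  proof
    assume eq: "\<zeta> = principal W p"
    obtain n where n: "a n p \<notin> k" using pos_reach(2)[OF FV[OF p] k, of 0] by blast
    have kH: "k \<in> H" using k by (simp add: pos_def)
    define h where "h = a (- n) ` k"
    have h: "pos h" "p \<notin> h"
      using pos_shift[OF k] a_mem[OF FV[OF p] kH, of n] n by (auto simp: h_def)
    have "F \<inter> h \<in> \<zeta>" using pos_trace[OF h(1)] UW by (simp add: \<zeta>_def)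
    then show False using eq h by (simp add: principal_def)
  qed
  moreover have "\<xi> \<noteq> principal W p" if p: "p \<in> F" for p
  proof
    assume eq: "\<xi> = principal W p"
    obtain n where n: "a n p \<in> k" using pos_reach(1)[OF FV[OF p] k, of 0] by blast
    have kH: "k \<in> H" using k by (simp add: pos_def)
    define h where "h = a (- n) ` k"
    have h: "pos h" "p \<in> h"
      using pos_shift[OF k] a_mem[OF FV[OF p] kH, of n] n by (auto simp: h_def)
    have e: "F - F \<inter> h = F - h" by blast
    have "F - h \<in> \<xi>"
      using pos_trace[OF h(1)] hs_compl[of "F \<inter> h"] UW unfolding e by (simp add: \<xi>_def)
    then show False using eq h by (simp add: principal_def)
  qed
  ultimately have bd: "\<zeta> \<in> roller_boundary F \<mu>" "\<xi> \<in> roller_boundary F \<mu>"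
    unfolding roller_boundary_def roller_compactification_def W_def[symmetric] by auto
  \<comment> \<open>The two ends are opposite orientations: they disagree on every wall. A majority
    vote of both with a third orientation is then the third one, so the interval between them is the
    whole compactification.\<close>
  have part: "\<zeta> \<inter> \<xi> = {}" "\<zeta> \<union> \<xi> = \<Union>W"
  proof -
    have one: "(up A \<and> \<not> dn A) \<or> (dn A \<and> \<not> up A)" if "A \<in> \<Union>W" for A
      using trace[of A] up_excl[of A "F - A"] dn_excl[of A "F - A"] UW that by blast
    show "\<zeta> \<inter> \<xi> = {}" unfolding \<zeta>_def \<xi>_def using one by auto
    show "\<zeta> \<union> \<xi> = \<Union>W" unfolding \<zeta>_def \<xi>_def using one by auto
  qed
  have "principal W p \<in> m_interval (roller_compactification F \<mu>) roller_median \<zeta> \<xi>"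
    if p: "p \<in> F" for p
  proof -
    have "principal W p \<subseteq> \<zeta> \<union> \<xi>" unfolding part by (auto simp: principal_def)
    then have "roller_median \<zeta> \<xi> (principal W p) = principal W p"
      unfolding roller_median_def using part(1) by blast
    then show ?thesis
      using or_p[OF p] by (simp add: m_interval_def roller_compactification_def W_def)
  qed
  then have "principal W ` F \<subseteq> m_interval (roller_compactification F \<mu>) roller_median \<zeta> \<xi>" by blast
  then show ?thesis
    unfolding median_flat_def F_def[symmetric]
    using bF submedian_algebra[OF sub] submedian_discrete[OF sub] dim bd unfolding W_def by blast
qed

end

section \<open>Group actions normalising a cyclic group\<close>

locale halfspaces_action = halfspaces V H \<mu>
  for V :: "'v set" and H and \<mu> +
  fixes G :: "('g, 'b) monoid_scheme" (structure) and \<phi> :: "'g \<Rightarrow> 'v \<Rightarrow> 'v" and g :: 'g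
  assumes group: "group G"
    and action: "group_action G V \<phi>"
    and \<phi>_H: "f \<in> carrier G \<Longrightarrow> h \<in> H \<Longrightarrow> \<phi> f ` h \<in> H"
    and g_in: "g \<in> carrier G"
    and g_normal: "generate G {g} \<lhd> G"
    and V_nonempty: "V \<noteq> {}"
begin

definition pw :: "int \<Rightarrow> 'v \<Rightarrow> 'v" where
  "pw n = \<phi> (g [^] n)"

lemma \<phi>_in: "f \<in> carrier G \<Longrightarrow> x \<in> V \<Longrightarrow> \<phi> f x \<in> V"
  using group_action.element_image[OF action] by blast

lemma \<phi>_mult: "x \<in> V \<Longrightarrow> f \<in> carrier G \<Longrightarrow> k \<in> carrier G \<Longrightarrow> \<phi> (f \<otimes> k) x = \<phi> f (\<phi> k x)"
  using group_action.composition_rule[OF action] .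

lemma \<phi>_one: "x \<in> V \<Longrightarrow> \<phi> \<one> x = x"
  using group_action.id_eq_one[OF action] by (metis restrict_apply')

lemma \<phi>_inv: "f \<in> carrier G \<Longrightarrow> x \<in> V \<Longrightarrow> \<phi> (m_inv G f) (\<phi> f x) = x"
  "f \<in> carrier G \<Longrightarrow> x \<in> V \<Longrightarrow> \<phi> f (\<phi> (m_inv G f) x) = x"
  using \<phi>_mult[symmetric] \<phi>_one group.inv_closed[OF group] group.l_inv[OF group] group.r_inv[OF group]
  by auto

lemma pow_in: "g [^] (n::int) \<in> carrier G"
  using group.int_pow_closed[OF group g_in] .

sublocale halfspaces_int V H \<mu> pw
proof
  fix x :: 'v and h :: "'v set" and m n :: int
  show "x \<in> V \<Longrightarrow> pw n x \<in> V" unfolding pw_def by (rule \<phi>_in[OF pow_in])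
  show "x \<in> V \<Longrightarrow> pw (m + n) x = pw m (pw n x)"
    unfolding pw_def using \<phi>_mult pow_in group.int_pow_mult[OF group g_in] by simp
  show "x \<in> V \<Longrightarrow> pw 0 x = x"
    unfolding pw_def using \<phi>_one by simp
  show "h \<in> H \<Longrightarrow> pw n ` h \<in> H" unfolding pw_def by (rule \<phi>_H[OF pow_in])
qed (rule V_nonempty)

lemma inv_in: "f \<in> carrier G \<Longrightarrow> m_inv G f \<in> carrier G"
  using group.inv_closed[OF group] .

lemma \<phi>_mem: "f \<in> carrier G \<Longrightarrow> x \<in> V \<Longrightarrow> h \<in> H \<Longrightarrow> \<phi> f x \<in> h \<longleftrightarrow> x \<in> \<phi> (m_inv G f) ` h"
proof
  assume f: "f \<in> carrier G" "x \<in> V" "h \<in> H"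
  show "x \<in> \<phi> (m_inv G f) ` h" if "\<phi> f x \<in> h"
    using that \<phi>_inv(1)[OF f(1,2)] by (metis image_eqI)
  show "\<phi> f x \<in> h" if im: "x \<in> \<phi> (m_inv G f) ` h"
  proof -
    obtain y where "y \<in> h" "x = \<phi> (m_inv G f) y" using im by blast
    then show ?thesis using \<phi>_inv(2)[OF f(1), of y] H_sub[OF f(3)] by auto
  qed
qed

lemma \<phi>_compl: assumes "f \<in> carrier G" "h \<in> H" shows "\<phi> f ` (V - h) = V - \<phi> f ` h"
proof -
  have "inj_on (\<phi> f) V"
    by (rule inj_on_inverseI[where g = "\<phi> (m_inv G f)"]) (rule \<phi>_inv(1)[OF assms(1)])
  moreover have "\<phi> f ` V = V"
  proof (intro equalityI subsetI)
    fix x assume "x \<in> V"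
    then show "x \<in> \<phi> f ` V"
      using \<phi>_inv(2)[OF assms(1)] \<phi>_in[OF inv_in[OF assms(1)]] by (metis image_eqI)
  qed (use \<phi>_in[OF assms(1)] in auto)
  ultimately show ?thesis using inj_on_image_set_diff[of "\<phi> f" V V h] H_sub[OF assms(2)] by simp
qed

lemma \<phi>_inv_image: assumes "f \<in> carrier G" "h \<in> H"
  shows "\<phi> (m_inv G f) ` \<phi> f ` h = h" "\<phi> f ` \<phi> (m_inv G f) ` h = h"
  using \<phi>_inv[OF assms(1)] H_sub[OF assms(2)] by (force simp: image_image)+

section \<open>Conjugation of powers and invariance of the classes\<close>

lemma generate_eq: "generate G {g} = range (\<lambda>n::int. g [^] n)"
  using group.generate_pow[OF group g_in] by auto

text \<open>Normality makes the conjugate of \<open>g\<close> by \<open>f\<close> a power of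
  \<open>g\<close>, whose exponent depends on \<open>f\<close> only. The identity is kept on the
  level of the action because the action may have a kernel.\<close>

lemma power_conj:
  assumes f: "f \<in> carrier G"
  shows "\<exists>e. \<forall>x\<in>V. \<forall>n. \<phi> f (pw n x) = pw (e * n) (\<phi> f x)"
proof -
  have "f \<otimes> g \<otimes> m_inv G f \<in> generate G {g}"
    using normal.inv_op_closed2[OF g_normal f] generate.incl[of g "{g}" G] by blast
  then obtain e where e: "f \<otimes> g \<otimes> m_inv G f = g [^] (e::int)" unfolding generate_eq by blast
  have one: "\<phi> f (pw 1 x) = pw e (\<phi> f x)" if x: "x \<in> V" for x
  proof -
    have "pw e (\<phi> f x) = \<phi> (f \<otimes> g \<otimes> m_inv G f) (\<phi> f x)" unfolding pw_def e ..
    also have "\<dots> = \<phi> f (\<phi> g (\<phi> (m_inv G f) (\<phi> f x)))"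
      using \<phi>_mult \<phi>_in x f g_in inv_in[OF f] monoid.m_closed[OF group.is_monoid[OF group]] by simp
    also have "\<dots> = \<phi> f (pw 1 x)"
      unfolding pw_def using \<phi>_inv(1)[OF f x] group.int_pow_1[OF group g_in] by simp
    finally show ?thesis by simp
  qed
  have "\<phi> f (pw n x) = pw (e * n) (\<phi> f x)" if x: "x \<in> V" for x n
  proof (induction n rule: int_induct[where k = 0])
    case base
    then show ?case using a_zero x \<phi>_in[OF f x] by simp
  next
    case (step1 i)
    have "\<phi> f (pw (i + 1) x) = \<phi> f (pw 1 (pw i x))"
      using a_add[OF x, of 1 i] by (simp add: add.commute)
    also have "\<dots> = pw e (pw (e * i) (\<phi> f x))" using one[OF a_in[OF x]] step1 by simp
    also have "\<dots> = pw (e * (i + 1)) (\<phi> f x)"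
      using a_add[OF \<phi>_in[OF f x], of e "e * i"] by (simp add: algebra_simps)
    finally show ?case .
  next
    case (step2 i)
    have "\<phi> f (pw i x) = \<phi> f (pw 1 (pw (i - 1) x))" using a_add[OF x, of 1 "i - 1"] by simp
    also have "\<dots> = pw e (\<phi> f (pw (i - 1) x))" using one[OF a_in[OF x]] .
    finally have "pw (- e) (pw (e * i) (\<phi> f x)) = pw (- e) (pw e (\<phi> f (pw (i - 1) x)))"
      using step2 by simp
    then show ?case
      using a_add[OF \<phi>_in[OF f x], of "- e" "e * i"] a_add[OF \<phi>_in[OF f a_in[OF x]], of "- e" e "i - 1"]
        a_zero[OF \<phi>_in[OF f a_in[OF x]]] by (simp add: algebra_simps)
  qed
  then show ?thesis by blast
qed

text \<open>Conjugating back shows that \<open>g\<close> acts like its power with exponent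
  \<open>e' * e\<close>. Translates of an attracting halfspace are distinct, so this product is 1
  and both factors are units.\<close>

lemma power_conj_sign:
  assumes f: "f \<in> carrier G" and S: "Skew \<noteq> {}"
  shows "\<exists>e. (e = 1 \<or> e = -1) \<and> (\<forall>x\<in>V. \<forall>n. \<phi> f (pw n x) = pw (e * n) (\<phi> f x))"
proof -
  obtain e where e: "\<And>x n. x \<in> V \<Longrightarrow> \<phi> f (pw n x) = pw (e * n) (\<phi> f x)"
    using power_conj[OF f] by blast
  obtain e' where e': "\<And>x n. x \<in> V \<Longrightarrow> \<phi> (m_inv G f) (pw n x) = pw (e' * n) (\<phi> (m_inv G f) x)"
    using power_conj[OF inv_in[OF f]] by blast
  have fx: "pw 1 x = pw (e' * e) x" if x: "x \<in> V" for x
  proof -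
    have "pw 1 x = \<phi> (m_inv G f) (\<phi> f (pw 1 x))" using \<phi>_inv(1)[OF f a_in[OF x]] by simp
    also have "\<dots> = pw (e' * e) (\<phi> (m_inv G f) (\<phi> f x))"
      using e[OF x, of 1] e'[OF \<phi>_in[OF f x], of e] by simp
    also have "\<dots> = pw (e' * e) x" using \<phi>_inv(1)[OF f x] by simp
    finally show ?thesis .
  qed
  obtain h where h: "pos h" using S H_compl by (auto simp: Skew_def)
  have hV: "h \<subseteq> V" using h H_sub by (simp add: pos_def)
  have "pw 1 ` h = pw (e' * e) ` h" by (rule image_cong[OF refl]) (use fx hV in blast)
  then have "e' * e = 1" using injD[OF pos_inj[OF h], of 1 "e' * e"] by simp
  then have "e = 1 \<or> e = -1" using zmult_eq_1_iff[of e' e] by auto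
  then show ?thesis using e by blast
qed

lemma \<phi>_Inv: assumes f: "f \<in> carrier G" and h: "h \<in> Inv" shows "\<phi> f ` h \<in> Inv"
proof -
  obtain n where n: "h \<in> H" "pw n ` h = V - h" using h by (auto simp: Inv_def)
  obtain e where e: "\<And>x n. x \<in> V \<Longrightarrow> \<phi> f (pw n x) = pw (e * n) (\<phi> f x)"
    using power_conj[OF f] by blast
  have "pw (e * n) ` \<phi> f ` h = \<phi> f ` pw n ` h"
    unfolding image_image by (rule image_cong[OF refl]) (use e H_sub[OF n(1)] in auto)
  also have "\<dots> = V - \<phi> f ` h" using n \<phi>_compl[OF f n(1)] by simp
  finally show ?thesis using \<phi>_H[OF f n(1)] by (auto simp: Inv_def)
qed

text \<open>With exponent 1 the image of an attracting halfspace is attracting; with exponent -1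
  time is reversed and the complement of the image is attracting.\<close>

lemma \<phi>_Skew: assumes f: "f \<in> carrier G" and h: "h \<in> Skew" shows "\<phi> f ` h \<in> Skew"
proof -
  have S: "Skew \<noteq> {}" using h by blast
  obtain e'
    where e': "e' = 1 \<or> e' = -1" "\<And>x n. x \<in> V \<Longrightarrow> \<phi> (m_inv G f) (pw n x) = pw (e' * n) (\<phi> (m_inv G f) x)"
    using power_conj_sign[OF inv_in[OF f] S] by blast
  have *: "\<phi> f ` k \<in> Skew" if k: "pos k" for k
  proof -
    have kH: "k \<in> H" using k by (simp add: pos_def)
    have mem: "pw n x \<in> \<phi> f ` k \<longleftrightarrow> pw (e' * n) (\<phi> (m_inv G f) x) \<in> k" if x: "x \<in> V" for x n
      using \<phi>_mem[OF inv_in[OF f] a_in[OF x] kH, of n] e'(2)[OF x] group.inv_inv[OF group f] by simp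
    show ?thesis
    proof (cases "e' = 1")
      case True
      have "pos (\<phi> f ` k)"
        unfolding pos_def using \<phi>_H[OF f kH] k mem \<phi>_in[OF inv_in[OF f]] True by (simp add: pos_def)
      then show ?thesis by (simp add: Skew_def pos_def)
    next
      case False
      then have "e' = -1" using e'(1) by simp
      then have m: "pw n x \<in> \<phi> f ` k \<longleftrightarrow> pw (- n) (\<phi> (m_inv G f) x) \<in> k" if "x \<in> V" for x n
        using mem[OF that] by simp
      have "pos (V - \<phi> f ` k)"
        unfolding pos_def
      proof (intro conjI ballI)
        show "V - \<phi> f ` k \<in> H" using H_compl[OF \<phi>_H[OF f kH]] .
        fix x assume x: "x \<in> V"
        obtain N where "\<forall>n\<ge>N. pw n (\<phi> (m_inv G f) x) \<in> k \<and> pw (- n) (\<phi> (m_inv G f) x) \<notin> k"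
          using k \<phi>_in[OF inv_in[OF f] x] unfolding pos_def by meson
        then show "\<exists>N. \<forall>n\<ge>N. pw n x \<in> V - \<phi> f ` k \<and> pw (- n) x \<notin> V - \<phi> f ` k"
          using m[OF x] a_in[OF x] by (intro exI[of _ N]) simp
      qed
      then show ?thesis using \<phi>_H[OF f kH] by (simp add: Skew_def)
    qed
  qed
  have hH: "h \<in> H" using h classes_sub by blast
  have "pos h \<or> pos (V - h)" using h by (simp add: Skew_def)
  then show ?thesis
  proof
    assume "pos (V - h)"
    then have "V - \<phi> f ` h \<in> Skew" using *[of "V - h"] \<phi>_compl[OF f hH] by simp
    then show ?thesis using Skew_compl[of "V - \<phi> f ` h"] H_compl_compl[OF \<phi>_H[OF f hH]] by simp
  qed (rule *)
qed

lemma \<phi>_Triv: assumes f: "f \<in> carrier G" and h: "h \<in> Triv" shows "\<phi> f ` h \<in> Triv"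
proof -
  have hH: "h \<in> H" using h classes_sub by blast
  have "\<phi> f ` h \<notin> Inv" "\<phi> f ` h \<notin> Skew"
    using \<phi>_Inv[OF inv_in[OF f], of "\<phi> f ` h"] \<phi>_Skew[OF inv_in[OF f], of "\<phi> f ` h"] \<phi>_inv_image(1)[OF f hH] h
    by (auto simp: Triv_def)
  then show ?thesis using \<phi>_H[OF f hH] by (simp add: Triv_def)
qed

lemma \<phi>_class: "is_class K \<Longrightarrow> f \<in> carrier G \<Longrightarrow> h \<in> K \<Longrightarrow> \<phi> f ` h \<in> K"
  unfolding is_class_def using \<phi>_Inv \<phi>_Skew \<phi>_Triv by blast

text \<open>At a \<open>Triv\<close> halfspace orbits in \<open>M\<close> are constant, so the
  exponent of conjugation does not matter there. At a \<open>Skew\<close> halfspace it is 1 or -1,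
  and monotonicity is preserved or reversed.\<close>

lemma \<phi>_M: assumes f: "f \<in> carrier G" and x: "x \<in> M" shows "\<phi> f x \<in> M"
proof -
  have xV: "x \<in> V" using x by (rule M_in)
  define i where "i = m_inv G f"
  have i: "i \<in> carrier G" using inv_in[OF f] by (simp add: i_def)
  obtain e
    where e: "\<And>x n. x \<in> V \<Longrightarrow> \<phi> i (pw n x) = pw (e * n) (\<phi> i x)" and sign: "Skew \<noteq> {} \<Longrightarrow> e = 1 \<or> e = -1"
    using power_conj[OF i] power_conj_sign[OF i] by (cases "Skew = {}") blast+
  have mem: "pw n (\<phi> f x) \<in> h \<longleftrightarrow> pw (e * n) x \<in> \<phi> i ` h" if h: "h \<in> H" for n h
  proof -
    have y: "\<phi> f x \<in> V" using \<phi>_in[OF f xV] .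
    have "\<phi> i (pw n (\<phi> f x)) = pw (e * n) x" using e[OF y] \<phi>_inv(1)[OF f xV] by (simp add: i_def)
    moreover have "pw n (\<phi> f x) = \<phi> f (\<phi> i (pw n (\<phi> f x)))"
      using \<phi>_inv(2)[OF f a_in[OF y]] by (simp add: i_def)
    ultimately have "pw n (\<phi> f x) = \<phi> f (pw (e * n) x)" by simp
    then show ?thesis using \<phi>_mem[OF f a_in[OF xV] h] by (simp add: i_def)
  qed
  have "monotone_at (\<phi> f x) h" if h: "h \<in> H - Inv" for h
  proof -
    have hH: "h \<in> H" using h by simp
    have cases: "h \<in> Triv \<or> h \<in> Skew" using H_cases h by blast
    show ?thesis
    proof (cases "h \<in> Triv")
      case True
      then have "\<phi> i ` h \<in> Triv" using \<phi>_Triv[OF i] by blast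
      then have "pw n (\<phi> f x) \<in> h \<longleftrightarrow> x \<in> \<phi> i ` h" for n
        using mem[OF hH] Triv_constant[OF x] by simp
      then show ?thesis by (simp add: monotone_at_def)
    next
      case False
      then have hS: "h \<in> Skew" using cases by blast
      then have es: "e = 1 \<or> e = -1" using sign by blast
      have "\<phi> i ` h \<in> Skew" using \<phi>_Skew[OF i hS] .
      then have "\<phi> i ` h \<in> H - Inv" using Skew_Inv classes_sub by blast
      then have "monotone_at x (\<phi> i ` h)" using x by (simp add: M_def)
      then consider "\<And>n. pw n x \<in> \<phi> i ` h \<Longrightarrow> pw (n + 1) x \<in> \<phi> i ` h" | "\<And>n. pw (n + 1) x \<in> \<phi> i ` h \<Longrightarrow> pw n x \<in> \<phi> i ` h"
        unfolding monotone_at_def by blast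
      then show ?thesis
      proof cases
        case 1
        then show ?thesis
          using es 1[of "- n - 1" for n] unfolding monotone_at_def mem[OF hH] by auto
      next
        case 2
        then show ?thesis
          using es 2[of "- n - 1" for n] unfolding monotone_at_def mem[OF hH] by auto
      qed
    qed
  qed
  then show ?thesis using \<phi>_in[OF f xV] by (simp add: M_def)
qed

lemma \<phi>_M_image: assumes f: "f \<in> carrier G" shows "\<phi> f ` M = M"
proof (intro equalityI subsetI)
  fix x assume "x \<in> M"
  then show "x \<in> \<phi> f ` M"
    using \<phi>_M[OF inv_in[OF f]] \<phi>_inv(2)[OF f M_in] by (metis image_eqI)
qed (use \<phi>_M[OF f] in auto)

text \<open>An element of the group need not preserve the fibre through \<open>b\<close>, so the
  image is projected back to it. The restriction to the fibre is there because
  \<open>BijGroup\<close> consists of extensional functions.\<close>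

definition act :: "'v \<Rightarrow> 'v set set \<Rightarrow> 'g \<Rightarrow> 'v \<Rightarrow> 'v" where
  "act b K f = (\<lambda>x\<in>Fac b K. pr b K (\<phi> f x))"

text \<open>As the class \<open>K\<close> is invariant, the sides of \<open>\<phi> f x\<close> on
  \<open>K\<close> depend only on the sides of \<open>x\<close> on \<open>K\<close>. This is what
  turns \<open>act\<close> into an action and makes \<open>split\<close> equivariant.\<close>

lemma pr_\<phi>_pr:
  assumes b: "b \<in> M" and K: "is_class K" and f: "f \<in> carrier G" and x: "x \<in> M"
  shows "pr b K (\<phi> f (pr b K x)) = pr b K (\<phi> f x)"
proof (rule pr_eqI)
  show "pr b K (\<phi> f x) \<in> Fac b K" using pr_spec(1)[OF b K \<phi>_M[OF f x]] .
  fix h assume h: "h \<in> K"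
  have hH: "h \<in> H" using h class_sub K by blast
  have P: "pr b K x \<in> M" using pr_spec(1)[OF b K x] Fac_M by blast
  have h': "\<phi> (m_inv G f) ` h \<in> K" using \<phi>_class[OF K inv_in[OF f] h] .
  show "pr b K (\<phi> f x) \<in> h \<longleftrightarrow> \<phi> f (pr b K x) \<in> h"
    using pr_spec(2)[OF b K \<phi>_M[OF f x] h] pr_spec(2)[OF b K x h'] \<phi>_mem[OF f M_in[OF x] hH] \<phi>_mem[OF f M_in[OF P] hH]
    by simp
qed

lemma act_pr: assumes "b \<in> M" "is_class K" "f \<in> carrier G" "x \<in> M"
  shows "act b K f (pr b K x) = pr b K (\<phi> f x)"
  unfolding act_def using pr_\<phi>_pr[OF assms] pr_spec(1)[OF assms(1,2,4)] by simp

lemma act_in: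
  assumes "b \<in> M" "is_class K" "f \<in> carrier G" "x \<in> Fac b K" shows "act b K f x \<in> Fac b K"
  unfolding act_def
  using pr_spec(1)[OF assms(1,2) \<phi>_M[OF assms(3) Fac_M[OF assms(4)]]] assms(4) by simp

lemma act_mult:
  assumes b: "b \<in> M" and K: "is_class K" and f: "f \<in> carrier G" "k \<in> carrier G" and x: "x \<in> Fac b K"
  shows "act b K (f \<otimes> k) x = act b K f (act b K k x)"
proof -
  have xM: "x \<in> M" using x Fac_M by blast
  have "act b K f (act b K k x) = act b K f (pr b K (\<phi> k x))" using x by (simp add: act_def)
  also have "\<dots> = pr b K (\<phi> f (\<phi> k x))" using act_pr[OF b K f(1) \<phi>_M[OF f(2) xM]] .
  also have "\<dots> = act b K (f \<otimes> k) x" using \<phi>_mult[OF M_in[OF xM] f] x by (simp add: act_def)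
  finally show ?thesis by simp
qed

lemma act_one: assumes "x \<in> Fac b K" shows "act b K \<one> x = x"
  using assms \<phi>_one[OF Fac_V[OF assms]] pr_id[OF assms] by (simp add: act_def)

lemma act_bij: assumes b: "b \<in> M" and K: "is_class K" and f: "f \<in> carrier G"
  shows "bij_betw (act b K f) (Fac b K) (Fac b K)"
proof (rule bij_betw_byWitness[where f' = "act b K (m_inv G f)"])
  show "\<forall>x\<in>Fac b K. act b K (m_inv G f) (act b K f x) = x"
    using act_mult[OF b K inv_in[OF f] f] act_one group.l_inv[OF group f] by simp
  show "\<forall>x\<in>Fac b K. act b K f (act b K (m_inv G f) x) = x"
    using act_mult[OF b K f inv_in[OF f]] act_one group.r_inv[OF group f] by simp
qed (use act_in[OF b K f] act_in[OF b K inv_in[OF f]] in auto)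

lemma act_median_action: assumes b: "b \<in> M" and K: "is_class K"
  shows "median_action G (Fac b K) \<mu> (act b K)"
  unfolding median_action_def
proof (intro conjI ballI)
  have in_Bij: "act b K f \<in> Bij (Fac b K)" if "f \<in> carrier G" for f
    using act_bij[OF b K that] by (simp add: Bij_def act_def)
  have "act b K (f \<otimes> k) = compose (Fac b K) (act b K f) (act b K k)"
    if fk: "f \<in> carrier G" "k \<in> carrier G" for f k
  proof (rule extensionalityI[of _ "Fac b K"])
    show "act b K (f \<otimes> k) \<in> extensional (Fac b K)" by (simp add: act_def)
    show "compose (Fac b K) (act b K f) (act b K k) \<in> extensional (Fac b K)" by simp
    show "act b K (f \<otimes> k) x = compose (Fac b K) (act b K f) (act b K k) x" if "x \<in> Fac b K" for x
      using act_mult[OF b K fk that] that by (simp add: compose_eq)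
  qed
  then have "act b K \<in> hom G (BijGroup (Fac b K))"
    using in_Bij by (auto simp: hom_def BijGroup_def restrict_def)
  then show "group_action G (Fac b K) (act b K)"
    unfolding group_action_def group_hom_def group_hom_axioms_def
    using group group_BijGroup by blast
  fix f assume f: "f \<in> carrier G"
  show "median_iso (Fac b K) \<mu> (Fac b K) \<mu> (act b K f)"
    unfolding median_iso_def
  proof (intro conjI ballI)
    show "bij_betw (act b K f) (Fac b K) (Fac b K)" using act_bij[OF b K f] .
    fix x y z assume xyz: "x \<in> Fac b K" "y \<in> Fac b K" "z \<in> Fac b K"
    have m: "\<mu> x y z \<in> Fac b K" using Fac_submedian[OF b] xyz by (simp add: submedian_def)
    have V: "x \<in> V" "y \<in> V" "z \<in> V" using xyz Fac_V by auto
    have fM: "\<phi> f x \<in> M" "\<phi> f y \<in> M" "\<phi> f z \<in> M" using \<phi>_M[OF f] xyz Fac_M by auto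
    have "\<mu> (\<phi> f x) (\<phi> f y) (\<phi> f z) = \<phi> f (\<mu> x y z)"
    proof (rule \<mu>_eqI)
      show "\<phi> f (\<mu> x y z) \<in> V" using \<phi>_in[OF f \<mu>_in[OF V]] .
      fix h assume h: "h \<in> H"
      show "\<phi> f (\<mu> x y z) \<in> h \<longleftrightarrow> (\<phi> f x \<in> h \<and> \<phi> f y \<in> h \<or> \<phi> f y \<in> h \<and> \<phi> f z \<in> h \<or> \<phi> f x \<in> h \<and> \<phi> f z \<in> h)"
        using \<phi>_mem[OF f \<mu>_in[OF V] h] \<phi>_mem[OF f V(1) h] \<phi>_mem[OF f V(2) h] \<phi>_mem[OF f V(3) h]
          \<mu>_iff[OF V \<phi>_H[OF inv_in[OF f] h]] by simp
    qed (use \<phi>_in[OF f] V in auto)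
    then show "act b K f (\<mu> x y z) = \<mu> (act b K f x) (act b K f y) (act b K f z)"
      using pr_median[OF b K fM] xyz m by (simp add: act_def)
  qed
qed

lemma split_equivariant:
  assumes b: "b \<in> M" and f: "f \<in> carrier G" and x: "x \<in> M" and s: "split b x = (t, u, q)"
  shows "split b (\<phi> f x) = (act b Triv f t, act b Skew f u, act b Inv f q)"
  using s act_pr[OF b _ f x] by (auto simp: split_def)

lemma act_g_Triv: assumes b: "b \<in> M" and t: "t \<in> Fac b Triv" shows "act b Triv g t = t"
proof -
  have tM: "t \<in> M" using t Fac_M by blast
  have "pr b Triv (pw 1 t) = t"
    by (rule pr_eqI[OF t]) (use Triv_constant[OF tM] in simp)
  then show ?thesis using t group.int_pow_1[OF group g_in] by (simp add: act_def pw_def)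
qed

end

section \<open>Axes and the median set\<close>

context halfspaces_int
begin

text \<open>
  Common form of the loxodromic case (\<open>Y = X\<close>) and of the inverting case (\<open>Y\<close> the cubical
  quotient): only the hyperplanes that are not inverted contribute to distances in \<open>Y\<close>.
\<close>

context
  fixes Y :: "'w skeleton" and \<pi> :: "'a \<Rightarrow> 'w" and A :: "'w \<Rightarrow> 'w"
  assumes Y_verts: "verts Y = \<pi> ` V"
    and Y_edges: "\<And>x y. x \<in> V \<Longrightarrow> y \<in> V \<Longrightarrow> {\<pi> x, \<pi> y} \<in> edges Y \<longleftrightarrow> card (N x y) = 1"
    and Y_dist: "\<And>x y. x \<in> V \<Longrightarrow> y \<in> V \<Longrightarrow> gdist Y (\<pi> x) (\<pi> y) = card (N x y)"
    and Y_A: "\<And>x. x \<in> V \<Longrightarrow> A (\<pi> x) = \<pi> (a 1 x)"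
begin

lemma geodesic_orbit:
  assumes x: "x \<in> V" and ax: "translates_along Y A L \<gamma>" "\<pi> x = \<gamma> i0" and ik: "i \<le> k"
  shows "card (N (a i x) (a k x)) = nat (k - i) * L"
proof -
  have geo: "\<And>i j. int (gdist Y (\<gamma> i) (\<gamma> j)) = \<bar>i - j\<bar>" and tr: "\<And>i. A (\<gamma> i) = \<gamma> (i + int L)"
    using ax(1) by (auto simp: translates_along_def bi_infinite_geodesic_def)
  have orb: "\<pi> (a (int n) x) = \<gamma> (i0 + int n * int L)" for n
  proof (induction n)
    case 0
    then show ?case using ax(2) a_zero x by simp
  next
    case (Suc n)
    have "\<pi> (a (int (Suc n)) x) = A (\<pi> (a (int n) x))"
      using Y_A[OF a_in[OF x], of "int n"] a_add[OF x, of 1 "int n"] by (simp add: add.commute)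
    then show ?case using Suc tr by (simp add: algebra_simps)
  qed
  define n where "n = nat (k - i)"
  have n: "k = i + int n" using ik by (simp add: n_def)
  have "card (N (a i x) (a k x)) = card (N x (a (int n) x))"
    using N_shift[OF x a_in[OF x], of i "int n"] a_add[OF x, of i "int n"] n by simp
  also have "int \<dots> = int (gdist Y (\<pi> x) (\<pi> (a (int n) x)))" using Y_dist[OF x a_in[OF x]] by simp
  also have "\<dots> = int n * int L" using geo ax(2) orb by simp
  finally show ?thesis by (metis n_def of_nat_eq_iff of_nat_mult)
qed

text \<open>An axis makes the counted distances additive along the orbit, which is monotonicity by
  \<open>M_if_geodesic\<close>. Conversely the path of \<open>axis_exists\<close> maps to a geodesic
  of \<open>Y\<close>, and by \<open>translation_min\<close> its step is the translation
  length.\<close>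

lemma axes_union_iff:
  assumes S: "Skew \<noteq> {}" and x: "x \<in> V"
  shows "\<pi> x \<in> axes_union Y A \<longleftrightarrow> x \<in> M"
proof
  assume "\<pi> x \<in> axes_union Y A"
  then obtain \<gamma> i0 where ax: "axis Y A \<gamma>" "\<pi> x = \<gamma> i0" by (auto simp: axes_union_def)
  have "translates_along Y A (translation_length Y A) \<gamma>" using ax(1) by (simp add: axis_def)
  then have "card (N (a i x) (a k x)) = nat (k - i) * translation_length Y A" if "i \<le> k" for i k
    using geodesic_orbit[where \<gamma> = \<gamma> and L = "translation_length Y A", OF x _ ax(2) that] by blast
  then show "x \<in> M" using M_if_geodesic[OF x] by blast
next
  assume xM: "x \<in> M"
  define l where "l = card (N x (a 1 x))"
  have l0: "0 < l" using translation_pos_iff[OF xM] S by (simp add: l_def)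
  have len: "translation_length Y A = l"
    unfolding translation_length_def
  proof (rule Least_equality)
    show "\<exists>y\<in>verts Y. gdist Y y (A y) = l"
      using x Y_A Y_dist a_in Y_verts by (intro bexI[of _ "\<pi> x"]) (simp_all add: l_def)
    show "l \<le> n" if n: "\<exists>y\<in>verts Y. gdist Y y (A y) = n" for n
    proof -
      obtain y where "y \<in> V" "gdist Y (\<pi> y) (A (\<pi> y)) = n" using n Y_verts by auto
      then show ?thesis using translation_min[OF xM, of y] Y_A Y_dist a_in by (simp add: l_def)
    qed
  qed
  obtain c :: "int \<Rightarrow> 'a" where c: "c 0 = x" "\<And>i. c i \<in> M" "\<And>i. c (i + int l) = a 1 (c i)"
    "\<And>i. card (N (c i) (c (i + 1))) = 1" "\<And>i j. int (card (N (c i) (c j))) = \<bar>i - j\<bar>"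
    using axis_exists[OF xM l0[unfolded l_def]] unfolding l_def[symmetric] by metis
  have cV: "c i \<in> V" for i using c(2) M_in by blast
  define \<gamma> where "\<gamma> i = \<pi> (c i)" for i
  have "bi_infinite_geodesic Y \<gamma>"
  proof (rule bi_infinite_geodesicI[of Y "gdist Y"])
    show "gdist Y u w \<le> gdist Y u v + gdist Y v w"
      if "u \<in> verts Y" "v \<in> verts Y" "w \<in> verts Y" for u v w
      using that N_triangle Y_dist unfolding Y_verts by auto
    show "gdist Y u u = 0" if "u \<in> verts Y" for u using that Y_dist unfolding Y_verts by auto
    show "gdist Y u v \<le> 1" if "{u, v} \<in> edges Y" "u \<in> verts Y" "v \<in> verts Y" for u v
      using that Y_edges Y_dist unfolding Y_verts by auto
    show "{\<gamma> i, \<gamma> (i + 1)} \<in> edges Y" for i using c(4) Y_edges[OF cV cV] by (simp add: \<gamma>_def)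
    show "int (gdist Y (\<gamma> i) (\<gamma> j)) = \<bar>i - j\<bar>" for i j
      using c(5) Y_dist[OF cV cV] by (simp add: \<gamma>_def)
  qed (use cV Y_verts in \<open>auto simp: \<gamma>_def\<close>)
  then have "axis Y A \<gamma>"
    unfolding axis_def translates_along_def len using l0 Y_A[OF cV] c(3) by (simp add: \<gamma>_def)
  moreover have "\<pi> x = \<gamma> 0" using c(1) by (simp add: \<gamma>_def)
  ultimately show "\<pi> x \<in> axes_union Y A" unfolding axes_union_def by blast
qed

end

lemma D_between:
  assumes "x \<in> V" "y \<in> V" "z \<in> V" "card (D x z) = card (D x y) + card (D y z)" "h \<in> D x y"
  shows "z \<notin> h"
proof
  assume z: "z \<in> h"
  have fin: "finite (D x y)" "finite (D y z)" using D_finite assms by auto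
  have "D x z \<subseteq> (D x y - {h}) \<union> D y z" using z by (auto simp: D_iff)
  then have "card (D x z) \<le> card ((D x y - {h}) \<union> D y z)" using fin by (intro card_mono) auto
  also have "\<dots> \<le> card (D x y - {h}) + card (D y z)" by (rule card_Un_le)
  also have "\<dots> < card (D x y) + card (D y z)" using card_Diff1_less[OF fin(1) assms(5)] by simp
  finally show False using assms(4) by simp
qed

text \<open>An inverted \<open>h\<close> is visited at time \<open>i\<close>, left at
  \<open>i + m\<close> and visited again at \<open>i + 2 * m\<close>, but a geodesic orbit crosses
  each wall at most once.\<close>

lemma no_inversion_if_geodesic:
  assumes x: "x \<in> V" and eq: "\<And>i k. i \<le> k \<Longrightarrow> card (D (a i x) (a k x)) = nat (k - i) * L"
  shows "Inv = {}"
proof (rule ccontr)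
  assume "Inv \<noteq> {}"
  then obtain h where h: "h \<in> Inv" by blast
  then obtain m where m: "h \<in> H" "a m ` h = V - h" by (auto simp: Inv_def)
  obtain i where i: "a i x \<in> h" using Inv_crosses[OF x h] .
  have flip: "a (i + m * q) x \<in> h \<longleftrightarrow> even q" for q
  proof -
    have "a (i + m * q) x \<in> a (m * q) ` h"
      using a_mem_shift[OF x m(1), of "i + m * q" "m * q"] i by simp
    then show ?thesis using flip_iterate[OF m, of q] by (auto split: if_splits)
  qed
  have 1: "a i x \<in> h" "a (i + m) x \<notin> h" "a (i + m * 2) x \<in> h"
    using flip[of 0] flip[of 1] flip[of 2] by auto
  have add: "card (D (a p x) (a r x)) = card (D (a p x) (a q x)) + card (D (a q x) (a r x))"
    if "p \<le> q" "q \<le> r" for p q r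
  proof -
    have "nat (r - p) = nat (q - p) + nat (r - q)" using that by simp
    then show ?thesis using eq[of p r] eq[of p q] eq[of q r] that by (simp add: algebra_simps)
  qed
  show False
  proof (cases "0 \<le> m")
    case True
    then have "h \<in> D (a i x) (a (i + m) x)" using 1 m by (simp add: D_iff)
    then show False
      using D_between[OF a_in[OF x] a_in[OF x] a_in[OF x] add, of i "i + m" "i + m * 2" h] 1 True
      by auto
  next
    case False
    then have "h \<in> D (a (i + m * 2) x) (a (i + m) x)" using 1 m by (simp add: D_iff)
    then show False
      using D_between[OF a_in[OF x] a_in[OF x] a_in[OF x] add, of "i + m * 2" "i + m" i h] 1 False
      by auto
  qed
qed

end

section \<open>Isometries of CAT(0) cube complexes\<close>

context CAT0
begin

lemma dist_D: "x \<in> V \<Longrightarrow> y \<in> V \<Longrightarrow> d x y = card (D x y)"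
  using sep_card sep_eq by metis

lemma X_wall_graph: "wall_graph X"
  unfolding wall_graph_def using E_iff_dist dist_D by (auto simp: E_def)

lemma crossing_eq_iff: assumes "h \<in> Hs" "k \<in> Hs" shows "crossing h = crossing k \<longleftrightarrow> h = k \<or> h = V - k"
proof
  assume "crossing h = crossing k"
  then have "{h, V - h} = {k, V - k}"
    using halfspaces_of_crossing[OF assms(1)] halfspaces_of_crossing[OF assms(2)] by simp
  then show "h = k \<or> h = V - k" by (auto simp: doubleton_eq_iff)
qed (use crossing_compl assms in auto)

context
  fixes f f' :: "'v \<Rightarrow> 'v"
  assumes f_in: "\<And>x. x \<in> V \<Longrightarrow> f x \<in> V" "\<And>x. x \<in> V \<Longrightarrow> f' x \<in> V"
    and f_inv: "\<And>x. x \<in> V \<Longrightarrow> f' (f x) = x" "\<And>x. x \<in> V \<Longrightarrow> f (f' x) = x"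
    and f_edge: "\<And>x y. x \<in> V \<Longrightarrow> y \<in> V \<Longrightarrow> E (f x) (f y) \<longleftrightarrow> E x y"
begin

lemma automorphism_dist: assumes "x \<in> V" "y \<in> V" shows "d (f x) (f y) = d x y"
proof -
  have le: "d (q x) (q y) \<le> d x y"
    if q: "\<And>x. x \<in> V \<Longrightarrow> q x \<in> V" "\<And>x y. E x y \<Longrightarrow> E (q x) (q y)" and xy: "x \<in> V" "y \<in> V"
    for q :: "'v \<Rightarrow> 'v" and x y
  proof -
    obtain p where p: "walk_from_to X x p y" "length p = Suc (d x y)" using dist_walk[OF xy] .
    have "successively E (map q p)"
      using p(1)
      unfolding walk_from_to_def walk_iff successively_map by (auto intro: successively_mono q(2))
    then have "walk_from_to X (q x) (map q p) (q y)"
      using p(1) q(1) by (auto simp: walk_from_to_def walk_iff hd_map last_map)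
    then show ?thesis using gdist_le p(2) by fastforce
  qed
  have "E (f' u) (f' v)" if "E u v" for u v
    using f_edge[of "f' u" "f' v"] f_in f_inv E_D[OF that] that by simp
  then have "d (f' (f x)) (f' (f y)) \<le> d (f x) (f y)" using le[of f'] f_in assms by blast
  moreover have "d (f x) (f y) \<le> d x y"
    by (rule le[of f]) (use f_in f_edge E_D assms in auto)
  ultimately show ?thesis using f_inv assms by simp
qed

lemma automorphism_Hs: assumes "h \<in> Hs" shows "f ` h \<in> Hs"
proof -
  obtain u v where uv: "h = side u v" "E u v" using assms by (auto simp: Hs_def)
  have V: "u \<in> V" "v \<in> V" using E_D uv by auto
  have "f ` side u v = side (f u) (f v)"
  proof (intro equalityI subsetI)
    fix y assume "y \<in> side (f u) (f v)"
    then have y: "y \<in> V" "d (f u) y < d (f v) y" by (auto simp: side_def)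
    then have "f' y \<in> side u v"
      using automorphism_dist[OF V(1) f_in(2)[OF y(1)]] automorphism_dist[OF V(2) f_in(2)[OF y(1)]] f_inv f_in
      by (simp add: side_def)
    then show "y \<in> f ` side u v" using f_inv(2)[OF y(1)] by (metis image_eqI)
  qed (use automorphism_dist V f_in in \<open>auto simp: side_def\<close>)
  then show ?thesis using side_Hs f_edge V uv by simp
qed

lemma automorphism_crossing: assumes "h \<in> Hs" shows "(\<lambda>e. f ` e) ` crossing h = crossing (f ` h)"
proof (intro equalityI subsetI)
  fix e assume "e \<in> (\<lambda>e. f ` e) ` crossing h"
  then obtain u v where uv: "e = {f u, f v}" "E u v" "u \<in> h" "v \<notin> h" by (auto simp: crossing_def)
  have V: "u \<in> V" "v \<in> V" using E_D uv by auto
  have "f v \<notin> f ` h"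
  proof
    assume "f v \<in> f ` h"
    then obtain w where "w \<in> h" "f v = f w" by blast
    then show False using f_inv(1)[OF V(2)] f_inv(1)[of w] Hs_sub[OF assms] uv by auto
  qed
  then show "e \<in> crossing (f ` h)" using uv V f_edge unfolding crossing_def by blast
next
  fix e assume "e \<in> crossing (f ` h)"
  then obtain u v where uv: "e = {u, v}" "E u v" "u \<in> f ` h" "v \<notin> f ` h"
    by (auto simp: crossing_def)
  have V: "u \<in> V" "v \<in> V" using E_D uv by auto
  have "E (f' u) (f' v)" using f_edge[of "f' u" "f' v"] f_in f_inv V uv by simp
  moreover have "f' u \<in> h"
    using uv(3) f_inv(1) Hs_sub[OF assms] by (metis imageE subsetD)
  moreover have "f' v \<notin> h" using uv(4) f_inv(2)[OF V(2)] by (metis image_eqI)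
  ultimately have "{f' u, f' v} \<in> crossing h" by (auto simp: crossing_def)
  moreover have "e = f ` {f' u, f' v}" using uv f_inv V by simp
  ultimately show "e \<in> (\<lambda>e. f ` e) ` crossing h" by blast
qed

lemma inverts_crossing_iff: assumes h: "h \<in> Hs" shows "inverts X f (crossing h) \<longleftrightarrow> f ` h = V - h"
proof
  assume "inverts X f (crossing h)"
  then obtain A B where "{h, V - h} = {A, B}" "f ` A = B" "f ` B = A"
    unfolding inverts_def halfspaces_of_crossing[OF h] by auto
  then show "f ` h = V - h" by (auto simp: doubleton_eq_iff)
next
  assume fh: "f ` h = V - h"
  have fc: "f ` (V - h) = h"
  proof (intro equalityI subsetI)
    fix y assume "y \<in> f ` (V - h)"
    then obtain x where x: "x \<in> V" "x \<notin> h" "y = f x" by blast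
    have "f x \<notin> V - h"
    proof
      assume "f x \<in> V - h"
      then obtain w where "w \<in> h" "f x = f w" using fh by blast
      then show False using f_inv(1)[OF x(1)] f_inv(1)[of w] Hs_sub[OF h] x by auto
    qed
    then show "y \<in> h" using f_in x by blast
  next
    fix y assume y: "y \<in> h"
    then have yV: "y \<in> V" using Hs_sub[OF h] by blast
    have "f' y \<notin> h"
    proof
      assume "f' y \<in> h"
      then have "f (f' y) \<in> V - h" using fh by blast
      then show False using f_inv(2)[OF yV] y by simp
    qed
    then show "y \<in> f ` (V - h)" using f_inv(2)[OF yV] f_in(2)[OF yV] by (metis DiffI image_eqI)
  qed
  have "h \<noteq> V - h" using Hs_nonempty[OF h] Hs_sub[OF h] by blast
  then show "inverts X f (crossing h)"
    unfolding inverts_def halfspaces_of_crossing[OF h] automorphism_crossing[OF h] fh crossing_compl[OF h]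
    using fh fc by blast
qed

end

end

locale CAT0_action = CAT0 X for X :: "'v skeleton" +
  fixes G :: "('g, 'b) monoid_scheme" (structure) and \<phi> :: "'g \<Rightarrow> 'v \<Rightarrow> 'v" and g :: 'g
  assumes group: "group G"
    and cubical: "cubical_action G X \<phi>"
    and g_in: "g \<in> carrier G"
    and g_normal: "generate G {g} \<lhd> G"
begin

lemma \<phi>_inverse:
  assumes f: "f \<in> carrier G"
  shows "x \<in> V \<Longrightarrow> \<phi> f x \<in> V" "x \<in> V \<Longrightarrow> \<phi> (m_inv G f) x \<in> V"
    "x \<in> V \<Longrightarrow> \<phi> (m_inv G f) (\<phi> f x) = x" "x \<in> V \<Longrightarrow> \<phi> f (\<phi> (m_inv G f) x) = x"
    "x \<in> V \<Longrightarrow> y \<in> V \<Longrightarrow> E (\<phi> f x) (\<phi> f y) \<longleftrightarrow> E x y"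
proof -
  have act: "group_action G V \<phi>" using cubical by (simp add: cubical_action_def)
  have i: "m_inv G f \<in> carrier G" using group.inv_closed[OF group f] .
  have one: "\<phi> \<one> x = x" if "x \<in> V" for x
    using group_action.id_eq_one[OF act] that by (metis restrict_apply')
  show "x \<in> V \<Longrightarrow> \<phi> f x \<in> V" "x \<in> V \<Longrightarrow> \<phi> (m_inv G f) x \<in> V"
    using group_action.element_image[OF act] f i by blast+
  show "x \<in> V \<Longrightarrow> \<phi> (m_inv G f) (\<phi> f x) = x" "x \<in> V \<Longrightarrow> \<phi> f (\<phi> (m_inv G f) x) = x"
    using group_action.composition_rule[OF act, symmetric] f i one group.l_inv[OF group f] group.r_inv[OF group f]
    by auto
  show "x \<in> V \<Longrightarrow> y \<in> V \<Longrightarrow> E (\<phi> f x) (\<phi> f y) \<longleftrightarrow> E x y"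
    using cubical f by (simp add: cubical_action_def E_def)
qed

sublocale halfspaces_action V Hs "median X" G \<phi> g
proof (intro halfspaces_action.intro halfspaces_action_axioms.intro)
  show "halfspaces V Hs (median X)" by unfold_locales
  show "group G" using group .
  show "group_action G V \<phi>" using cubical by (simp add: cubical_action_def)
  show "\<phi> f ` h \<in> Hs" if "f \<in> carrier G" "h \<in> Hs" for f h
    using automorphism_Hs[of "\<phi> f" "\<phi> (m_inv G f)"] \<phi>_inverse[OF that(1)] that(2) by blast
  show "g \<in> carrier G" using g_in .
  show "generate G {g} \<lhd> G" using g_normal .
  show "V \<noteq> {}" using V_nonempty .
qed

lemma elliptic_iff: "elliptic G X \<phi> g \<longleftrightarrow> Skew = {}"
proof -
  have "elliptic G X \<phi> g \<longleftrightarrow> (\<forall>x\<in>V. \<exists>B. \<forall>n. card (D x (pw n x)) \<le> B)"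
    unfolding elliptic_def generate_eq using dist_D a_in by (auto simp: pw_def)
  then show ?thesis using bounded_orbits_iff by simp
qed

lemma inverted_eq: "inverted_hyperplanes G X \<phi> g = crossing ` Inv"
proof (intro equalityI subsetI)
  fix J assume "J \<in> inverted_hyperplanes G X \<phi> g"
  then obtain h n where h: "h \<in> Hs" "J = crossing h" and inv: "inverts X (\<phi> (g [^] (n::int))) J"
    unfolding inverted_hyperplanes_def hyperplanes_eq generate_eq by auto
  have "pw n ` h = V - h"
    using inverts_crossing_iff[of "\<phi> (g [^] n)" "\<phi> (m_inv G (g [^] n))" h] \<phi>_inverse[OF pow_in[of n]] h inv
    unfolding pw_def by blast
  then show "J \<in> crossing ` Inv" using h by (auto simp: Inv_def)
next
  fix J assume "J \<in> crossing ` Inv"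
  then obtain h n where h: "h \<in> Hs" "J = crossing h" "pw n ` h = V - h" by (auto simp: Inv_def)
  have "inverts X (\<phi> (g [^] n)) J"
    using inverts_crossing_iff[of "\<phi> (g [^] n)" "\<phi> (m_inv G (g [^] n))" h] \<phi>_inverse[OF pow_in[of n]] h
    unfolding pw_def by blast
  then show "J \<in> inverted_hyperplanes G X \<phi> g"
    unfolding inverted_hyperplanes_def hyperplanes_eq generate_eq using h by blast
qed

text \<open>Each inverted hyperplane has two sides in \<open>Inv\<close>, exactly one of which
  contains \<open>b\<close>; this matches the dimension count of the cube factor.\<close>

lemma inverted_card:
  assumes b: "b \<in> V"
  shows "finite (inverted_hyperplanes G X \<phi> g)" "card (inverted_hyperplanes G X \<phi> g) = card {h \<in> Inv. b \<in> h}"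
proof -
  show "finite (inverted_hyperplanes G X \<phi> g)" unfolding inverted_eq using Inv_finite by simp
  have "crossing ` Inv = crossing ` {h \<in> Inv. b \<in> h}"
  proof (intro equalityI subsetI)
    fix J assume "J \<in> crossing ` Inv"
    then obtain h where h: "h \<in> Inv" "J = crossing h" by blast
    have hH: "h \<in> Hs" using h classes_sub by blast
    show "J \<in> crossing ` {h \<in> Inv. b \<in> h}"
    proof (cases "b \<in> h")
      case False
      then have "V - h \<in> {h \<in> Inv. b \<in> h}" using Inv_compl h b by simp
      moreover have "J = crossing (V - h)" using crossing_compl[OF hH] h by simp
      ultimately show ?thesis by blast
    qed (use h in blast)
  qed auto
  moreover have "inj_on crossing {h \<in> Inv. b \<in> h}"
  proof (rule inj_onI)
    fix h k assume hk: "h \<in> {h \<in> Inv. b \<in> h}" "k \<in> {h \<in> Inv. b \<in> h}" "crossing h = crossing k"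
    then have "h = k \<or> h = V - k" using crossing_eq_iff classes_sub by blast
    then show "h = k" using hk by auto
  qed
  ultimately show "card (inverted_hyperplanes G X \<phi> g) = card {h \<in> Inv. b \<in> h}"
    unfolding inverted_eq by (simp add: card_image)
qed

subsection \<open>The elliptic case\<close>

lemma stabilised_cube_iff: "stabilised_cube X {\<phi> g} n C \<longleftrightarrow> stabilised_cube X (\<phi> ` generate G {g}) n C"
proof
  assume "stabilised_cube X {\<phi> g} n C"
  then have C: "cube X n C" "pw 1 ` C = C"
    using group.int_pow_1[OF group g_in] by (auto simp: stabilised_cube_def pw_def)
  have CV: "C \<subseteq> V" using C by (simp add: cube_def)
  have add: "pw m ` pw n ` C = pw (m + n) ` C" for m n
    unfolding image_image by (rule image_cong[OF refl]) (metis CV a_add subsetD)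
  have zero: "pw 0 ` C = C" using a_zero CV by force
  have "pw n ` C = C" for n
  proof (induction n rule: int_induct[where k = 0])
    case base
    then show ?case using zero .
  next
    case (step1 i)
    then show ?case using add[of 1 i] C(2) by (simp add: add.commute)
  next
    case (step2 i)
    have "pw (i - 1) ` C = pw (i - 1) ` pw 1 ` C" using C(2) by simp
    also have "\<dots> = C" using add[of "i - 1" 1] step2 by simp
    finally show ?case .
  qed
  then show "stabilised_cube X (\<phi> ` generate G {g}) n C"
    using C(1) by (auto simp: stabilised_cube_def generate_eq pw_def)
next
  assume "stabilised_cube X (\<phi> ` generate G {g}) n C"
  then show "stabilised_cube X {\<phi> g} n C"
    using generate.incl[of g "{g}" G] by (auto simp: stabilised_cube_def)
qed

lemma stabilised_cube_pw: "stabilised_cube X (\<phi> ` generate G {g}) n C \<longleftrightarrow> cube X n C \<and> (\<forall>m. pw m ` C = C)"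
  by (auto simp: stabilised_cube_def generate_eq pw_def)

lemma card_Inv_eq: "v \<in> V \<Longrightarrow> b \<in> V \<Longrightarrow> card {h \<in> Inv. v \<in> h} = card {h \<in> Inv. b \<in> h}"
  using card_Inv_containing by (meson antisym)

text \<open>Without \<open>Skew\<close> the powers of \<open>g\<close> move points of
  \<open>M\<close> across \<open>Inv\<close> walls only, so they preserve the fibre, which is a cube
  of \<open>X\<close> by \<open>cube_in_Fac\<close>.\<close>

lemma Fac_stabilised:
  assumes S: "Skew = {}" and x: "x \<in> M"
  shows "stabilised_cube X (\<phi> ` generate G {g}) (card {h \<in> Inv. x \<in> h}) (Fac x Inv)"
proof -
  have sub: "pw m ` Fac x Inv \<subseteq> Fac x Inv" for m
  proof (rule image_subsetI)
    fix y assume y: "y \<in> Fac x Inv"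
    have yM: "y \<in> M" using y Fac_M by blast
    have "pw m y \<in> h \<longleftrightarrow> x \<in> h" if h: "h \<in> Hs - Inv" for h
    proof -
      have "h \<in> Triv" using H_cases[of h] h S by blast
      then show ?thesis using Triv_constant[OF yM] Fac_agree[OF y, of h] h by simp
    qed
    then show "pw m y \<in> Fac x Inv" using M_shift[OF yM] by (simp add: Fac_def)
  qed
  have "pw m ` Fac x Inv = Fac x Inv" for m
  proof (intro equalityI subsetI)
    fix y assume y: "y \<in> Fac x Inv"
    then have "pw (- m) y \<in> Fac x Inv" using sub by blast
    moreover have "pw m (pw (- m) y) = y"
      using a_add[OF Fac_V[OF y], of m "- m"] a_zero[OF Fac_V[OF y]] by simp
    ultimately show "y \<in> pw m ` Fac x Inv" by (metis image_eqI)
  qed (use sub in blast)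
  moreover have "Fac x Inv \<subseteq> verts X" using Fac_V by blast
  then have "cube X (card {h \<in> Inv. x \<in> h}) (Fac x Inv)"
    using cube_in_Fac[OF x X_wall_graph] by metis
  ultimately show ?thesis by (simp add: stabilised_cube_pw)
qed

text \<open>An inverted halfspace at \<open>v\<close> separates \<open>v\<close> from some point of
  its orbit, which remains in the cube, so it is a direction of the cube. If these are all
  directions, the orbit of \<open>v\<close> crosses no other wall and \<open>v\<close> is in
  \<open>M\<close>.\<close>

lemma stabilised_cube_dim:
  assumes C: "stabilised_cube X (\<phi> ` generate G {g}) n C" and v: "v \<in> C"
  shows "card {h \<in> Inv. v \<in> h} \<le> n" "n = card {h \<in> Inv. v \<in> h} \<Longrightarrow> Skew = {} \<Longrightarrow> v \<in> M"
proof -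
  have cube: "cube X n C" and st: "\<And>m. pw m ` C = C" using C by (auto simp: stabilised_cube_pw)
  have vV: "v \<in> V" using cube v by (auto simp: cube_def)
  have orb: "pw m v \<in> C" for m using st v by blast
  obtain f h
    where fh: "bij_betw f (Pow {..<n}) C" "inj_on h {..<n}" "\<And>A. A \<subseteq> {..<n} \<Longrightarrow> D v (f A) = h ` A"
    using cube_structure[OF X_wall_graph cube v] by metis
  have D_sub: "D v y \<subseteq> h ` {..<n}" if "y \<in> C" for y
  proof -
    have "y \<in> f ` Pow {..<n}" using bij_betw_imp_surj_on[OF fh(1)] that by simp
    then obtain A where "A \<subseteq> {..<n}" "y = f A" by auto
    then show ?thesis using fh(3) by auto
  qed
  have sub: "{k \<in> Inv. v \<in> k} \<subseteq> h ` {..<n}"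
  proof
    fix k assume k: "k \<in> {k \<in> Inv. v \<in> k}"
    then obtain m where m: "k \<in> Hs" "pw m ` k = V - k" "v \<in> k" by (auto simp: Inv_def)
    then have "k \<in> D v (pw m v)" unfolding D_iff by blast
    then show "k \<in> h ` {..<n}" using D_sub[OF orb] by blast
  qed
  have card: "card (h ` {..<n}) = n" using card_image[OF fh(2)] by simp
  show "card {h \<in> Inv. v \<in> h} \<le> n" using card_mono[OF _ sub] card by simp
  assume n: "n = card {h \<in> Inv. v \<in> h}" and S: "Skew = {}"
  \<comment> \<open>Equal cardinality turns the inclusion into equality: the cube has no directions
    besides the inverted ones.\<close>
  have eq: "{k \<in> Inv. v \<in> k} = h ` {..<n}"
    by (rule card_subset_eq[OF _ sub]) (use card n in simp_all)
  have const: "pw m v \<in> k \<longleftrightarrow> v \<in> k" if k: "k \<in> Hs - Inv" for k m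
  proof -
    have *: "pw m v \<in> k" if k: "k \<in> Hs - Inv" "v \<in> k" for k
    proof (rule ccontr)
      assume "pw m v \<notin> k"
      then have "k \<in> D v (pw m v)" using k by (simp add: D_iff)
      then have "k \<in> {k \<in> Inv. v \<in> k}" using D_sub[OF orb] eq by blast
      then show False using k by blast
    qed
    have "V - k \<in> Hs - Inv" using k H_compl Inv_compl[of "V - k"] H_compl_compl by auto
    then show ?thesis using *[OF k] *[of "V - k"] vV a_in[OF vV] by blast
  qed
  have "monotone_at v k" if "k \<in> Hs - Inv" for k
    unfolding monotone_at_def using const[OF that] by simp
  then show "v \<in> M" using vV by (simp add: M_def)
qed

lemma min_dim:
  assumes S: "Skew = {}" and b: "b \<in> V"
  shows "min_stabilised_dim X (\<phi> ` generate G {g}) = card {h \<in> Inv. b \<in> h}"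
  unfolding min_stabilised_dim_def
proof (rule Least_equality)
  obtain x where x: "x \<in> M" using M_nonempty by blast
  show "\<exists>C. stabilised_cube X (\<phi> ` generate G {g}) (card {h \<in> Inv. b \<in> h}) C"
    using Fac_stabilised[OF S x] card_Inv_eq[OF M_in[OF x] b] by auto
  fix n assume "\<exists>C. stabilised_cube X (\<phi> ` generate G {g}) n C"
  then obtain C where C: "stabilised_cube X (\<phi> ` generate G {g}) n C" by blast
  then have "C \<noteq> {}" "C \<subseteq> V" by (auto simp: stabilised_cube_def cube_def bij_betw_def)
  then obtain v where v: "v \<in> C" "v \<in> V" by blast
  show "card {h \<in> Inv. b \<in> h} \<le> n"
    using stabilised_cube_dim(1)[OF C v(1)] card_Inv_eq[OF v(2) b] by simp
qed

lemma elliptic_M: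
  assumes S: "Skew = {}"
  shows "\<Union>{C. stabilised_cube X (\<phi> ` generate G {g}) (min_stabilised_dim X (\<phi> ` generate G {g})) C} = M"
proof (intro equalityI subsetI)
  fix v assume "v \<in> \<Union>{C. stabilised_cube X (\<phi> ` generate G {g}) (min_stabilised_dim X (\<phi> ` generate G {g})) C}"
  then obtain C
    where C: "stabilised_cube X (\<phi> ` generate G {g}) (min_stabilised_dim X (\<phi> ` generate G {g})) C" "v \<in> C"
      by blast
  then have "v \<in> V" by (auto simp: stabilised_cube_def cube_def)
  then show "v \<in> M" using stabilised_cube_dim(2)[OF C] min_dim[OF S] S by blast
next
  fix v assume v: "v \<in> M"
  have "v \<in> Fac v Inv" using base_in_Fac[OF v] .
  then show "v \<in> \<Union>{C. stabilised_cube X (\<phi> ` generate G {g}) (min_stabilised_dim X (\<phi> ` generate G {g})) C}"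
    using Fac_stabilised[OF S v] min_dim[OF S M_in[OF v]] by auto
qed

subsection \<open>The loxodromic case\<close>

lemma N_eq_D: "Inv = {} \<Longrightarrow> N = D"
  by (simp add: fun_eq_iff N_def D_def)

lemma pw_1: "pw 1 = \<phi> g"
  unfolding pw_def using group.int_pow_1[OF group g_in] by simp

lemma loxodromic_M:
  assumes "Skew \<noteq> {}" "Inv = {}"
  shows "axes_union X (\<phi> g) = M"
proof -
  have "x \<in> axes_union X (\<phi> g) \<longleftrightarrow> x \<in> M" if "x \<in> V" for x
    using axes_union_iff[of X "\<lambda>x. x" "\<phi> g" x] that assms N_eq_D dist_D E_iff_dist pw_1
    by (simp add: E_def)
  moreover have "axes_union X (\<phi> g) \<subseteq> V"
    by (auto simp: axes_union_def axis_def translates_along_def bi_infinite_geodesic_def)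
  ultimately show ?thesis using M_in by blast
qed

lemma loxodromic_Inv: assumes "loxodromic X \<phi> g" shows "Inv = {}"
proof -
  obtain \<gamma> where ax: "translates_along X (\<phi> g) (translation_length X (\<phi> g)) \<gamma>"
    using assms by (auto simp: loxodromic_def axis_def)
  define L where "L = translation_length X (\<phi> g)"
  define x where "x = \<gamma> 0"
  have \<gamma>: "\<And>i. \<gamma> i \<in> V" "\<And>i j. int (d (\<gamma> i) (\<gamma> j)) = \<bar>i - j\<bar>" "\<And>i. \<phi> g (\<gamma> i) = \<gamma> (i + int L)"
    using ax by (auto simp: translates_along_def bi_infinite_geodesic_def L_def)
  have xV: "x \<in> V" using \<gamma>(1) by (simp add: x_def)
  have orb: "pw (int n) x = \<gamma> (int n * int L)" for n
  proof (induction n)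
    case 0
    then show ?case using a_zero[OF xV] by (simp add: x_def)
  next
    case (Suc n)
    have "pw (int (Suc n)) x = \<phi> g (pw (int n) x)" using a_add[OF xV, of 1 "int n"] pw_1 by simp
    then show ?case using Suc \<gamma>(3) by (simp add: algebra_simps)
  qed
  have "card (D (pw i x) (pw k x)) = nat (k - i) * L" if ik: "i \<le> k" for i k
  proof -
    define n where "n = nat (k - i)"
    have k: "k = i + int n" using ik by (simp add: n_def)
    have "card (D (pw i x) (pw k x)) = card (D x (pw (int n) x))"
      using D_shift[OF xV a_in[OF xV], of i "int n"] a_add[OF xV, of i "int n"] k by simp
    also have "int \<dots> = int (d x (pw (int n) x))" using dist_D[OF xV a_in[OF xV]] by simp
    also have "\<dots> = int n * int L" using \<gamma>(2) orb by (simp add: x_def)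
    finally show ?thesis by (metis n_def of_nat_eq_iff of_nat_mult)
  qed
  then show ?thesis using no_inversion_if_geodesic[OF xV] by blast
qed

subsection \<open>The inverting case\<close>

definition W :: "'v set set set" where
  "W = (\<lambda>h. {h, V - h}) ` (Hs - Inv)"

lemma compl_notin_Inv: "h \<in> Hs - Inv \<Longrightarrow> V - h \<in> Hs - Inv"
  using H_compl Inv_compl[of "V - h"] H_compl_compl by auto

lemma quotient_walls_eq: "quotient_walls X (inverted_hyperplanes G X \<phi> g) = W"
proof -
  have "hyperplanes X - crossing ` Inv = crossing ` (Hs - Inv)"
  proof (intro equalityI subsetI)
    fix J assume "J \<in> crossing ` (Hs - Inv)"
    then obtain h where h: "h \<in> Hs - Inv" "J = crossing h" by blast
    have "J \<notin> crossing ` Inv"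
    proof
      assume "J \<in> crossing ` Inv"
      then obtain k where k: "k \<in> Inv" "crossing h = crossing k" using h by auto
      then have "h = k \<or> h = V - k" using crossing_eq_iff[of h k] h classes_sub by blast
      then show False using h k Inv_compl by blast
    qed
    then show "J \<in> hyperplanes X - crossing ` Inv" using h by (auto simp: hyperplanes_eq)
  qed (auto simp: hyperplanes_eq)
  then show ?thesis
    unfolding quotient_walls_def inverted_eq W_def
    by (simp only: image_image) (rule image_cong, use halfspaces_of_crossing in auto)
qed

lemma Union_W: "\<Union>W = Hs - Inv"
  unfolding W_def using compl_notin_Inv by auto

definition \<pi> :: "'v \<Rightarrow> 'v set set" where
  "\<pi> x = principal W x"

lemma \<pi>_iff: "h \<in> \<pi> x \<longleftrightarrow> h \<in> Hs - Inv \<and> x \<in> h"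
  by (auto simp: \<pi>_def principal_def Union_W)

lemma differing_card:
  assumes xy: "x \<in> V" "y \<in> V"
  shows "card (differing_walls W (\<pi> x) (\<pi> y)) = card (N x y)"
proof -
  have "differing_walls W (\<pi> x) (\<pi> y) = (\<lambda>h. {h, V - h}) ` N x y"
  proof (intro equalityI subsetI)
    fix w assume "w \<in> differing_walls W (\<pi> x) (\<pi> y)"
    then obtain h where h: "h \<in> Hs - Inv" "w = {h, V - h}" and ne: "\<pi> x \<inter> w \<noteq> \<pi> y \<inter> w"
      by (auto simp: differing_walls_def W_def)
    have hc: "V - h \<in> Hs - Inv" using compl_notin_Inv h by blast
    have "(x \<in> h) \<noteq> (y \<in> h)"
    proof
      assume same: "x \<in> h \<longleftrightarrow> y \<in> h"
      have "k \<in> \<pi> x \<longleftrightarrow> k \<in> \<pi> y" if "k \<in> w" for k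
        using that h same xy unfolding \<pi>_iff by auto
      then show False using ne by blast
    qed
    then consider "h \<in> N x y" | "V - h \<in> N x y" using h hc xy by (auto simp: N_iff)
    then show "w \<in> (\<lambda>h. {h, V - h}) ` N x y"
    proof cases
      case 2
      have "w = {V - h, V - (V - h)}" using h H_compl_compl[of h] by auto
      then show ?thesis using 2 by blast
    qed (use h in blast)
  next
    fix w assume "w \<in> (\<lambda>h. {h, V - h}) ` N x y"
    then obtain h where h: "h \<in> N x y" "w = {h, V - h}" by blast
    then have "h \<in> Hs - Inv" "x \<in> h" "y \<notin> h" by (auto simp: N_iff)
    moreover from this have "h \<in> \<pi> x \<inter> w" "h \<notin> \<pi> y" using h by (auto simp: \<pi>_iff)
    ultimately show "w \<in> differing_walls W (\<pi> x) (\<pi> y)"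
      using h by (auto simp: differing_walls_def W_def)
  qed
  moreover have "inj_on (\<lambda>h. {h, V - h}) (N x y)"
  proof (rule inj_onI)
    fix h k assume hk: "h \<in> N x y" "k \<in> N x y" "{h, V - h} = {k, V - k}"
    then have "h = k \<or> h = V - k" by (auto simp: doubleton_eq_iff)
    then show "h = k" using hk by (auto simp: N_iff)
  qed
  ultimately show ?thesis by (simp add: card_image)
qed

lemma \<pi>_orientation: assumes "x \<in> V" shows "orientation W (\<pi> x)"
  unfolding orientation_def
proof (intro conjI ballI impI)
  show "\<pi> x \<subseteq> \<Union>W" by (auto simp: \<pi>_iff Union_W)
  fix w assume "w \<in> W"
  then obtain h where h: "h \<in> Hs - Inv" "w = {h, V - h}" by (auto simp: W_def)
  have hc: "V - h \<in> Hs - Inv" using compl_notin_Inv h by blast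
  show "\<exists>!A. A \<in> w \<and> A \<in> \<pi> x"
  proof (cases "x \<in> h")
    case True
    then show ?thesis using h by (intro ex1I[of _ h]) (auto simp: \<pi>_iff)
  next
    case False
    then show ?thesis using h hc assms by (intro ex1I[of _ "V - h"]) (auto simp: \<pi>_iff)
  qed
next
  fix A B assume "A \<in> \<pi> x" "B \<in> \<Union>W" "A \<subseteq> B"
  then show "B \<in> \<pi> x" by (auto simp: \<pi>_iff Union_W)
qed

text \<open>Only finitely many walls were removed, so an orientation of the remaining ones extends
  to a vertex of \<open>X\<close>. Hence every vertex of the cubical quotient is principal.\<close>

lemma orientation_lift:
  assumes \<sigma>: "orientation W \<sigma>" and x: "x \<in> V" and fin: "finite (differing_walls W \<sigma> (\<pi> x))"
  shows "\<exists>v\<in>V. \<pi> v = \<sigma>"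
proof -
  have sub: "\<sigma> \<subseteq> Hs - Inv" using \<sigma> by (simp add: orientation_def Union_W)
  have choice: "V - h \<in> \<sigma> \<longleftrightarrow> h \<notin> \<sigma>" if h: "h \<in> Hs - Inv" for h
  proof -
    have "\<forall>w\<in>W. \<exists>!A. A \<in> w \<and> A \<in> \<sigma>" 
      using \<sigma> unfolding orientation_def by (elim conjE)
    moreover have "{h, V - h} \<in> W" using h by (auto simp: W_def)
    ultimately have ex1: "\<exists>!A. A \<in> {h, V - h} \<and> A \<in> \<sigma>" by (rule bspec)
    have "h \<noteq> V - h" using h H_not_self_compl by blast
    then show ?thesis using ex1 by auto
  qed
  have up: "B \<in> \<sigma>" if "A \<in> \<sigma>" "B \<in> Hs - Inv" "A \<subseteq> B" for A B
    using \<sigma> that unfolding orientation_def Union_W by blast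
  have meet: "A \<inter> B \<noteq> {}" if AB: "A \<in> \<sigma>" "B \<in> \<sigma>" for A B
  proof
    assume "A \<inter> B = {}"
    then have "A \<subseteq> V - B" using AB sub Hs_sub by blast
    then have "V - B \<in> \<sigma>" using up[OF AB(1) compl_notin_Inv] AB sub by blast
    then show False using choice[of B] AB sub by blast
  qed
  \<comment> \<open>On the removed walls the sides containing a member of \<open>\<sigma>\<close>
    are forced and the others follow \<open>x\<close>, as in the gate projection. Any two sides that
    follow \<open>x\<close> meet at \<open>x\<close>.\<close>
  define \<rho> where "\<rho> = {k \<in> Inv. (\<exists>A\<in>\<sigma>. A \<subseteq> k) \<or> (x \<in> k \<and> (\<forall>A\<in>\<sigma>. A \<inter> k \<noteq> {}))}"
  have "\<exists>v\<in>V. \<forall>h\<in>Hs. v \<in> h \<longleftrightarrow> h \<in> \<sigma> \<union> \<rho>"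
  proof (rule H_complete[OF _ _ _ x])
    show "\<sigma> \<union> \<rho> \<subseteq> Hs" using sub classes_sub by (auto simp: \<rho>_def)
    show "V - h \<in> \<sigma> \<union> \<rho> \<longleftrightarrow> h \<notin> \<sigma> \<union> \<rho>" if hH: "h \<in> Hs" for h
    proof (cases "h \<in> Inv")
      case False
      then have "h \<notin> \<rho>" "V - h \<notin> \<rho>" using compl_notin_Inv[of h] hH by (auto simp: \<rho>_def)
      then show ?thesis using choice False hH by auto
    next
      case True
      have hV: "h \<subseteq> V" using hH Hs_sub by blast
      have AV: "A \<subseteq> V" if "A \<in> \<sigma>" for A using that sub Hs_sub by blast
      have 1: "\<not> (A \<subseteq> h \<and> B \<inter> h = {})" if "A \<in> \<sigma>" "B \<in> \<sigma>" for A B using meet[OF that] by blast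
      have "A \<subseteq> V - h \<longleftrightarrow> A \<inter> h = {}" "A \<inter> (V - h) = {} \<longleftrightarrow> A \<subseteq> h" if "A \<in> \<sigma>" for A
        using AV[OF that] by blast+
      then have "V - h \<in> \<rho> \<longleftrightarrow> (\<exists>A\<in>\<sigma>. A \<inter> h = {}) \<or> (x \<notin> h \<and> (\<forall>A\<in>\<sigma>. \<not> A \<subseteq> h))"
        using Inv_compl[OF True] x unfolding \<rho>_def by auto
      moreover have "h \<in> \<rho> \<longleftrightarrow> (\<exists>A\<in>\<sigma>. A \<subseteq> h) \<or> (x \<in> h \<and> (\<forall>A\<in>\<sigma>. \<not> A \<inter> h = {}))"
        using True unfolding \<rho>_def by auto
      ultimately have "V - h \<in> \<rho> \<longleftrightarrow> h \<notin> \<rho>" using 1 by blast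
      moreover have "h \<notin> \<sigma>" "V - h \<notin> \<sigma>" using True Inv_compl sub by auto
      ultimately show ?thesis by simp
    qed
    have sr: "A \<inter> k \<noteq> {}" if A: "A \<in> \<sigma>" and k: "k \<in> \<rho>" for A k
    proof -
      from k have "(\<exists>A\<in>\<sigma>. A \<subseteq> k) \<or> (\<forall>A\<in>\<sigma>. A \<inter> k \<noteq> {})" by (auto simp: \<rho>_def)
      then show ?thesis
      proof
        assume "\<exists>B\<in>\<sigma>. B \<subseteq> k"
        then obtain B where "B \<in> \<sigma>" "B \<subseteq> k" by blast
        then show ?thesis using meet[OF A] by blast
      qed (use A in blast)
    qed
    have rr: "k \<inter> l \<noteq> {}" if k: "k \<in> \<rho>" and l: "l \<in> \<rho>" for k l
    proof -
      from k have "(\<exists>A\<in>\<sigma>. A \<subseteq> k) \<or> x \<in> k" by (auto simp: \<rho>_def)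
      then show ?thesis
      proof
        assume "\<exists>B\<in>\<sigma>. B \<subseteq> k"
        then obtain B where "B \<in> \<sigma>" "B \<subseteq> k" by blast
        then show ?thesis using sr[OF _ l] by blast
      next
        assume xk: "x \<in> k"
        from l have "(\<exists>A\<in>\<sigma>. A \<subseteq> l) \<or> x \<in> l" by (auto simp: \<rho>_def)
        then show ?thesis
        proof
          assume "\<exists>B\<in>\<sigma>. B \<subseteq> l"
          then obtain B where "B \<in> \<sigma>" "B \<subseteq> l" by blast
          then show ?thesis using sr[OF _ k] by blast
        qed (use xk in blast)
      qed
    qed
    show "h \<inter> k \<noteq> {}" if "h \<in> \<sigma> \<union> \<rho>" "k \<in> \<sigma> \<union> \<rho>" for h k
      using that meet[of h k] sr[of h k] sr[of k h] rr[of h k] Int_commute[of h k] by (metis UnE)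
    have inj: "inj_on (\<lambda>h. {h, V - h}) {h \<in> \<sigma>. x \<notin> h}"
    proof (rule inj_onI)
      fix h k assume hk: "h \<in> {h \<in> \<sigma>. x \<notin> h}" "k \<in> {h \<in> \<sigma>. x \<notin> h}" "{h, V - h} = {k, V - k}"
      then have "h = k \<or> h = V - k" by (auto simp: doubleton_eq_iff)
      then show "h = k" using hk x by auto
    qed
    have "(\<lambda>h. {h, V - h}) ` {h \<in> \<sigma>. x \<notin> h} \<subseteq> differing_walls W \<sigma> (\<pi> x)"
    proof (rule image_subsetI)
      fix h assume h: "h \<in> {h \<in> \<sigma>. x \<notin> h}"
      then have "{h, V - h} \<in> W" using sub by (auto simp: W_def)
      moreover have "h \<in> \<sigma> \<inter> {h, V - h}" "h \<notin> \<pi> x \<inter> {h, V - h}" using h by (auto simp: \<pi>_iff)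
      ultimately show "{h, V - h} \<in> differing_walls W \<sigma> (\<pi> x)"
        unfolding differing_walls_def by blast
    qed
    then have "finite {h \<in> \<sigma>. x \<notin> h}" by (rule finite_imageD[OF finite_subset[OF _ fin] inj])
    moreover have "finite \<rho>" using Inv_finite by (simp add: \<rho>_def)
    moreover have "{h \<in> \<sigma> \<union> \<rho>. x \<notin> h} \<subseteq> {h \<in> \<sigma>. x \<notin> h} \<union> \<rho>" by auto
    ultimately show "finite {h \<in> \<sigma> \<union> \<rho>. x \<notin> h}" using finite_subset by blast
  qed
  then obtain v where v: "v \<in> V" "\<forall>h\<in>Hs. v \<in> h \<longleftrightarrow> h \<in> \<sigma> \<union> \<rho>" ..
  have "h \<in> \<pi> v \<longleftrightarrow> h \<in> \<sigma>" for h
  proof (cases "h \<in> Hs - Inv")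
    case True
    then have "h \<notin> \<rho>" by (auto simp: \<rho>_def)
    then show ?thesis using v True by (simp add: \<pi>_iff)
  next
    case False
    then show ?thesis using sub by (auto simp: \<pi>_iff)
  qed
  then have "\<pi> v = \<sigma>" by blast
  then show ?thesis using v(1) by blast
qed

definition Y :: "'v set set skeleton" where
  "Y = cubical_quotient X (inverted_hyperplanes G X \<phi> g)"

lemma Y_verts: "verts Y = \<pi> ` V"
proof -
  have "verts Y = {\<sigma>. orientation W \<sigma> \<and> (\<exists>x\<in>V. finite (differing_walls W \<sigma> (\<pi> x)))}"
    unfolding Y_def cubical_quotient_def quotient_walls_eq Let_def \<pi>_def by simp
  also have "\<dots> = \<pi> ` V"
  proof (intro equalityI subsetI)
    fix \<sigma> assume "\<sigma> \<in> {\<sigma>. orientation W \<sigma> \<and> (\<exists>x\<in>V. finite (differing_walls W \<sigma> (\<pi> x)))}"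
    then show "\<sigma> \<in> \<pi> ` V" using orientation_lift by blast
  next
    fix \<sigma> assume "\<sigma> \<in> \<pi> ` V"
    then obtain x where x: "x \<in> V" "\<sigma> = \<pi> x" by blast
    have "differing_walls W (\<pi> x) (\<pi> x) = {}" by (simp add: differing_walls_def)
    then show "\<sigma> \<in> {\<sigma>. orientation W \<sigma> \<and> (\<exists>x\<in>V. finite (differing_walls W \<sigma> (\<pi> x)))}"
      using x \<pi>_orientation by (intro CollectI conjI bexI[of _ x]) simp_all
  qed
  finally show ?thesis .
qed

lemma Y_edges: assumes "x \<in> V" "y \<in> V" shows "{\<pi> x, \<pi> y} \<in> edges Y \<longleftrightarrow> card (N x y) = 1"
proof -
  have e: "edges Y = {{\<sigma>, \<tau>} | \<sigma> \<tau>. \<sigma> \<in> verts Y \<and> \<tau> \<in> verts Y \<and> card (differing_walls W \<sigma> \<tau>) = 1}"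
    unfolding Y_def cubical_quotient_def quotient_walls_eq Let_def by simp
  have sym: "card (differing_walls W \<sigma> \<tau>) = card (differing_walls W \<tau> \<sigma>)" for \<sigma> \<tau>
    by (rule arg_cong[where f = card]) (auto simp: differing_walls_def)
  show ?thesis
  proof
    assume "{\<pi> x, \<pi> y} \<in> edges Y"
    then have "\<exists>\<sigma> \<tau>. {\<pi> x, \<pi> y} = {\<sigma>, \<tau>} \<and> \<sigma> \<in> verts Y \<and> \<tau> \<in> verts Y \<and> card (differing_walls W \<sigma> \<tau>) = 1"
      by (simp only: e mem_Collect_eq)
    then obtain \<sigma> \<tau> where "{\<pi> x, \<pi> y} = {\<sigma>, \<tau>}" "card (differing_walls W \<sigma> \<tau>) = 1"
      by (elim exE conjE) (rule that)
    then have "card (differing_walls W (\<pi> x) (\<pi> y)) = 1" using sym by (auto simp: doubleton_eq_iff)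
    then show "card (N x y) = 1" using differing_card[OF assms] by simp
  next
    assume "card (N x y) = 1"
    then have "card (differing_walls W (\<pi> x) (\<pi> y)) = 1" using differing_card[OF assms] by simp
    then show "{\<pi> x, \<pi> y} \<in> edges Y" unfolding e Y_verts using assms by blast
  qed
qed

text \<open>Follow a geodesic of \<open>X\<close>: crossing an inverted wall does not change the
  image, crossing any other wall is one edge of the quotient and uses up one element of
  \<open>N x y\<close>.\<close>

lemma Y_walk: "x \<in> V \<Longrightarrow> y \<in> V \<Longrightarrow> \<exists>p. walk_from_to Y (\<pi> x) p (\<pi> y) \<and> length p = Suc (card (N x y))"
proof (induction "card (D x y)" arbitrary: x)
  case 0
  then have "D x y = {}" using D_finite by simp
  then have "x = y" using vertex_eqI[OF 0(2,3)] by (auto simp: D_def)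
  then show ?case using walk_from_to_sing[of "\<pi> x" Y] 0 Y_verts by (intro exI[of _ "[\<pi> x]"]) simp
next
  case (Suc n)
  then have "D x y \<noteq> {}" by force
  then obtain z h where z: "z \<in> V" "h \<in> D x y" "D x z = {h}" "D z y = D x y - {h}"
    using D_neighbour[OF Suc.prems] by metis
  have fin: "finite (D x y)" using D_finite Suc.prems by blast
  have n: "n = card (D z y)" using Suc.hyps(2) z fin by simp
  obtain p where p: "walk_from_to Y (\<pi> z) p (\<pi> y)" "length p = Suc (card (N z y))"
    using Suc.hyps(1)[OF n z(1) Suc.prems(2)] by blast
  have ND: "N u v = D u v - Inv" for u v by (auto simp: N_def D_def)
  show ?case
  proof (cases "h \<in> Inv")
    case True
    then have "N x z = {}" "N z y = N x y" unfolding ND z by auto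
    have "card (N x z) = 0" "card (N z x) = 0"
      using \<open>N x z = {}\<close> N_sym[OF Suc.prems(1) z(1)] by auto
    then have "N z x = {}" using N_finite[OF z(1) Suc.prems(1)] by simp
    have "k \<in> \<pi> x \<longleftrightarrow> k \<in> \<pi> z" for k
    proof -
      have "k \<notin> N x z" "k \<notin> N z x" using \<open>N x z = {}\<close> \<open>N z x = {}\<close> by simp_all
      then show ?thesis unfolding \<pi>_iff N_iff by blast
    qed
    then have "\<pi> x = \<pi> z" by blast
    then show ?thesis using p \<open>N z y = N x y\<close> by auto
  next
    case False
    then have "N x z = {h}" "N z y = N x y - {h}" "h \<in> N x y" unfolding ND z using z(2) by auto
    then have "{\<pi> x, \<pi> z} \<in> edges Y" "card (N x y) = Suc (card (N z y))"
      using Y_edges[OF Suc.prems(1) z(1)] card_Suc_Diff1[OF N_finite[OF Suc.prems], of h]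
      by simp_all
    then show ?thesis
      using walk_from_to_append[OF walk_from_to_sing[of "\<pi> x" Y] p(1)] p(2) Suc.prems Y_verts
      by (intro exI[of _ "[\<pi> x] @ p"]) simp
  qed
qed

lemma Y_dist: assumes "x \<in> V" "y \<in> V" shows "gdist Y (\<pi> x) (\<pi> y) = card (N x y)"
proof -
  obtain p where p: "walk_from_to Y (\<pi> x) p (\<pi> y)" "length p = Suc (card (N x y))"
    using Y_walk[OF assms] by blast
  obtain q where q: "walk_from_to Y (\<pi> x) q (\<pi> y)" "length q = Suc (gdist Y (\<pi> x) (\<pi> y))"
    using gdist_walk[OF p(1)] by blast
  have "Suc (card (differing_walls W (\<pi> x) (\<pi> y))) \<le> length q"
  proof (rule walk_length_ge[OF _ _ _ q(1)])
    fix \<sigma> \<tau> \<upsilon> assume "\<sigma> \<in> verts Y" "\<tau> \<in> verts Y" "\<upsilon> \<in> verts Y"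
    then obtain u v w where uvw: "u \<in> V" "v \<in> V" "w \<in> V" "\<sigma> = \<pi> u" "\<tau> = \<pi> v" "\<upsilon> = \<pi> w"
      unfolding Y_verts by blast
    then show "card (differing_walls W \<sigma> \<upsilon>) \<le> card (differing_walls W \<sigma> \<tau>) + card (differing_walls W \<tau> \<upsilon>)"
      using N_triangle differing_card by simp
  next
    show "card (differing_walls W \<sigma> \<sigma>) = 0" for \<sigma> by (simp add: differing_walls_def)
    fix \<sigma> \<tau> assume st: "{\<sigma>, \<tau>} \<in> edges Y" "\<sigma> \<in> verts Y" "\<tau> \<in> verts Y"
    then obtain u v where uv: "u \<in> V" "v \<in> V" "\<sigma> = \<pi> u" "\<tau> = \<pi> v" unfolding Y_verts by blast
    then show "card (differing_walls W \<sigma> \<tau>) \<le> 1" using st(1) Y_edges differing_card by simp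
  qed
  then show ?thesis using gdist_le[OF p(1)] p(2) q(2) differing_card[OF assms] by simp
qed

lemma Y_translation: assumes x: "x \<in> V" shows "induced_isometry (\<phi> g) (\<pi> x) = \<pi> (pw 1 x)"
proof (intro equalityI subsetI)
  fix A assume "A \<in> induced_isometry (\<phi> g) (\<pi> x)"
  then obtain h where h: "h \<in> Hs - Inv" "x \<in> h" "A = pw 1 ` h"
    by (auto simp: induced_isometry_def \<pi>_iff pw_1)
  then show "A \<in> \<pi> (pw 1 x)" using a_H Inv_shift_iff by (auto simp: \<pi>_iff)
next
  fix A assume "A \<in> \<pi> (pw 1 x)"
  then have A: "A \<in> Hs" "A \<notin> Inv" "pw 1 x \<in> A" by (auto simp: \<pi>_iff)
  have "pw (- 1) ` A \<in> \<pi> x" using a_mem[OF x A(1), of 1] A a_H Inv_shift_iff by (simp add: \<pi>_iff)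
  moreover have "A = \<phi> g ` pw (- 1) ` A" using shift_unshift(1)[OF A(1), of 1] pw_1 by simp
  ultimately show "A \<in> induced_isometry (\<phi> g) (\<pi> x)" unfolding induced_isometry_def by blast
qed

lemma inverting_M:
  assumes "Skew \<noteq> {}"
  shows "{x \<in> V. quotient_map X (inverted_hyperplanes G X \<phi> g) x
    \<in> axes_union (cubical_quotient X (inverted_hyperplanes G X \<phi> g)) (induced_isometry (\<phi> g))} = M"
  unfolding quotient_map_def quotient_walls_eq \<pi>_def[symmetric] Y_def[symmetric]
  using axes_union_iff[OF Y_verts Y_edges Y_dist Y_translation assms] M_in by blast

section \<open>Identification of the median set and assembly of the theorem\<close>

lemma Med_eq: "Med G X \<phi> g = M"
proof (cases "Skew = {}")
  case True
  then show ?thesis using elliptic_M by (simp add: Med_def elliptic_iff)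
next
  case False
  then have ne: "\<not> elliptic G X \<phi> g" by (simp add: elliptic_iff)
  show ?thesis
  proof (cases "Inv = {}")
    case True
    then have "\<not> inverting G X \<phi> g" by (simp add: inverting_def inverted_eq)
    then show ?thesis using ne loxodromic_M[OF False True] by (simp add: Med_def)
  next
    case i: False
    then have "inverting G X \<phi> g" using ne by (simp add: inverting_def inverted_eq)
    then show ?thesis using ne inverting_M[OF False] by (simp add: Med_def)
  qed
qed

lemma Med_decomposition:
  "median_subalgebra X (Med G X \<phi> g)
    \<and> (\<forall>h\<in>carrier G. \<phi> h ` Med G X \<phi> g = Med G X \<phi> g)
    \<and> (\<exists>(T :: 'v set) \<mu>T (F :: 'v set) \<mu>F (Q :: 'v set) \<mu>Q \<Psi> \<alpha> \<beta> \<kappa>.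
          median_algebra T \<mu>T \<and> median_algebra F \<mu>F \<and> median_algebra Q \<mu>Q
        \<and> median_iso (Med G X \<phi> g) (median X) (T \<times> F \<times> Q) (prod3_median \<mu>T \<mu>F \<mu>Q) \<Psi>
        \<and> (median_action G T \<mu>T \<alpha> \<and> median_action G F \<mu>F \<beta> \<and> median_action G Q \<mu>Q \<kappa>
           \<and> (\<forall>h\<in>carrier G. \<forall>x\<in>Med G X \<phi> g. \<forall>t f q.
                \<Psi> x = (t, f, q) \<longrightarrow> \<Psi> (\<phi> h x) = (\<alpha> h t, \<beta> h f, \<kappa> h q)))
        \<and> (elliptic G X \<phi> g \<longrightarrow> (\<exists>p. F = {p}))
        \<and> (\<not> elliptic G X \<phi> g \<longrightarrow>
             median_flat F \<mu>F
           \<and> (\<exists>l::nat. l > 0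
                \<and> (\<forall>x\<in>verts X.
                     (\<lambda>n. real (gdist X x (\<phi> (g [^] n) x)) / real n) \<longlonglongrightarrow> real l)
                \<and> acts_by_translations F \<mu>F (\<beta> g) l))
        \<and> finite_dimensional_cube Q \<mu>Q
        \<and> (\<forall>t\<in>T. \<alpha> g t = t)
        \<and> (loxodromic X \<phi> g \<longrightarrow> m_dimension Q \<mu>Q = 0)
        \<and> (elliptic G X \<phi> g \<longrightarrow> m_dimension Q \<mu>Q = enat (min_stabilised_dim X {\<phi> g}))
        \<and> (\<not> loxodromic X \<phi> g \<and> \<not> elliptic G X \<phi> g \<longrightarrow>
             finite (inverted_hyperplanes G X \<phi> g)
           \<and> m_dimension Q \<mu>Q = enat (card (inverted_hyperplanes G X \<phi> g))))"
  unfolding Med_eq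
proof (intro conjI exI)
  obtain b where b: "b \<in> M" using M_nonempty by blast
  have bV: "b \<in> V" using b M_in by blast
  \<comment> \<open>The witnesses of the existential quantifiers were opened before \<open>b\<close>
    was obtained, so they may not mention it. A closed choice term serves as base point
    instead.\<close>
  let ?b = "SOME b. b \<in> M"
  have b': "?b \<in> M" using b by (rule someI)
  have b'V: "?b \<in> V" using b' M_in by blast
  define l where "l = card (N ?b (pw 1 ?b))"
  show "median_subalgebra X M" using M_submedian by (simp add: median_subalgebra_def submedian_def)
  show "\<forall>h\<in>carrier G. \<phi> h ` M = M" using \<phi>_M_image by blast
  show "median_algebra (Fac ?b Triv) (median X)" "median_algebra (Fac ?b Skew) (median X)" "median_algebra (Fac ?b Inv) (median X)"
    using submedian_algebra[OF Fac_submedian[OF b']] by auto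
  show "median_iso M (median X) (Fac ?b Triv \<times> Fac ?b Skew \<times> Fac ?b Inv) (prod3_median (median X) (median X) (median X)) (split ?b)"
    using split_median_iso[OF b'] .
  show "median_action G (Fac ?b Triv) (median X) (act ?b Triv)" "median_action G (Fac ?b Skew) (median X) (act ?b Skew)"
    "median_action G (Fac ?b Inv) (median X) (act ?b Inv)"
    using act_median_action[OF b'] by auto
  show "\<forall>h\<in>carrier G. \<forall>x\<in>M. \<forall>t f q. split ?b x = (t, f, q) \<longrightarrow> split ?b (\<phi> h x) = (act ?b Triv h t, act ?b Skew h f, act ?b Inv h q)"
    using split_equivariant[OF b'] by blast
  show "elliptic G X \<phi> g \<longrightarrow> (\<exists>p. Fac ?b Skew = {p})"
  proof
    assume "elliptic G X \<phi> g"
    then have S: "Skew = {}" by (simp add: elliptic_iff)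
    have "x = ?b" if "x \<in> Fac ?b Skew" for x
      using Fac_eqI[OF that base_in_Fac[OF b']] S by blast
    then show "\<exists>p. Fac ?b Skew = {p}" using base_in_Fac[OF b'] by blast
  qed
  show "\<not> elliptic G X \<phi> g \<longrightarrow> median_flat (Fac ?b Skew) (median X) \<and> (\<exists>l::nat. l > 0
      \<and> (\<forall>x\<in>verts X. (\<lambda>n. real (gdist X x (\<phi> (g [^] n) x)) / real n) \<longlonglongrightarrow> real l)
      \<and> acts_by_translations (Fac ?b Skew) (median X) (act ?b Skew g) l)"
  proof
    assume "\<not> elliptic G X \<phi> g"
    then have S: "Skew \<noteq> {}" by (simp add: elliptic_iff)
    have "l > 0" using translation_pos_iff[OF b'] S by (simp add: l_def)
    moreover have "(\<lambda>n. real (d x (\<phi> (g [^] n) x)) / real n) \<longlonglongrightarrow> real l" if x: "x \<in> V" for x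
    proof -
      have "d x (\<phi> (g [^] n) x) = card (D x (pw (int n) x))" for n
        using dist_D[OF x a_in[OF x, of "int n"]] by (simp add: pw_def int_pow_int)
      then show ?thesis using stable_length[OF b' x] by (simp add: l_def)
    qed
    moreover have "acts_by_translations (Fac ?b Skew) (median X) (act ?b Skew g) l"
      unfolding acts_by_translations_def
    proof
      fix p assume p: "p \<in> Fac ?b Skew"
      show "\<exists>\<gamma>. translates_along (cubulation (Fac ?b Skew) (median X)) (act ?b Skew g) l \<gamma> \<and> p \<in> range \<gamma>"
        unfolding l_def by (rule flat_translation[OF b' S p]) (simp add: act_def pw_1)
    qed
    ultimately show "median_flat (Fac ?b Skew) (median X) \<and> (\<exists>l::nat. l > 0
      \<and> (\<forall>x\<in>verts X. (\<lambda>n. real (gdist X x (\<phi> (g [^] n) x)) / real n) \<longlonglongrightarrow> real l)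
      \<and> acts_by_translations (Fac ?b Skew) (median X) (act ?b Skew g) l)"
      using flat_median_flat[OF b' S] by blast
  qed
  show "finite_dimensional_cube (Fac ?b Inv) (median X)"
    using cube_factor_finite_dimensional[OF b'] .
  show "\<forall>t\<in>Fac ?b Triv. act ?b Triv g t = t" using act_g_Triv[OF b'] by blast
  have dim: "m_dimension (Fac ?b Inv) (median X) = enat (card {h \<in> Inv. ?b \<in> h})"
    using cube_factor_dimension[OF b'] .
  show "loxodromic X \<phi> g \<longrightarrow> m_dimension (Fac ?b Inv) (median X) = 0"
  proof
    assume "loxodromic X \<phi> g"
    then have "card {h \<in> Inv. ?b \<in> h} = 0" using loxodromic_Inv by simp
    then show "m_dimension (Fac ?b Inv) (median X) = 0" unfolding dim by (simp add: zero_enat_def)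
  qed
  show "elliptic G X \<phi> g \<longrightarrow> m_dimension (Fac ?b Inv) (median X) = enat (min_stabilised_dim X {\<phi> g})"
  proof
    assume "elliptic G X \<phi> g"
    then have S: "Skew = {}" by (simp add: elliptic_iff)
    have "min_stabilised_dim X {\<phi> g} = min_stabilised_dim X (\<phi> ` generate G {g})"
      unfolding min_stabilised_dim_def stabilised_cube_iff ..
    then show "m_dimension (Fac ?b Inv) (median X) = enat (min_stabilised_dim X {\<phi> g})"
      using dim min_dim[OF S b'V] by simp
  qed
  show "\<not> loxodromic X \<phi> g \<and> \<not> elliptic G X \<phi> g \<longrightarrow> finite (inverted_hyperplanes G X \<phi> g)
      \<and> m_dimension (Fac ?b Inv) (median X) = enat (card (inverted_hyperplanes G X \<phi> g))"
    using dim inverted_card[OF b'V] by simp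
qed

end

theorem theorem1p3:
  fixes G :: "('g, 'b) monoid_scheme" (structure)
    and X :: "'v skeleton"
    and \<phi> :: "'g \<Rightarrow> 'v \<Rightarrow> 'v"
    and g :: 'g
  assumes "group G"
    and "CAT0_cube_complex X"
    and "cubical_action G X \<phi>"
    and "g \<in> carrier G"
    and "generate G {g} \<lhd> G"
  shows "median_subalgebra X (Med G X \<phi> g)
    \<and> (\<forall>h\<in>carrier G. \<phi> h ` Med G X \<phi> g = Med G X \<phi> g)
    \<and> (\<exists>(T :: 'v set) \<mu>T (F :: 'v set) \<mu>F (Q :: 'v set) \<mu>Q \<Psi> \<alpha> \<beta> \<kappa>.
          median_algebra T \<mu>T \<and> median_algebra F \<mu>F \<and> median_algebra Q \<mu>Q
        \<and> median_iso (Med G X \<phi> g) (median X) (T \<times> F \<times> Q) (prod3_median \<mu>T \<mu>F \<mu>Q) \<Psi>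
        \<and> (median_action G T \<mu>T \<alpha> \<and> median_action G F \<mu>F \<beta> \<and> median_action G Q \<mu>Q \<kappa>
           \<and> (\<forall>h\<in>carrier G. \<forall>x\<in>Med G X \<phi> g. \<forall>t f q.
                \<Psi> x = (t, f, q) \<longrightarrow> \<Psi> (\<phi> h x) = (\<alpha> h t, \<beta> h f, \<kappa> h q)))
        \<and> (elliptic G X \<phi> g \<longrightarrow> (\<exists>p. F = {p}))
        \<and> (\<not> elliptic G X \<phi> g \<longrightarrow>
             median_flat F \<mu>F
           \<and> (\<exists>l::nat. l > 0
                \<and> (\<forall>x\<in>verts X.
                     (\<lambda>n. real (gdist X x (\<phi> (g [^] n) x)) / real n) \<longlonglongrightarrow> real l)
                \<and> acts_by_translations F \<mu>F (\<beta> g) l))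
        \<and> finite_dimensional_cube Q \<mu>Q
        \<and> (\<forall>t\<in>T. \<alpha> g t = t)
        \<and> (loxodromic X \<phi> g \<longrightarrow> m_dimension Q \<mu>Q = 0)
        \<and> (elliptic G X \<phi> g \<longrightarrow> m_dimension Q \<mu>Q = enat (min_stabilised_dim X {\<phi> g}))
        \<and> (\<not> loxodromic X \<phi> g \<and> \<not> elliptic G X \<phi> g \<longrightarrow>
             finite (inverted_hyperplanes G X \<phi> g)
           \<and> m_dimension Q \<mu>Q = enat (card (inverted_hyperplanes G X \<phi> g))))"
proof -
  interpret CAT0_action X G \<phi> g
    using assms by (intro CAT0_action.intro CAT0_action_axioms.intro CAT0.intro)
  show ?thesis by (rule Med_decomposition)
qed

end
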